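(* Consider a surface of revolution generated by a unit speed profile curve $(v(x),e^{f(x)})$, i.e. $v'(x)^2+\big((e^{f})'(x)\big)^2=1$, with metric $dx^2+e^{2f(x)}dy^2$, and on it the biharmonic heat equation $$u_t=\left(f'(x)\frac{\partial}{\partial x}+\frac{\partial^2}{\partial x^2}+e^{-2f(x)}\frac{\partial^2}{\partial y^2}\right)^{2}u,\qquad u=u(x,y,t).$$ For an arbitrary function $f$, the minimal algebra of Lie point symmetries of this equation is generated by $$X_1=\frac{\partial}{\partial y},\quad X_2=\frac{\partial}{\partial t},\quad X_3=u\frac{\partial}{\partial u},\quad X_u=\mathcal{G}(x,y,t)\frac{\partial}{\partial u},$$ where $\mathcal{G}$ is any solution of the equation. For the following functions $f$ the Lie point symmetry algebra is larger: it is generated by $X_1,X_2,X_3,X_u$ together with the additional vector fields listed. 1. $f(x)=\ln\left[\beta_5(x-\alpha_2)^{\alpha_3}\right]$ with $\beta_5>0$, $x>\alpha_2$, $\alpha_3\neq0,1$. Additional field: $$\frac{x-\alpha_2}{4}\frac{\partial}{\partial x}-\frac{\alpha_3-1}{4}\,y\frac{\partial}{\partial y}+t\frac{\partial}{\partial t}.$$ 2. Flat surfaces, where $f(x)=\ln|\beta_3x+\beta_4|$ with constants $\beta_3,\beta_4$, in the following three cases. (a) Cylinder, $f(x)=\ln\beta_4$ with $\beta_4>0$. Additional fields: $$\frac{\partial}{\partial x},\qquad -\beta_4^2y\frac{\partial}{\partial x}+x\frac{\partial}{\partial y},\qquad \frac{x}{4}\frac{\partial}{\partial x}+\frac{y}{4}\frac{\partial}{\partial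 y}+t\frac{\partial}{\partial t}.$$ (b) Plane, $f(x)=\ln(x+\beta_4)$ with $\beta_4>0$, $x>-\beta_4$. Additional fields: $$\frac{x+\beta_4}{4}\frac{\partial}{\partial x}+t\frac{\partial}{\partial t},\quad -\cos(y)\frac{\partial}{\partial x}+\frac{\sin(y)}{x+\beta_4}\frac{\partial}{\partial y},\quad \sin(y)\frac{\partial}{\partial x}+\frac{\cos(y)}{x+\beta_4}\frac{\partial}{\partial y}.$$ (c) Cone, $f(x)=\ln\left[l(x+\beta_4)\right]$ with $l>0$, $x>-\beta_4$. Additional fields: $$\frac{x+\beta_4}{4}\frac{\partial}{\partial x}+t\frac{\partial}{\partial t},\quad -l\cos(ly)\frac{\partial}{\partial x}+\frac{\sin(ly)}{x+\beta_4}\frac{\partial}{\partial y},\quad l\sin(ly)\frac{\partial}{\partial x}+\frac{\cos(ly)}{x+\beta_4}\frac{\partial}{\partial y}.$$ 3. $f(x)=\beta_3x+C$ with constants $\beta_3\neq0$ and $C$ (pseudosphere). Additional fields: $$-\beta_3^{-1}\frac{\partial}{\partial x}+y\frac{\partial}{\partial y},\qquad 2\beta_3e^{2C}y\frac{\partial}{\partial x}+\left(e^{-2\beta_3x}-\beta_3^2e^{2C}y^2\right)\frac{\partial}{\partial y}.$$ 4. $f(x)=\ln\left|\alpha_7\sinh\left(\beta_7^{-1}x+\alpha_8\right)\right|$ with $\alpha_7,\beta_7>0$ and $\alpha_8$ constant, considered for $\alpha_7\le\beta_7$ and $-\alpha_8\beta_7<x\le\beta_7\,\mathrm{arsinh}\left(\sqrt{\beta_7^2-\alpha_7^2}/\alpha_7\right)-\alpha_8\beta_7$.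 Additional fields: $$-\alpha_7\cos(\beta_7^{-1}\alpha_7y)\frac{\partial}{\partial x}+\coth(\beta_7^{-1}x)\sin(\beta_7^{-1}\alpha_7y)\frac{\partial}{\partial y},$$ $$\alpha_7\sin(\beta_7^{-1}\alpha_7y)\frac{\partial}{\partial x}+\coth(\beta_7^{-1}x)\cos(\beta_7^{-1}\alpha_7y)\frac{\partial}{\partial y}.$$ 5. $f(x)=\ln\left[\alpha_7\cosh\left(\beta_7^{-1}x+\alpha_8\right)\right]$ with $\alpha_7,\beta_7>0$ and $\alpha_8$ constant, for $-\beta_7\left(\mathrm{arcsinh}\frac{\beta_7}{\alpha_7}+\alpha_8\right)\le x\le\beta_7\left(\mathrm{arcsinh}\frac{\beta_7}{\alpha_7}-\alpha_8\right)$. Additional fields: $$-\alpha_7e^{\beta_7^{-1}\alpha_7y}\frac{\partial}{\partial x}+\tanh(\beta_7^{-1}x)e^{\beta_7^{-1}\alpha_7y}\frac{\partial}{\partial y},\qquad \alpha_7e^{-\beta_7^{-1}\alpha_7y}\frac{\partial}{\partial x}+\tanh(\beta_7^{-1}x)e^{-\beta_7^{-1}\alpha_7y}\frac{\partial}{\partial y}.$$ 6. $f(x)=\ln\left|\alpha_5\cos\left(\beta_6^{-1}x+\alpha_6\right)\right|$ with $\alpha_5,\beta_6>0$ and $\alpha_6>0$, where: if $\alpha_5=\beta_6$, then $-\beta_6\left(\frac{\pi}{2}+\alpha_6\right)\le x\le\beta_6\left(\frac{\pi}{2}-\alpha_6\right)$; if $\alpha_5<\beta_6$, then $x\in\mathbb{R}$;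 if $\alpha_5>\beta_6$, then $-\beta_6\left(\alpha_6+\arcsin\frac{\beta_6}{\alpha_5}\right)\le x\le\beta_6\left(\arcsin\frac{\beta_6}{\alpha_5}-\alpha_6\right)$. Additional fields: $$\alpha_5\cos(\beta_6^{-1}\alpha_5y)\frac{\partial}{\partial x}+\tan(\beta_6^{-1}x)\sin(\beta_6^{-1}\alpha_5y)\frac{\partial}{\partial y},$$ $$-\alpha_5\sin(\beta_6^{-1}\alpha_5y)\frac{\partial}{\partial x}+\tan(\beta_6^{-1}x)\cos(\beta_6^{-1}\alpha_5y)\frac{\partial}{\partial y}.$$ This is the complete classification: apart from the forms of $f$ in items 1–6 (with the flat form $\ln|\beta_3x+\beta_4|$ in item 2), the symmetry algebra is the minimal one generated by $X_1,X_2,X_3,X_u$.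
   Context: The square of the operator denotes composition with itself, so the equation is $u_t=\Delta^2u$, where $\Delta=\partial_x^2+f'(x)\partial_x+e^{-2f(x)}\partial_y^2$ is the Laplacian of the metric $dx^2+e^{2f(x)}dy^2$. The surface is parameterized by $(v(x),e^{f(x)}\cos y,e^{f(x)}\sin y)$, $0\le y\le2\pi$. The symmetry analysis is local in $(x,y,t,u)$; no periodicity in $y$ is imposed on the vector fields. A Lie point symmetry is a vector field $X=\xi\,\partial_x+\phi\,\partial_y+\tau\,\partial_t+\zeta\,\partial_u$, with coefficients that are differentiable functions of $(x,y,t,u)$, whose fourth prolongation $X^{[4]}$ (the standard extension of $X$ to derivatives of $u$ up to order four) satisfies $X^{[4]}\left[u_t-\Delta^2u\right]=0$ whenever $u_t=\Delta^2u$. "Generated by" means spanned as a real vector space, with $\mathcal{G}$ ranging over all solutions of the equation.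
   Formalization: In items 4–6 the coth, tanh, tan in the fields take the shifted argument of f (x/β7+α8, resp. x/β6+α6), as the printed fields fail for nonzero shift; in the completeness claim the mirror form ln[β5(α2−x)^α3], x<α2, is also excepted, since its algebra is larger. *)

theory Defs
  imports "HOL-Analysis.Analysis" "HOL-Library.Function_Algebras"
begin

definition open_interval :: "real set \<Rightarrow> bool" where
  "open_interval S \<longleftrightarrow> open S \<and> is_interval S \<and> S \<noteq> {}"

primrec C_k_on :: "nat \<Rightarrow> ('a::euclidean_space \<Rightarrow> 'b::real_normed_vector) \<Rightarrow> 'a set \<Rightarrow> bool" where
  "C_k_on 0 g S \<longleftrightarrow> continuous_on S g"
| "C_k_on (Suc k) g S \<longleftrightarrow> (\<forall>p\<in>S. g differentiable (at p)) \<and>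
     (\<forall>b\<in>Basis. C_k_on k (\<lambda>p. frechet_derivative g (at p) b) S)"

text \<open>The profile curve is \<open>(v(x), exp (f x))\<close>, parameterized by arc length. Four derivatives of
  \<open>f\<close> occur in the symmetry condition.\<close>

definition unit_speed_profile :: "(real \<Rightarrow> real) \<Rightarrow> (real \<Rightarrow> real) \<Rightarrow> real set \<Rightarrow> bool" where
  "unit_speed_profile v f I \<longleftrightarrow> C_k_on 4 f I \<and> (\<forall>x\<in>I. v differentiable (at x)) \<and>
     (\<forall>x\<in>I. (deriv v x)\<^sup>2 + (deriv (\<lambda>s. exp (f s)) x)\<^sup>2 = 1)"


subsection \<open>Solutions of the equation\<close>

definition laplacian ::
    "(real \<Rightarrow> real) \<Rightarrow> (real \<Rightarrow> real \<Rightarrow> real \<Rightarrow> real) \<Rightarrow> real \<Rightarrow> real \<Rightarrow> real \<Rightarrow> real" where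
  "laplacian f u x y t =
     deriv f x * deriv (\<lambda>s. u s y t) x + deriv (\<lambda>s. deriv (\<lambda>r. u r y t) s) x
     + exp (- 2 * f x) * deriv (\<lambda>s. deriv (\<lambda>r. u x r t) s) y"

definition is_solution ::
    "(real \<Rightarrow> real) \<Rightarrow> real set \<Rightarrow> real set \<Rightarrow> real set \<Rightarrow> (real \<Rightarrow> real \<Rightarrow> real \<Rightarrow> real) \<Rightarrow> bool" where
  "is_solution f I J T u \<longleftrightarrow> C_k_on 4 (\<lambda>(x, y, t). u x y t) (I \<times> J \<times> T) \<and>
     (\<forall>x\<in>I. \<forall>y\<in>J. \<forall>t\<in>T. deriv (\<lambda>s. u x y s) t = laplacian f (laplacian f u) x y t)"


subsection \<open>Jet space\<close>

text \<open>The coordinate \<open>j (a, b, c)\<close> of a jet stands for the derivative of \<open>u\<close> taken \<open>a\<close> times in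
  \<open>x\<close>, \<open>b\<close> times in \<open>y\<close> and \<open>c\<close> times in \<open>t\<close>; \<open>j (0, 0, 0)\<close> is \<open>u\<close> itself. Only coordinates of order
  at most four are ever used. A differential function is a function of \<open>x\<close>, \<open>y\<close>, \<open>t\<close> and a jet.\<close>

type_synonym jet = "nat \<times> nat \<times> nat \<Rightarrow> real"
type_synonym diff_fun = "real \<Rightarrow> real \<Rightarrow> real \<Rightarrow> jet \<Rightarrow> real"

definition orders :: "nat \<Rightarrow> (nat \<times> nat \<times> nat) set" where
  "orders n = {(a, b, c). a + b + c \<le> n}"

definition jet_pderiv :: "nat \<times> nat \<times> nat \<Rightarrow> diff_fun \<Rightarrow> diff_fun" where
  "jet_pderiv m P x y t j = deriv (\<lambda>s. P x y t (j(m := s))) (j m)"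

text \<open>Total derivatives. They are applied only to differential functions of order at most three, so
  that summing over the coordinates of order at most three loses nothing.\<close>

definition Dx :: "diff_fun \<Rightarrow> diff_fun" where
  "Dx P x y t j = deriv (\<lambda>s. P s y t j) x
     + (\<Sum>(a, b, c)\<in>orders 3. j (Suc a, b, c) * jet_pderiv (a, b, c) P x y t j)"

definition Dy :: "diff_fun \<Rightarrow> diff_fun" where
  "Dy P x y t j = deriv (\<lambda>s. P x s t j) y
     + (\<Sum>(a, b, c)\<in>orders 3. j (a, Suc b, c) * jet_pderiv (a, b, c) P x y t j)"

definition Dt :: "diff_fun \<Rightarrow> diff_fun" where
  "Dt P x y t j = deriv (\<lambda>s. P x y s j) t
     + (\<Sum>(a, b, c)\<in>orders 3. j (a, b, Suc c) * jet_pderiv (a, b, c) P x y t j)"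

definition jet_laplacian :: "(real \<Rightarrow> real) \<Rightarrow> diff_fun \<Rightarrow> diff_fun" where
  "jet_laplacian f P x y t j =
     deriv f x * Dx P x y t j + Dx (Dx P) x y t j + exp (- 2 * f x) * Dy (Dy P) x y t j"

text \<open>The differential function \<open>u_t - \<Delta>\<^sup>2 u\<close>.\<close>

definition biharmonic_heat :: "(real \<Rightarrow> real) \<Rightarrow> diff_fun" where
  "biharmonic_heat f x y t j =
     j (0, 0, 1) - jet_laplacian f (jet_laplacian f (\<lambda>x y t j. j (0, 0, 0))) x y t j"


subsection \<open>Vector fields and their prolongations\<close>

text \<open>A vector field maps \<open>(x, y, t, u)\<close> to the quadruple of its coefficients of
  \<open>\<partial>_x\<close>, \<open>\<partial>_y\<close>, \<open>\<partial>_t\<close>, \<open>\<partial>_u\<close>.\<close>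

type_synonym vfield = "real \<times> real \<times> real \<times> real \<Rightarrow> real \<times> real \<times> real \<times> real"

definition coeff_x :: "vfield \<Rightarrow> diff_fun" where
  "coeff_x X x y t j = fst (X (x, y, t, j (0, 0, 0)))"

definition coeff_y :: "vfield \<Rightarrow> diff_fun" where
  "coeff_y X x y t j = fst (snd (X (x, y, t, j (0, 0, 0))))"

definition coeff_t :: "vfield \<Rightarrow> diff_fun" where
  "coeff_t X x y t j = fst (snd (snd (X (x, y, t, j (0, 0, 0)))))"

definition coeff_u :: "vfield \<Rightarrow> diff_fun" where
  "coeff_u X x y t j = snd (snd (snd (X (x, y, t, j (0, 0, 0)))))"

text \<open>The coefficient of the prolonged field along the jet coordinate \<open>(a, b, c)\<close>, by the recursion
  \<open>\<zeta>\<^bsup>m,i\<^esup> = D\<^sub>i \<zeta>\<^bsup>m\<^esup> - u\<^bsub>m,x\<^esub> D\<^sub>i \<xi> - u\<^bsub>m,y\<^esub> D\<^sub>i \<phi> - u\<^bsub>m,t\<^esub> D\<^sub>i \<tau>\<close>. The result does not depend on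
  the order in which the differentiations are performed.\<close>

fun prolongation_coeff :: "vfield \<Rightarrow> nat \<Rightarrow> nat \<Rightarrow> nat \<Rightarrow> diff_fun" where
  "prolongation_coeff X 0 0 0 = coeff_u X"
| "prolongation_coeff X (Suc a) b c = (\<lambda>x y t j. Dx (prolongation_coeff X a b c) x y t j
     - j (Suc a, b, c) * Dx (coeff_x X) x y t j
     - j (a, Suc b, c) * Dx (coeff_y X) x y t j
     - j (a, b, Suc c) * Dx (coeff_t X) x y t j)"
| "prolongation_coeff X 0 (Suc b) c = (\<lambda>x y t j. Dy (prolongation_coeff X 0 b c) x y t j
     - j (1, b, c) * Dy (coeff_x X) x y t j
     - j (0, Suc b, c) * Dy (coeff_y X) x y t j
     - j (0, b, Suc c) * Dy (coeff_t X) x y t j)"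
| "prolongation_coeff X 0 0 (Suc c) = (\<lambda>x y t j. Dt (prolongation_coeff X 0 0 c) x y t j
     - j (1, 0, c) * Dt (coeff_x X) x y t j
     - j (0, 1, c) * Dt (coeff_y X) x y t j
     - j (0, 0, Suc c) * Dt (coeff_t X) x y t j)"

definition fourth_prolongation :: "vfield \<Rightarrow> diff_fun \<Rightarrow> diff_fun" where
  "fourth_prolongation X P x y t j =
     coeff_x X x y t j * deriv (\<lambda>s. P s y t j) x
     + coeff_y X x y t j * deriv (\<lambda>s. P x s t j) y
     + coeff_t X x y t j * deriv (\<lambda>s. P x y s j) t
     + (\<Sum>(a, b, c)\<in>orders 4. prolongation_coeff X a b c x y t j * jet_pderiv (a, b, c) P x y t j)"


subsection \<open>Symmetry algebras\<close>

text \<open>Vector fields on \<open>\<Omega>\<close> are represented by total functions that vanish outside \<open>\<Omega>\<close>, so that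
  equality of functions is equality of vector fields on \<open>\<Omega>\<close>.\<close>

definition on_domain :: "(real \<times> real \<times> real \<times> real) set \<Rightarrow> vfield \<Rightarrow> vfield" where
  "on_domain \<Omega> X = (\<lambda>p. if p \<in> \<Omega> then X p else 0)"

definition vf_scale :: "real \<Rightarrow> vfield \<Rightarrow> vfield" where
  "vf_scale c X = (\<lambda>p. c *\<^sub>R X p)"

interpretation vf: vector_space vf_scale
  by unfold_locales (auto simp: vf_scale_def fun_eq_iff algebra_simps)

definition lie_symmetries ::
    "(real \<Rightarrow> real) \<Rightarrow> (real \<times> real \<times> real \<times> real) set \<Rightarrow> vfield set" where
  "lie_symmetries f \<Omega> = {X. C_k_on 4 X \<Omega> \<and> (\<forall>p. p \<notin> \<Omega> \<longrightarrow> X p = 0) \<and>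
     (\<forall>x y t j. (x, y, t, j (0, 0, 0)) \<in> \<Omega> \<longrightarrow> biharmonic_heat f x y t j = 0 \<longrightarrow>
        fourth_prolongation X (biharmonic_heat f) x y t j = 0)}"

definition minimal_generators ::
    "(real \<Rightarrow> real) \<Rightarrow> real set \<Rightarrow> real set \<Rightarrow> real set \<Rightarrow> vfield set" where
  "minimal_generators f I J T =
     {\<lambda>(x, y, t, u). (0, 1, 0, 0), \<lambda>(x, y, t, u). (0, 0, 1, 0), \<lambda>(x, y, t, u). (0, 0, 0, u)}
     \<union> {(\<lambda>(x, y, t, u). (0, 0, 0, G x y t)) | G. is_solution f I J T G}"

definition generated_algebra ::
    "(real \<times> real \<times> real \<times> real) set \<Rightarrow> vfield set \<Rightarrow> vfield set" where
  "generated_algebra \<Omega> S = vf.span (on_domain \<Omega> ` S)"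

definition symmetry_algebra_is_minimal ::
    "(real \<Rightarrow> real) \<Rightarrow> real set \<Rightarrow> real set \<Rightarrow> real set \<Rightarrow> real set \<Rightarrow> bool" where
  "symmetry_algebra_is_minimal f I J T U \<longleftrightarrow>
     lie_symmetries f (I \<times> J \<times> T \<times> U)
       = generated_algebra (I \<times> J \<times> T \<times> U) (minimal_generators f I J T)"

definition symmetry_algebra_enlarged_by ::
    "(real \<Rightarrow> real) \<Rightarrow> real set \<Rightarrow> real set \<Rightarrow> real set \<Rightarrow> real set \<Rightarrow> vfield set \<Rightarrow> bool" where
  "symmetry_algebra_enlarged_by f I J T U A \<longleftrightarrow>
     lie_symmetries f (I \<times> J \<times> T \<times> U)
       = generated_algebra (I \<times> J \<times> T \<times> U) (minimal_generators f I J T \<union> A) \<and>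
     generated_algebra (I \<times> J \<times> T \<times> U) (minimal_generators f I J T)
       \<subset> lie_symmetries f (I \<times> J \<times> T \<times> U)"


subsection \<open>The exceptional forms\<close>

text \<open>Since \<open>ln 0 = 0\<close>, non-vanishing of the argument of the logarithm is required explicitly. The
  power form is admitted on either side of its singular point: reversing the orientation of the
  profile curve, \<open>x \<mapsto> - x\<close>, interchanges the two sides, so the symmetry algebra is larger than the
  minimal one on both. The other forms are invariant under this reflection.\<close>

definition exceptional_form :: "(real \<Rightarrow> real) \<Rightarrow> real set \<Rightarrow> bool" where
  "exceptional_form f I \<longleftrightarrow>
     (\<exists>\<beta>5>0. \<exists>\<alpha>2 \<alpha>3. \<alpha>3 \<noteq> 0 \<and> \<alpha>3 \<noteq> 1 \<and>
        ((\<forall>x\<in>I. x > \<alpha>2 \<and> f x = ln (\<beta>5 * (x - \<alpha>2) powr \<alpha>3)) \<or>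
         (\<forall>x\<in>I. x < \<alpha>2 \<and> f x = ln (\<beta>5 * (\<alpha>2 - x) powr \<alpha>3)))) \<or>
     (\<exists>\<beta>3 \<beta>4. \<forall>x\<in>I. \<beta>3 * x + \<beta>4 \<noteq> 0 \<and> f x = ln \<bar>\<beta>3 * x + \<beta>4\<bar>) \<or>
     (\<exists>\<beta>3 C. \<beta>3 \<noteq> 0 \<and> (\<forall>x\<in>I. f x = \<beta>3 * x + C)) \<or>
     (\<exists>\<alpha>7>0. \<exists>\<beta>7>0. \<exists>\<alpha>8. \<alpha>7 \<le> \<beta>7 \<and>
        (\<forall>x\<in>I. sinh (x / \<beta>7 + \<alpha>8) \<noteq> 0 \<and> f x = ln \<bar>\<alpha>7 * sinh (x / \<beta>7 + \<alpha>8)\<bar>)) \<or>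
     (\<exists>\<alpha>7>0. \<exists>\<beta>7>0. \<exists>\<alpha>8. \<forall>x\<in>I. f x = ln (\<alpha>7 * cosh (x / \<beta>7 + \<alpha>8))) \<or>
     (\<exists>\<alpha>5>0. \<exists>\<beta>6>0. \<exists>\<alpha>6>0.
        \<forall>x\<in>I. cos (x / \<beta>6 + \<alpha>6) \<noteq> 0 \<and> f x = ln \<bar>\<alpha>5 * cos (x / \<beta>6 + \<alpha>6)\<bar>)"

end

theory Submission
  imports Defs
begin

text \<open>The prolonged field applied to \<open>u_t - \<Delta>\<^sup>2 u\<close> can be evaluated on the Taylor polynomial \<open>u\<close> of a
  jet. Its dependence on the jet coordinates of order four shows that the time component depends on
  \<open>t\<close> only and that, for fixed \<open>t\<close>, the spatial part \<open>V\<close> does not depend on \<open>u\<close> and is a conformal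
  field, with some factor \<open>\<lambda>\<close>. The commutator \<open>\<Delta> (V u) = V (\<Delta> u) + 2 \<lambda> \<Delta> u\<close>, valid because the
  surface has dimension two, then reduces the symmetry condition to an identity in the \<open>u\<close>-component,
  from which special jets yield \<open>\<tau>' = 4 \<lambda>\<close>. Hence \<open>\<lambda>\<close> is constant, and a symmetry is a homothety
  \<open>\<xi> \<partial>_x + \<phi> \<partial>_y\<close> of the metric with factor \<open>\<Lambda>\<close>, plus \<open>(4 \<Lambda> t + c) \<partial>_t\<close>, plus a constant multiple of
  \<open>u \<partial>_u\<close>, plus \<open>G \<partial>_u\<close> with a solution \<open>G\<close>.

  For a homothety, \<open>\<xi> = \<Lambda> x + g y\<close> with \<open>exp (- 2 f) g'' = f'' (\<Lambda> x + g) + f' \<Lambda>\<close>. If \<open>g\<close> is not constant,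
  comparing two values of \<open>y\<close> makes \<open>exp (2 f) f''\<close> constant, so \<open>h = exp f\<close> satisfies \<open>h'' = c h\<close>; if
  \<open>g\<close> is constant, \<open>f' (\<Lambda> x + g)\<close> is constant. The solutions of these equations are the exceptional
  forms; the bound \<open>\<alpha>7 \<le> \<beta>7\<close> in the hyperbolic case comes from the unit speed condition.\<close>

section \<open>Calculus of continuously differentiable functions\<close>

text \<open>The coefficients of a symmetry are of class \<open>C_k_on 4\<close> only, and the
  prolongation consumes all four derivatives, so the determining equations cannot be differentiated
  freely. Along the Taylor polynomial of a jet the formal total derivatives become ordinary ones:
  the condition turns into \<open>heat_op\<close> of the characteristic plus transport terms, and
  these cancel against the transport terms of the commutator. The condition is available only on
  jets with \<open>heat_form f x j = 0\<close>. Each test jet therefore changes few coordinates and,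
  where the equation contains them, is repaired in \<open>(4, 0, 0)\<close>, whose coefficient is
  the constant \<open>- 1\<close>. The factor in \<tau>' = 4 \<lambda> arises because the commutator
  is applied twice, each time contributing 2 \<lambda>. This equation still allows \<lambda> to
  depend on \<open>t\<close>; the terms linear in \<open>u_x\<close> and \<open>u_y\<close> then
  make \<xi> and \<phi> independent of \<open>t\<close>, which freezes \<lambda>.\<close>

lemma C_k_on_cong:
  assumes "open S" "C_k_on k g S" "\<And>p. p \<in> S \<Longrightarrow> g p = h p"
  shows "C_k_on k h S"
  using assms(2,3)
proof (induction k arbitrary: g h)
  case 0
  then show ?case by (simp cong: continuous_on_cong)
next
  case (Suc k)
  have fr: "frechet_derivative g (at p) = frechet_derivative h (at p)" and
       df: "h differentiable (at p)" if "p \<in> S" for p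
  proof -
    have g: "g differentiable (at p)" using Suc.prems that by simp
    show "frechet_derivative g (at p) = frechet_derivative h (at p)"
      by (rule frechet_derivative_transform_within_open[OF g assms(1) that Suc.prems(2)])
    from g show "h differentiable (at p)"
      unfolding differentiable_def
      using has_derivative_transform_within_open[OF _ assms(1) that] Suc.prems(2) by blast
  qed
  show ?case
    unfolding C_k_on.simps
  proof (intro conjI ballI)
    fix b :: 'a assume b: "b \<in> Basis"
    have "C_k_on k (\<lambda>p. frechet_derivative g (at p) b) S" using Suc.prems b by simp
    then show "C_k_on k (\<lambda>p. frechet_derivative h (at p) b) S"
      by (rule Suc.IH) (simp add: fr)
  qed (auto simp: df)
qed

lemma C_k_on_Suc_imp: "C_k_on (Suc k) g S \<Longrightarrow> C_k_on k g S"
proof (induction k arbitrary: g)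
  case 0
  then show ?case
    by (auto intro!: continuous_at_imp_continuous_on differentiable_imp_continuous_within)
next
  case (Suc k)
  then show ?case by (meson C_k_on.simps(2))
qed

lemma C_k_on_le: "C_k_on n g S \<Longrightarrow> k \<le> n \<Longrightarrow> C_k_on k g S"
proof (induction n)
  case (Suc n)
  then show ?case by (metis C_k_on_Suc_imp le_Suc_eq)
qed simp

lemma C_k_on_subset: "C_k_on k g S \<Longrightarrow> R \<subseteq> S \<Longrightarrow> C_k_on k g R"
proof (induction k arbitrary: g)
  case 0
  then show ?case using continuous_on_subset by auto
next
  case (Suc k)
  then show ?case by (simp add: subset_iff)
qed

lemma C_k_on_imp_continuous: "C_k_on k g S \<Longrightarrow> continuous_on S g"
  using C_k_on_le[of k g S 0] by simp

text \<open>\<open>frechet_derivative\<close> is a choice operator; this rule accepts an explicit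
  derivative instead, and \<open>C_k_on_cong\<close> transfers the regularity of its
  components.\<close>

lemma C_k_on_SucI:
  assumes "open S" "\<And>p. p \<in> S \<Longrightarrow> (g has_derivative g' p) (at p)"
    "\<And>b. b \<in> Basis \<Longrightarrow> C_k_on k (\<lambda>p. g' p b) S"
  shows "C_k_on (Suc k) g S"
  unfolding C_k_on.simps
proof (intro conjI ballI)
  fix p assume "p \<in> S" then show "g differentiable (at p)" using assms(2) differentiable_def by blast
next
  fix b :: 'a assume b: "b \<in> Basis"
  show "C_k_on k (\<lambda>p. frechet_derivative g (at p) b) S"
    by (rule C_k_on_cong[OF assms(1) assms(3)[OF b]])
      (metis assms(2) frechet_derivative_at)
qed

lemma C_k_on_SucD:
  assumes "C_k_on (Suc k) g S" "p \<in> S"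
  shows "(g has_derivative frechet_derivative g (at p)) (at p)"
  using assms frechet_derivative_works by auto

lemma C_k_on_const [simp]: "C_k_on k (\<lambda>p. c) S"
proof (induction k arbitrary: c)
  case (Suc k)
  then show ?case by simp
qed simp

lemma C_k_on_linear:
  assumes "bounded_linear L" "open S"
  shows "C_k_on k L S"
proof (cases k)
  case 0
  then show ?thesis using assms(1) by (simp add: linear_continuous_on)
next
  case (Suc n)
  show ?thesis unfolding Suc
    by (rule C_k_on_SucI[OF assms(2), where g' = "\<lambda>_. L"])
      (auto intro: bounded_linear_imp_has_derivative assms)
qed

lemma C_k_on_bounded_linear:
  assumes "bounded_linear L" "open S" "C_k_on k g S"
  shows "C_k_on k (\<lambda>p. L (g p)) S"
  using assms(3)
proof (induction k arbitrary: g)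
  case 0
  then show ?case
    using assms(1) by (auto intro: bounded_linear.continuous_on)
next
  case (Suc k)
  show ?case
  proof (rule C_k_on_SucI[OF assms(2)])
    show "((\<lambda>p. L (g p)) has_derivative (\<lambda>h. L (frechet_derivative g (at p) h))) (at p)" if "p \<in> S" for p
      by (rule bounded_linear.has_derivative[OF assms(1) C_k_on_SucD[OF Suc.prems that]])
  qed (use Suc in auto)
qed

lemma C_k_on_add:
  assumes "open S" "C_k_on k g S" "C_k_on k h S"
  shows "C_k_on k (\<lambda>p. g p + h p) S"
  using assms(2,3)
proof (induction k arbitrary: g h)
  case 0
  then show ?case by (simp add: continuous_on_add)
next
  case (Suc k)
  show ?case
  proof (rule C_k_on_SucI[OF assms(1)])
    show "((\<lambda>p. g p + h p) has_derivative
        (\<lambda>v. frechet_derivative g (at p) v + frechet_derivative h (at p) v)) (at p)" if "p \<in> S" for p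
      using that Suc.prems by (intro has_derivative_add C_k_on_SucD)
  qed (use Suc in auto)
qed

lemma C_k_on_sum:
  assumes "open S" "\<And>i. i \<in> A \<Longrightarrow> C_k_on k (g i) S"
  shows "C_k_on k (\<lambda>p. \<Sum>i\<in>A. g i p) S"
  using assms(2)
proof (induction A rule: infinite_finite_induct)
  case (insert x F)
  then show ?case by (simp add: C_k_on_add assms(1))
qed simp_all

lemma C_k_on_mult:
  fixes g h :: "'a::euclidean_space \<Rightarrow> real"
  assumes "open S" "C_k_on k g S" "C_k_on k h S"
  shows "C_k_on k (\<lambda>p. g p * h p) S"
  using assms(2,3)
proof (induction k arbitrary: g h)
  case 0
  then show ?case by (simp add: continuous_on_mult)
next
  case (Suc k)
  show ?case
  proof (rule C_k_on_SucI[OF assms(1)])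
    show "((\<lambda>p. g p * h p) has_derivative
        (\<lambda>v. g p * frechet_derivative h (at p) v + frechet_derivative g (at p) v * h p)) (at p)"
      if "p \<in> S" for p
      using that Suc.prems by (intro has_derivative_mult C_k_on_SucD)
    show "C_k_on k (\<lambda>p. g p * frechet_derivative h (at p) b + frechet_derivative g (at p) b * h p) S"
      if "b \<in> Basis" for b
      using that Suc.prems C_k_on_Suc_imp[OF Suc.prems(1)] C_k_on_Suc_imp[OF Suc.prems(2)]
      by (intro C_k_on_add Suc.IH assms(1)) auto
  qed
qed

lemma C_k_on_Pair:
  assumes "open S" "C_k_on k g S" "C_k_on k h S"
  shows "C_k_on k (\<lambda>p. (g p, h p)) S"
  using assms(2,3)
proof (induction k arbitrary: g h)
  case 0
  then show ?case by (simp add: continuous_on_Pair)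
next
  case (Suc k)
  show ?case
  proof (rule C_k_on_SucI[OF assms(1)])
    show "((\<lambda>p. (g p, h p)) has_derivative
        (\<lambda>v. (frechet_derivative g (at p) v, frechet_derivative h (at p) v))) (at p)" if "p \<in> S" for p
      using that Suc.prems by (intro has_derivative_Pair C_k_on_SucD)
  qed (use Suc in auto)
qed

text \<open>The induction keeps \<open>g\<close> fixed and varies \<open>h\<close>: expanded in the
  basis of the intermediate space, the derivative of the composite is a sum of products of a
  component of \<open>g'\<close> with a partial derivative of \<open>h\<close> composed with
  \<open>g\<close>, and the latter is an instance of the induction hypothesis.\<close>

lemma C_k_on_compose:
  fixes g :: "'a::euclidean_space \<Rightarrow> 'b::euclidean_space" and h :: "'b \<Rightarrow> real"
  assumes "open S" "C_k_on k g S" "C_k_on k h R" "g ` S \<subseteq> R"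
  shows "C_k_on k (\<lambda>p. h (g p)) S"
  using assms(2-)
proof (induction k arbitrary: h)
  case 0
  then show ?case by (auto intro: continuous_on_compose2)
next
  case (Suc k)
  let ?g' = "\<lambda>p. frechet_derivative g (at p)" and ?h' = "\<lambda>q. frechet_derivative h (at q)"
  have gS: "g p \<in> R" if "p \<in> S" for p using Suc.prems(3) that by auto
  show ?case
  proof (rule C_k_on_SucI[OF assms(1)])
    show "((\<lambda>p. h (g p)) has_derivative (\<lambda>v. ?h' (g p) (?g' p v))) (at p)" if "p \<in> S" for p
      by (rule has_derivative_compose[OF C_k_on_SucD[OF Suc.prems(1) that]
          C_k_on_SucD[OF Suc.prems(2) gS[OF that]]])
    fix b :: 'a assume b: "b \<in> Basis"
    have *: "C_k_on k (\<lambda>p. \<Sum>i\<in>Basis. (?g' p b \<bullet> i) * ?h' (g p) i) S"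
    proof (intro C_k_on_sum C_k_on_mult assms(1))
      fix i :: 'b assume i: "i \<in> Basis"
      show "C_k_on k (\<lambda>p. ?g' p b \<bullet> i) S"
        using Suc.prems(1) b by (intro C_k_on_bounded_linear[OF bounded_linear_inner_left assms(1)]) auto
      show "C_k_on k (\<lambda>p. ?h' (g p) i) S"
        using Suc.prems i by (intro Suc.IH[OF C_k_on_Suc_imp[OF Suc.prems(1)]]) auto
    qed
    have eq: "(\<Sum>i\<in>Basis. (?g' p b \<bullet> i) * ?h' (g p) i) = ?h' (g p) (?g' p b)" if "p \<in> S" for p
    proof -
      have lin: "linear (?h' (g p))"
        using C_k_on_SucD[OF Suc.prems(2) gS[OF that]] has_derivative_linear by blast
      have "?h' (g p) (?g' p b) = ?h' (g p) (\<Sum>i\<in>Basis. (?g' p b \<bullet> i) *\<^sub>R i)"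
        by (simp add: euclidean_representation)
      also have "\<dots> = (\<Sum>i\<in>Basis. (?g' p b \<bullet> i) * ?h' (g p) i)"
        by (simp add: linear_sum[OF lin] linear_cmul[OF lin])
      finally show ?thesis by simp
    qed
    show "C_k_on k (\<lambda>p. ?h' (g p) (?g' p b)) S"
      by (rule C_k_on_cong[OF assms(1) * eq])
  qed
qed

lemma C_k_on_fst [intro]: "open S \<Longrightarrow> C_k_on k fst S"
  by (rule C_k_on_linear[OF bounded_linear_fst])

lemma C_k_on_snd [intro]: "open S \<Longrightarrow> C_k_on k snd S"
  by (rule C_k_on_linear[OF bounded_linear_snd])

lemma C_k_on_fst_comp: "open S \<Longrightarrow> C_k_on k g S \<Longrightarrow> C_k_on k (\<lambda>p. fst (g p)) S"
  by (rule C_k_on_bounded_linear[OF bounded_linear_fst])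

lemma C_k_on_snd_comp: "open S \<Longrightarrow> C_k_on k g S \<Longrightarrow> C_k_on k (\<lambda>p. snd (g p)) S"
  by (rule C_k_on_bounded_linear[OF bounded_linear_snd])

lemma C_k_on_cmult:
  fixes g :: "'a::euclidean_space \<Rightarrow> real"
  shows "open S \<Longrightarrow> C_k_on k g S \<Longrightarrow> C_k_on k (\<lambda>p. c * g p) S"
  by (intro C_k_on_mult) auto

lemma C_k_on_minus:
  fixes g :: "'a::euclidean_space \<Rightarrow> real"
  shows "open S \<Longrightarrow> C_k_on k g S \<Longrightarrow> C_k_on k (\<lambda>p. - g p) S"
  using C_k_on_cmult[of S k g "-1"] by simp

lemma C_k_on_diff:
  fixes g h :: "'a::euclidean_space \<Rightarrow> real"
  shows "open S \<Longrightarrow> C_k_on k g S \<Longrightarrow> C_k_on k h S \<Longrightarrow> C_k_on k (\<lambda>p. g p - h p) S"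
  using C_k_on_add[of S k g "\<lambda>p. - h p"] by (simp add: C_k_on_minus)

lemma C_k_on_power:
  fixes g :: "'a::euclidean_space \<Rightarrow> real"
  shows "open S \<Longrightarrow> C_k_on k g S \<Longrightarrow> C_k_on k (\<lambda>p. g p ^ n) S"
  by (induction n) (auto intro: C_k_on_mult)


subsection \<open>Functions of one real variable\<close>

lemma C_k_on_real_SucI:
  fixes g :: "real \<Rightarrow> real"
  assumes "open S" "\<And>x. x \<in> S \<Longrightarrow> (g has_real_derivative g' x) (at x)" "C_k_on k g' S"
  shows "C_k_on (Suc k) g S"
  by (rule C_k_on_SucI[OF assms(1), where g' = "\<lambda>x h. g' x * h"])
    (use assms in \<open>auto simp: has_field_derivative_def\<close>)

lemma C_k_on_realD:
  fixes g :: "real \<Rightarrow> real"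
  assumes "C_k_on (Suc k) g S" "x \<in> S"
  shows "(g has_real_derivative deriv g x) (at x)"
  using assms DERIV_deriv_iff_real_differentiable by auto

lemma C_k_on_deriv:
  fixes g :: "real \<Rightarrow> real"
  assumes "C_k_on (Suc k) g S" "open S"
  shows "C_k_on k (deriv g) S"
proof (rule C_k_on_cong[OF assms(2)])
  show "C_k_on k (\<lambda>p. frechet_derivative g (at p) 1) S" using assms by simp
  show "frechet_derivative g (at p) 1 = deriv g p" if "p \<in> S" for p
  proof -
    have "frechet_derivative g (at p) = (*) (deriv g p)"
      using C_k_on_realD[OF assms(1) that] frechet_derivative_at
      by (metis has_field_derivative_def)
    then show ?thesis by simp
  qed
qed

lemma C_k_on_exp: "C_k_on k (exp :: real \<Rightarrow> real) UNIV"
proof (induction k)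
  case (Suc k)
  show ?case by (rule C_k_on_real_SucI[OF _ _ Suc]) (auto intro: DERIV_exp)
qed (simp add: continuous_on_exp)

lemma C_k_on_sin_cos: "C_k_on k (sin :: real \<Rightarrow> real) UNIV \<and> C_k_on k (cos :: real \<Rightarrow> real) UNIV"
proof (induction k)
  case 0
  show ?case by (simp add: continuous_on_sin continuous_on_cos)
next
  case (Suc k)
  have "C_k_on (Suc k) (sin :: real \<Rightarrow> real) UNIV"
    by (rule C_k_on_real_SucI[where g' = cos]) (use Suc in \<open>auto intro: DERIV_sin\<close>)
  moreover have "C_k_on (Suc k) (cos :: real \<Rightarrow> real) UNIV"
    by (rule C_k_on_real_SucI[where g' = "\<lambda>x. - sin x"])
      (use Suc in \<open>auto intro: DERIV_cos C_k_on_minus\<close>)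
  ultimately show ?case by blast
qed

lemma C_k_on_sinh_cosh: "C_k_on k (sinh :: real \<Rightarrow> real) UNIV \<and> C_k_on k (cosh :: real \<Rightarrow> real) UNIV"
proof (induction k)
  case 0
  show ?case by (auto intro!: continuous_intros)
next
  case (Suc k)
  have "C_k_on (Suc k) (sinh :: real \<Rightarrow> real) UNIV"
    by (rule C_k_on_real_SucI[where g' = cosh]) (use Suc in \<open>auto intro!: derivative_eq_intros\<close>)
  moreover have "C_k_on (Suc k) (cosh :: real \<Rightarrow> real) UNIV"
    by (rule C_k_on_real_SucI[where g' = sinh])
      (use Suc in \<open>auto intro!: derivative_eq_intros\<close>)
  ultimately show ?case by blast
qed

text \<open>The derivative of \<open>inverse\<close> is a polynomial in \<open>inverse\<close>
  itself, so the induction closes without any other function.\<close>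

lemma C_k_on_inverse: "C_k_on k (inverse :: real \<Rightarrow> real) (- {0})"
proof (induction k)
  case 0
  show ?case by (auto intro!: continuous_intros)
next
  case (Suc k)
  have o: "open (- {0 :: real})" by (simp add: open_Compl)
  show ?case
    by (rule C_k_on_real_SucI[OF o, where g' = "\<lambda>x. - (inverse x * inverse x)"])
      (auto intro!: derivative_eq_intros C_k_on_minus C_k_on_mult o Suc simp: power2_eq_square)
qed

lemma C_k_on_divide:
  fixes g h :: "'a::euclidean_space \<Rightarrow> real"
  assumes "open S" "C_k_on k g S" "C_k_on k h S" "\<And>p. p \<in> S \<Longrightarrow> h p \<noteq> 0"
  shows "C_k_on k (\<lambda>p. g p / h p) S"
proof -
  have "C_k_on k (\<lambda>p. inverse (h p)) S"
    by (rule C_k_on_compose[OF assms(1,3) C_k_on_inverse]) (use assms(4) in auto)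
  then show ?thesis unfolding divide_inverse by (intro C_k_on_mult assms)
qed

lemma C_k_on_exp_comp:
  fixes g :: "'a::euclidean_space \<Rightarrow> real"
  shows "open S \<Longrightarrow> C_k_on k g S \<Longrightarrow> C_k_on k (\<lambda>p. exp (g p)) S"
  by (rule C_k_on_compose[OF _ _ C_k_on_exp]) auto

lemma C_k_on_sin_comp:
  fixes g :: "'a::euclidean_space \<Rightarrow> real"
  shows "open S \<Longrightarrow> C_k_on k g S \<Longrightarrow> C_k_on k (\<lambda>p. sin (g p)) S"
  by (rule C_k_on_compose[OF _ _ conjunct1[OF C_k_on_sin_cos]]) auto

lemma C_k_on_cos_comp:
  fixes g :: "'a::euclidean_space \<Rightarrow> real"
  shows "open S \<Longrightarrow> C_k_on k g S \<Longrightarrow> C_k_on k (\<lambda>p. cos (g p)) S"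
  by (rule C_k_on_compose[OF _ _ conjunct2[OF C_k_on_sin_cos]]) auto

lemma C_k_on_sinh_comp:
  fixes g :: "'a::euclidean_space \<Rightarrow> real"
  shows "open S \<Longrightarrow> C_k_on k g S \<Longrightarrow> C_k_on k (\<lambda>p. sinh (g p)) S"
  by (rule C_k_on_compose[OF _ _ conjunct1[OF C_k_on_sinh_cosh]]) auto

lemma C_k_on_cosh_comp:
  fixes g :: "'a::euclidean_space \<Rightarrow> real"
  shows "open S \<Longrightarrow> C_k_on k g S \<Longrightarrow> C_k_on k (\<lambda>p. cosh (g p)) S"
  by (rule C_k_on_compose[OF _ _ conjunct2[OF C_k_on_sinh_cosh]]) auto

lemmas C_k_on_intros =
  C_k_on_const C_k_on_add C_k_on_diff C_k_on_minus C_k_on_mult C_k_on_divide C_k_on_power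
  C_k_on_exp_comp C_k_on_sin_comp C_k_on_cos_comp C_k_on_sinh_comp C_k_on_cosh_comp
  C_k_on_Pair C_k_on_fst_comp C_k_on_snd_comp C_k_on_fst C_k_on_snd


subsection \<open>Equality of mixed partial derivatives\<close>

text \<open>The second difference is an ordinary difference in \<open>x\<close> of
  \<open>\<lambda>s. F s (b+h) - F s b\<close>; the mean value theorem is applied to it and then, in
  \<open>y\<close>, to the resulting difference of \<open>Fx\<close>.\<close>

lemma mixed_difference_mean_value:
  fixes F :: "real \<Rightarrow> real \<Rightarrow> real"
  assumes h: "h > 0"
    and Fx: "\<And>x y. x \<in> {a..a+h} \<Longrightarrow> y \<in> {b..b+h} \<Longrightarrow> ((\<lambda>s. F s y) has_real_derivative Fx x y) (at x)"
    and Fxy: "\<And>x y. x \<in> {a..a+h} \<Longrightarrow> y \<in> {b..b+h} \<Longrightarrow> ((\<lambda>s. Fx x s) has_real_derivative Fxy x y) (at y)"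
  obtains x y where "x \<in> {a<..<a+h}" "y \<in> {b<..<b+h}"
    "F (a+h) (b+h) - F (a+h) b - F a (b+h) + F a b = h * h * Fxy x y"
proof -
  have "\<exists>z. a < z \<and> z < a + h \<and>
      (F (a+h) (b+h) - F (a+h) b) - (F a (b+h) - F a b) = (a + h - a) * (Fx z (b+h) - Fx z b)"
    by (rule MVT2[where f = "\<lambda>s. F s (b+h) - F s b"]) (use h in \<open>auto intro!: DERIV_diff Fx\<close>)
  then obtain x where x: "a < x" "x < a + h" and
    1: "(F (a+h) (b+h) - F (a+h) b) - (F a (b+h) - F a b) = h * (Fx x (b+h) - Fx x b)" by auto
  have "\<exists>z. b < z \<and> z < b + h \<and> Fx x (b+h) - Fx x b = (b + h - b) * Fxy x z"
    by (rule MVT2) (use h x in \<open>auto intro!: Fxy\<close>)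
  then obtain y where y: "b < y" "y < b + h" and 2: "Fx x (b+h) - Fx x b = h * Fxy x y" by auto
  from that[of x y] x y 1 2 show thesis by (auto simp: algebra_simps)
qed

text \<open>Schwarz's theorem. The second difference is symmetric in the two variables, so computing
  it in both orders makes a value of \<open>Fxy\<close> equal to a value of \<open>Fyx\<close> at
  points arbitrarily close to \<open>(a, b)\<close>; continuity at \<open>(a, b)\<close> excludes a
  gap between the two limits.\<close>

lemma mixed_partials_eq:
  fixes F Fx Fy Fxy Fyx :: "real \<Rightarrow> real \<Rightarrow> real"
  assumes r: "r > 0"
    and Fx: "\<And>x y. \<bar>x - a\<bar> < r \<Longrightarrow> \<bar>y - b\<bar> < r \<Longrightarrow> ((\<lambda>s. F s y) has_real_derivative Fx x y) (at x)"
    and Fxy: "\<And>x y. \<bar>x - a\<bar> < r \<Longrightarrow> \<bar>y - b\<bar> < r \<Longrightarrow> ((\<lambda>s. Fx x s) has_real_derivative Fxy x y) (at y)"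
    and Fy: "\<And>x y. \<bar>x - a\<bar> < r \<Longrightarrow> \<bar>y - b\<bar> < r \<Longrightarrow> ((\<lambda>s. F x s) has_real_derivative Fy x y) (at y)"
    and Fyx: "\<And>x y. \<bar>x - a\<bar> < r \<Longrightarrow> \<bar>y - b\<bar> < r \<Longrightarrow> ((\<lambda>s. Fy s y) has_real_derivative Fyx x y) (at x)"
    and c1: "isCont (\<lambda>(x, y). Fxy x y) (a, b)" and c2: "isCont (\<lambda>(x, y). Fyx x y) (a, b)"
  shows "Fxy a b = Fyx a b"
proof (rule ccontr)
  assume ne: "Fxy a b \<noteq> Fyx a b"
  define e where "e = \<bar>Fxy a b - Fyx a b\<bar> / 2"
  have e: "e > 0" using ne by (simp add: e_def)
  obtain d1 where d1: "d1 > 0" "\<And>p. dist p (a, b) < d1 \<Longrightarrow> dist ((\<lambda>(x, y). Fxy x y) p) (Fxy a b) < e"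
    using c1 e unfolding continuous_at_eps_delta by fastforce
  obtain d2 where d2: "d2 > 0" "\<And>p. dist p (a, b) < d2 \<Longrightarrow> dist ((\<lambda>(x, y). Fyx x y) p) (Fyx a b) < e"
    using c2 e unfolding continuous_at_eps_delta by fastforce
  \<comment> \<open>The distance of a point of the small square from \<open>(a, b)\<close> is below
    the sum of both sides, so \<open>2 * h\<close> must stay under \<open>d1\<close> and
    \<open>d2\<close>.\<close>
  define h where "h = Min {r, d1, d2} / 3"
  have h: "h > 0" "h < r" "2 * h < d1" "2 * h < d2" using r d1(1) d2(1) by (auto simp: h_def)
  have close: "dist (x, y) (a, b) < d" if "x \<in> {a<..<a+h}" "y \<in> {b<..<b+h}" "2 * h < d" for x y d
  proof -
    have "dist (x, y) (a, b) \<le> \<bar>x - a\<bar> + \<bar>y - b\<bar>"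
      by (simp add: dist_Pair_Pair dist_real_def sqrt_sum_squares_le_sum_abs)
    also have "\<dots> < d" using that by auto
    finally show ?thesis .
  qed
  obtain x y where xy: "x \<in> {a<..<a+h}" "y \<in> {b<..<b+h}"
    "F (a+h) (b+h) - F (a+h) b - F a (b+h) + F a b = h * h * Fxy x y"
    by (rule mixed_difference_mean_value[OF h(1), of a b F Fx Fxy]) (use h in \<open>auto intro!: Fx Fxy\<close>)
  obtain y' x' where xy': "y' \<in> {b<..<b+h}" "x' \<in> {a<..<a+h}"
    "F (a+h) (b+h) - F a (b+h) - F (a+h) b + F a b = h * h * Fyx x' y'"
    by (rule mixed_difference_mean_value[OF h(1), of b a "\<lambda>y x. F x y" "\<lambda>y x. Fy x y" "\<lambda>y x. Fyx x y"])
      (use h in \<open>auto intro!: Fy Fyx\<close>)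
  have "Fxy x y = Fyx x' y'" using xy(3) xy'(3) h(1) by (simp add: algebra_simps)
  moreover have "\<bar>Fxy x y - Fxy a b\<bar> < e"
    using d1(2)[OF close[OF xy(1,2) h(3)]] by (simp add: dist_real_def)
  moreover have "\<bar>Fyx x' y' - Fyx a b\<bar> < e"
    using d2(2)[OF close[OF xy'(2,1) h(4)]] by (simp add: dist_real_def)
  ultimately show False unfolding e_def by argo
qed


section \<open>Functions of three and of four variables\<close>

definition dx :: "(real \<Rightarrow> real \<Rightarrow> real \<Rightarrow> real) \<Rightarrow> real \<Rightarrow> real \<Rightarrow> real \<Rightarrow> real" where
  "dx w x y t = deriv (\<lambda>s. w s y t) x"

definition dy :: "(real \<Rightarrow> real \<Rightarrow> real \<Rightarrow> real) \<Rightarrow> real \<Rightarrow> real \<Rightarrow> real \<Rightarrow> real" where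
  "dy w x y t = deriv (\<lambda>s. w x s t) y"

definition dt :: "(real \<Rightarrow> real \<Rightarrow> real \<Rightarrow> real) \<Rightarrow> real \<Rightarrow> real \<Rightarrow> real \<Rightarrow> real" where
  "dt w x y t = deriv (\<lambda>s. w x y s) t"

definition C3 :: "nat \<Rightarrow> (real \<times> real \<times> real) set \<Rightarrow> (real \<Rightarrow> real \<Rightarrow> real \<Rightarrow> real) \<Rightarrow> bool" where
  "C3 k D w \<longleftrightarrow> C_k_on k (\<lambda>(x, y, t). w x y t) D"

lemma C3_iff: "C3 k D w \<longleftrightarrow> C_k_on k (\<lambda>p. w (fst p) (fst (snd p)) (snd (snd p))) D"
  by (simp add: C3_def case_prod_unfold)

lemma C3_cong:
  assumes "open D" "C3 k D v" "\<And>x y t. (x, y, t) \<in> D \<Longrightarrow> v x y t = w x y t"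
  shows "C3 k D w"
  using assms(2) unfolding C3_def by (rule C_k_on_cong[OF assms(1)]) (use assms(3) in auto)

lemma C3_le: "C3 n D w \<Longrightarrow> k \<le> n \<Longrightarrow> C3 k D w"
  unfolding C3_def by (rule C_k_on_le)

lemma C3_subset: "C3 k D w \<Longrightarrow> R \<subseteq> D \<Longrightarrow> C3 k R w"
  unfolding C3_def by (rule C_k_on_subset)

lemma C3_const: "C3 k D (\<lambda>x y t. c)"
  by (simp add: C3_def case_prod_unfold)

lemma C3_add: "open D \<Longrightarrow> C3 k D v \<Longrightarrow> C3 k D w \<Longrightarrow> C3 k D (\<lambda>x y t. v x y t + w x y t)"
  unfolding C3_iff by (rule C_k_on_add)

lemma C3_diff: "open D \<Longrightarrow> C3 k D v \<Longrightarrow> C3 k D w \<Longrightarrow> C3 k D (\<lambda>x y t. v x y t - w x y t)"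
  unfolding C3_iff by (rule C_k_on_diff)

lemma C3_mult: "open D \<Longrightarrow> C3 k D v \<Longrightarrow> C3 k D w \<Longrightarrow> C3 k D (\<lambda>x y t. v x y t * w x y t)"
  unfolding C3_iff by (rule C_k_on_mult)

lemma C3_sum: "open D \<Longrightarrow> (\<And>i. i \<in> A \<Longrightarrow> C3 k D (w i)) \<Longrightarrow> C3 k D (\<lambda>x y t. \<Sum>i\<in>A. w i x y t)"
  unfolding C3_iff by (rule C_k_on_sum)

lemma C3_of_x:
  assumes "open D" "C_k_on k a I" "\<And>x y t. (x, y, t) \<in> D \<Longrightarrow> x \<in> I"
  shows "C3 k D (\<lambda>x y t. a x)"
  unfolding C3_iff by (rule C_k_on_compose[OF assms(1) _ assms(2)]) (use assms in \<open>auto intro: C_k_on_intros\<close>)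

lemma has_derivative_partials3:
  assumes "(g has_derivative g') (at (x, y, t))"
  shows "((\<lambda>s. g (s, y, t)) has_real_derivative g' (1, 0, 0)) (at x)"
    "((\<lambda>s. g (x, s, t)) has_real_derivative g' (0, 1, 0)) (at y)"
    "((\<lambda>s. g (x, y, s)) has_real_derivative g' (0, 0, 1)) (at t)"
proof -
  have lin: "linear g'" using assms has_derivative_linear by blast
  have 1: "((\<lambda>s. g (s, y, t)) has_derivative (\<lambda>h. g' (h, 0, 0))) (at x)"
    by (rule has_derivative_compose[of "\<lambda>s. (s, y, t)" _ _ _ g, OF _ assms]) (auto intro!: derivative_eq_intros simp: zero_prod_def)
  have 2: "((\<lambda>s. g (x, s, t)) has_derivative (\<lambda>h. g' (0, h, 0))) (at y)"
    by (rule has_derivative_compose[of "\<lambda>s. (x, s, t)" _ _ _ g, OF _ assms]) (auto intro!: derivative_eq_intros simp: zero_prod_def)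
  have 3: "((\<lambda>s. g (x, y, s)) has_derivative (\<lambda>h. g' (0, 0, h))) (at t)"
    by (rule has_derivative_compose[of "\<lambda>s. (x, y, s)" _ _ _ g, OF _ assms]) (auto intro!: derivative_eq_intros simp: zero_prod_def)
  have "g' (h, 0, 0) = g' (1, 0, 0) * h" "g' (0, h, 0) = g' (0, 1, 0) * h" "g' (0, 0, h) = g' (0, 0, 1) * h" for h
    using linear_cmul[OF lin, of h "(1, 0, 0)"] linear_cmul[OF lin, of h "(0, 1, 0)"]
      linear_cmul[OF lin, of h "(0, 0, 1)"] by simp_all
  then have "(\<lambda>h. g' (h, 0, 0)) = (*) (g' (1, 0, 0))" "(\<lambda>h. g' (0, h, 0)) = (*) (g' (0, 1, 0))"
    "(\<lambda>h. g' (0, 0, h)) = (*) (g' (0, 0, 1))" by blast+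
  with 1 2 3 show "((\<lambda>s. g (s, y, t)) has_real_derivative g' (1, 0, 0)) (at x)"
    "((\<lambda>s. g (x, s, t)) has_real_derivative g' (0, 1, 0)) (at y)"
    "((\<lambda>s. g (x, y, s)) has_real_derivative g' (0, 0, 1)) (at t)"
    by (simp_all add: has_field_derivative_def)
qed

lemma C3_frechet:
  assumes "C3 (Suc k) D w" "(x, y, t) \<in> D"
  shows "((\<lambda>(x, y, t). w x y t) has_derivative frechet_derivative (\<lambda>(x, y, t). w x y t) (at (x, y, t)))
    (at (x, y, t))"
  using C_k_on_SucD assms unfolding C3_def by blast

lemma has_real_derivative_deriv:
  "(g has_real_derivative d) (at x) \<Longrightarrow> (g has_real_derivative deriv g x) (at x)"
  using DERIV_imp_deriv by blast

lemma C3_has_deriv: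
  assumes "C3 (Suc k) D w" "(x, y, t) \<in> D"
  shows C3_has_dx: "((\<lambda>s. w s y t) has_real_derivative dx w x y t) (at x)"
    and C3_has_dy: "((\<lambda>s. w x s t) has_real_derivative dy w x y t) (at y)"
    and C3_has_dt: "((\<lambda>s. w x y s) has_real_derivative dt w x y t) (at t)"
  using has_derivative_partials3[OF C3_frechet[OF assms]]
  by (auto simp: dx_def dy_def dt_def intro: has_real_derivative_deriv)

lemma
  assumes "C3 (Suc k) D w" "open D"
  shows C3_dx: "C3 k D (dx w)" and C3_dy: "C3 k D (dy w)" and C3_dt: "C3 k D (dt w)"
proof -
  let ?g' = "\<lambda>p. frechet_derivative (\<lambda>(x, y, t). w x y t) (at p)"
  have *: "C_k_on k (\<lambda>p. ?g' p b) D" if "b \<in> Basis" for b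
    using assms(1) that by (auto simp: C3_def)
  have e: "dx w x y t = ?g' (x, y, t) (1, 0, 0)" "dy w x y t = ?g' (x, y, t) (0, 1, 0)"
    "dt w x y t = ?g' (x, y, t) (0, 0, 1)" if "(x, y, t) \<in> D" for x y t
    using has_derivative_partials3[OF C3_frechet[OF assms(1) that]]
    by (auto simp: dx_def dy_def dt_def intro: DERIV_imp_deriv)
  have b: "(1, 0, 0) \<in> (Basis :: (real \<times> real \<times> real) set)" "(0, 1, 0) \<in> (Basis :: (real \<times> real \<times> real) set)"
    "(0, 0, 1) \<in> (Basis :: (real \<times> real \<times> real) set)"
    by (auto simp: Basis_prod_def zero_prod_def)
  show "C3 k D (dx w)" "C3 k D (dy w)" "C3 k D (dt w)"
    unfolding C3_def using e
    by (auto intro: C_k_on_cong[OF assms(2) *[OF b(1)]] C_k_on_cong[OF assms(2) *[OF b(2)]]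
        C_k_on_cong[OF assms(2) *[OF b(3)]])
qed

lemma open3_nhds:
  assumes "open D" "(x, y, t) \<in> D"
  shows "eventually (\<lambda>s. (s, y, t) \<in> D) (nhds x)" "eventually (\<lambda>s. (x, s, t) \<in> D) (nhds y)"
    "eventually (\<lambda>s. (x, y, s) \<in> D) (nhds t)"
proof -
  have "continuous_on UNIV (\<lambda>s. (s, y, t))" "continuous_on UNIV (\<lambda>s. (x, s, t))"
    "continuous_on UNIV (\<lambda>s. (x, y, s))" by (auto intro!: continuous_intros)
  then have "open ((\<lambda>s. (s, y, t)) -` D)" "open ((\<lambda>s. (x, s, t)) -` D)" "open ((\<lambda>s. (x, y, s)) -` D)"
    using assms(1) by (auto intro: open_vimage)
  from eventually_nhds_in_open[OF this(1)] eventually_nhds_in_open[OF this(2)]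
    eventually_nhds_in_open[OF this(3)] assms(2)
  show "eventually (\<lambda>s. (s, y, t) \<in> D) (nhds x)" "eventually (\<lambda>s. (x, s, t) \<in> D) (nhds y)"
    "eventually (\<lambda>s. (x, y, s) \<in> D) (nhds t)" by auto
qed

text \<open>A derivative depends only on the germ, so an identity on the open set \<open>D\<close>
  may itself be differentiated. Higher derivatives are computed below by rewriting the first
  derivative with this rule and differentiating the result.\<close>

lemma
  assumes "open D" "\<And>x y t. (x, y, t) \<in> D \<Longrightarrow> v x y t = w x y t" "(x, y, t) \<in> D"
  shows dx_cong: "dx v x y t = dx w x y t" and dy_cong: "dy v x y t = dy w x y t"
    and dt_cong: "dt v x y t = dt w x y t"
  unfolding dx_def dy_def dt_def
  by (auto intro!: deriv_cong_ev eventually_mono[OF open3_nhds(1)[OF assms(1,3)]]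
      eventually_mono[OF open3_nhds(2)[OF assms(1,3)]] eventually_mono[OF open3_nhds(3)[OF assms(1,3)]] assms(2))

lemma
  assumes "C3 (Suc k) D v" "C3 (Suc k) D w" "(x, y, t) \<in> D"
  shows dx_add: "dx (\<lambda>x y t. v x y t + w x y t) x y t = dx v x y t + dx w x y t"
    and dy_add: "dy (\<lambda>x y t. v x y t + w x y t) x y t = dy v x y t + dy w x y t"
    and dt_add: "dt (\<lambda>x y t. v x y t + w x y t) x y t = dt v x y t + dt w x y t"
    and dx_diff: "dx (\<lambda>x y t. v x y t - w x y t) x y t = dx v x y t - dx w x y t"
    and dy_diff: "dy (\<lambda>x y t. v x y t - w x y t) x y t = dy v x y t - dy w x y t"
    and dt_diff: "dt (\<lambda>x y t. v x y t - w x y t) x y t = dt v x y t - dt w x y t"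
    and dx_mult: "dx (\<lambda>x y t. v x y t * w x y t) x y t = dx v x y t * w x y t + v x y t * dx w x y t"
    and dy_mult: "dy (\<lambda>x y t. v x y t * w x y t) x y t = dy v x y t * w x y t + v x y t * dy w x y t"
    and dt_mult: "dt (\<lambda>x y t. v x y t * w x y t) x y t = dt v x y t * w x y t + v x y t * dt w x y t"
  using C3_has_deriv[OF assms(1,3)] C3_has_deriv[OF assms(2,3)]
  unfolding dx_def[of "\<lambda>x y t. v x y t + w x y t"] dy_def[of "\<lambda>x y t. v x y t + w x y t"]
    dt_def[of "\<lambda>x y t. v x y t + w x y t"] dx_def[of "\<lambda>x y t. v x y t - w x y t"]
    dy_def[of "\<lambda>x y t. v x y t - w x y t"] dt_def[of "\<lambda>x y t. v x y t - w x y t"]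
    dx_def[of "\<lambda>x y t. v x y t * w x y t"] dy_def[of "\<lambda>x y t. v x y t * w x y t"]
    dt_def[of "\<lambda>x y t. v x y t * w x y t"]
  by (auto intro!: DERIV_imp_deriv derivative_eq_intros)

lemma C3_isCont: "C3 k D w \<Longrightarrow> open D \<Longrightarrow> (x, y, t) \<in> D \<Longrightarrow> isCont (\<lambda>(x, y, t). w x y t) (x, y, t)"
  unfolding C3_def using C_k_on_imp_continuous continuous_on_eq_continuous_at by blast

lemma open3_box:
  assumes "open D" "(a, b, c) \<in> (D :: (real \<times> real \<times> real) set)"
  obtains r where "r > 0"
    "\<And>x y t. \<bar>x - a\<bar> < r \<Longrightarrow> \<bar>y - b\<bar> < r \<Longrightarrow> \<bar>t - c\<bar> < r \<Longrightarrow> (x, y, t) \<in> D"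
proof -
  obtain e where e: "e > 0" "\<And>q. dist q (a, b, c) < e \<Longrightarrow> q \<in> D"
    using assms open_dist by blast
  have "(x, y, t) \<in> D" if "\<bar>x - a\<bar> < e / 3" "\<bar>y - b\<bar> < e / 3" "\<bar>t - c\<bar> < e / 3" for x y t
  proof (rule e(2))
    have 1: "dist (x, y, t) (a, b, c) \<le> \<bar>x - a\<bar> + dist (y, t) (b, c)"
      using sqrt_sum_squares_le_sum_abs[of "x - a" "dist (y, t) (b, c)"]
      by (simp add: dist_Pair_Pair dist_real_def)
    have 2: "dist (y, t) (b, c) \<le> \<bar>y - b\<bar> + \<bar>t - c\<bar>"
      by (simp add: dist_Pair_Pair dist_real_def sqrt_sum_squares_le_sum_abs)
    from 1 2 that show "dist (x, y, t) (a, b, c) < e" by linarith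
  qed
  then show thesis using that[of "e / 3"] e(1) by auto
qed

text \<open>One variable is frozen, which reduces each claim to \<open>mixed_partials_eq\<close> on
  a square in the other two.\<close>

lemma
  assumes "C3 (Suc (Suc k)) D w" "open D" "(x, y, t) \<in> D"
  shows dx_dy_commute: "dx (dy w) x y t = dy (dx w) x y t"
    and dx_dt_commute: "dx (dt w) x y t = dt (dx w) x y t"
    and dy_dt_commute: "dy (dt w) x y t = dt (dy w) x y t"
proof -
  obtain r where r: "r > 0"
    "\<And>a b c. \<bar>a - x\<bar> < r \<Longrightarrow> \<bar>b - y\<bar> < r \<Longrightarrow> \<bar>c - t\<bar> < r \<Longrightarrow> (a, b, c) \<in> D"
    using open3_box[OF assms(2,3)] by blast
  note d1 = C3_has_deriv[OF assms(1)]
  note dx1 = C3_has_deriv[OF C3_dx[OF assms(1,2)]] and dy1 = C3_has_deriv[OF C3_dy[OF assms(1,2)]]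
    and dt1 = C3_has_deriv[OF C3_dt[OF assms(1,2)]]
  note c = C3_isCont[OF _ assms(2,3)]
  have cc: "isCont (\<lambda>(a, b). v a b t) (x, y)" "isCont (\<lambda>(a, b). v a y b) (x, t)"
    "isCont (\<lambda>(a, b). v x a b) (y, t)" if "C3 k D v" for v
  proof -
    have *: "isCont (\<lambda>q. (\<lambda>(x, y, t). v x y t) (h q)) p" if "h p = (x, y, t)" "isCont h p"
      for h :: "real \<times> real \<Rightarrow> real \<times> real \<times> real" and p
      using isCont_o2[OF that(2)] c[OF \<open>C3 k D v\<close>] that(1) by simp
    show "isCont (\<lambda>(a, b). v a b t) (x, y)"
      using *[of "\<lambda>(a, b). (a, b, t)" "(x, y)"]
      by (simp add: case_prod_unfold continuous_intros)
    show "isCont (\<lambda>(a, b). v a y b) (x, t)"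
      using *[of "\<lambda>(a, b). (a, y, b)" "(x, t)"]
      by (simp add: case_prod_unfold continuous_intros)
    show "isCont (\<lambda>(a, b). v x a b) (y, t)"
      using *[of "\<lambda>(a, b). (x, a, b)" "(y, t)"]
      by (simp add: case_prod_unfold continuous_intros)
  qed
  note ct = C3_dx[OF C3_dy[OF assms(1,2)] assms(2)] C3_dy[OF C3_dx[OF assms(1,2)] assms(2)]
    C3_dx[OF C3_dt[OF assms(1,2)] assms(2)] C3_dt[OF C3_dx[OF assms(1,2)] assms(2)]
    C3_dy[OF C3_dt[OF assms(1,2)] assms(2)] C3_dt[OF C3_dy[OF assms(1,2)] assms(2)]
  show "dx (dy w) x y t = dy (dx w) x y t"
    by (rule sym, rule mixed_partials_eq[OF r(1), of x y "\<lambda>a b. w a b t" "\<lambda>a b. dx w a b t"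
          "\<lambda>a b. dy (dx w) a b t" "\<lambda>a b. dy w a b t" "\<lambda>a b. dx (dy w) a b t"])
      (use r cc(1)[OF ct(1)] cc(1)[OF ct(2)] in \<open>auto intro!: d1 dx1 dy1\<close>)
  show "dx (dt w) x y t = dt (dx w) x y t"
    by (rule sym, rule mixed_partials_eq[OF r(1), of x t "\<lambda>a b. w a y b" "\<lambda>a b. dx w a y b"
          "\<lambda>a b. dt (dx w) a y b" "\<lambda>a b. dt w a y b" "\<lambda>a b. dx (dt w) a y b"])
      (use r cc(2)[OF ct(3)] cc(2)[OF ct(4)] in \<open>auto intro!: d1 dx1 dt1\<close>)
  show "dy (dt w) x y t = dt (dy w) x y t"
    by (rule sym, rule mixed_partials_eq[OF r(1), of y t "\<lambda>a b. w x a b" "\<lambda>a b. dy w x a b"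
          "\<lambda>a b. dt (dy w) x a b" "\<lambda>a b. dt w x a b" "\<lambda>a b. dy (dt w) x a b"])
      (use r cc(3)[OF ct(5)] cc(3)[OF ct(6)] in \<open>auto intro!: d1 dy1 dt1\<close>)
qed

section \<open>Partial derivatives of functions of \<open>(x, y, t, u)\<close>\<close>

definition px :: "(real \<times> real \<times> real \<times> real \<Rightarrow> real) \<Rightarrow> real \<times> real \<times> real \<times> real \<Rightarrow> real" where
  "px h = (\<lambda>(x, y, t, u). deriv (\<lambda>s. h (s, y, t, u)) x)"

definition py :: "(real \<times> real \<times> real \<times> real \<Rightarrow> real) \<Rightarrow> real \<times> real \<times> real \<times> real \<Rightarrow> real" where
  "py h = (\<lambda>(x, y, t, u). deriv (\<lambda>s. h (x, s, t, u)) y)"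

definition pt :: "(real \<times> real \<times> real \<times> real \<Rightarrow> real) \<Rightarrow> real \<times> real \<times> real \<times> real \<Rightarrow> real" where
  "pt h = (\<lambda>(x, y, t, u). deriv (\<lambda>s. h (x, y, s, u)) t)"

definition pu :: "(real \<times> real \<times> real \<times> real \<Rightarrow> real) \<Rightarrow> real \<times> real \<times> real \<times> real \<Rightarrow> real" where
  "pu h = (\<lambda>(x, y, t, u). deriv (\<lambda>s. h (x, y, t, s)) u)"

lemma frechet_partials4:
  assumes "C_k_on (Suc k) h \<Omega>" "p \<in> \<Omega>"
  shows "px h p = frechet_derivative h (at p) (1, 0, 0, 0)" "py h p = frechet_derivative h (at p) (0, 1, 0, 0)"
    "pt h p = frechet_derivative h (at p) (0, 0, 1, 0)" "pu h p = frechet_derivative h (at p) (0, 0, 0, 1)"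
proof -
  obtain x y t u where p: "p = (x, y, t, u)" by (metis prod.exhaust)
  let ?h' = "frechet_derivative h (at p)"
  have D: "(h has_derivative ?h') (at (x, y, t, u))" using C_k_on_SucD[OF assms] p by simp
  have lin: "linear ?h'" using D has_derivative_linear by blast
  have 1: "((\<lambda>s. h (s, y, t, u)) has_derivative (\<lambda>r. ?h' (r, 0, 0, 0))) (at x)"
    by (rule has_derivative_compose[of "\<lambda>s. (s, y, t, u)" _ _ _ h, OF _ D]) (auto intro!: derivative_eq_intros simp: zero_prod_def)
  have 2: "((\<lambda>s. h (x, s, t, u)) has_derivative (\<lambda>r. ?h' (0, r, 0, 0))) (at y)"
    by (rule has_derivative_compose[of "\<lambda>s. (x, s, t, u)" _ _ _ h, OF _ D]) (auto intro!: derivative_eq_intros simp: zero_prod_def)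
  have 3: "((\<lambda>s. h (x, y, s, u)) has_derivative (\<lambda>r. ?h' (0, 0, r, 0))) (at t)"
    by (rule has_derivative_compose[of "\<lambda>s. (x, y, s, u)" _ _ _ h, OF _ D]) (auto intro!: derivative_eq_intros simp: zero_prod_def)
  have 4: "((\<lambda>s. h (x, y, t, s)) has_derivative (\<lambda>r. ?h' (0, 0, 0, r))) (at u)"
    by (rule has_derivative_compose[of "\<lambda>s. (x, y, t, s)" _ _ _ h, OF _ D]) (auto intro!: derivative_eq_intros simp: zero_prod_def)
  have "?h' (r, 0, 0, 0) = ?h' (1, 0, 0, 0) * r" "?h' (0, r, 0, 0) = ?h' (0, 1, 0, 0) * r"
    "?h' (0, 0, r, 0) = ?h' (0, 0, 1, 0) * r" "?h' (0, 0, 0, r) = ?h' (0, 0, 0, 1) * r" for r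
    using linear_cmul[OF lin, of r "(1, 0, 0, 0)"] linear_cmul[OF lin, of r "(0, 1, 0, 0)"]
      linear_cmul[OF lin, of r "(0, 0, 1, 0)"] linear_cmul[OF lin, of r "(0, 0, 0, 1)"]
    by simp_all
  then have "(\<lambda>r. ?h' (r, 0, 0, 0)) = (*) (?h' (1, 0, 0, 0))" "(\<lambda>r. ?h' (0, r, 0, 0)) = (*) (?h' (0, 1, 0, 0))"
    "(\<lambda>r. ?h' (0, 0, r, 0)) = (*) (?h' (0, 0, 1, 0))" "(\<lambda>r. ?h' (0, 0, 0, r)) = (*) (?h' (0, 0, 0, 1))"
    by blast+
  with 1 2 3 4 show "px h p = ?h' (1, 0, 0, 0)" "py h p = ?h' (0, 1, 0, 0)"
    "pt h p = ?h' (0, 0, 1, 0)" "pu h p = ?h' (0, 0, 0, 1)"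
    unfolding p px_def py_def pt_def pu_def
    by (auto intro!: DERIV_imp_deriv simp: has_field_derivative_def)
qed

lemma
  assumes "C_k_on (Suc k) h \<Omega>" "open \<Omega>"
  shows C_k_on_px: "C_k_on k (px h) \<Omega>" and C_k_on_py: "C_k_on k (py h) \<Omega>"
    and C_k_on_pt: "C_k_on k (pt h) \<Omega>" and C_k_on_pu: "C_k_on k (pu h) \<Omega>"
proof -
  have b: "(1, 0, 0, 0) \<in> (Basis :: (real \<times> real \<times> real \<times> real) set)"
    "(0, 1, 0, 0) \<in> (Basis :: (real \<times> real \<times> real \<times> real) set)"
    "(0, 0, 1, 0) \<in> (Basis :: (real \<times> real \<times> real \<times> real) set)"
    "(0, 0, 0, 1) \<in> (Basis :: (real \<times> real \<times> real \<times> real) set)"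
    by (auto simp: Basis_prod_def zero_prod_def)
  have *: "C_k_on k (\<lambda>p. frechet_derivative h (at p) b) \<Omega>" if "b \<in> Basis" for b
    using assms(1) that by auto
  show "C_k_on k (px h) \<Omega>" "C_k_on k (py h) \<Omega>" "C_k_on k (pt h) \<Omega>" "C_k_on k (pu h) \<Omega>"
    using frechet_partials4[OF assms(1)]
    by (auto intro: C_k_on_cong[OF assms(2) *[OF b(1)]] C_k_on_cong[OF assms(2) *[OF b(2)]]
        C_k_on_cong[OF assms(2) *[OF b(3)]] C_k_on_cong[OF assms(2) *[OF b(4)]])
qed

lemma chain_rule4:
  assumes "C_k_on (Suc k) h \<Omega>" "(X s, Y s, Z s, W s) \<in> \<Omega>"
    and "(X has_real_derivative X') (at s)" "(Y has_real_derivative Y') (at s)"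
      "(Z has_real_derivative Z') (at s)" "(W has_real_derivative W') (at s)"
  shows "((\<lambda>s. h (X s, Y s, Z s, W s)) has_real_derivative
     (let p = (X s, Y s, Z s, W s) in px h p * X' + py h p * Y' + pt h p * Z' + pu h p * W')) (at s)"
proof -
  let ?p = "(X s, Y s, Z s, W s)"
  let ?h' = "frechet_derivative h (at ?p)"
  have D: "(h has_derivative ?h') (at ?p)" using C_k_on_SucD[OF assms(1,2)] .
  have lin: "linear ?h'" using D has_derivative_linear by blast
  have "((\<lambda>s. h (X s, Y s, Z s, W s)) has_derivative (\<lambda>r. ?h' (X' * r, Y' * r, Z' * r, W' * r))) (at s)"
    by (rule has_derivative_compose[of "\<lambda>s. (X s, Y s, Z s, W s)" _ _ _ h, OF _ D])
      (use assms(3-) in \<open>auto intro!: has_derivative_Pair simp: has_field_derivative_def\<close>)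
  moreover have "?h' (X' * r, Y' * r, Z' * r, W' * r) =
      (px h ?p * X' + py h ?p * Y' + pt h ?p * Z' + pu h ?p * W') * r" for r
  proof -
    have "(X' * r, Y' * r, Z' * r, W' * r) = (X' * r) *\<^sub>R (1, 0, 0, 0) + (Y' * r) *\<^sub>R (0, 1, 0, 0)
        + (Z' * r) *\<^sub>R (0, 0, 1, 0) + (W' * r) *\<^sub>R (0, 0, 0, 1)" by simp
    then have "?h' (X' * r, Y' * r, Z' * r, W' * r) = (X' * r) * ?h' (1, 0, 0, 0) + (Y' * r) * ?h' (0, 1, 0, 0)
        + (Z' * r) * ?h' (0, 0, 1, 0) + (W' * r) * ?h' (0, 0, 0, 1)"
      by (simp only: linear_add[OF lin] linear_cmul[OF lin] real_scaleR_def)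
    then show ?thesis unfolding frechet_partials4[OF assms(1,2)] by (simp add: algebra_simps)
  qed
  ultimately show ?thesis unfolding has_field_derivative_def Let_def by simp
qed


section \<open>Differential functions\<close>

lemma finite_orders [simp]: "finite (orders n)"
  by (rule finite_subset[of _ "{..n} \<times> {..n} \<times> {..n}"]) (auto simp: orders_def)

lemma orders_mono: "m \<in> orders n \<Longrightarrow> n \<le> k \<Longrightarrow> m \<in> orders k"
  by (auto simp: orders_def)

text \<open>The order of a differential function is expressed as invariance under changes of the
  higher jet coordinates, which requires no regularity in the lower ones.\<close>

definition depends_on_order :: "nat \<Rightarrow> diff_fun \<Rightarrow> bool" where
  "depends_on_order n P \<longleftrightarrow> (\<forall>x y t j j'. (\<forall>m\<in>orders n. j m = j' m) \<longrightarrow> P x y t j = P x y t j')"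

lemma depends_on_orderD:
  "depends_on_order n P \<Longrightarrow> (\<And>m. m \<in> orders n \<Longrightarrow> j m = j' m) \<Longrightarrow> P x y t j = P x y t j'"
  by (auto simp: depends_on_order_def)

lemma depends_on_order_le: "depends_on_order n P \<Longrightarrow> n \<le> k \<Longrightarrow> depends_on_order k P"
  unfolding depends_on_order_def using orders_mono by metis

lemma jet_pderiv_eq_0:
  assumes "depends_on_order n P" "m \<notin> orders n"
  shows "jet_pderiv m P x y t j = 0"
proof -
  have "(\<lambda>s. P x y t (j(m := s))) = (\<lambda>s. P x y t j)"
    using assms(2) by (intro ext depends_on_orderD[OF assms(1)]) auto
  then show ?thesis by (simp add: jet_pderiv_def)
qed

lemma depends_on_order_jet_pderiv:
  assumes "depends_on_order n P"
  shows "depends_on_order n (jet_pderiv m P)"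
proof (cases "m \<in> orders n")
  case True
  have "jet_pderiv m P x y t j = jet_pderiv m P x y t j'" if "\<forall>m\<in>orders n. j m = j' m" for x y t j j'
  proof -
    have "(\<lambda>s. P x y t (j(m := s))) = (\<lambda>s. P x y t (j'(m := s)))"
      using that by (intro ext depends_on_orderD[OF assms]) auto
    then show ?thesis using that True by (simp add: jet_pderiv_def)
  qed
  then show ?thesis by (auto simp: depends_on_order_def)
next
  case False
  then show ?thesis by (auto simp: depends_on_order_def jet_pderiv_eq_0[OF assms])
qed

lemma
  assumes "depends_on_order n P"
  shows depends_on_order_Dx: "depends_on_order (Suc n) (Dx P)"
    and depends_on_order_Dy: "depends_on_order (Suc n) (Dy P)"
    and depends_on_order_Dt: "depends_on_order (Suc n) (Dt P)"
proof -
  have p: "jet_pderiv m P x y t j = jet_pderiv m P x y t j'"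
    and P: "P x y t j = P x y t j'"
    if "\<forall>m\<in>orders (Suc n). j m = j' m" for x y t j j' m
    using that by (auto intro!: depends_on_orderD[OF depends_on_order_jet_pderiv[OF assms]]
        depends_on_orderD[OF assms] simp: orders_def)
  have s: "(Suc a, b, c) \<in> orders (Suc n)" "(a, Suc b, c) \<in> orders (Suc n)"
    "(a, b, Suc c) \<in> orders (Suc n)" if "(a, b, c) \<in> orders n" for a b c
    using that by (auto simp: orders_def)
  have "j (Suc a, b, c) * jet_pderiv (a, b, c) P x y t j = j' (Suc a, b, c) * jet_pderiv (a, b, c) P x y t j'"
    "j (a, Suc b, c) * jet_pderiv (a, b, c) P x y t j = j' (a, Suc b, c) * jet_pderiv (a, b, c) P x y t j'"
    "j (a, b, Suc c) * jet_pderiv (a, b, c) P x y t j = j' (a, b, Suc c) * jet_pderiv (a, b, c) P x y t j'"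
    if "\<forall>m\<in>orders (Suc n). j m = j' m" for x y t j j' a b c
    using that s[of a b c] p[OF that, of "(a, b, c)"] jet_pderiv_eq_0[OF assms, of "(a, b, c)"]
    by (cases "(a, b, c) \<in> orders n"; simp)+
  note e = this
  have e0: "deriv (\<lambda>s. P s y t j) x = deriv (\<lambda>s. P s y t j') x"
    "deriv (\<lambda>s. P x s t j) y = deriv (\<lambda>s. P x s t j') y"
    "deriv (\<lambda>s. P x y s j) t = deriv (\<lambda>s. P x y s j') t"
    if "\<forall>m\<in>orders (Suc n). j m = j' m" for x y t j j'
    using P[OF that] by simp_all
  show "depends_on_order (Suc n) (Dx P)" "depends_on_order (Suc n) (Dy P)" "depends_on_order (Suc n) (Dt P)"
    unfolding depends_on_order_def Dx_def Dy_def Dt_def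
    by (auto intro!: arg_cong2[where f = "(+)"] sum.cong intro: e e0)
qed

definition level :: "nat \<Rightarrow> (nat \<times> nat \<times> nat) set" where
  "level n = {(a, b, c). a + b + c = n}"

text \<open>A total derivative is affine in the coordinates of top order. Two jets that agree up to
  order \<open>n\<close> have equal explicit derivatives and equal \<open>jet_pderiv\<close> terms,
  so only the indices of exact order \<open>n\<close>, whose shifted coordinate has order
  \<open>n + 1\<close>, contribute to the difference.\<close>

lemma
  assumes "depends_on_order n P" "n \<le> 3" "\<And>m. m \<in> orders n \<Longrightarrow> j m = j' m"
  shows Dx_difference: "Dx P x y t j' - Dx P x y t j =
      (\<Sum>(a, b, c)\<in>level n. (j' (Suc a, b, c) - j (Suc a, b, c)) * jet_pderiv (a, b, c) P x y t j)"
    and Dy_difference: "Dy P x y t j' - Dy P x y t j =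
      (\<Sum>(a, b, c)\<in>level n. (j' (a, Suc b, c) - j (a, Suc b, c)) * jet_pderiv (a, b, c) P x y t j)"
proof -
  have sub: "level n \<subseteq> orders 3" using assms(2) by (auto simp: level_def orders_def)
  have p: "jet_pderiv m P x y t j' = jet_pderiv m P x y t j" for m
    by (rule sym) (auto intro!: depends_on_orderD[OF depends_on_order_jet_pderiv[OF assms(1)]] assms(3))
  have P: "P s r q j' = P s r q j" for s r q
    by (rule sym) (auto intro!: depends_on_orderD[OF assms(1)] assms(3))
  have 0: "j' (Suc (fst m), snd m) = j (Suc (fst m), snd m) \<or> jet_pderiv m P x y t j = 0"
    "j' (fst m, Suc (fst (snd m)), snd (snd m)) = j (fst m, Suc (fst (snd m)), snd (snd m))
      \<or> jet_pderiv m P x y t j = 0"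
    if "m \<in> orders 3" "m \<notin> level n" for m
  proof -
    have "(Suc (fst m), snd m) \<in> orders n" "(fst m, Suc (fst (snd m)), snd (snd m)) \<in> orders n"
      if "m \<in> orders n" using that \<open>m \<notin> level n\<close> by (auto simp: orders_def level_def)
    then show "j' (Suc (fst m), snd m) = j (Suc (fst m), snd m) \<or> jet_pderiv m P x y t j = 0"
      "j' (fst m, Suc (fst (snd m)), snd (snd m)) = j (fst m, Suc (fst (snd m)), snd (snd m))
      \<or> jet_pderiv m P x y t j = 0"
      using assms(3) jet_pderiv_eq_0[OF assms(1), of m] by metis+
  qed
  have "Dx P x y t j' - Dx P x y t j =
      (\<Sum>(a, b, c)\<in>orders 3. (j' (Suc a, b, c) - j (Suc a, b, c)) * jet_pderiv (a, b, c) P x y t j)"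
    by (simp add: Dx_def p P case_prod_unfold left_diff_distrib sum_subtractf)
  also have "\<dots> = (\<Sum>(a, b, c)\<in>level n. (j' (Suc a, b, c) - j (Suc a, b, c)) * jet_pderiv (a, b, c) P x y t j)"
    by (intro sum.mono_neutral_right sub ballI) (use 0 in \<open>auto simp: case_prod_unfold\<close>)
  finally show "Dx P x y t j' - Dx P x y t j =
      (\<Sum>(a, b, c)\<in>level n. (j' (Suc a, b, c) - j (Suc a, b, c)) * jet_pderiv (a, b, c) P x y t j)" .
  have "Dy P x y t j' - Dy P x y t j =
      (\<Sum>(a, b, c)\<in>orders 3. (j' (a, Suc b, c) - j (a, Suc b, c)) * jet_pderiv (a, b, c) P x y t j)"
    by (simp add: Dy_def p P case_prod_unfold left_diff_distrib sum_subtractf)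
  also have "\<dots> = (\<Sum>(a, b, c)\<in>level n. (j' (a, Suc b, c) - j (a, Suc b, c)) * jet_pderiv (a, b, c) P x y t j)"
    by (intro sum.mono_neutral_right sub ballI) (use 0 in \<open>auto simp: case_prod_unfold\<close>)
  finally show "Dy P x y t j' - Dy P x y t j =
      (\<Sum>(a, b, c)\<in>level n. (j' (a, Suc b, c) - j (a, Suc b, c)) * jet_pderiv (a, b, c) P x y t j)" .
qed

lemma depends_on_order_coeffs:
  "depends_on_order 0 (coeff_x X)" "depends_on_order 0 (coeff_y X)"
  "depends_on_order 0 (coeff_t X)" "depends_on_order 0 (coeff_u X)"
  by (auto simp: depends_on_order_def orders_def coeff_x_def coeff_y_def coeff_t_def coeff_u_def)

lemma depends_on_order_prolongation_coeff: "depends_on_order (a + b + c) (prolongation_coeff X a b c)"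
proof -
  have *: "depends_on_order (Suc n)
      (\<lambda>x y t j. P x y t j - j m1 * Q1 x y t j - j m2 * Q2 x y t j - j m3 * Q3 x y t j)"
    if "depends_on_order (Suc n) P" "depends_on_order (Suc 0) Q1" "depends_on_order (Suc 0) Q2"
      "depends_on_order (Suc 0) Q3" "m1 \<in> orders (Suc n)" "m2 \<in> orders (Suc n)" "m3 \<in> orders (Suc n)"
    for n P Q1 Q2 Q3 m1 m2 m3
  proof -
    have "depends_on_order (Suc n) Q1" "depends_on_order (Suc n) Q2" "depends_on_order (Suc n) Q3"
      using that(2-4) by (auto intro: depends_on_order_le)
    with that(1,5-) show ?thesis unfolding depends_on_order_def by metis
  qed
  note c = depends_on_order_coeffs[of X]
  show ?thesis
  proof (induction X a b c rule: prolongation_coeff.induct)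
    case (1 X)
    then show ?case by (simp add: depends_on_order_coeffs)
  next
    case (2 X a b c)
    show ?case unfolding prolongation_coeff.simps add_Suc
      by (intro * depends_on_order_Dx depends_on_order_coeffs 2) (auto simp: orders_def)
  next
    case (3 X b c)
    show ?case unfolding prolongation_coeff.simps add_Suc add_0
      by (intro * depends_on_order_Dy depends_on_order_coeffs 3[simplified]) (auto simp: orders_def)
  next
    case (4 X c)
    show ?case unfolding prolongation_coeff.simps add_Suc add_0
      by (intro * depends_on_order_Dt depends_on_order_coeffs 4[simplified]) (auto simp: orders_def)
  qed
qed

text \<open>Polynomials in the jet coordinates whose coefficients are \<open>C_k_on k\<close>
  functions of \<open>(x, y, t, u)\<close>. Generating this class inductively avoids
  differentiability on the infinite-dimensional jet space: closure under total derivatives is proved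
  by rule induction. The clause \<open>cong\<close> discards values over points outside
  \<Omega>.\<close>

inductive smooth_diff_fun :: "(real \<times> real \<times> real \<times> real) set \<Rightarrow> nat \<Rightarrow> nat \<Rightarrow> diff_fun \<Rightarrow> bool"
  for \<Omega> where
  base: "C_k_on k h \<Omega> \<Longrightarrow> smooth_diff_fun \<Omega> k n (\<lambda>x y t j. h (x, y, t, j (0, 0, 0)))"
| coord: "m \<in> orders n \<Longrightarrow> smooth_diff_fun \<Omega> k n (\<lambda>x y t j. j m)"
| add: "smooth_diff_fun \<Omega> k n P \<Longrightarrow> smooth_diff_fun \<Omega> k n Q \<Longrightarrow>
    smooth_diff_fun \<Omega> k n (\<lambda>x y t j. P x y t j + Q x y t j)"
| mult: "smooth_diff_fun \<Omega> k n P \<Longrightarrow> smooth_diff_fun \<Omega> k n Q \<Longrightarrow>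
    smooth_diff_fun \<Omega> k n (\<lambda>x y t j. P x y t j * Q x y t j)"
| cong: "smooth_diff_fun \<Omega> k n P \<Longrightarrow>
    (\<And>x y t j. (x, y, t, j (0, 0, 0)) \<in> \<Omega> \<Longrightarrow> P x y t j = Q x y t j) \<Longrightarrow> smooth_diff_fun \<Omega> k n Q"

lemma smooth_diff_fun_mono:
  "smooth_diff_fun \<Omega> k n P \<Longrightarrow> k' \<le> k \<Longrightarrow> n \<le> n' \<Longrightarrow> smooth_diff_fun \<Omega> k' n' P"
proof (induction rule: smooth_diff_fun.induct)
  case (base k h n) then show ?case by (auto intro: smooth_diff_fun.base C_k_on_le)
next
  case (coord m n k) then show ?case by (auto intro: smooth_diff_fun.coord orders_mono)
next
  case (add k n P Q) then show ?case by (auto intro: smooth_diff_fun.add)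
next
  case (mult k n P Q) then show ?case by (auto intro: smooth_diff_fun.mult)
next
  case (cong k n P Q) then show ?case by (blast intro: smooth_diff_fun.cong)
qed

lemma open4_nhds:
  assumes "open \<Omega>" "(x, y, t, u) \<in> \<Omega>"
  shows "eventually (\<lambda>s. (s, y, t, u) \<in> \<Omega>) (nhds x)" "eventually (\<lambda>s. (x, s, t, u) \<in> \<Omega>) (nhds y)"
    "eventually (\<lambda>s. (x, y, s, u) \<in> \<Omega>) (nhds t)" "eventually (\<lambda>s. (x, y, t, s) \<in> \<Omega>) (nhds u)"
proof -
  have "continuous_on UNIV (\<lambda>s. (s, y, t, u))" "continuous_on UNIV (\<lambda>s. (x, s, t, u))"
    "continuous_on UNIV (\<lambda>s. (x, y, s, u))" "continuous_on UNIV (\<lambda>s. (x, y, t, s))"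
    by (auto intro!: continuous_intros)
  then have "open ((\<lambda>s. (s, y, t, u)) -` \<Omega>)" "open ((\<lambda>s. (x, s, t, u)) -` \<Omega>)"
    "open ((\<lambda>s. (x, y, s, u)) -` \<Omega>)" "open ((\<lambda>s. (x, y, t, s)) -` \<Omega>)"
    using assms(1) by (auto intro: open_vimage)
  from eventually_nhds_in_open[OF this(1)] eventually_nhds_in_open[OF this(2)]
    eventually_nhds_in_open[OF this(3)] eventually_nhds_in_open[OF this(4)] assms(2)
  show "eventually (\<lambda>s. (s, y, t, u) \<in> \<Omega>) (nhds x)" "eventually (\<lambda>s. (x, s, t, u) \<in> \<Omega>) (nhds y)"
    "eventually (\<lambda>s. (x, y, s, u) \<in> \<Omega>) (nhds t)" "eventually (\<lambda>s. (x, y, t, s) \<in> \<Omega>) (nhds u)" by auto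
qed

lemma C_k_on_has_partials:
  assumes "C_k_on (Suc k) h \<Omega>" "(x, y, t, u) \<in> \<Omega>"
  shows "((\<lambda>s. h (s, y, t, u)) has_real_derivative px h (x, y, t, u)) (at x)"
    "((\<lambda>s. h (x, s, t, u)) has_real_derivative py h (x, y, t, u)) (at y)"
    "((\<lambda>s. h (x, y, s, u)) has_real_derivative pt h (x, y, t, u)) (at t)"
    "((\<lambda>s. h (x, y, t, s)) has_real_derivative pu h (x, y, t, u)) (at u)"
  using chain_rule4[OF assms(1), of "\<lambda>s. s" x "\<lambda>s. y" "\<lambda>s. t" "\<lambda>s. u" 1 0 0 0]
    chain_rule4[OF assms(1), of "\<lambda>s. x" y "\<lambda>s. s" "\<lambda>s. t" "\<lambda>s. u" 0 1 0 0]
    chain_rule4[OF assms(1), of "\<lambda>s. x" t "\<lambda>s. y" "\<lambda>s. s" "\<lambda>s. u" 0 0 1 0]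
    chain_rule4[OF assms(1), of "\<lambda>s. x" u "\<lambda>s. y" "\<lambda>s. t" "\<lambda>s. s" 0 0 0 1] assms(2)
  by (simp_all add: Let_def)

lemma smooth_diff_fun_has_derivs:
  assumes "smooth_diff_fun \<Omega> k n P" "k > 0" "open \<Omega>" "(x, y, t, j (0, 0, 0)) \<in> \<Omega>"
  shows "((\<lambda>s. P s y t j) has_real_derivative deriv (\<lambda>s. P s y t j) x) (at x)"
    "((\<lambda>s. P x s t j) has_real_derivative deriv (\<lambda>s. P x s t j) y) (at y)"
    "((\<lambda>s. P x y s j) has_real_derivative deriv (\<lambda>s. P x y s j) t) (at t)"
    "((\<lambda>s. P x y t (j(m := s))) has_real_derivative jet_pderiv m P x y t j) (at (j m))"
proof -
  have ex_add: "\<exists>d. ((\<lambda>s. F s + G s) has_real_derivative d) (at r)"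
    and ex_mult: "\<exists>d. ((\<lambda>s. F s * G s) has_real_derivative d) (at r)"
    if "\<exists>d. (F has_real_derivative d) (at r)" "\<exists>d. (G has_real_derivative d) (at r)"
    for F G :: "real \<Rightarrow> real" and r
    using that DERIV_add DERIV_mult by blast+
  have ex_cong: "\<exists>d. (G has_real_derivative d) (at r)"
    if "\<exists>d. (F has_real_derivative d) (at r)" "eventually (\<lambda>s. F s = G s) (nhds r)"
    for F G :: "real \<Rightarrow> real" and r
    using that DERIV_cong_ev[OF refl that(2) refl] by blast
  have "(\<exists>d. ((\<lambda>s. P s y t j) has_real_derivative d) (at x)) \<and>
    (\<exists>d. ((\<lambda>s. P x s t j) has_real_derivative d) (at y)) \<and>
    (\<exists>d. ((\<lambda>s. P x y s j) has_real_derivative d) (at t)) \<and>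
    (\<exists>d. ((\<lambda>s. P x y t (j(m := s))) has_real_derivative d) (at (j m)))"
    using assms
  proof (induction rule: smooth_diff_fun.induct)
    case (base k h n)
    then obtain k' where k: "k = Suc k'" using gr0_implies_Suc by blast
    have "\<exists>d. ((\<lambda>s. h (x, y, t, (j(m := s)) (0, 0, 0))) has_real_derivative d) (at (j m))"
    proof (cases "m = (0, 0, 0)")
      case True
      then show ?thesis using C_k_on_has_partials(4)[OF base(1)[unfolded k] base(4)] by auto
    qed (auto intro: exI[of _ 0])
    then show ?case using C_k_on_has_partials(1-3)[OF base(1)[unfolded k] base(4)] by blast
  next
    case (coord m' n k)
    have "\<exists>d. ((\<lambda>s. (j(m := s)) m') has_real_derivative d) (at (j m))"
      by (intro exI[of _ "if m = m' then 1 else 0"]) auto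
    then show ?case by (auto intro: DERIV_const)
  next
    case (add k n P Q) then show ?case using add.IH(1)[OF add.prems] add.IH(2)[OF add.prems]
      by (intro conjI ex_add) auto
  next
    case (mult k n P Q) then show ?case using mult.IH(1)[OF mult.prems] mult.IH(2)[OF mult.prems]
      by (intro conjI ex_mult) auto
  next
    case (cong k n P Q)
    have "eventually (\<lambda>s. P s y t j = Q s y t j) (nhds x)" "eventually (\<lambda>s. P x s t j = Q x s t j) (nhds y)"
      "eventually (\<lambda>s. P x y s j = Q x y s j) (nhds t)"
      using open4_nhds[OF cong.prems(2,3)] cong.hyps(2) by (auto elim!: eventually_mono)
    moreover have "eventually (\<lambda>s. P x y t (j(m := s)) = Q x y t (j(m := s))) (nhds (j m))"
    \<comment> \<open>Only the coordinate \<open>u\<close> moves the base point: for it membership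
      in \<Omega> is preserved locally, for every other coordinate it is unaffected.\<close>
    proof (cases "m = (0, 0, 0)")
      case True
      show ?thesis
        by (rule eventually_mono[OF open4_nhds(4)[OF cong.prems(2,3), folded True]])
          (rule cong.hyps(2), simp add: True)
    next
      case False
      then show ?thesis using cong.prems(3) by (intro always_eventually allI cong.hyps(2)) auto
    qed
    ultimately show ?case using cong.IH[OF cong.prems] ex_cong by meson
  qed
  then show "((\<lambda>s. P s y t j) has_real_derivative deriv (\<lambda>s. P s y t j) x) (at x)"
    "((\<lambda>s. P x s t j) has_real_derivative deriv (\<lambda>s. P x s t j) y) (at y)"
    "((\<lambda>s. P x y s j) has_real_derivative deriv (\<lambda>s. P x y s j) t) (at t)"
    "((\<lambda>s. P x y t (j(m := s))) has_real_derivative jet_pderiv m P x y t j) (at (j m))"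
    unfolding jet_pderiv_def by (auto intro: has_real_derivative_deriv dest: DERIV_imp_deriv)
qed


lemma
  assumes "smooth_diff_fun \<Omega> k n P" "smooth_diff_fun \<Omega> k n Q" "k > 0" "open \<Omega>" "(x, y, t, j (0, 0, 0)) \<in> \<Omega>"
  shows Dx_add: "Dx (\<lambda>x y t j. P x y t j + Q x y t j) x y t j = Dx P x y t j + Dx Q x y t j"
    and Dy_add: "Dy (\<lambda>x y t j. P x y t j + Q x y t j) x y t j = Dy P x y t j + Dy Q x y t j"
    and Dt_add: "Dt (\<lambda>x y t j. P x y t j + Q x y t j) x y t j = Dt P x y t j + Dt Q x y t j"
    and Dx_mult: "Dx (\<lambda>x y t j. P x y t j * Q x y t j) x y t j = Dx P x y t j * Q x y t j + P x y t j * Dx Q x y t j"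
    and Dy_mult: "Dy (\<lambda>x y t j. P x y t j * Q x y t j) x y t j = Dy P x y t j * Q x y t j + P x y t j * Dy Q x y t j"
    and Dt_mult: "Dt (\<lambda>x y t j. P x y t j * Q x y t j) x y t j = Dt P x y t j * Q x y t j + P x y t j * Dt Q x y t j"
proof -
  note dP = smooth_diff_fun_has_derivs[where j = j, OF assms(1,3-5)]
    and dQ = smooth_diff_fun_has_derivs[where j = j, OF assms(2-5)]
  have a: "deriv (\<lambda>s. P s y t j + Q s y t j) x = deriv (\<lambda>s. P s y t j) x + deriv (\<lambda>s. Q s y t j) x"
    "deriv (\<lambda>s. P x s t j + Q x s t j) y = deriv (\<lambda>s. P x s t j) y + deriv (\<lambda>s. Q x s t j) y"
    "deriv (\<lambda>s. P x y s j + Q x y s j) t = deriv (\<lambda>s. P x y s j) t + deriv (\<lambda>s. Q x y s j) t"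
    using DERIV_add[OF dP(1) dQ(1)] DERIV_add[OF dP(2) dQ(2)] DERIV_add[OF dP(3) dQ(3)]
    by (auto intro: DERIV_imp_deriv)
  have am: "jet_pderiv m (\<lambda>x y t j. P x y t j + Q x y t j) x y t j = jet_pderiv m P x y t j + jet_pderiv m Q x y t j" for m
    using DERIV_add[OF dP(4) dQ(4), of m] by (auto simp: jet_pderiv_def intro: DERIV_imp_deriv)
  have b: "deriv (\<lambda>s. P s y t j * Q s y t j) x = deriv (\<lambda>s. P s y t j) x * Q x y t j + P x y t j * deriv (\<lambda>s. Q s y t j) x"
    "deriv (\<lambda>s. P x s t j * Q x s t j) y = deriv (\<lambda>s. P x s t j) y * Q x y t j + P x y t j * deriv (\<lambda>s. Q x s t j) y"
    "deriv (\<lambda>s. P x y s j * Q x y s j) t = deriv (\<lambda>s. P x y s j) t * Q x y t j + P x y t j * deriv (\<lambda>s. Q x y s j) t"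
    using DERIV_mult[OF dP(1) dQ(1)] DERIV_mult[OF dP(2) dQ(2)] DERIV_mult[OF dP(3) dQ(3)]
    by (auto intro: DERIV_imp_deriv simp: mult.commute)
  have bm: "jet_pderiv m (\<lambda>x y t j. P x y t j * Q x y t j) x y t j
      = jet_pderiv m P x y t j * Q x y t j + P x y t j * jet_pderiv m Q x y t j" for m
    using DERIV_mult[OF dP(4) dQ(4), of m] unfolding jet_pderiv_def
    by (auto intro!: DERIV_imp_deriv simp: mult.commute)
  show "Dx (\<lambda>x y t j. P x y t j + Q x y t j) x y t j = Dx P x y t j + Dx Q x y t j"
    "Dy (\<lambda>x y t j. P x y t j + Q x y t j) x y t j = Dy P x y t j + Dy Q x y t j"
    "Dt (\<lambda>x y t j. P x y t j + Q x y t j) x y t j = Dt P x y t j + Dt Q x y t j"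
    by (simp_all add: Dx_def Dy_def Dt_def a am case_prod_unfold distrib_left sum.distrib)
  show "Dx (\<lambda>x y t j. P x y t j * Q x y t j) x y t j = Dx P x y t j * Q x y t j + P x y t j * Dx Q x y t j"
    "Dy (\<lambda>x y t j. P x y t j * Q x y t j) x y t j = Dy P x y t j * Q x y t j + P x y t j * Dy Q x y t j"
    "Dt (\<lambda>x y t j. P x y t j * Q x y t j) x y t j = Dt P x y t j * Q x y t j + P x y t j * Dt Q x y t j"
    by (simp_all add: Dx_def Dy_def Dt_def b bm case_prod_unfold algebra_simps sum.distrib sum_distrib_left)
qed

lemma jet_pderiv_coord: "jet_pderiv m (\<lambda>x y t j. j m') x y t j = (if m = m' then 1 else 0)"
  by (auto simp: jet_pderiv_def)

lemma
  assumes "(a, b, c) \<in> orders 3"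
  shows Dx_coord: "Dx (\<lambda>x y t j. j (a, b, c)) = (\<lambda>x y t j. j (Suc a, b, c))"
    and Dy_coord: "Dy (\<lambda>x y t j. j (a, b, c)) = (\<lambda>x y t j. j (a, Suc b, c))"
    and Dt_coord: "Dt (\<lambda>x y t j. j (a, b, c)) = (\<lambda>x y t j. j (a, b, Suc c))"
proof -
  have "(\<Sum>(a', b', c')\<in>orders 3. F (a', b', c') * jet_pderiv (a', b', c') (\<lambda>x y t j. j (a, b, c)) x y t j)
      = F (a, b, c)" for F :: "_ \<Rightarrow> real" and x y t j
  proof -
    have "(\<Sum>(a', b', c')\<in>orders 3. F (a', b', c') * jet_pderiv (a', b', c') (\<lambda>x y t j. j (a, b, c)) x y t j)
        = (\<Sum>m\<in>orders 3. if m = (a, b, c) then F m else 0)"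
      by (rule sum.cong) (auto simp: jet_pderiv_coord split: if_splits)
    then show ?thesis using assms by simp
  qed
  note * = this
  have "Dx (\<lambda>x y t j. j (a, b, c)) x y t j = j (Suc a, b, c)"
    "Dy (\<lambda>x y t j. j (a, b, c)) x y t j = j (a, Suc b, c)"
    "Dt (\<lambda>x y t j. j (a, b, c)) x y t j = j (a, b, Suc c)" for x y t j
    using *[of "\<lambda>(a, b, c). j (Suc a, b, c)"] *[of "\<lambda>(a, b, c). j (a, Suc b, c)"]
      *[of "\<lambda>(a, b, c). j (a, b, Suc c)"]
    by (simp_all add: Dx_def Dy_def Dt_def)
  then show "Dx (\<lambda>x y t j. j (a, b, c)) = (\<lambda>x y t j. j (Suc a, b, c))"
    "Dy (\<lambda>x y t j. j (a, b, c)) = (\<lambda>x y t j. j (a, Suc b, c))"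
    "Dt (\<lambda>x y t j. j (a, b, c)) = (\<lambda>x y t j. j (a, b, Suc c))"
    by blast+
qed

lemma
  assumes "depends_on_order 0 P"
  shows Dx_order_0: "Dx P x y t j = deriv (\<lambda>s. P s y t j) x + j (1, 0, 0) * jet_pderiv (0, 0, 0) P x y t j"
    and Dy_order_0: "Dy P x y t j = deriv (\<lambda>s. P x s t j) y + j (0, 1, 0) * jet_pderiv (0, 0, 0) P x y t j"
    and Dt_order_0: "Dt P x y t j = deriv (\<lambda>s. P x y s j) t + j (0, 0, 1) * jet_pderiv (0, 0, 0) P x y t j"
proof -
  have 0: "(\<Sum>m\<in>orders 3. F m * jet_pderiv m P x y t j) = F (0, 0, 0) * jet_pderiv (0, 0, 0) P x y t j"
    for F :: "_ \<Rightarrow> real"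
  proof -
    have "(\<Sum>m\<in>orders 3. F m * jet_pderiv m P x y t j) = (\<Sum>m\<in>{(0, 0, 0)}. F m * jet_pderiv m P x y t j)"
    proof (rule sum.mono_neutral_right)
      show "\<forall>m\<in>orders 3 - {(0, 0, 0)}. F m * jet_pderiv m P x y t j = 0"
        using jet_pderiv_eq_0[OF assms] by (auto simp: orders_def)
    qed (auto simp: orders_def[of 3, THEN eqset_imp_iff])
    then show ?thesis by simp
  qed
  show "Dx P x y t j = deriv (\<lambda>s. P s y t j) x + j (1, 0, 0) * jet_pderiv (0, 0, 0) P x y t j"
    "Dy P x y t j = deriv (\<lambda>s. P x s t j) y + j (0, 1, 0) * jet_pderiv (0, 0, 0) P x y t j"
    "Dt P x y t j = deriv (\<lambda>s. P x y s j) t + j (0, 0, 1) * jet_pderiv (0, 0, 0) P x y t j"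
    using 0[of "\<lambda>(a, b, c). j (Suc a, b, c)"] 0[of "\<lambda>(a, b, c). j (a, Suc b, c)"] 0[of "\<lambda>(a, b, c). j (a, b, Suc c)"]
    by (simp_all add: Dx_def Dy_def Dt_def case_prod_unfold)
qed

lemma
  shows Dx_base: "Dx (\<lambda>x y t j. h (x, y, t, j (0, 0, 0))) x y t j
      = px h (x, y, t, j (0, 0, 0)) + j (1, 0, 0) * pu h (x, y, t, j (0, 0, 0))"
    and Dy_base: "Dy (\<lambda>x y t j. h (x, y, t, j (0, 0, 0))) x y t j
      = py h (x, y, t, j (0, 0, 0)) + j (0, 1, 0) * pu h (x, y, t, j (0, 0, 0))"
    and Dt_base: "Dt (\<lambda>x y t j. h (x, y, t, j (0, 0, 0))) x y t j
      = pt h (x, y, t, j (0, 0, 0)) + j (0, 0, 1) * pu h (x, y, t, j (0, 0, 0))"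
proof -
  have 0: "depends_on_order 0 (\<lambda>x y t j. h (x, y, t, j (0, 0, 0)))"
    by (auto simp: depends_on_order_def orders_def)
  have "jet_pderiv (0, 0, 0) (\<lambda>x y t j. h (x, y, t, j (0, 0, 0))) x y t j = pu h (x, y, t, j (0, 0, 0))"
    by (simp add: jet_pderiv_def pu_def)
  with Dx_order_0[OF 0] Dy_order_0[OF 0] Dt_order_0[OF 0]
  show "Dx (\<lambda>x y t j. h (x, y, t, j (0, 0, 0))) x y t j
      = px h (x, y, t, j (0, 0, 0)) + j (1, 0, 0) * pu h (x, y, t, j (0, 0, 0))"
    "Dy (\<lambda>x y t j. h (x, y, t, j (0, 0, 0))) x y t j
      = py h (x, y, t, j (0, 0, 0)) + j (0, 1, 0) * pu h (x, y, t, j (0, 0, 0))"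
    "Dt (\<lambda>x y t j. h (x, y, t, j (0, 0, 0))) x y t j
      = pt h (x, y, t, j (0, 0, 0)) + j (0, 0, 1) * pu h (x, y, t, j (0, 0, 0))"
    by (auto simp: px_def py_def pt_def orders_def)
qed

lemma
  assumes "open \<Omega>" "\<And>x y t j. (x, y, t, j (0, 0, 0)) \<in> \<Omega> \<Longrightarrow> P x y t j = Q x y t j"
    and "(x, y, t, j (0, 0, 0)) \<in> \<Omega>"
  shows Dx_cong: "Dx P x y t j = Dx Q x y t j" and Dy_cong: "Dy P x y t j = Dy Q x y t j"
    and Dt_cong: "Dt P x y t j = Dt Q x y t j"
proof -
  have 1: "deriv (\<lambda>s. P s y t j) x = deriv (\<lambda>s. Q s y t j) x" "deriv (\<lambda>s. P x s t j) y = deriv (\<lambda>s. Q x s t j) y"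
    "deriv (\<lambda>s. P x y s j) t = deriv (\<lambda>s. Q x y s j) t"
    using open4_nhds[OF assms(1,3)]
    by (auto intro!: deriv_cong_ev elim!: eventually_mono intro: assms(2))
  have 2: "jet_pderiv m P x y t j = jet_pderiv m Q x y t j" for m
    unfolding jet_pderiv_def
  proof (rule deriv_cong_ev)
    show "eventually (\<lambda>s. P x y t (j(m := s)) = Q x y t (j(m := s))) (nhds (j m))"
    proof (cases "m = (0, 0, 0)")
      case True
      show ?thesis
        by (rule eventually_mono[OF open4_nhds(4)[OF assms(1,3), folded True]])
          (rule assms(2), simp add: True)
    next
      case False
      then show ?thesis using assms(3) by (intro always_eventually allI assms(2)) auto
    qed
  qed simp
  show "Dx P x y t j = Dx Q x y t j" "Dy P x y t j = Dy Q x y t j" "Dt P x y t j = Dt Q x y t j"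
    by (simp_all add: Dx_def Dy_def Dt_def 1 2)
qed

text \<open>Each total derivative costs one degree of smoothness of the coefficients and raises the
  order by one. The bound \<open>n \<le> 3\<close> reflects that the sums in \<open>Dx\<close>,
  \<open>Dy\<close>, \<open>Dt\<close> run over the coordinates of order at most three.\<close>

lemma
  assumes "smooth_diff_fun \<Omega> (Suc k) n P" "n \<le> 3" "open \<Omega>"
  shows smooth_diff_fun_Dx: "smooth_diff_fun \<Omega> k (Suc n) (Dx P)"
    and smooth_diff_fun_Dy: "smooth_diff_fun \<Omega> k (Suc n) (Dy P)"
    and smooth_diff_fun_Dt: "smooth_diff_fun \<Omega> k (Suc n) (Dt P)"
proof -
  have "smooth_diff_fun \<Omega> k (Suc n) (Dx P) \<and> smooth_diff_fun \<Omega> k (Suc n) (Dy P) \<and> smooth_diff_fun \<Omega> k (Suc n) (Dt P)"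
    using assms
  proof (induction "Suc k" n P rule: smooth_diff_fun.induct)
    case (base h n)
    note h = smooth_diff_fun.base[OF C_k_on_px[OF base(1,3)], of "Suc n"]
      smooth_diff_fun.base[OF C_k_on_py[OF base(1,3)], of "Suc n"]
      smooth_diff_fun.base[OF C_k_on_pt[OF base(1,3)], of "Suc n"]
      smooth_diff_fun.base[OF C_k_on_pu[OF base(1,3)], of "Suc n"]
    have c: "(1, 0, 0) \<in> orders (Suc n)" "(0, 1, 0) \<in> orders (Suc n)" "(0, 0, 1) \<in> orders (Suc n)"
      by (auto simp: orders_def)
    show ?case
      unfolding Dx_base[abs_def, of h] Dy_base[abs_def, of h] Dt_base[abs_def, of h]
      by (intro conjI smooth_diff_fun.add[OF h(1)] smooth_diff_fun.add[OF h(2)] smooth_diff_fun.add[OF h(3)]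
          smooth_diff_fun.mult[OF _ h(4)] smooth_diff_fun.coord c)
  next
    case (coord m n)
    obtain a b c where m: "m = (a, b, c)" by (metis prod.exhaust)
    have 3: "(a, b, c) \<in> orders 3" using coord m orders_mono by blast
    show ?case unfolding m Dx_coord[OF 3] Dy_coord[OF 3] Dt_coord[OF 3]
      using coord m by (intro conjI smooth_diff_fun.coord) (auto simp: orders_def)
  next
    case (add n P Q)
    note IH = add.hyps(2)[OF add.prems] add.hyps(4)[OF add.prems]
    have "smooth_diff_fun \<Omega> k (Suc n) (Dx (\<lambda>x y t j. P x y t j + Q x y t j))"
      by (rule smooth_diff_fun.cong[of _ _ _ "\<lambda>x y t j. Dx P x y t j + Dx Q x y t j"])
        (use IH in \<open>auto simp: Dx_add[OF add.hyps(1,3) zero_less_Suc assms(3)] intro: smooth_diff_fun.add\<close>)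
    moreover have "smooth_diff_fun \<Omega> k (Suc n) (Dy (\<lambda>x y t j. P x y t j + Q x y t j))"
      by (rule smooth_diff_fun.cong[of _ _ _ "\<lambda>x y t j. Dy P x y t j + Dy Q x y t j"])
        (use IH in \<open>auto simp: Dy_add[OF add.hyps(1,3) zero_less_Suc assms(3)] intro: smooth_diff_fun.add\<close>)
    moreover have "smooth_diff_fun \<Omega> k (Suc n) (Dt (\<lambda>x y t j. P x y t j + Q x y t j))"
      by (rule smooth_diff_fun.cong[of _ _ _ "\<lambda>x y t j. Dt P x y t j + Dt Q x y t j"])
        (use IH in \<open>auto simp: Dt_add[OF add.hyps(1,3) zero_less_Suc assms(3)] intro: smooth_diff_fun.add\<close>)
    ultimately show ?case by blast
  next
    case (mult n P Q)
    have PQ: "smooth_diff_fun \<Omega> k (Suc n) P" "smooth_diff_fun \<Omega> k (Suc n) Q"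
      using mult.hyps(1,3) by (auto intro: smooth_diff_fun_mono)
    note IH = mult.hyps(2)[OF mult.prems] mult.hyps(4)[OF mult.prems]
    have PQ': "smooth_diff_fun \<Omega> k (Suc n) (\<lambda>x y t j. P' x y t j * Q x y t j + P x y t j * Q' x y t j)"
      if "smooth_diff_fun \<Omega> k (Suc n) P'" "smooth_diff_fun \<Omega> k (Suc n) Q'" for P' Q'
      by (rule smooth_diff_fun.add[OF smooth_diff_fun.mult[OF that(1) PQ(2)] smooth_diff_fun.mult[OF PQ(1) that(2)]])
    have "smooth_diff_fun \<Omega> k (Suc n) (Dx (\<lambda>x y t j. P x y t j * Q x y t j))"
      by (rule smooth_diff_fun.cong[OF PQ'[OF conjunct1[OF IH(1)] conjunct1[OF IH(2)]]])
        (simp add: Dx_mult[OF mult.hyps(1,3) zero_less_Suc assms(3)])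
    moreover have "smooth_diff_fun \<Omega> k (Suc n) (Dy (\<lambda>x y t j. P x y t j * Q x y t j))"
      by (rule smooth_diff_fun.cong[OF PQ'[OF conjunct1[OF conjunct2[OF IH(1)]] conjunct1[OF conjunct2[OF IH(2)]]]])
        (simp add: Dy_mult[OF mult.hyps(1,3) zero_less_Suc assms(3)])
    moreover have "smooth_diff_fun \<Omega> k (Suc n) (Dt (\<lambda>x y t j. P x y t j * Q x y t j))"
      by (rule smooth_diff_fun.cong[OF PQ'[OF conjunct2[OF conjunct2[OF IH(1)]] conjunct2[OF conjunct2[OF IH(2)]]]])
        (simp add: Dt_mult[OF mult.hyps(1,3) zero_less_Suc assms(3)])
    ultimately show ?case by blast
  next
    case (cong n P Q)
    note IH = cong.hyps(2)[OF cong.prems]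
    have "smooth_diff_fun \<Omega> k (Suc n) (Dx Q)"
      by (rule smooth_diff_fun.cong[OF conjunct1[OF IH]]) (rule Dx_cong[OF assms(3) cong.hyps(3)])
    moreover have "smooth_diff_fun \<Omega> k (Suc n) (Dy Q)"
      by (rule smooth_diff_fun.cong[OF conjunct1[OF conjunct2[OF IH]]]) (rule Dy_cong[OF assms(3) cong.hyps(3)])
    moreover have "smooth_diff_fun \<Omega> k (Suc n) (Dt Q)"
      by (rule smooth_diff_fun.cong[OF conjunct2[OF conjunct2[OF IH]]]) (rule Dt_cong[OF assms(3) cong.hyps(3)])
    ultimately show ?case by blast
  qed
  then show "smooth_diff_fun \<Omega> k (Suc n) (Dx P)" "smooth_diff_fun \<Omega> k (Suc n) (Dy P)"
    "smooth_diff_fun \<Omega> k (Suc n) (Dt P)" by auto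
qed

text \<open>The contact condition: \<open>J\<close> is the full jet of its own component
  \<open>(0, 0, 0)\<close>. It is demanded at all points of space because it is used for
  polynomials.\<close>

definition holonomic :: "(real \<Rightarrow> real \<Rightarrow> real \<Rightarrow> jet) \<Rightarrow> bool" where
  "holonomic J \<longleftrightarrow> (\<forall>x y t a b c.
     ((\<lambda>s. J s y t (a, b, c)) has_real_derivative J x y t (Suc a, b, c)) (at x) \<and>
     ((\<lambda>s. J x s t (a, b, c)) has_real_derivative J x y t (a, Suc b, c)) (at y) \<and>
     ((\<lambda>s. J x y s (a, b, c)) has_real_derivative J x y t (a, b, Suc c)) (at t))"

lemma holonomicD:
  assumes "holonomic J"
  shows "((\<lambda>s. J s y t (a, b, c)) has_real_derivative J x y t (Suc a, b, c)) (at x)"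
    "((\<lambda>s. J x s t (a, b, c)) has_real_derivative J x y t (a, Suc b, c)) (at y)"
    "((\<lambda>s. J x y s (a, b, c)) has_real_derivative J x y t (a, b, Suc c)) (at t)"
  using assms by (auto simp: holonomic_def)

lemma holonomic_eventually:
  assumes "holonomic J" "open \<Omega>" "(x, y, t, J x y t (0, 0, 0)) \<in> \<Omega>"
  shows "eventually (\<lambda>s. (s, y, t, J s y t (0, 0, 0)) \<in> \<Omega>) (nhds x)"
    "eventually (\<lambda>s. (x, s, t, J x s t (0, 0, 0)) \<in> \<Omega>) (nhds y)"
    "eventually (\<lambda>s. (x, y, s, J x y s (0, 0, 0)) \<in> \<Omega>) (nhds t)"
proof -
  have *: "eventually (\<lambda>s. p s \<in> \<Omega>) (nhds r)" if "isCont p r" "p r \<in> \<Omega>" for p and r :: real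
    using topological_tendstoD[OF that(1)[unfolded isCont_def tendsto_at_iff_tendsto_nhds] assms(2) that(2)] .
  have "isCont (\<lambda>s. J s y t (0, 0, 0)) x" "isCont (\<lambda>s. J x s t (0, 0, 0)) y" "isCont (\<lambda>s. J x y s (0, 0, 0)) t"
    by (rule DERIV_isCont[OF holonomicD(1)[OF assms(1)]] DERIV_isCont[OF holonomicD(2)[OF assms(1)]]
        DERIV_isCont[OF holonomicD(3)[OF assms(1)]])+
  then have "isCont (\<lambda>s. (s, y, t, J s y t (0, 0, 0))) x" "isCont (\<lambda>s. (x, s, t, J x s t (0, 0, 0))) y"
    "isCont (\<lambda>s. (x, y, s, J x y s (0, 0, 0))) t" by (auto intro!: continuous_intros)
  from *[OF this(1)] *[OF this(2)] *[OF this(3)] assms(3)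
  show "eventually (\<lambda>s. (s, y, t, J s y t (0, 0, 0)) \<in> \<Omega>) (nhds x)"
    "eventually (\<lambda>s. (x, s, t, J x s t (0, 0, 0)) \<in> \<Omega>) (nhds y)"
    "eventually (\<lambda>s. (x, y, s, J x y s (0, 0, 0)) \<in> \<Omega>) (nhds t)" by auto
qed

text \<open>The defining property of total derivatives: along the jet of a function they are the
  partial derivatives of the substituted expression. On the generators this is the chain rule, and
  sums and products follow from the two Leibniz rules.\<close>

lemma total_derivative:
  assumes "smooth_diff_fun \<Omega> k n P" "k > 0" "n \<le> 3" "open \<Omega>" "holonomic J" "(x, y, t, J x y t (0, 0, 0)) \<in> \<Omega>"
  shows "((\<lambda>s. P s y t (J s y t)) has_real_derivative Dx P x y t (J x y t)) (at x)"
    "((\<lambda>s. P x s t (J x s t)) has_real_derivative Dy P x y t (J x y t)) (at y)"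
    "((\<lambda>s. P x y s (J x y s)) has_real_derivative Dt P x y t (J x y t)) (at t)"
proof -
  have "((\<lambda>s. P s y t (J s y t)) has_real_derivative Dx P x y t (J x y t)) (at x) \<and>
    ((\<lambda>s. P x s t (J x s t)) has_real_derivative Dy P x y t (J x y t)) (at y) \<and>
    ((\<lambda>s. P x y s (J x y s)) has_real_derivative Dt P x y t (J x y t)) (at t)"
    using assms
  proof (induction rule: smooth_diff_fun.induct)
    case (base k h n)
    then obtain k' where k: "k = Suc k'" using gr0_implies_Suc by blast
    note J = holonomicD[OF assms(5), of _ _ 0 0 0]
    show ?case
      unfolding Dx_base[of h] Dy_base[of h] Dt_base[of h]
      using chain_rule4[OF base(1)[unfolded k], of "\<lambda>s. s" x "\<lambda>s. y" "\<lambda>s. t" "\<lambda>s. J s y t (0, 0, 0)", OF assms(6) DERIV_ident DERIV_const DERIV_const J(1)]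
        chain_rule4[OF base(1)[unfolded k], of "\<lambda>s. x" y "\<lambda>s. s" "\<lambda>s. t" "\<lambda>s. J x s t (0, 0, 0)", OF assms(6) DERIV_const DERIV_ident DERIV_const J(2)]
        chain_rule4[OF base(1)[unfolded k], of "\<lambda>s. x" t "\<lambda>s. y" "\<lambda>s. s" "\<lambda>s. J x y s (0, 0, 0)", OF assms(6) DERIV_const DERIV_const DERIV_ident J(3)]
      by (simp add: Let_def mult.commute)
  next
    case (coord m n k)
    obtain a b c where m: "m = (a, b, c)" by (metis prod.exhaust)
    have "(a, b, c) \<in> orders 3" using coord m orders_mono by blast
    then show ?case unfolding m by (simp add: Dx_coord Dy_coord Dt_coord holonomicD[OF assms(5)])
  next
    case (add k n P Q)
    note D = Dx_add[where j = "J x y t", OF add.hyps add.prems(1) assms(4,6)]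
      Dy_add[where j = "J x y t", OF add.hyps add.prems(1) assms(4,6)]
      Dt_add[where j = "J x y t", OF add.hyps add.prems(1) assms(4,6)]
    show ?case unfolding D using add.IH(1)[OF add.prems] add.IH(2)[OF add.prems] by (auto intro: DERIV_add)
  next
    case (mult k n P Q)
    note D = Dx_mult[where j = "J x y t", OF mult.hyps mult.prems(1) assms(4,6)]
      Dy_mult[where j = "J x y t", OF mult.hyps mult.prems(1) assms(4,6)]
      Dt_mult[where j = "J x y t", OF mult.hyps mult.prems(1) assms(4,6)]
    show ?case unfolding D using mult.IH(1)[OF mult.prems] mult.IH(2)[OF mult.prems]
      by (auto intro!: derivative_eq_intros)
  next
    case (cong k n P Q)
    have "eventually (\<lambda>s. P s y t (J s y t) = Q s y t (J s y t)) (nhds x)"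
      "eventually (\<lambda>s. P x s t (J x s t) = Q x s t (J x s t)) (nhds y)"
      "eventually (\<lambda>s. P x y s (J x y s) = Q x y s (J x y s)) (nhds t)"
      using holonomic_eventually[OF assms(5,4,6)] by (auto elim!: eventually_mono intro: cong.hyps(2))
    note ev = this
    have "Dx P x y t (J x y t) = Dx Q x y t (J x y t)" "Dy P x y t (J x y t) = Dy Q x y t (J x y t)"
      "Dt P x y t (J x y t) = Dt Q x y t (J x y t)"
      by (rule Dx_cong[OF assms(4) cong.hyps(2)] Dy_cong[OF assms(4) cong.hyps(2)]
          Dt_cong[OF assms(4) cong.hyps(2)]; simp add: assms(6))+
    then show ?case
      using cong.IH[OF cong.prems] DERIV_cong_ev[OF refl ev(1) refl] DERIV_cong_ev[OF refl ev(2) refl]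
        DERIV_cong_ev[OF refl ev(3) refl] by simp
  qed
  then show "((\<lambda>s. P s y t (J s y t)) has_real_derivative Dx P x y t (J x y t)) (at x)"
    "((\<lambda>s. P x s t (J x s t)) has_real_derivative Dy P x y t (J x y t)) (at y)"
    "((\<lambda>s. P x y s (J x y s)) has_real_derivative Dt P x y t (J x y t)) (at t)" by auto
qed


section \<open>The biharmonic heat operator in jet coordinates\<close>

text \<open>The expansion of \<open>u_t - \<Delta>\<^sup>2 u\<close>. With b = exp(-2f) one has b' =
  -2f'b and b'' = (4f'^2 - 2f'')b, which produces the coefficients of the
  \<open>y\<close>-derivatives. The expression is linear in the jet with coefficients in
  \<open>x\<close> alone, so it can also be evaluated on the family of prolongation
  coefficients.\<close>

definition heat_form :: "(real \<Rightarrow> real) \<Rightarrow> real \<Rightarrow> jet \<Rightarrow> real" where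
  "heat_form f x j = j (0, 0, 1) - (j (4, 0, 0) + 2 * deriv f x * j (3, 0, 0)
     + (2 * deriv (deriv f) x + (deriv f x)\<^sup>2) * j (2, 0, 0)
     + (deriv (deriv (deriv f)) x + deriv f x * deriv (deriv f) x) * j (1, 0, 0)
     + 2 * exp (- 2 * f x) * j (2, 2, 0) - 2 * deriv f x * exp (- 2 * f x) * j (1, 2, 0)
     + (2 * (deriv f x)\<^sup>2 - 2 * deriv (deriv f) x) * exp (- 2 * f x) * j (0, 2, 0)
     + (exp (- 2 * f x))\<^sup>2 * j (0, 4, 0))"

lemma heat_form_add: "heat_form f x (\<lambda>m. p m + q m) = heat_form f x p + heat_form f x q"
  by (simp add: heat_form_def algebra_simps)

lemma heat_form_cmult: "heat_form f x (\<lambda>m. c * p m) = c * heat_form f x p"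
  by (simp add: heat_form_def algebra_simps)

lemma heat_form_sum: "heat_form f x (\<lambda>m. \<Sum>i\<in>A. c i * p i m) = (\<Sum>i\<in>A. c i * heat_form f x (p i))"
proof (induction A rule: infinite_finite_induct)
  case (insert i F)
  then show ?case by (simp add: heat_form_add heat_form_cmult)
qed (simp_all add: heat_form_def)

lemma heat_form_cong: "(\<And>m. m \<in> orders 4 \<Longrightarrow> p m = q m) \<Longrightarrow> heat_form f x p = heat_form f x q"
  by (simp add: heat_form_def orders_def)

lemma metric_coeff_derivs:
  assumes "C_k_on 4 f I" "open I" "x \<in> I"
  shows "(f has_real_derivative deriv f x) (at x)"
    "(deriv f has_real_derivative deriv (deriv f) x) (at x)"
    "(deriv (deriv f) has_real_derivative deriv (deriv (deriv f)) x) (at x)"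
    "(deriv (deriv (deriv f)) has_real_derivative deriv (deriv (deriv (deriv f))) x) (at x)"
    "((\<lambda>x. exp (- 2 * f x)) has_real_derivative - 2 * deriv f x * exp (- 2 * f x)) (at x)"
    "deriv (\<lambda>x. exp (- 2 * f x)) x = - 2 * deriv f x * exp (- 2 * f x)"
    "deriv (deriv (\<lambda>x. exp (- 2 * f x))) x = (4 * (deriv f x)\<^sup>2 - 2 * deriv (deriv f) x) * exp (- 2 * f x)"
proof -
  have f: "C_k_on (Suc 3) f I" using assms by (simp add: numeral_eq_Suc del: C_k_on.simps)
  have f1: "C_k_on (Suc 2) (deriv f) I" using C_k_on_deriv[OF f assms(2)] by (simp add: numeral_eq_Suc del: C_k_on.simps)
  have f2: "C_k_on (Suc 1) (deriv (deriv f)) I" using C_k_on_deriv[OF f1 assms(2)] by (simp add: numeral_eq_Suc del: C_k_on.simps)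
  have f3: "C_k_on (Suc 0) (deriv (deriv (deriv f))) I" using C_k_on_deriv[OF f2 assms(2)] by (simp del: C_k_on.simps)
  note d = C_k_on_realD[OF f] C_k_on_realD[OF f1] C_k_on_realD[OF f2] C_k_on_realD[OF f3]
  show "(f has_real_derivative deriv f x) (at x)"
    "(deriv f has_real_derivative deriv (deriv f) x) (at x)"
    "(deriv (deriv f) has_real_derivative deriv (deriv (deriv f)) x) (at x)"
    "(deriv (deriv (deriv f)) has_real_derivative deriv (deriv (deriv (deriv f))) x) (at x)"
    using d assms(3) by auto
  have e: "((\<lambda>x. exp (- 2 * f x)) has_real_derivative - 2 * deriv f s * exp (- 2 * f s)) (at s)" if "s \<in> I" for s
    using d(1)[OF that] by (auto intro!: derivative_eq_intros)
  then show "((\<lambda>x. exp (- 2 * f x)) has_real_derivative - 2 * deriv f x * exp (- 2 * f x)) (at x)"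
    and "deriv (\<lambda>x. exp (- 2 * f x)) x = - 2 * deriv f x * exp (- 2 * f x)"
    using assms(3) DERIV_imp_deriv by blast+
  have "deriv (deriv (\<lambda>x. exp (- 2 * f x))) x = deriv (\<lambda>x. - 2 * deriv f x * exp (- 2 * f x)) x"
    by (rule deriv_cong_ev[OF eventually_mono[OF eventually_nhds_in_open[OF assms(2,3)]] refl])
      (use e DERIV_imp_deriv in blast)
  also have "\<dots> = (4 * (deriv f x)\<^sup>2 - 2 * deriv (deriv f) x) * exp (- 2 * f x)"
    by (rule DERIV_imp_deriv)
      (use d(1,2)[OF assms(3)] in \<open>auto intro!: derivative_eq_intros simp: algebra_simps power2_eq_square\<close>)
  finally show "deriv (deriv (\<lambda>x. exp (- 2 * f x))) x = (4 * (deriv f x)\<^sup>2 - 2 * deriv (deriv f) x) * exp (- 2 * f x)" .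
qed

lemma
  assumes "C_k_on (Suc k) c I" "open I"
  shows smooth_diff_fun_coeff: "(a, b, d) \<in> orders n \<Longrightarrow>
      smooth_diff_fun (I \<times> UNIV) (Suc k) n (\<lambda>x y t j. c x * j (a, b, d))"
    and Dx_coeff: "(a, b, d) \<in> orders 3 \<Longrightarrow> x \<in> I \<Longrightarrow>
      Dx (\<lambda>x y t j. c x * j (a, b, d)) x y t j = deriv c x * j (a, b, d) + c x * j (Suc a, b, d)"
    and Dy_coeff: "(a, b, d) \<in> orders 3 \<Longrightarrow> x \<in> I \<Longrightarrow>
      Dy (\<lambda>x y t j. c x * j (a, b, d)) x y t j = c x * j (a, Suc b, d)"
proof -
  have o: "open (I \<times> (UNIV :: (real \<times> real \<times> real) set))" using assms(2) by (simp add: open_Times)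
  have "C_k_on (Suc k) (\<lambda>p. c (fst p)) (I \<times> (UNIV :: (real \<times> real \<times> real) set))"
    by (rule C_k_on_compose[OF o _ assms(1)]) (auto simp del: C_k_on.simps intro: C_k_on_fst o)
  note c = smooth_diff_fun.base[OF this, simplified]
  show s: "smooth_diff_fun (I \<times> UNIV) (Suc k) n (\<lambda>x y t j. c x * j (a, b, d))" if "(a, b, d) \<in> orders n" for a b d n
    by (rule smooth_diff_fun.mult[OF c smooth_diff_fun.coord[OF that]])
  show "Dx (\<lambda>x y t j. c x * j (a, b, d)) x y t j = deriv c x * j (a, b, d) + c x * j (Suc a, b, d)"
    "Dy (\<lambda>x y t j. c x * j (a, b, d)) x y t j = c x * j (a, Suc b, d)"
    if "(a, b, d) \<in> orders 3" "x \<in> I"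
    using Dx_mult[OF c smooth_diff_fun.coord[OF that(1)] _ o, of x y t j]
      Dy_mult[OF c smooth_diff_fun.coord[OF that(1)] _ o, of x y t j]
      Dx_base[of "\<lambda>p. c (fst p)" x y t j] Dy_base[of "\<lambda>p. c (fst p)" x y t j] that
    by (simp_all add: Dx_coord Dy_coord px_def py_def pu_def)
qed

lemma biharmonic_heat_eq:
  assumes f: "C_k_on 4 f I" "open I" and x: "x \<in> I"
  shows "biharmonic_heat f x y t j = heat_form f x j"
proof -
  define b where "b = (\<lambda>x. exp (- 2 * f x))"
  have o: "open (I \<times> (UNIV :: (real \<times> real \<times> real) set))" using f(2) by (simp add: open_Times)
  have C: "C_k_on (Suc 3) f I" using f(1) by (simp add: numeral_eq_Suc del: C_k_on.simps)
  have Ca3: "C_k_on (Suc 2) (deriv f) I" using C_k_on_deriv[OF C f(2)] by (simp add: numeral_eq_Suc del: C_k_on.simps)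
  have Ca1: "C_k_on (Suc 1) (deriv (deriv f)) I" using C_k_on_deriv[OF Ca3 f(2)] by (simp add: numeral_eq_Suc del: C_k_on.simps)
  have Cb3: "C_k_on (Suc 3) b I" unfolding b_def using C by (intro C_k_on_exp_comp C_k_on_cmult f(2)) simp_all
  have Cb1: "C_k_on (Suc 2) (deriv b) I" using C_k_on_deriv[OF Cb3 f(2)] by (simp add: numeral_eq_Suc del: C_k_on.simps)
  have le: "C_k_on (Suc 0) (deriv f) I" "C_k_on (Suc 0) (deriv (deriv f)) I" "C_k_on (Suc 0) b I" "C_k_on (Suc 0) (deriv b) I"
    using C_k_on_le[OF Ca3, of "Suc 0"] C_k_on_le[OF Ca1, of "Suc 0"] C_k_on_le[OF Cb3, of "Suc 0"] C_k_on_le[OF Cb1, of "Suc 0"]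
    by (simp_all del: C_k_on.simps)
  define P where "P = jet_laplacian f (\<lambda>x y t j. j (0, 0, 0))"
  have ord: "(0, 0, 0) \<in> orders 3" "(Suc 0, 0, 0) \<in> orders 3" "(0, Suc 0, 0) \<in> orders 3"
    "(Suc (Suc 0), 0, 0) \<in> orders 3" "(0, Suc (Suc 0), 0) \<in> orders 3" "(Suc 0, Suc (Suc 0), 0) \<in> orders 3"
    "(Suc (Suc (Suc 0)), 0, 0) \<in> orders 3" "(0, Suc (Suc (Suc 0)), 0) \<in> orders 3"
    "(Suc 0, Suc 0, 0) \<in> orders 3" "(Suc (Suc 0), Suc 0, 0) \<in> orders 3"
    by (auto simp: orders_def)
  have P: "P = (\<lambda>x y t j. deriv f x * j (Suc 0, 0, 0) + j (Suc (Suc 0), 0, 0) + b x * j (0, Suc (Suc 0), 0))"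
    unfolding P_def jet_laplacian_def b_def by (simp add: Dx_coord Dy_coord ord)
  note sc = smooth_diff_fun_coeff[OF le(1) f(2)] smooth_diff_fun_coeff[OF le(2) f(2)]
    smooth_diff_fun_coeff[OF le(3) f(2)] smooth_diff_fun_coeff[OF le(4) f(2)] smooth_diff_fun.coord
  note Dxc = Dx_coeff[OF le(1) f(2)] Dx_coeff[OF le(2) f(2)] Dx_coeff[OF le(3) f(2)] Dx_coeff[OF le(4) f(2)]
  note Dyc = Dy_coeff[OF le(1) f(2)] Dy_coeff[OF le(2) f(2)] Dy_coeff[OF le(3) f(2)] Dy_coeff[OF le(4) f(2)]
  have add3: "Dx (\<lambda>x y t j. A x y t j + B x y t j) x y t j = Dx A x y t j + Dx B x y t j"
    "Dy (\<lambda>x y t j. A x y t j + B x y t j) x y t j = Dy A x y t j + Dy B x y t j"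
    if "smooth_diff_fun (I \<times> UNIV) (Suc 0) 3 A" "smooth_diff_fun (I \<times> UNIV) (Suc 0) 3 B" "x \<in> I" for A B x y t j
    using that by (auto intro!: Dx_add[OF that(1,2) _ o] Dy_add[OF that(1,2) _ o])
  have DxP: "Dx P x y t j = deriv (deriv f) x * j (Suc 0, 0, 0) + deriv f x * j (Suc (Suc 0), 0, 0)
      + j (Suc (Suc (Suc 0)), 0, 0) + deriv b x * j (0, Suc (Suc 0), 0) + b x * j (Suc 0, Suc (Suc 0), 0)"
    if "x \<in> I" for x y t j
    unfolding P using that
    by (simp add: add3 sc smooth_diff_fun.add Dxc Dx_coord ord)
  have DyP: "Dy P x y t j = deriv f x * j (Suc 0, Suc 0, 0)
      + j (Suc (Suc 0), Suc 0, 0) + b x * j (0, Suc (Suc (Suc 0)), 0)"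
    if "x \<in> I" for x y t j
    unfolding P using that
    by (simp add: add3 sc smooth_diff_fun.add Dyc Dy_coord ord)
  have DxDxP: "Dx (Dx P) x y t j = deriv (deriv (deriv f)) x * j (Suc 0, 0, 0) + 2 * deriv (deriv f) x * j (Suc (Suc 0), 0, 0)
      + deriv f x * j (Suc (Suc (Suc 0)), 0, 0)
      + j (Suc (Suc (Suc (Suc 0))), 0, 0) + deriv (deriv b) x * j (0, Suc (Suc 0), 0)
      + 2 * deriv b x * j (Suc 0, Suc (Suc 0), 0) + b x * j (Suc (Suc 0), Suc (Suc 0), 0)"
    \<comment> \<open>The formula for \<open>Dx P\<close> holds over \<open>I\<close> only; on the
      open set \<open>I \<times> UNIV\<close> it may nevertheless be differentiated again.\<close>
    by (subst Dx_cong[OF o DxP]) (use x in \<open>auto simp: add3 sc smooth_diff_fun.add Dxc Dx_coord ord\<close>)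
  have DyDyP: "Dy (Dy P) x y t j = deriv f x * j (Suc 0, Suc (Suc 0), 0)
      + j (Suc (Suc 0), Suc (Suc 0), 0) + b x * j (0, Suc (Suc (Suc (Suc 0))), 0)"
    by (subst Dy_cong[OF o DyP]) (use x in \<open>auto simp: add3 sc smooth_diff_fun.add Dyc Dy_coord ord\<close>)
  note bd = metric_coeff_derivs(6,7)[OF f x, folded b_def]
  have "biharmonic_heat f x y t j = j (0, 0, 1) - (deriv f x * Dx P x y t j + Dx (Dx P) x y t j + b x * Dy (Dy P) x y t j)"
    unfolding biharmonic_heat_def P_def[symmetric] by (simp only: jet_laplacian_def b_def)
  moreover have "exp (- 2 * f x) = b x" by (simp add: b_def)
  ultimately show ?thesis
    unfolding DxP[OF x] DxDxP DyDyP bd heat_form_def by (simp only:) (simp add: eval_nat_numeral algebra_simps)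
qed

text \<open>The equation contains neither \<open>y\<close> nor \<open>t\<close> explicitly, and by
  linearity its derivative along the coordinate \<open>m\<close> is its value on the unit jet at
  \<open>m\<close>. The sum over \<open>orders 4\<close> therefore recombines to
  \<open>heat_form\<close> applied to the prolongation coefficients.\<close>

lemma fourth_prolongation_eq:
  assumes f: "C_k_on 4 f I" "open I" and x: "x \<in> I"
  shows "fourth_prolongation X (biharmonic_heat f) x y t j =
    coeff_x X x y t j * deriv (\<lambda>s. heat_form f s j) x
    + heat_form f x (\<lambda>(a, b, c). prolongation_coeff X a b c x y t j)"
proof -
  note e = biharmonic_heat_eq[OF f]
  have "deriv (\<lambda>s. biharmonic_heat f s y t j) x = deriv (\<lambda>s. heat_form f s j) x"
    by (rule deriv_cong_ev[OF eventually_mono[OF eventually_nhds_in_open[OF f(2) x]] refl]) (rule e)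
  moreover have "jet_pderiv m (biharmonic_heat f) x y t j = heat_form f x (\<lambda>m'. if m' = m then 1 else 0)" for m
  proof -
    have u: "((\<lambda>s. (j(m := s)) m') has_real_derivative (if m' = m then 1 else 0)) (at r)" for m' r
      by auto
    have "((\<lambda>s. heat_form f x (j(m := s))) has_real_derivative heat_form f x (\<lambda>m'. if m' = m then 1 else 0)) (at (j m))"
      unfolding heat_form_def by (intro DERIV_diff DERIV_add DERIV_cmult u)
    then show ?thesis unfolding jet_pderiv_def e[OF x] by (rule DERIV_imp_deriv)
  qed
  moreover have "(\<Sum>(a, b, c)\<in>orders 4. prolongation_coeff X a b c x y t j * heat_form f x (\<lambda>m'. if m' = (a, b, c) then 1 else 0))
      = heat_form f x (\<lambda>(a, b, c). prolongation_coeff X a b c x y t j)" (is "?l = heat_form f x ?z")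
  proof -
    have "?l = (\<Sum>m\<in>orders 4. ?z m * heat_form f x (\<lambda>m'. if m' = m then 1 else 0))"
      by (rule sum.cong) auto
    also have "\<dots> = heat_form f x (\<lambda>m'. \<Sum>m\<in>orders 4. ?z m * (if m' = m then 1 else 0))"
      by (rule heat_form_sum[symmetric])
    also have "\<dots> = heat_form f x ?z"
      by (rule heat_form_cong) (simp add: if_distrib[of "(*) _"] cong: if_cong)
    finally show ?thesis .
  qed
  ultimately show ?thesis
    unfolding fourth_prolongation_def by (simp add: e[OF x])
qed

section \<open>Prolongation along a function\<close>

text \<open>The \<open>k\<close>-th derivative of z^n / n!. The branch for \<open>k > n\<close> is
  needed because the subtraction of naturals truncates at zero.\<close>

definition divided_power :: "nat \<Rightarrow> nat \<Rightarrow> real \<Rightarrow> real" where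
  "divided_power n k z = (if k \<le> n then z ^ (n - k) / fact (n - k) else 0)"

lemma DERIV_divided_power:
  "((\<lambda>s. divided_power n k (s - a)) has_real_derivative divided_power n (Suc k) (r - a)) (at r)"
proof (cases "k < n")
  case True
  then obtain m where "n - k = Suc m" "n - Suc k = m" by (metis Suc_diff_Suc)
  with True have e: "divided_power n k = (\<lambda>z. z ^ Suc m / fact (Suc m))"
    "divided_power n (Suc k) = (\<lambda>z. z ^ m / fact m)"
    by (auto simp: divided_power_def fun_eq_iff)
  have 1: "((\<lambda>s. s - a) has_real_derivative 1) (at r)" by (auto intro!: derivative_eq_intros)
  have "(1 + real m) * (r - a) ^ m / fact (Suc m) = (r - a) ^ m / fact m"
    by (simp add: divide_simps)
  moreover have "((\<lambda>s. (s - a) ^ Suc m / fact (Suc m)) has_real_derivative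
      (1 + real m) * (r - a) ^ m / fact (Suc m)) (at r)"
    using DERIV_cdivide[OF DERIV_power[OF 1, of "Suc m"], of "fact (Suc m)"] by simp
  ultimately show ?thesis unfolding e by simp
next
  case False
  then show ?thesis by (cases "k = n") (auto simp: divided_power_def)
qed

lemma divided_power_0: "divided_power n k 0 = (if n = k then 1 else 0)"
  by (auto simp: divided_power_def)

text \<open>All derivatives of the polynomial of degree at most four with prescribed jet
  \<open>j\<close> at the base point. Being a polynomial, it is smooth and holonomic everywhere,
  whatever the jet.\<close>

definition taylor_jet :: "real \<Rightarrow> real \<Rightarrow> real \<Rightarrow> jet \<Rightarrow> real \<Rightarrow> real \<Rightarrow> real \<Rightarrow> jet" where
  "taylor_jet x0 y0 t0 j x y t = (\<lambda>(a, b, c). \<Sum>m\<in>orders 4. j m * divided_power (fst m) a (x - x0)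
     * divided_power (fst (snd m)) b (y - y0) * divided_power (snd (snd m)) c (t - t0))"

lemma holonomic_taylor_jet: "holonomic (taylor_jet x0 y0 t0 j)"
  unfolding holonomic_def taylor_jet_def
  by (auto intro!: DERIV_sum derivative_eq_intros DERIV_divided_power)

lemma taylor_jet_at:
  assumes "m \<in> orders 4"
  shows "taylor_jet x0 y0 t0 j x0 y0 t0 m = j m"
proof -
  have "taylor_jet x0 y0 t0 j x0 y0 t0 m = (\<Sum>m'\<in>orders 4. if m = m' then j m' else 0)"
    unfolding taylor_jet_def case_prod_unfold
    by (rule sum.cong) (auto simp: divided_power_0 prod_eq_iff)
  then show ?thesis using assms by simp
qed

lemma C3_divided_power:
  assumes "open D"
  shows "C3 k D (\<lambda>x y t. divided_power n i (x - a))" "C3 k D (\<lambda>x y t. divided_power n i (y - a))"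
    "C3 k D (\<lambda>x y t. divided_power n i (t - a))"
  using assms unfolding divided_power_def C3_iff
  by (cases "i \<le> n"; simp del: C_k_on.simps; intro C_k_on_intros; simp)+

lemma C3_taylor_jet: "C3 k UNIV (\<lambda>x y t. taylor_jet x0 y0 t0 j x y t m)"
  unfolding taylor_jet_def case_prod_unfold
  by (intro C3_sum C3_mult C3_const C3_divided_power) auto

text \<open>The nesting, \<open>t\<close> innermost and \<open>x\<close> outermost, is the one in
  which \<open>prolongation_coeff\<close> recurses.\<close>

definition deriv3 :: "nat \<Rightarrow> nat \<Rightarrow> nat \<Rightarrow> (real \<Rightarrow> real \<Rightarrow> real \<Rightarrow> real) \<Rightarrow> real \<Rightarrow> real \<Rightarrow> real \<Rightarrow> real" where
  "deriv3 a b c w = (dx ^^ a) ((dy ^^ b) ((dt ^^ c) w))"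

lemma deriv3_simps:
  "deriv3 0 0 0 w = w" "deriv3 (Suc a) b c w = dx (deriv3 a b c w)"
  "deriv3 0 (Suc b) c w = dy (deriv3 0 b c w)" "deriv3 0 0 (Suc c) w = dt (deriv3 0 0 c w)"
  by (simp_all add: deriv3_def)

lemma C3_deriv3:
  assumes "open D" "C3 n D w" "a + b + c \<le> n"
  shows "C3 (n - (a + b + c)) D (deriv3 a b c w)"
proof -
  have t: "c \<le> n \<Longrightarrow> C3 (n - c) D ((dt ^^ c) w)" for c
  proof (induction c)
    case (Suc c)
    then have "C3 (Suc (n - Suc c)) D ((dt ^^ c) w)" by (simp add: Suc_diff_Suc)
    then show ?case using C3_dt[OF _ assms(1)] by auto
  qed (simp add: assms)
  have y: "b + c \<le> n \<Longrightarrow> C3 (n - (b + c)) D ((dy ^^ b) ((dt ^^ c) w))" for b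
  proof (induction b)
    case (Suc b)
    then have "C3 (Suc (n - (Suc b + c))) D ((dy ^^ b) ((dt ^^ c) w))" by (simp add: Suc_diff_Suc)
    then show ?case using C3_dy[OF _ assms(1)] by auto
  qed (simp add: t)
  have "a + (b + c) \<le> n \<Longrightarrow> C3 (n - (a + (b + c))) D ((dx ^^ a) ((dy ^^ b) ((dt ^^ c) w)))" for a
  proof (induction a)
    case (Suc a)
    then have "C3 (Suc (n - (Suc a + (b + c)))) D ((dx ^^ a) ((dy ^^ b) ((dt ^^ c) w)))" by (simp add: Suc_diff_Suc)
    then show ?case using C3_dx[OF _ assms(1)] by auto
  qed (simp add: y)
  then show ?thesis using assms(3) by (simp add: deriv3_def add.assoc)
qed

lemma smooth_diff_fun_diff:
  assumes "smooth_diff_fun \<Omega> k n P" "smooth_diff_fun \<Omega> k n Q"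
  shows "smooth_diff_fun \<Omega> k n (\<lambda>x y t j. P x y t j - Q x y t j)"
proof -
  have "smooth_diff_fun \<Omega> k n (\<lambda>x y t j. (\<lambda>_. - 1) (x, y, t, j (0, 0, 0)))"
    by (rule smooth_diff_fun.base) simp
  from smooth_diff_fun.add[OF assms(1) smooth_diff_fun.mult[OF this assms(2)]] show ?thesis by simp
qed

lemma smooth_diff_fun_coeffs:
  assumes "C_k_on k X \<Omega>" "open \<Omega>"
  shows "smooth_diff_fun \<Omega> k n (coeff_x X)" "smooth_diff_fun \<Omega> k n (coeff_y X)"
    "smooth_diff_fun \<Omega> k n (coeff_t X)" "smooth_diff_fun \<Omega> k n (coeff_u X)"
  unfolding coeff_x_def[abs_def] coeff_y_def[abs_def] coeff_t_def[abs_def] coeff_u_def[abs_def]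
  using smooth_diff_fun.base[where h = "\<lambda>p. fst (X p)"] smooth_diff_fun.base[where h = "\<lambda>p. fst (snd (X p))"]
    smooth_diff_fun.base[where h = "\<lambda>p. fst (snd (snd (X p)))"] smooth_diff_fun.base[where h = "\<lambda>p. snd (snd (snd (X p)))"]
    assms by (simp_all add: C_k_on_fst_comp C_k_on_snd_comp)

text \<open>Every step of the recursion spends one derivative of \<open>X\<close>, so order four
  leaves merely continuous coefficients. The factors \<open>D \<xi>\<close>,
  \<open>D \<phi>\<close>, \<open>D \<tau>\<close> are of class three and order one and are weakened
  to match.\<close>

lemma smooth_diff_fun_prolongation_coeff:
  assumes "C_k_on 4 X \<Omega>" "open \<Omega>"
  shows "a + b + c \<le> 4 \<Longrightarrow> smooth_diff_fun \<Omega> (4 - (a + b + c)) (a + b + c) (prolongation_coeff X a b c)"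
  using assms(1)
proof (induction X a b c rule: prolongation_coeff.induct)
  case (1 X)
  then show ?case using smooth_diff_fun_coeffs[OF _ assms(2)] by simp
next
  case (2 X a b c)
  have le: "k \<le> 3" if "k = 4 - (Suc a + b + c)" for k using that by simp
  have "smooth_diff_fun \<Omega> (Suc (4 - (Suc a + b + c))) (a + b + c) (prolongation_coeff X a b c)"
  proof -
    have "4 - (a + b + c) = Suc (4 - (Suc a + b + c))" using 2(2) by simp
    then show ?thesis using 2 by simp
  qed
  note P = smooth_diff_fun_Dx[OF this _ assms(2)]
  have "smooth_diff_fun \<Omega> 3 1 (Dx Q)" if "smooth_diff_fun \<Omega> 4 0 Q" for Q
    using smooth_diff_fun_Dx[of \<Omega> 3 0 Q] that assms(2) by simp
  note Q = this[THEN smooth_diff_fun_mono[OF _ le[OF refl], where n' = "Suc a + b + c"]]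
  note c = smooth_diff_fun_coeffs[OF 2(3) assms(2), of 0]
  show ?case unfolding prolongation_coeff.simps
    by (intro smooth_diff_fun_diff smooth_diff_fun.mult smooth_diff_fun.coord Q[OF c(1)] Q[OF c(2)] Q[OF c(3)])
      (use P 2(2) in \<open>auto simp: orders_def\<close>)
next
  case (3 X b c)
  have le: "k \<le> 3" if "k = 4 - (0 + Suc b + c)" for k using that by simp
  have "smooth_diff_fun \<Omega> (Suc (4 - (0 + Suc b + c))) (0 + b + c) (prolongation_coeff X 0 b c)"
  proof -
    have "4 - (0 + b + c) = Suc (4 - (0 + Suc b + c))" using 3(2) by simp
    then show ?thesis using 3 by simp
  qed
  note P = smooth_diff_fun_Dy[OF this _ assms(2)]
  have "smooth_diff_fun \<Omega> 3 1 (Dy Q)" if "smooth_diff_fun \<Omega> 4 0 Q" for Q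
    using smooth_diff_fun_Dy[of \<Omega> 3 0 Q] that assms(2) by simp
  note Q = this[THEN smooth_diff_fun_mono[OF _ le[OF refl], where n' = "0 + Suc b + c"]]
  note c = smooth_diff_fun_coeffs[OF 3(3) assms(2), of 0]
  show ?case unfolding prolongation_coeff.simps
    by (intro smooth_diff_fun_diff smooth_diff_fun.mult smooth_diff_fun.coord Q[OF c(1)] Q[OF c(2)] Q[OF c(3)])
      (use P 3(2) in \<open>auto simp: orders_def\<close>)
next
  case (4 X c)
  have le: "k \<le> 3" if "k = 4 - (0 + 0 + Suc c)" for k using that by simp
  have "smooth_diff_fun \<Omega> (Suc (4 - (0 + 0 + Suc c))) (0 + 0 + c) (prolongation_coeff X 0 0 c)"
  proof -
    have "4 - (0 + 0 + c) = Suc (4 - (0 + 0 + Suc c))" using 4(2) by simp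
    then show ?thesis using 4 by simp
  qed
  note P = smooth_diff_fun_Dt[OF this _ assms(2)]
  have "smooth_diff_fun \<Omega> 3 1 (Dt Q)" if "smooth_diff_fun \<Omega> 4 0 Q" for Q
    using smooth_diff_fun_Dt[of \<Omega> 3 0 Q] that assms(2) by simp
  note Q = this[THEN smooth_diff_fun_mono[OF _ le[OF refl], where n' = "0 + 0 + Suc c"]]
  note c = smooth_diff_fun_coeffs[OF 4(3) assms(2), of 0]
  show ?case unfolding prolongation_coeff.simps
    by (intro smooth_diff_fun_diff smooth_diff_fun.mult smooth_diff_fun.coord Q[OF c(1)] Q[OF c(2)] Q[OF c(3)])
      (use P 4(2) in \<open>auto simp: orders_def\<close>)
qed


lemma C3_graph:
  assumes "open D" "C3 k D u" "C_k_on k h \<Omega>" "\<And>x y t. (x, y, t) \<in> D \<Longrightarrow> (x, y, t, u x y t) \<in> \<Omega>"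
  shows "C3 k D (\<lambda>x y t. h (x, y, t, u x y t))"
  unfolding C3_iff
proof (rule C_k_on_compose[OF assms(1) _ assms(3)])
  show "C_k_on k (\<lambda>p. (fst p, fst (snd p), snd (snd p), u (fst p) (fst (snd p)) (snd (snd p)))) D"
    using assms(2) by (intro C_k_on_intros assms(1)) (simp add: C3_iff)
qed (use assms(4) in auto)

text \<open>Restricts all prolongation data to the jets of one smooth function, the component
  \<open>(0, 0, 0)\<close> of \<open>j\<close>. The set \<open>D\<close> below consists of the
  points over which its graph lies in \<Omega>.\<close>

locale jet_lift =
  fixes X :: vfield and \<Omega> :: "(real \<times> real \<times> real \<times> real) set" and j :: "real \<Rightarrow> real \<Rightarrow> real \<Rightarrow> jet"
  assumes X: "C_k_on 4 X \<Omega>" and open_\<Omega>: "open \<Omega>" and holonomic: "holonomic j"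
    and smooth: "C3 k UNIV (\<lambda>x y t. j x y t m)"
begin

definition D :: "(real \<times> real \<times> real) set" where
  "D = {(x, y, t). (x, y, t, j x y t (0, 0, 0)) \<in> \<Omega>}"

definition cx :: "real \<Rightarrow> real \<Rightarrow> real \<Rightarrow> real" where "cx x y t = coeff_x X x y t (j x y t)"
definition cy :: "real \<Rightarrow> real \<Rightarrow> real \<Rightarrow> real" where "cy x y t = coeff_y X x y t (j x y t)"
definition ct :: "real \<Rightarrow> real \<Rightarrow> real \<Rightarrow> real" where "ct x y t = coeff_t X x y t (j x y t)"
definition cu :: "real \<Rightarrow> real \<Rightarrow> real \<Rightarrow> real" where "cu x y t = coeff_u X x y t (j x y t)"

definition characteristic :: "real \<Rightarrow> real \<Rightarrow> real \<Rightarrow> real" where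
  "characteristic x y t = cu x y t - cx x y t * j x y t (1, 0, 0) - cy x y t * j x y t (0, 1, 0)
     - ct x y t * j x y t (0, 0, 1)"

lemma open_D: "open D"
proof -
  have "continuous_on UNIV (\<lambda>p. j (fst p) (fst (snd p)) (snd (snd p)) (0, 0, 0))"
    using C_k_on_imp_continuous smooth[of 0 "(0, 0, 0)"] by (auto simp: C3_iff)
  then have "continuous_on UNIV (\<lambda>p. (fst p, fst (snd p), snd (snd p), j (fst p) (fst (snd p)) (snd (snd p)) (0, 0, 0)))"
    by (intro continuous_intros)
  then have "open ((\<lambda>p. (fst p, fst (snd p), snd (snd p), j (fst p) (fst (snd p)) (snd (snd p)) (0, 0, 0))) -` \<Omega>)"
    using open_\<Omega> by (auto intro: open_vimage)
  also have "(\<lambda>p. (fst p, fst (snd p), snd (snd p), j (fst p) (fst (snd p)) (snd (snd p)) (0, 0, 0))) -` \<Omega> = D"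
    by (auto simp: D_def)
  finally show ?thesis .
qed

lemma C3_j: "C3 k D (\<lambda>x y t. j x y t m)"
  using C3_subset[OF smooth] by blast

lemma C3_coeffs: "C3 4 D cx" "C3 4 D cy" "C3 4 D ct" "C3 4 D cu"
proof -
  have *: "C3 4 D (\<lambda>x y t. h (x, y, t, j x y t (0, 0, 0)))" if "C_k_on 4 h \<Omega>" for h
    by (rule C3_graph[OF open_D C3_j that]) (auto simp: D_def)
  show "C3 4 D cx" "C3 4 D cy" "C3 4 D ct" "C3 4 D cu"
    using *[of "\<lambda>p. fst (X p)"] *[of "\<lambda>p. fst (snd (X p))"]
      *[of "\<lambda>p. fst (snd (snd (X p)))"] *[of "\<lambda>p. snd (snd (snd (X p)))"] X open_\<Omega>
    by (simp_all add: cx_def[abs_def] cy_def[abs_def] ct_def[abs_def] cu_def[abs_def] coeff_x_def coeff_y_def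
        coeff_t_def coeff_u_def C_k_on_fst_comp C_k_on_snd_comp)
qed

lemma C3_characteristic: "C3 4 D characteristic"
  unfolding characteristic_def[abs_def]
  by (intro C3_diff C3_mult C3_coeffs C3_j open_D)

lemma coeff_total_derivs:
  assumes "(x, y, t) \<in> D"
  shows "((\<lambda>s. cx s y t) has_real_derivative Dx (coeff_x X) x y t (j x y t)) (at x)"
    "((\<lambda>s. cy s y t) has_real_derivative Dx (coeff_y X) x y t (j x y t)) (at x)"
    "((\<lambda>s. ct s y t) has_real_derivative Dx (coeff_t X) x y t (j x y t)) (at x)"
    "((\<lambda>s. cx x s t) has_real_derivative Dy (coeff_x X) x y t (j x y t)) (at y)"
    "((\<lambda>s. cy x s t) has_real_derivative Dy (coeff_y X) x y t (j x y t)) (at y)"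
    "((\<lambda>s. ct x s t) has_real_derivative Dy (coeff_t X) x y t (j x y t)) (at y)"
    "((\<lambda>s. cx x y s) has_real_derivative Dt (coeff_x X) x y t (j x y t)) (at t)"
    "((\<lambda>s. cy x y s) has_real_derivative Dt (coeff_y X) x y t (j x y t)) (at t)"
    "((\<lambda>s. ct x y s) has_real_derivative Dt (coeff_t X) x y t (j x y t)) (at t)"
proof -
  have p: "(x, y, t, j x y t (0, 0, 0)) \<in> \<Omega>" using assms by (simp add: D_def)
  note c = smooth_diff_fun_coeffs[OF X open_\<Omega>, of 0]
  note T = total_derivative[OF _ _ _ open_\<Omega> holonomic p, of 4 0]
  show "((\<lambda>s. cx s y t) has_real_derivative Dx (coeff_x X) x y t (j x y t)) (at x)"
    "((\<lambda>s. cy s y t) has_real_derivative Dx (coeff_y X) x y t (j x y t)) (at x)"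
    "((\<lambda>s. ct s y t) has_real_derivative Dx (coeff_t X) x y t (j x y t)) (at x)"
    "((\<lambda>s. cx x s t) has_real_derivative Dy (coeff_x X) x y t (j x y t)) (at y)"
    "((\<lambda>s. cy x s t) has_real_derivative Dy (coeff_y X) x y t (j x y t)) (at y)"
    "((\<lambda>s. ct x s t) has_real_derivative Dy (coeff_t X) x y t (j x y t)) (at y)"
    "((\<lambda>s. cx x y s) has_real_derivative Dt (coeff_x X) x y t (j x y t)) (at t)"
    "((\<lambda>s. cy x y s) has_real_derivative Dt (coeff_y X) x y t (j x y t)) (at t)"
    "((\<lambda>s. ct x y s) has_real_derivative Dt (coeff_t X) x y t (j x y t)) (at t)"
    using T[OF c(1)] T[OF c(2)] T[OF c(3)] by (simp_all add: cx_def cy_def ct_def)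
qed

text \<open>The classical formula expressing the prolongation through derivatives of the
  characteristic. Both sides obey the same recursion: differentiating
  \<open>cx * j (Suc a, b, c)\<close> by Leibniz produces \<open>Dx (coeff_x X)\<close> times a
  coordinate, which is one of the terms subtracted in \<open>prolongation_coeff\<close>; the same
  happens for \<open>cy\<close> and \<open>ct\<close>.\<close>

lemma prolongation_coeff_along:
  assumes "a + b + c \<le> 4" "(x, y, t) \<in> D"
  shows "prolongation_coeff X a b c x y t (j x y t) = deriv3 a b c characteristic x y t
    + cx x y t * j x y t (Suc a, b, c) + cy x y t * j x y t (a, Suc b, c) + ct x y t * j x y t (a, b, Suc c)"
proof -
  define R where "R a b c x y t = deriv3 a b c characteristic x y t
    + cx x y t * j x y t (Suc a, b, c) + cy x y t * j x y t (a, Suc b, c) + ct x y t * j x y t (a, b, Suc c)"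
    for a b c x y t
  note hd = holonomicD[OF holonomic]
  have C: "C3 (Suc (3 - (a + b + c))) D (deriv3 a b c characteristic)" if "a + b + c \<le> 3" for a b c
  proof -
    have "4 - (a + b + c) = Suc (3 - (a + b + c))" using that by simp
    then show ?thesis using C3_deriv3[OF open_D C3_characteristic, of a b c] that by simp
  qed
  have S: "smooth_diff_fun \<Omega> (Suc (3 - (a + b + c))) (a + b + c) (prolongation_coeff X a b c)" if "a + b + c \<le> 3" for a b c
  proof -
    have "4 - (a + b + c) = Suc (3 - (a + b + c))" using that by simp
    then show ?thesis using smooth_diff_fun_prolongation_coeff[OF X open_\<Omega>, of a b c] that by simp
  qed
  have DR:
    "((\<lambda>s. R a b c s y t) has_real_derivative dx (deriv3 a b c characteristic) x y t
      + (cx x y t * j x y t (Suc (Suc a), b, c) + Dx (coeff_x X) x y t (j x y t) * j x y t (Suc a, b, c))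
      + (cy x y t * j x y t (Suc a, Suc b, c) + Dx (coeff_y X) x y t (j x y t) * j x y t (a, Suc b, c))
      + (ct x y t * j x y t (Suc a, b, Suc c) + Dx (coeff_t X) x y t (j x y t) * j x y t (a, b, Suc c))) (at x)"
    "((\<lambda>s. R a b c x s t) has_real_derivative dy (deriv3 a b c characteristic) x y t
      + (cx x y t * j x y t (Suc a, Suc b, c) + Dy (coeff_x X) x y t (j x y t) * j x y t (Suc a, b, c))
      + (cy x y t * j x y t (a, Suc (Suc b), c) + Dy (coeff_y X) x y t (j x y t) * j x y t (a, Suc b, c))
      + (ct x y t * j x y t (a, Suc b, Suc c) + Dy (coeff_t X) x y t (j x y t) * j x y t (a, b, Suc c))) (at y)"
    "((\<lambda>s. R a b c x y s) has_real_derivative dt (deriv3 a b c characteristic) x y t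
      + (cx x y t * j x y t (Suc a, b, Suc c) + Dt (coeff_x X) x y t (j x y t) * j x y t (Suc a, b, c))
      + (cy x y t * j x y t (a, Suc b, Suc c) + Dt (coeff_y X) x y t (j x y t) * j x y t (a, Suc b, c))
      + (ct x y t * j x y t (a, b, Suc (Suc c)) + Dt (coeff_t X) x y t (j x y t) * j x y t (a, b, Suc c))) (at t)"
    if "a + b + c \<le> 3" "(x, y, t) \<in> D" for a b c x y t
    unfolding R_def
    by (intro DERIV_add DERIV_mult' C3_has_dx[OF C[OF that(1)] that(2)] C3_has_dy[OF C[OF that(1)] that(2)]
        C3_has_dt[OF C[OF that(1)] that(2)] coeff_total_derivs[OF that(2)] hd)+
  have "\<forall>x y t. (x, y, t) \<in> D \<longrightarrow> prolongation_coeff X a b c x y t (j x y t) = R a b c x y t" (is "?E a b c")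
    if "a + b + c \<le> 4" for a b c
  proof -
    have along: "((\<lambda>s. R a b c s y t) has_real_derivative Dx (prolongation_coeff X a b c) x y t (j x y t)) (at x)"
      "((\<lambda>s. R a b c x s t) has_real_derivative Dy (prolongation_coeff X a b c) x y t (j x y t)) (at y)"
      "((\<lambda>s. R a b c x y s) has_real_derivative Dt (prolongation_coeff X a b c) x y t (j x y t)) (at t)"
      if E: "?E a b c" and le: "a + b + c \<le> 3" and p: "(x, y, t) \<in> D" for a b c x y t
    proof -
      have q: "(x, y, t, j x y t (0, 0, 0)) \<in> \<Omega>" using p by (simp add: D_def)
      note T = total_derivative[OF S[OF le] zero_less_Suc le open_\<Omega> holonomic q]
      have ev: "eventually (\<lambda>s. prolongation_coeff X a b c s y t (j s y t) = R a b c s y t) (nhds x)"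
        "eventually (\<lambda>s. prolongation_coeff X a b c x s t (j x s t) = R a b c x s t) (nhds y)"
        "eventually (\<lambda>s. prolongation_coeff X a b c x y s (j x y s) = R a b c x y s) (nhds t)"
        using open3_nhds[OF open_D p] E by (auto elim!: eventually_mono)
      show "((\<lambda>s. R a b c s y t) has_real_derivative Dx (prolongation_coeff X a b c) x y t (j x y t)) (at x)"
        "((\<lambda>s. R a b c x s t) has_real_derivative Dy (prolongation_coeff X a b c) x y t (j x y t)) (at y)"
        "((\<lambda>s. R a b c x y s) has_real_derivative Dt (prolongation_coeff X a b c) x y t (j x y t)) (at t)"
        using T DERIV_cong_ev[OF refl ev(1) refl] DERIV_cong_ev[OF refl ev(2) refl]
          DERIV_cong_ev[OF refl ev(3) refl] by auto
    qed
    \<comment> \<open>The three inductions follow the recursion: pure \<open>t\<close>-derivatives,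
      then \<open>y\<close> on top of them, then \<open>x\<close>. In each step both expressions are
      derivatives of the same function, so uniqueness of derivatives identifies them.\<close>
    have t: "c \<le> 4 \<Longrightarrow> ?E 0 0 c" for c
    proof (induction c)
      case 0
      show ?case by (simp add: R_def deriv3_simps characteristic_def cx_def cy_def ct_def cu_def)
    next
      case (Suc c)
      show ?case
      proof (intro allI impI)
        fix x y t assume p: "(x, y, t) \<in> D"
        show "prolongation_coeff X 0 0 (Suc c) x y t (j x y t) = R 0 0 (Suc c) x y t"
          using DERIV_unique[OF along(3)[OF Suc.IH _ p] DR(3)[OF _ p]] Suc.prems
          by (simp add: R_def deriv3_simps)
      qed
    qed
    have y: "b + c \<le> 4 \<Longrightarrow> ?E 0 b c" for b c
    proof (induction b)
      case 0
      then show ?case using t by simp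
    next
      case (Suc b)
      show ?case
      proof (intro allI impI)
        fix x y t assume p: "(x, y, t) \<in> D"
        show "prolongation_coeff X 0 (Suc b) c x y t (j x y t) = R 0 (Suc b) c x y t"
          using DERIV_unique[OF along(2)[OF Suc.IH _ p] DR(2)[OF _ p]] Suc.prems
          by (simp add: R_def deriv3_simps)
      qed
    qed
    have "a + b + c \<le> 4 \<Longrightarrow> ?E a b c" for a b c
    proof (induction a)
      case 0
      then show ?case using y by simp
    next
      case (Suc a)
      show ?case
      proof (intro allI impI)
        fix x y t assume p: "(x, y, t) \<in> D"
        show "prolongation_coeff X (Suc a) b c x y t (j x y t) = R (Suc a) b c x y t"
          using DERIV_unique[OF along(1)[OF Suc.IH _ p] DR(1)[OF _ p]] Suc.prems
          by (simp add: R_def deriv3_simps)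
      qed
    qed
    then show ?thesis using that .
  qed
  then show ?thesis using assms unfolding R_def by blast
qed

end

section \<open>The biharmonic heat operator acting on functions\<close>

definition heat_op :: "(real \<Rightarrow> real) \<Rightarrow> (real \<Rightarrow> real \<Rightarrow> real \<Rightarrow> real) \<Rightarrow> real \<Rightarrow> real \<Rightarrow> real \<Rightarrow> real" where
  "heat_op f w x y t = dt w x y t - laplacian f (laplacian f w) x y t"

lemma laplacian_eq: "laplacian f w = (\<lambda>x y t. deriv f x * dx w x y t + dx (dx w) x y t
    + exp (- 2 * f x) * dy (dy w) x y t)"
  by (simp add: fun_eq_iff laplacian_def dx_def dy_def)

lemma laplacian_cong:
  assumes "open D" "\<And>x y t. (x, y, t) \<in> D \<Longrightarrow> v x y t = w x y t" "(x, y, t) \<in> D"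
  shows "laplacian f v x y t = laplacian f w x y t"
proof -
  have 1: "dx v x y t = dx w x y t" "dy v x y t = dy w x y t" if "(x, y, t) \<in> D" for x y t
    using dx_cong[OF assms(1,2)] dy_cong[OF assms(1,2)] that by auto
  show ?thesis
    unfolding laplacian_eq
    using 1[OF assms(3)] dx_cong[OF assms(1) 1(1) assms(3)] dy_cong[OF assms(1) 1(2) assms(3)] by simp
qed

lemma heat_op_cong:
  assumes "open D" "\<And>x y t. (x, y, t) \<in> D \<Longrightarrow> v x y t = w x y t" "(x, y, t) \<in> D"
  shows "heat_op f v x y t = heat_op f w x y t"
  unfolding heat_op_def
  using laplacian_cong[OF assms(1) laplacian_cong[OF assms(1,2)] assms(3)] dt_cong[OF assms] by simp

locale surface =
  fixes f :: "real \<Rightarrow> real" and I :: "real set"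
  assumes f: "C_k_on 4 f I" and open_I: "open I"
begin

abbreviation "met x \<equiv> exp (- 2 * f x)"

lemmas metric_derivs = metric_coeff_derivs[OF f open_I]

lemma C_k_on_deriv_f: "C_k_on 3 (deriv f) I"
  using C_k_on_deriv[of 3 f I] f open_I by (simp add: numeral_eq_Suc del: C_k_on.simps)

lemma C3_deriv_f:
  assumes "open D" "D \<subseteq> I \<times> UNIV"
  shows "C3 3 D (\<lambda>x y t. deriv f x)"
  by (rule C3_of_x[OF assms(1) C_k_on_deriv_f]) (use assms(2) in auto)

lemma C3_met:
  assumes "open D" "D \<subseteq> I \<times> UNIV"
  shows "C3 4 D (\<lambda>x y t. met x)"
proof (rule C3_of_x[OF assms(1)])
  show "C_k_on 4 (\<lambda>x. met x) I" by (intro C_k_on_intros open_I f)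
qed (use assms(2) in auto)

lemma C3_laplacian:
  assumes "open D" "D \<subseteq> I \<times> UNIV" "C3 (Suc (Suc k)) D w" "k \<le> 3"
  shows "C3 k D (laplacian f w)"
  unfolding laplacian_eq using assms(4)
  by (intro C3_add C3_mult assms(1) C3_le[OF C3_deriv_f[OF assms(1,2)]] C3_le[OF C3_met[OF assms(1,2)]]
      C3_le[OF C3_dx[OF assms(3,1)]] C3_dx[OF C3_dx[OF assms(3,1)] assms(1)] C3_dy[OF C3_dy[OF assms(3,1)] assms(1)]) auto

lemma laplacian_add:
  assumes "open D" "C3 2 D v" "C3 2 D w" "(x, y, t) \<in> D"
  shows "laplacian f (\<lambda>x y t. v x y t + w x y t) x y t = laplacian f v x y t + laplacian f w x y t"
proof -
  have C: "C3 (Suc (Suc 0)) D v" "C3 (Suc (Suc 0)) D w" using assms by (simp_all add: numeral_2_eq_2)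
  note C1 = C3_dx[OF C(1) assms(1)] C3_dx[OF C(2) assms(1)] C3_dy[OF C(1) assms(1)] C3_dy[OF C(2) assms(1)]
  have "dx (dx (\<lambda>x y t. v x y t + w x y t)) x y t = dx (dx v) x y t + dx (dx w) x y t"
    by (subst dx_cong[OF assms(1) dx_add[OF C] assms(4)], assumption) (rule dx_add[OF C1(1,2) assms(4)])
  moreover have "dy (dy (\<lambda>x y t. v x y t + w x y t)) x y t = dy (dy v) x y t + dy (dy w) x y t"
    by (subst dy_cong[OF assms(1) dy_add[OF C] assms(4)], assumption) (rule dy_add[OF C1(3,4) assms(4)])
  ultimately show ?thesis unfolding laplacian_eq using dx_add[OF C assms(4)] by (simp add: algebra_simps)
qed

lemma laplacian_mult:
  assumes "open D" "C3 2 D v" "C3 2 D w" "(x, y, t) \<in> D"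
  shows "laplacian f (\<lambda>x y t. v x y t * w x y t) x y t = v x y t * laplacian f w x y t
    + w x y t * laplacian f v x y t + 2 * (dx v x y t * dx w x y t + met x * dy v x y t * dy w x y t)"
proof -
  have C: "C3 (Suc (Suc 0)) D v" "C3 (Suc (Suc 0)) D w" using assms by (simp_all add: numeral_2_eq_2)
  have C0: "C3 (Suc 0) D v" "C3 (Suc 0) D w" using C C3_le by blast+
  note C1 = C3_dx[OF C(1) assms(1)] C3_dx[OF C(2) assms(1)] C3_dy[OF C(1) assms(1)] C3_dy[OF C(2) assms(1)]
  note m = C3_mult[OF assms(1) C1(1) C0(2)] C3_mult[OF assms(1) C0(1) C1(2)]
    C3_mult[OF assms(1) C1(3) C0(2)] C3_mult[OF assms(1) C0(1) C1(4)]
  have "dx (dx (\<lambda>x y t. v x y t * w x y t)) x y t = dx (dx v) x y t * w x y t + 2 * dx v x y t * dx w x y t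
      + v x y t * dx (dx w) x y t"
    by (subst dx_cong[OF assms(1) dx_mult[OF C] assms(4)], assumption)
      (simp add: dx_add[OF m(1,2) assms(4)] dx_mult[OF C1(1) C0(2) assms(4)] dx_mult[OF C0(1) C1(2) assms(4)])
  moreover have "dy (dy (\<lambda>x y t. v x y t * w x y t)) x y t = dy (dy v) x y t * w x y t + 2 * dy v x y t * dy w x y t
      + v x y t * dy (dy w) x y t"
    by (subst dy_cong[OF assms(1) dy_mult[OF C] assms(4)], assumption)
      (simp add: dy_add[OF m(3,4) assms(4)] dy_mult[OF C1(3) C0(2) assms(4)] dy_mult[OF C0(1) C1(4) assms(4)])
  ultimately show ?thesis unfolding laplacian_eq using dx_mult[OF C assms(4)] by (simp add: algebra_simps)
qed

lemma commute3:
  assumes "open D" "C3 (Suc (Suc (Suc k))) D w" "(x, y, t) \<in> D"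
  shows "dy (dx (dx w)) x y t = dx (dx (dy w)) x y t" "dy (dy (dx w)) x y t = dx (dy (dy w)) x y t"
proof -
  note c = dx_dy_commute[OF assms(2,1)] dx_dy_commute[OF C3_dx[OF assms(2,1)] assms(1)]
    dx_dy_commute[OF C3_dy[OF assms(2,1)] assms(1)]
  show "dy (dx (dx w)) x y t = dx (dx (dy w)) x y t"
    using c(2)[OF assms(3)] dx_cong[OF assms(1) c(1) assms(3)] by simp
  show "dy (dy (dx w)) x y t = dx (dy (dy w)) x y t"
    using c(3)[OF assms(3)] dy_cong[OF assms(1) c(1) assms(3)] by simp
qed

text \<open>Mixed derivatives are normalised to have \<open>dx\<close> outermost, in agreement with
  \<open>deriv3\<close>; this is why the formula for \<open>dy\<close> has to go through
  \<open>commute3\<close>.\<close>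

lemma laplacian_first_derivs:
  assumes "open D" "D \<subseteq> I \<times> UNIV" "C3 (Suc (Suc (Suc k))) D w" "(x, y, t) \<in> D"
  shows "dx (laplacian f w) x y t = deriv (deriv f) x * dx w x y t + deriv f x * dx (dx w) x y t + dx (dx (dx w)) x y t
      + (- 2 * deriv f x * met x * dy (dy w) x y t + met x * dx (dy (dy w)) x y t)"
    and "dy (laplacian f w) x y t = deriv f x * dx (dy w) x y t + dx (dx (dy w)) x y t + met x * dy (dy (dy w)) x y t"
proof -
  have x: "x \<in> I" using assms(2,4) by auto
  note C1 = C3_dx[OF assms(3,1)] C3_dy[OF assms(3,1)]
  note C2 = C3_dx[OF C1(1) assms(1)] C3_dy[OF C1(2) assms(1)]
  show "dx (laplacian f w) x y t = deriv (deriv f) x * dx w x y t + deriv f x * dx (dx w) x y t + dx (dx (dx w)) x y t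
      + (- 2 * deriv f x * met x * dy (dy w) x y t + met x * dx (dy (dy w)) x y t)"
    unfolding laplacian_eq
    by (subst dx_def, rule DERIV_imp_deriv)
      (auto intro!: derivative_eq_intros metric_derivs(1,2)[OF x]
        C3_has_dx[OF C1(1) assms(4)] C3_has_dx[OF C2(1) assms(4)] C3_has_dx[OF C2(2) assms(4)])
  have "dy (laplacian f w) x y t = deriv f x * dy (dx w) x y t + dy (dx (dx w)) x y t + met x * dy (dy (dy w)) x y t"
    unfolding laplacian_eq
    by (subst dy_def, rule DERIV_imp_deriv)
      (auto intro!: derivative_eq_intros C3_has_dy[OF C1(1) assms(4)] C3_has_dy[OF C2(1) assms(4)] C3_has_dy[OF C2(2) assms(4)])
  then show "dy (laplacian f w) x y t = deriv f x * dx (dy w) x y t + dx (dx (dy w)) x y t + met x * dy (dy (dy w)) x y t"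
    using commute3[OF assms(1,3,4)] dx_dy_commute[OF assms(3,1,4)] by simp
qed

lemma heat_form_deriv3:
  assumes D: "open D" "D \<subseteq> I \<times> UNIV" and w: "C3 4 D w" and p: "(x, y, t) \<in> D"
  shows "heat_form f x (\<lambda>(a, b, c). deriv3 a b c w x y t) = heat_op f w x y t"
proof -
  have x: "x \<in> I" using D(2) p by auto
  have w': "C3 (Suc (Suc (Suc (Suc 0)))) D w" using w by (simp add: eval_nat_numeral)
  note C1 = C3_dx[OF w' D(1)] C3_dy[OF w' D(1)]
  note C2 = C3_dx[OF C1(1) D(1)] C3_dx[OF C1(2) D(1)] C3_dy[OF C1(2) D(1)]
  note C3 = C3_dx[OF C2(1) D(1)] C3_dx[OF C2(2) D(1)] C3_dx[OF C2(3) D(1)] C3_dy[OF C2(3) D(1)]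
  define v where "v = laplacian f w"
  note v1 = laplacian_first_derivs[OF D w', folded v_def]
  note hdx = C3_has_dx[OF C1(1) p] C3_has_dx[OF C2(1) p] C3_has_dx[OF C2(3) p] C3_has_dx[OF C3(1) p] C3_has_dx[OF C3(3) p]
  note hdy = C3_has_dy[OF C1(2) p] C3_has_dy[OF C2(2) p] C3_has_dy[OF C3(2) p] C3_has_dy[OF C3(4) p]
  have vxx: "dx (dx v) x y t = deriv (deriv (deriv f)) x * dx w x y t + 2 * deriv (deriv f) x * dx (dx w) x y t
      + deriv f x * dx (dx (dx w)) x y t + dx (dx (dx (dx w))) x y t
      + (4 * (deriv f x)\<^sup>2 - 2 * deriv (deriv f) x) * met x * dy (dy w) x y t
      - 4 * deriv f x * met x * dx (dy (dy w)) x y t + met x * dx (dx (dy (dy w))) x y t"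
    by (subst dx_cong[OF D(1) v1(1) p], assumption, subst dx_def, rule DERIV_imp_deriv)
      (auto intro!: derivative_eq_intros metric_derivs(1-3)[OF x] hdx
        simp: algebra_simps power2_eq_square)
  \<comment> \<open>Differentiating the formula for \<open>dy v\<close> once more leaves
    \<open>dy\<close> outside; both mixed terms are brought back to the normal order.\<close>
  have c4: "dy (dx (dx (dy w))) x y t = dx (dx (dy (dy w))) x y t" using commute3[OF D(1) C1(2) p] by simp
  have c3: "dy (dx (dy w)) x y t = dx (dy (dy w)) x y t" using dx_dy_commute[OF C1(2) D(1) p] by simp
  have vyy: "dy (dy v) x y t = deriv f x * dx (dy (dy w)) x y t + dx (dx (dy (dy w))) x y t
      + met x * dy (dy (dy (dy w))) x y t"
    unfolding c4[symmetric] c3[symmetric]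
    by (subst dy_cong[OF D(1) v1(2) p], assumption, subst dy_def, rule DERIV_imp_deriv)
      (auto intro!: derivative_eq_intros hdy)
  have "heat_op f w x y t = dt w x y t - (deriv f x * dx v x y t + dx (dx v) x y t + met x * dy (dy v) x y t)"
    unfolding heat_op_def v_def[symmetric] by (simp add: laplacian_eq[of f v])
  then show ?thesis
    unfolding v1(1)[OF p] vxx vyy heat_form_def
    by (simp add: deriv3_simps eval_nat_numeral algebra_simps)
qed

text \<open>The first rule separates the explicit \<open>x\<close>-derivative of the coefficients,
  collected in \<open>c'\<close>, from the shift of the jet. The fourth derivative of
  \<open>f\<close> enters through the coefficient of \<open>u_x\<close>.\<close>

lemma heat_form_derivs:
  assumes "holonomic j" "x \<in> I"
  shows "((\<lambda>s. heat_form f s (j s y t)) has_real_derivative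
      deriv (\<lambda>s. heat_form f s (j x y t)) x + heat_form f x (\<lambda>(a, b, c). j x y t (Suc a, b, c))) (at x)"
    "((\<lambda>s. heat_form f x (j x s t)) has_real_derivative heat_form f x (\<lambda>(a, b, c). j x y t (a, Suc b, c))) (at y)"
    "((\<lambda>s. heat_form f x (j x y s)) has_real_derivative heat_form f x (\<lambda>(a, b, c). j x y t (a, b, Suc c))) (at t)"
proof -
  note h = holonomicD[OF assms(1)] and m = metric_derivs(1-4)[OF assms(2)]
  define c' where "c' k = - (2 * deriv (deriv f) x * k (3, 0, 0)
     + (2 * deriv (deriv (deriv f)) x + 2 * deriv f x * deriv (deriv f) x) * k (2, 0, 0)
     + (deriv (deriv (deriv (deriv f))) x + (deriv (deriv f) x)\<^sup>2 + deriv f x * deriv (deriv (deriv f)) x) * k (1, 0, 0)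
     - 4 * deriv f x * met x * k (2, 2, 0) - (2 * deriv (deriv f) x - 4 * (deriv f x)\<^sup>2) * met x * k (1, 2, 0)
     + ((4 * deriv f x * deriv (deriv f) x - 2 * deriv (deriv (deriv f)) x)
       - 2 * deriv f x * (2 * (deriv f x)\<^sup>2 - 2 * deriv (deriv f) x)) * met x * k (0, 2, 0)
     - 4 * deriv f x * (met x)\<^sup>2 * k (0, 4, 0))" for k :: jet
  have "((\<lambda>s. heat_form f s (j x y t)) has_real_derivative c' (j x y t)) (at x)"
    unfolding heat_form_def c'_def
    by (auto intro!: derivative_eq_intros m simp: algebra_simps power2_eq_square power3_eq_cube)
  then have e: "deriv (\<lambda>s. heat_form f s (j x y t)) x = c' (j x y t)" by (rule DERIV_imp_deriv)
  show "((\<lambda>s. heat_form f s (j s y t)) has_real_derivative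
      deriv (\<lambda>s. heat_form f s (j x y t)) x + heat_form f x (\<lambda>(a, b, c). j x y t (Suc a, b, c))) (at x)"
    unfolding e unfolding heat_form_def c'_def
    by (auto intro!: derivative_eq_intros m h(1) simp: algebra_simps power2_eq_square power3_eq_cube)
  show "((\<lambda>s. heat_form f x (j x s t)) has_real_derivative heat_form f x (\<lambda>(a, b, c). j x y t (a, Suc b, c))) (at y)"
    "((\<lambda>s. heat_form f x (j x y s)) has_real_derivative heat_form f x (\<lambda>(a, b, c). j x y t (a, b, Suc c))) (at t)"
    unfolding heat_form_def by (auto intro!: derivative_eq_intros h(2) h(3))
qed

text \<open>For a holonomic jet field, iterated partial derivatives of the component
  \<open>(0, 0, 0)\<close> are simply the other components, so \<open>heat_form_deriv3\<close>
  evaluates to \<open>heat_form\<close> of the jet.\<close>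

lemma heat_op_jet:
  assumes "holonomic j" "\<And>k m. C3 k UNIV (\<lambda>x y t. j x y t m)" "x \<in> I"
  shows "heat_op f (\<lambda>x y t. j x y t (0, 0, 0)) x y t = heat_form f x (j x y t)"
proof -
  note h = holonomicD[OF assms(1)]
  have d: "dx (\<lambda>x y t. j x y t (a, b, c)) = (\<lambda>x y t. j x y t (Suc a, b, c))"
    "dy (\<lambda>x y t. j x y t (a, b, c)) = (\<lambda>x y t. j x y t (a, Suc b, c))"
    "dt (\<lambda>x y t. j x y t (a, b, c)) = (\<lambda>x y t. j x y t (a, b, Suc c))" for a b c
    by (simp_all add: fun_eq_iff dx_def dy_def dt_def DERIV_imp_deriv[OF h(1)] DERIV_imp_deriv[OF h(2)] DERIV_imp_deriv[OF h(3)])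
  have dt: "(dt ^^ c) (\<lambda>x y t. j x y t (0, 0, 0)) = (\<lambda>x y t. j x y t (0, 0, c))" for c
    by (induction c) (simp_all add: d)
  have dy: "(dy ^^ b) (\<lambda>x y t. j x y t (0, 0, c)) = (\<lambda>x y t. j x y t (0, b, c))" for b c
    by (induction b) (simp_all add: d)
  have dx: "(dx ^^ a) (\<lambda>x y t. j x y t (0, b, c)) = (\<lambda>x y t. j x y t (a, b, c))" for a b c
    by (induction a) (simp_all add: d)
  have D: "open (I \<times> (UNIV :: (real \<times> real) set))" using open_I by (simp add: open_Times)
  have "heat_op f (\<lambda>x y t. j x y t (0, 0, 0)) x y t
      = heat_form f x (\<lambda>(a, b, c). deriv3 a b c (\<lambda>x y t. j x y t (0, 0, 0)) x y t)"
    by (rule heat_form_deriv3[symmetric, OF D]) (use assms C3_subset[OF assms(2)] in auto)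
  then show ?thesis by (simp add: deriv3_def dt dy dx)
qed

text \<open>Inserting \<open>prolongation_coeff_along\<close> and using linearity splits off
  \<open>heat_op\<close> of the characteristic. What remains is \<open>heat_form\<close> of the
  shifted jets weighted with the components of \<open>X\<close>; the explicit
  \<open>x\<close>-derivative of the equation completes the \<open>x\<close>-part to the full
  derivative of \<open>heat_op f u\<close>.\<close>

lemma fourth_prolongation_along:
  assumes "jet_lift X \<Omega> j" "\<Omega> \<subseteq> I \<times> UNIV" "(x, y, t, j x y t (0, 0, 0)) \<in> \<Omega>"
  defines "u \<equiv> \<lambda>x y t. j x y t (0, 0, 0)"
  shows "fourth_prolongation X (biharmonic_heat f) x y t (j x y t) =
    heat_op f (jet_lift.characteristic X j) x y t
    + coeff_x X x y t (j x y t) * dx (heat_op f u) x y t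
    + coeff_y X x y t (j x y t) * dy (heat_op f u) x y t
    + coeff_t X x y t (j x y t) * dt (heat_op f u) x y t"
proof -
  interpret jet_lift X \<Omega> j by fact
  have x: "x \<in> I" using assms(2,3) by auto
  have p: "(x, y, t) \<in> D" using assms(3) by (simp add: D_def)
  have D: "D \<subseteq> I \<times> UNIV" using assms(2) by (auto simp: D_def)
  note h = heat_form_derivs[OF holonomic x]
  note e = heat_op_jet[OF holonomic smooth, folded u_def]
  have o: "open (I \<times> (UNIV :: (real \<times> real) set))" using open_I by (simp add: open_Times)
  have "dx (heat_op f u) x y t = dx (\<lambda>x y t. heat_form f x (j x y t)) x y t"
    "dy (heat_op f u) x y t = dy (\<lambda>x y t. heat_form f x (j x y t)) x y t"
    "dt (heat_op f u) x y t = dt (\<lambda>x y t. heat_form f x (j x y t)) x y t"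
    by (rule dx_cong[OF o] dy_cong[OF o] dt_cong[OF o]; use e x in auto)+
  then have d: "dx (heat_op f u) x y t = deriv (\<lambda>s. heat_form f s (j x y t)) x + heat_form f x (\<lambda>(a, b, c). j x y t (Suc a, b, c))"
    "dy (heat_op f u) x y t = heat_form f x (\<lambda>(a, b, c). j x y t (a, Suc b, c))"
    "dt (heat_op f u) x y t = heat_form f x (\<lambda>(a, b, c). j x y t (a, b, Suc c))"
    using DERIV_imp_deriv[OF h(1)] DERIV_imp_deriv[OF h(2)] DERIV_imp_deriv[OF h(3)]
    by (simp_all add: dx_def dy_def dt_def)
  have "heat_form f x (\<lambda>(a, b, c). prolongation_coeff X a b c x y t (j x y t))
      = heat_form f x (\<lambda>(a, b, c). deriv3 a b c characteristic x y t
        + cx x y t * j x y t (Suc a, b, c) + cy x y t * j x y t (a, Suc b, c) + ct x y t * j x y t (a, b, Suc c))"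
    by (rule heat_form_cong) (auto simp: orders_def prolongation_coeff_along[OF _ p])
  also have "\<dots> = heat_form f x (\<lambda>(a, b, c). deriv3 a b c characteristic x y t)
      + cx x y t * heat_form f x (\<lambda>(a, b, c). j x y t (Suc a, b, c))
      + cy x y t * heat_form f x (\<lambda>(a, b, c). j x y t (a, Suc b, c))
      + ct x y t * heat_form f x (\<lambda>(a, b, c). j x y t (a, b, Suc c))"
    by (simp add: case_prod_unfold heat_form_add heat_form_cmult)
  finally show ?thesis
    unfolding fourth_prolongation_eq[OF f open_I x] d heat_form_deriv3[OF open_D D C3_characteristic p]
    by (simp add: cx_def cy_def ct_def algebra_simps)
qed

end


section \<open>Highest-order terms of the prolongation\<close>

text \<open>Only one summand of the total derivative contains the coordinate \<open>n\<close> of top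
  order: the one whose index is \<open>n\<close> lowered by one in the direction of differentiation.
  If that entry of \<open>n\<close> is zero there is none.\<close>

lemma
  assumes "depends_on_order k P" "k \<le> 3" "n \<in> level (Suc k)"
  shows Dx_affine: "Dx P x y t (j(n := s)) = Dx P x y t j
      + (s - j n) * (if fst n = 0 then 0 else jet_pderiv (fst n - 1, snd n) P x y t j)"
    and Dy_affine: "Dy P x y t (j(n := s)) = Dy P x y t j
      + (s - j n) * (if fst (snd n) = 0 then 0 else jet_pderiv (fst n, fst (snd n) - 1, snd (snd n)) P x y t j)"
proof -
  obtain a b c where n: "n = (a, b, c)" by (metis prod.exhaust)
  have agree: "j m = (j(n := s)) m" if "m \<in> orders k" for m
    using that assms(3) by (auto simp: level_def orders_def)
  have fin: "finite (level k)" by (rule finite_subset[OF _ finite_orders[of k]]) (auto simp: level_def orders_def)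
  have "(\<Sum>(a', b', c')\<in>level k. ((j(n := s)) (Suc a', b', c') - j (Suc a', b', c')) * jet_pderiv (a', b', c') P x y t j)
      = (\<Sum>m\<in>level k. if a \<noteq> 0 \<and> m = (a - 1, b, c) then (s - j n) * jet_pderiv (a - 1, b, c) P x y t j else 0)"
    by (rule sum.cong) (auto simp: n split: if_splits)
  also have "\<dots> = (s - j n) * (if fst n = 0 then 0 else jet_pderiv (fst n - 1, snd n) P x y t j)"
    using assms(3) fin by (cases a) (auto simp: n level_def)
  finally show "Dx P x y t (j(n := s)) = Dx P x y t j
      + (s - j n) * (if fst n = 0 then 0 else jet_pderiv (fst n - 1, snd n) P x y t j)"
    using Dx_difference[where j = j and j' = "j(n := s)" and x = x and y = y and t = t, OF assms(1,2) agree] by simp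
  have "(\<Sum>(a', b', c')\<in>level k. ((j(n := s)) (a', Suc b', c') - j (a', Suc b', c')) * jet_pderiv (a', b', c') P x y t j)
      = (\<Sum>m\<in>level k. if b \<noteq> 0 \<and> m = (a, b - 1, c) then (s - j n) * jet_pderiv (a, b - 1, c) P x y t j else 0)"
    by (rule sum.cong) (auto simp: n split: if_splits)
  also have "\<dots> = (s - j n) * (if fst (snd n) = 0 then 0 else jet_pderiv (fst n, fst (snd n) - 1, snd (snd n)) P x y t j)"
    using assms(3) fin by (cases b) (auto simp: n level_def)
  finally show "Dy P x y t (j(n := s)) = Dy P x y t j
      + (s - j n) * (if fst (snd n) = 0 then 0 else jet_pderiv (fst n, fst (snd n) - 1, snd (snd n)) P x y t j)"
    using Dy_difference[where j = j and j' = "j(n := s)" and x = x and y = y and t = t, OF assms(1,2) agree] by simp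
qed

text \<open>The derivative of the prolongation coefficient along \<open>(a, b, 0)\<close> by a jet coordinate \<open>n\<close> of
  the same order \<open>a + b\<close>.\<close>

definition principal_part :: "vfield \<Rightarrow> nat \<Rightarrow> nat \<Rightarrow> nat \<times> nat \<times> nat \<Rightarrow> diff_fun" where
  "principal_part X a b n x y t j =
     (if n = (a, b, 0) then jet_pderiv (0, 0, 0) (coeff_u X) x y t j
        - j (1, 0, 0) * jet_pderiv (0, 0, 0) (coeff_x X) x y t j
        - j (0, 1, 0) * jet_pderiv (0, 0, 0) (coeff_y X) x y t j
        - j (0, 0, 1) * jet_pderiv (0, 0, 0) (coeff_t X) x y t j else 0)
     - real a * ((if n = (a, b, 0) then Dx (coeff_x X) x y t j else 0)
        + (if n = (a - 1, Suc b, 0) then Dx (coeff_y X) x y t j else 0)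
        + (if n = (a - 1, b, 1) then Dx (coeff_t X) x y t j else 0))
     - real b * ((if n = (Suc a, b - 1, 0) then Dy (coeff_x X) x y t j else 0)
        + (if n = (a, b, 0) then Dy (coeff_y X) x y t j else 0)
        + (if n = (a, b - 1, 1) then Dy (coeff_t X) x y t j else 0))"

lemma principal_part_depends: 
  assumes "\<And>m. m \<in> orders 1 \<Longrightarrow> j m = j' m"
  shows "principal_part X a b n x y t j = principal_part X a b n x y t j'"
proof -
  note c = depends_on_order_coeffs[of X]
  have D: "Dx P x y t j = Dx P x y t j'" "Dy P x y t j = Dy P x y t j'"
    "jet_pderiv (0, 0, 0) P x y t j = jet_pderiv (0, 0, 0) P x y t j'" if "depends_on_order 0 P" for P
  proof -
    show "Dx P x y t j = Dx P x y t j'" "Dy P x y t j = Dy P x y t j'"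
      by (rule depends_on_orderD[OF depends_on_order_Dx[OF that]] depends_on_orderD[OF depends_on_order_Dy[OF that]];
          use assms in simp)+
    show "jet_pderiv (0, 0, 0) P x y t j = jet_pderiv (0, 0, 0) P x y t j'"
      by (rule depends_on_orderD[OF depends_on_order_jet_pderiv[OF that]]) (use assms in \<open>simp add: orders_def\<close>)
  qed
  have "j (1, 0, 0) = j' (1, 0, 0)" "j (0, 1, 0) = j' (0, 1, 0)" "j (0, 0, 1) = j' (0, 0, 1)"
    using assms by (auto simp: orders_def)
  then show ?thesis
    using D[OF c(1)] D[OF c(2)] D[OF c(3)] D[OF c(4)] by (simp only: principal_part_def)
qed

text \<open>Every differentiation contributes one further total derivative of the components, which
  is why the factors \<open>real a\<close> and \<open>real b\<close> appear in
  \<open>principal_part\<close>. The truncated indices \<open>a - 1\<close> and \<open>b - 1\<close>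
  are harmless at zero, since these factors vanish there.\<close>

lemma principal_part_rec:
  assumes "a + b > 0" "n \<in> level (Suc (a + b))"
  shows "principal_part X (Suc a) b n x y t j =
      (if fst n = 0 then 0 else principal_part X a b (fst n - 1, snd n) x y t j)
      - (if n = (Suc a, b, 0) then Dx (coeff_x X) x y t j else 0)
      - (if n = (a, Suc b, 0) then Dx (coeff_y X) x y t j else 0)
      - (if n = (a, b, 1) then Dx (coeff_t X) x y t j else 0)"
    and "principal_part X 0 (Suc b) n x y t j =
      (if fst (snd n) = 0 then 0 else principal_part X 0 b (fst n, fst (snd n) - 1, snd (snd n)) x y t j)
      - (if n = (1, b, 0) then Dy (coeff_x X) x y t j else 0)
      - (if n = (0, Suc b, 0) then Dy (coeff_y X) x y t j else 0)
      - (if n = (0, b, 1) then Dy (coeff_t X) x y t j else 0)"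
proof -
  obtain n1 n2 n3 where n: "n = (n1, n2, n3)" by (metis prod.exhaust)
  show "principal_part X (Suc a) b n x y t j =
      (if fst n = 0 then 0 else principal_part X a b (fst n - 1, snd n) x y t j)
      - (if n = (Suc a, b, 0) then Dx (coeff_x X) x y t j else 0)
      - (if n = (a, Suc b, 0) then Dx (coeff_y X) x y t j else 0)
      - (if n = (a, b, 1) then Dx (coeff_t X) x y t j else 0)"
    unfolding n principal_part_def by (cases a; cases n1) (auto simp: algebra_simps)
  show "principal_part X 0 (Suc b) n x y t j =
      (if fst (snd n) = 0 then 0 else principal_part X 0 b (fst n, fst (snd n) - 1, snd (snd n)) x y t j)
      - (if n = (1, b, 0) then Dy (coeff_x X) x y t j else 0)
      - (if n = (0, Suc b, 0) then Dy (coeff_y X) x y t j else 0)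
      - (if n = (0, b, 1) then Dy (coeff_t X) x y t j else 0)"
    unfolding n principal_part_def by (cases b; cases n2) (auto simp: algebra_simps)
qed

lemma jet_pderiv_affine:
  assumes "\<And>s. P x y t (j(n := s)) = P x y t j + (s - j n) * d"
  shows "jet_pderiv n P x y t j = d"
proof -
  have "((\<lambda>s. P x y t j + (s - j n) * d) has_real_derivative d) (at (j n))"
    by (auto intro!: derivative_eq_intros)
  then show ?thesis unfolding jet_pderiv_def assms by (rule DERIV_imp_deriv)
qed

text \<open>The base case stands apart because the first prolongation is quadratic in the
  coordinates of order one: differentiating the products \<open>u_x * (u_x * \<xi>_u)\<close> and
  their analogues yields the \<open>u\<close>-derivatives in the leading term of
  \<open>principal_part\<close>.\<close>

lemma first_prolongation_pderiv:
  assumes "n \<in> level 1"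
  shows "jet_pderiv n (prolongation_coeff X 1 0 0) x y t j = principal_part X 1 0 n x y t j"
    and "jet_pderiv n (prolongation_coeff X 0 1 0) x y t j = principal_part X 0 1 n x y t j"
proof -
  note c = depends_on_order_coeffs[of X]
  have n: "n = (1, 0, 0) \<or> n = (0, 1, 0) \<or> n = (0, 0, 1)" 
    using assms by (cases n) (auto simp: level_def)
  have A: "deriv (\<lambda>s. P s y t (j(n := r))) x = deriv (\<lambda>s. P s y t j) x"
    "deriv (\<lambda>s. P x s t (j(n := r))) y = deriv (\<lambda>s. P x s t j) y"
    "jet_pderiv (0, 0, 0) P x y t (j(n := r)) = jet_pderiv (0, 0, 0) P x y t j"
    if "depends_on_order 0 P" for P r
  proof -
    have "P x' y' t' (j(n := r)) = P x' y' t' j" for x' y' t'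
      by (rule depends_on_orderD[OF that]) (use n in \<open>auto simp: orders_def\<close>)
    then show "deriv (\<lambda>s. P s y t (j(n := r))) x = deriv (\<lambda>s. P s y t j) x"
      "deriv (\<lambda>s. P x s t (j(n := r))) y = deriv (\<lambda>s. P x s t j) y" by simp_all
    show "jet_pderiv (0, 0, 0) P x y t (j(n := r)) = jet_pderiv (0, 0, 0) P x y t j"
      by (rule depends_on_orderD[OF depends_on_order_jet_pderiv[OF that]]) (use n in \<open>auto simp: orders_def\<close>)
  qed
  note D = Dx_order_0[OF c(1)] Dx_order_0[OF c(2)] Dx_order_0[OF c(3)] Dx_order_0[OF c(4)]
    Dy_order_0[OF c(1)] Dy_order_0[OF c(2)] Dy_order_0[OF c(3)] Dy_order_0[OF c(4)]
  show "jet_pderiv n (prolongation_coeff X 1 0 0) x y t j = principal_part X 1 0 n x y t j"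
  proof -
    let ?E = "\<lambda>P. deriv (\<lambda>s. P s y t j) x" and ?B = "\<lambda>P. jet_pderiv (0, 0, 0) P x y t j"
    have e: "prolongation_coeff X 1 0 0 x y t (j(n := s)) =
        ?E (coeff_u X) + (j(n := s)) (1, 0, 0) * ?B (coeff_u X)
        - (j(n := s)) (1, 0, 0) * (?E (coeff_x X) + (j(n := s)) (1, 0, 0) * ?B (coeff_x X))
        - (j(n := s)) (0, 1, 0) * (?E (coeff_y X) + (j(n := s)) (1, 0, 0) * ?B (coeff_y X))
        - (j(n := s)) (0, 0, 1) * (?E (coeff_t X) + (j(n := s)) (1, 0, 0) * ?B (coeff_t X))" for s
      by (simp only: prolongation_coeff.simps One_nat_def D A[OF c(1)] A[OF c(2)] A[OF c(3)] A[OF c(4)])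
    show ?thesis
      unfolding jet_pderiv_def[of n] e principal_part_def D
      by (rule DERIV_imp_deriv, use n in \<open>elim disjE\<close>)
        (simp_all, auto intro!: derivative_eq_intros simp: algebra_simps)
  qed
  show "jet_pderiv n (prolongation_coeff X 0 1 0) x y t j = principal_part X 0 1 n x y t j"
  proof -
    let ?E = "\<lambda>P. deriv (\<lambda>s. P x s t j) y" and ?B = "\<lambda>P. jet_pderiv (0, 0, 0) P x y t j"
    have e: "prolongation_coeff X 0 1 0 x y t (j(n := s)) =
        ?E (coeff_u X) + (j(n := s)) (0, 1, 0) * ?B (coeff_u X)
        - (j(n := s)) (1, 0, 0) * (?E (coeff_x X) + (j(n := s)) (0, 1, 0) * ?B (coeff_x X))
        - (j(n := s)) (0, 1, 0) * (?E (coeff_y X) + (j(n := s)) (0, 1, 0) * ?B (coeff_y X))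
        - (j(n := s)) (0, 0, 1) * (?E (coeff_t X) + (j(n := s)) (0, 1, 0) * ?B (coeff_t X))" for s
      by (simp only: prolongation_coeff.simps One_nat_def D A[OF c(1)] A[OF c(2)] A[OF c(3)] A[OF c(4)])
    show ?thesis
      unfolding jet_pderiv_def[of n] e principal_part_def D
      by (rule DERIV_imp_deriv, use n in \<open>elim disjE\<close>)
        (simp_all, auto intro!: derivative_eq_intros simp: algebra_simps)
  qed
qed

lemma level_orders: "n \<in> level k \<Longrightarrow> i < k \<Longrightarrow> m \<in> orders i \<Longrightarrow> m \<noteq> n"
  by (auto simp: level_def orders_def)

lemma coeff_total_deriv_upd:
  assumes "n \<in> level k" "k \<ge> 2"
  shows "Dx (coeff_x X) x y t (j(n := s)) = Dx (coeff_x X) x y t j" "Dx (coeff_y X) x y t (j(n := s)) = Dx (coeff_y X) x y t j"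
    "Dx (coeff_t X) x y t (j(n := s)) = Dx (coeff_t X) x y t j" "Dy (coeff_x X) x y t (j(n := s)) = Dy (coeff_x X) x y t j"
    "Dy (coeff_y X) x y t (j(n := s)) = Dy (coeff_y X) x y t j" "Dy (coeff_t X) x y t (j(n := s)) = Dy (coeff_t X) x y t j"
  by (rule depends_on_orderD[OF depends_on_order_Dx[OF depends_on_order_coeffs(1)]]
      depends_on_orderD[OF depends_on_order_Dx[OF depends_on_order_coeffs(2)]]
      depends_on_orderD[OF depends_on_order_Dx[OF depends_on_order_coeffs(3)]]
      depends_on_orderD[OF depends_on_order_Dy[OF depends_on_order_coeffs(1)]]
      depends_on_orderD[OF depends_on_order_Dy[OF depends_on_order_coeffs(2)]]
      depends_on_orderD[OF depends_on_order_Dy[OF depends_on_order_coeffs(3)]];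
      use assms level_orders[OF assms(1), of 1] in auto)+

text \<open>From order two on the coefficient is affine in its top coordinates, because the total
  derivatives of the components of \<open>X\<close> have order one and do not see them. The slope is
  then produced by \<open>principal_part_rec\<close>.\<close>

lemma
  assumes "1 \<le> a + b" "a + b \<le> 3"
    and "\<And>n j. n \<in> level (a + b) \<Longrightarrow>
      jet_pderiv n (prolongation_coeff X a b 0) x y t j = principal_part X a b n x y t j"
    and n: "n \<in> level (Suc (a + b))"
  shows prolongation_affine_x: "prolongation_coeff X (Suc a) b 0 x y t (j(n := s))
      = prolongation_coeff X (Suc a) b 0 x y t j + (s - j n) * principal_part X (Suc a) b n x y t j"
    and prolongation_affine_y: "a = 0 \<Longrightarrow> prolongation_coeff X 0 (Suc b) 0 x y t (j(n := s))
      = prolongation_coeff X 0 (Suc b) 0 x y t j + (s - j n) * principal_part X 0 (Suc b) n x y t j"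
proof -
  have dep: "depends_on_order (a + b) (prolongation_coeff X a b 0)"
    using depends_on_order_prolongation_coeff[of a b 0 X] by simp
  note u = coeff_total_deriv_upd[OF n, of X x y t j s]
  have 2: "2 \<le> Suc (a + b)" using assms(1) by simp
  define d where "d m = (if n = m then 1 else 0 :: real)" for m
  have v: "(j(n := s)) m = j m + (s - j n) * d m" for m by (simp add: d_def)
  have pos: "0 < a + b" using assms(1) by linarith
  define q where "q = (if fst n = 0 then 0 else jet_pderiv (fst n - 1, snd n) (prolongation_coeff X a b 0) x y t j)"
  have "q = (if fst n = 0 then 0 else principal_part X a b (fst n - 1, snd n) x y t j)"
    unfolding q_def using n by (cases n) (auto simp: level_def intro!: assms(3))
  then have r: "principal_part X (Suc a) b n x y t j = q - d (Suc a, b, 0) * Dx (coeff_x X) x y t j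
      - d (a, Suc b, 0) * Dx (coeff_y X) x y t j - d (a, b, Suc 0) * Dx (coeff_t X) x y t j"
    using principal_part_rec(1)[OF pos n, of X x y t j] by (simp add: d_def)
  show "prolongation_coeff X (Suc a) b 0 x y t (j(n := s))
      = prolongation_coeff X (Suc a) b 0 x y t j + (s - j n) * principal_part X (Suc a) b n x y t j"
    unfolding prolongation_coeff.simps u[OF 2] Dx_affine[OF dep assms(2) n] r q_def[symmetric] v
    by (simp add: algebra_simps)
  define q' where "q' = (if fst (snd n) = 0 then 0
      else jet_pderiv (fst n, fst (snd n) - 1, snd (snd n)) (prolongation_coeff X a b 0) x y t j)"
  have q': "q' = (if fst (snd n) = 0 then 0 else principal_part X a b (fst n, fst (snd n) - 1, snd (snd n)) x y t j)"
    unfolding q'_def using n by (cases n) (auto simp: level_def intro!: assms(3))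
  show "prolongation_coeff X 0 (Suc b) 0 x y t (j(n := s))
      = prolongation_coeff X 0 (Suc b) 0 x y t j + (s - j n) * principal_part X 0 (Suc b) n x y t j" if a: "a = 0"
  proof -
    have r: "principal_part X 0 (Suc b) n x y t j = q' - d (1, b, 0) * Dy (coeff_x X) x y t j
        - d (0, Suc b, 0) * Dy (coeff_y X) x y t j - d (0, b, Suc 0) * Dy (coeff_t X) x y t j"
      using principal_part_rec(2)[OF pos n, of X x y t j] q' a by (simp add: d_def)
    have "Dy (prolongation_coeff X 0 b 0) x y t (j(n := s)) = Dy (prolongation_coeff X 0 b 0) x y t j + (s - j n) * q'"
      using Dy_affine[OF dep assms(2) n, of x y t j s] unfolding q'_def a by simp
    then show ?thesis
      unfolding prolongation_coeff.simps u[OF 2] r v by (simp add: algebra_simps)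
  qed
qed

lemma prolongation_pderiv:
  "1 \<le> a + b \<Longrightarrow> a + b \<le> 4 \<Longrightarrow> n \<in> level (a + b) \<Longrightarrow>
    jet_pderiv n (prolongation_coeff X a b 0) x y t j = principal_part X a b n x y t j"
proof (induction a arbitrary: n j)
  case 0
  then show ?case
  proof (induction b arbitrary: n j)
    case (Suc b)
    show ?case
    proof (cases "b = 0")
      case True
      then show ?thesis using first_prolongation_pderiv(2)[of n] Suc.prems by simp
    next
      case False
      show ?thesis
        by (rule jet_pderiv_affine, rule prolongation_affine_y) (use False Suc in auto)
    qed
  qed simp
next
  case (Suc a)
  show ?case
  proof (cases "a + b = 0")
    case True
    then show ?thesis using first_prolongation_pderiv(1)[of n] Suc.prems by simp
  next
    case False
    show ?thesis
      by (rule jet_pderiv_affine, rule prolongation_affine_x) (use False Suc in auto)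
  qed
qed

lemma prolongation_affine:
  assumes "2 \<le> a + b" "a + b \<le> 4" "n \<in> level (a + b)"
  shows "prolongation_coeff X a b 0 x y t (j(n := s))
      = prolongation_coeff X a b 0 x y t j + (s - j n) * principal_part X a b n x y t j"
proof (cases a)
  case 0
  then obtain b' where b: "b = Suc b'" using assms(1) by (cases b) auto
  show ?thesis unfolding 0 b
    by (rule prolongation_affine_y[of 0]) (use assms 0 b in \<open>auto intro!: prolongation_pderiv[of 0 b', simplified]\<close>)
next
  case (Suc a')
  show ?thesis unfolding Suc
    by (rule prolongation_affine_x) (use assms Suc in \<open>auto intro!: prolongation_pderiv\<close>)
qed

context surface
begin

lemma heat_form_has_deriv:
  assumes "x \<in> I"
  shows "((\<lambda>s. heat_form f s j) has_real_derivative deriv (\<lambda>s. heat_form f s j) x) (at x)"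
proof -
  have "\<exists>d. ((\<lambda>s. heat_form f s j) has_real_derivative d) (at x)"
    unfolding heat_form_def by (rule exI) (auto intro!: derivative_eq_intros metric_derivs(1-4)[OF assms])
  then show ?thesis using has_real_derivative_deriv by blast
qed

text \<open>Among the prolongation coefficients entering the equation only those along
  \<open>(4, 0, 0)\<close>, \<open>(2, 2, 0)\<close> and \<open>(0, 4, 0)\<close> react to a
  coordinate of order four. The minus sign is that of the bilaplacian in the equation.\<close>

lemma heat_form_prolongation_affine:
  assumes n: "n \<in> level 4"
  shows "heat_form f x (\<lambda>(a, b, c). prolongation_coeff X a b c x y t (j(n := s)))
    = heat_form f x (\<lambda>(a, b, c). prolongation_coeff X a b c x y t j)
      - (s - j n) * (principal_part X 4 0 n x y t j + 2 * met x * principal_part X 2 2 n x y t j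
         + (met x)\<^sup>2 * principal_part X 0 4 n x y t j)"
proof -
  have low: "prolongation_coeff X a b c x y t (j(n := s)) = prolongation_coeff X a b c x y t j" if "a + b + c \<le> 3" for a b c
    by (rule depends_on_orderD[OF depends_on_order_prolongation_coeff])
      (use level_orders[OF n, of "a + b + c"] that in auto)
  have top: "prolongation_coeff X a b 0 x y t (j(n := s))
      = prolongation_coeff X a b 0 x y t j + (s - j n) * principal_part X a b n x y t j" if "a + b = 4" for a b
    by (rule prolongation_affine) (use n that in simp_all)
  have e: "prolongation_coeff X 4 0 0 x y t (j(n := s)) = prolongation_coeff X 4 0 0 x y t j + (s - j n) * principal_part X 4 0 n x y t j"
    "prolongation_coeff X 2 2 0 x y t (j(n := s)) = prolongation_coeff X 2 2 0 x y t j + (s - j n) * principal_part X 2 2 n x y t j"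
    "prolongation_coeff X 0 4 0 x y t (j(n := s)) = prolongation_coeff X 0 4 0 x y t j + (s - j n) * principal_part X 0 4 n x y t j"
    "prolongation_coeff X 0 0 1 x y t (j(n := s)) = prolongation_coeff X 0 0 1 x y t j"
    "prolongation_coeff X 3 0 0 x y t (j(n := s)) = prolongation_coeff X 3 0 0 x y t j"
    "prolongation_coeff X 2 0 0 x y t (j(n := s)) = prolongation_coeff X 2 0 0 x y t j"
    "prolongation_coeff X 1 0 0 x y t (j(n := s)) = prolongation_coeff X 1 0 0 x y t j"
    "prolongation_coeff X 1 2 0 x y t (j(n := s)) = prolongation_coeff X 1 2 0 x y t j"
    "prolongation_coeff X 0 2 0 x y t (j(n := s)) = prolongation_coeff X 0 2 0 x y t j"
    by (rule top low; simp)+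
  show ?thesis
    unfolding heat_form_def case_prod_conv e by (simp add: algebra_simps del: prolongation_coeff.simps)
qed

text \<open>The jet enters the conclusions only up to order one, so its higher coordinates may be
  chosen freely. The coordinates \<open>(3, 0, 1)\<close> and \<open>(0, 3, 1)\<close> detect the
  dependence of the time component on \<open>x\<close> and \<open>y\<close>,
  \<open>(3, 1, 0)\<close> gives the off-diagonal conformal equation, and exchanging
  \<open>(2, 2, 0)\<close> for \<open>(4, 0, 0)\<close> gives the diagonal one.\<close>

theorem principal_determining_equations:
  assumes x: "x \<in> I" and sym: "\<And>j. j (0, 0, 0) = u \<Longrightarrow> heat_form f x j = 0 \<Longrightarrow>
      coeff_x X x y t j * deriv (\<lambda>s. heat_form f s j) x
      + heat_form f x (\<lambda>(a, b, c). prolongation_coeff X a b c x y t j) = 0"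
    and u: "j (0, 0, 0) = u"
  shows "Dx (coeff_t X) x y t j = 0" "Dy (coeff_t X) x y t j = 0"
    "Dx (coeff_y X) x y t j + met x * Dy (coeff_x X) x y t j = 0"
    "deriv f x * coeff_x X x y t j = Dx (coeff_x X) x y t j - Dy (coeff_y X) x y t j"
proof -
  define k where "k = (\<lambda>m. if m \<in> orders 1 then j m else 0)"
  \<comment> \<open>Since \<open>(4, 0, 0)\<close> has coefficient \<open>- 1\<close> and vanishes
    in \<open>k\<close>, the value \<open>heat_form f x k\<close> there puts the jet on the
    equation.\<close>
  define j0 where "j0 = k((4, 0, 0) := heat_form f x k)"
  have j0_1: "j0 m = j m" if "m \<in> orders 1" for m
    using that by (auto simp: j0_def k_def orders_def)
  have H0: "heat_form f x j0 = 0"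
    by (simp add: j0_def heat_form_def k_def orders_def)
  have u0: "j0 (0, 0, 0) = u" using j0_1 u by (simp add: orders_def)
  have D: "Dx P x y t j0 = Dx P x y t j" "Dy P x y t j0 = Dy P x y t j" if "depends_on_order 0 P" for P
    by (rule depends_on_orderD[OF depends_on_order_Dx[OF that]] depends_on_orderD[OF depends_on_order_Dy[OF that]];
        use j0_1 in simp)+
  note D = D[OF depends_on_order_coeffs(1)] D[OF depends_on_order_coeffs(2)] D[OF depends_on_order_coeffs(3)]
  have cx: "coeff_x X x y t j' = coeff_x X x y t j" if "j' (0, 0, 0) = u" for j'
    using that u by (simp add: coeff_x_def)
  let ?Z = "\<lambda>j. heat_form f x (\<lambda>(a, b, c). prolongation_coeff X a b c x y t j)"
  let ?P = "\<lambda>n. principal_part X 4 0 n x y t j0 + 2 * met x * principal_part X 2 2 n x y t j0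
         + (met x)\<^sup>2 * principal_part X 0 4 n x y t j0"
  have m: "met x \<noteq> 0" by simp
  \<comment> \<open>A coordinate of order four that is absent from the equation can be raised by one
    without leaving the equation; affinity isolates its coefficient.\<close>
  have single: "?P n = 0" if n: "n \<in> level 4" "n \<notin> {(4, 0, 0), (2, 2, 0), (0, 4, 0)}" for n
  proof -
    define j1 where "j1 = j0(n := j0 n + 1)"
    have e: "heat_form f s j1 = heat_form f s j0" for s
    proof -
      have "j1 m = j0 m" if "m \<in> {(0, 0, 1), (4, 0, 0), (3, 0, 0), (2, 0, 0), (1, 0, 0), (2, 2, 0), (1, 2, 0), (0, 2, 0), (0, 4, 0)}" for m
        using n that by (auto simp: j1_def level_def)
      then show ?thesis by (simp add: heat_form_def)
    qed
    have u1: "j1 (0, 0, 0) = u" using n u0 by (auto simp: j1_def level_def)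
    have H1: "heat_form f x j1 = 0" using e[of x] H0 by simp
    have "?Z j1 = ?Z j0"
      using sym[of j1, OF u1 H1] sym[of j0, OF u0 H0] cx[of j1, OF u1] cx[of j0, OF u0]
      by (simp add: e del: prolongation_coeff.simps)
    then show ?thesis
      using heat_form_prolongation_affine[OF n(1), of x X y t j0 "j0 n + 1", folded j1_def] by simp
  qed
  have P0: "?P (3, 0, 1) = 0" "?P (0, 3, 1) = 0" "?P (3, 1, 0) = 0"
    by (rule single; simp add: level_def)+
  \<comment> \<open>The factors 4 are the entries \<open>a\<close> and \<open>b\<close> of
    \<open>(4, 0, 0)\<close> and \<open>(0, 4, 0)\<close>. The coordinate \<open>(3, 1, 0)\<close>
    is reached from \<open>(4, 0, 0)\<close> and also from \<open>(2, 2, 0)\<close>, where 2 meets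
    the coefficient \<open>2 * met x\<close>.\<close>
  have P: "?P (3, 0, 1) = - 4 * Dx (coeff_t X) x y t j"
    "?P (0, 3, 1) = - 4 * (met x)\<^sup>2 * Dy (coeff_t X) x y t j"
    "?P (3, 1, 0) = - 4 * (Dx (coeff_y X) x y t j + met x * Dy (coeff_x X) x y t j)"
    unfolding principal_part_def D by simp_all
  show "Dx (coeff_t X) x y t j = 0" "Dy (coeff_t X) x y t j = 0"
    "Dx (coeff_y X) x y t j + met x * Dy (coeff_x X) x y t j = 0"
  proof -
    have "- 4 * Dx (coeff_t X) x y t j = 0" by (rule trans[OF P(1)[symmetric] P0(1)])
    then show "Dx (coeff_t X) x y t j = 0" by linarith
    have "- 4 * (met x)\<^sup>2 * Dy (coeff_t X) x y t j = 0" by (rule trans[OF P(2)[symmetric] P0(2)])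
    then show "Dy (coeff_t X) x y t j = 0" unfolding mult_eq_0_iff by simp
    have "- 4 * (Dx (coeff_y X) x y t j + met x * Dy (coeff_x X) x y t j) = 0"
      by (rule trans[OF P(3)[symmetric] P0(3)])
    then show "Dx (coeff_y X) x y t j + met x * Dy (coeff_x X) x y t j = 0" unfolding mult_eq_0_iff by simp
  qed
  define j1 where "j1 = j0((2, 2, 0) := j0 (2, 2, 0) + 1)"
  \<comment> \<open>The compensation \<open>2 * met x\<close> is exact at the point \<open>x\<close>
    only. The explicit \<open>x\<close>-derivative of the equation therefore notices the change, and
    this is the origin of the term with \<open>deriv f x * coeff_x X\<close>.\<close>
  define j2 where "j2 = j1((4, 0, 0) := j1 (4, 0, 0) - 2 * met x)"
  have e: "heat_form f s j2 = heat_form f s j0 - 2 * (met s - met x)" for s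
    by (simp add: j2_def j1_def heat_form_def algebra_simps)
  have u2: "j2 (0, 0, 0) = u" using u0 by (simp add: j2_def j1_def)
  have "((\<lambda>s. heat_form f s j0 - 2 * (met s - met x)) has_real_derivative
      deriv (\<lambda>s. heat_form f s j0) x - 2 * (- 2 * deriv f x * met x - 0)) (at x)"
    by (intro DERIV_diff DERIV_cmult DERIV_const heat_form_has_deriv[OF x] metric_derivs(5)[OF x])
  then have d: "deriv (\<lambda>s. heat_form f s j2) x = deriv (\<lambda>s. heat_form f s j0) x + 4 * deriv f x * met x"
    unfolding e by (auto dest!: DERIV_imp_deriv)
  have pp: "principal_part X a b n x y t j1 = principal_part X a b n x y t j0" for a b n
    by (rule principal_part_depends) (auto simp: j1_def orders_def)
  have "?Z j2 = ?Z j0 - ?P (2, 2, 0) + 2 * met x * ?P (4, 0, 0)"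
    using heat_form_prolongation_affine[of "(2, 2, 0)" x X y t j0 "j0 (2, 2, 0) + 1", folded j1_def]
      heat_form_prolongation_affine[of "(4, 0, 0)" x X y t j1 "j1 (4, 0, 0) - 2 * met x", folded j2_def]
    unfolding pp by (simp add: level_def)
  moreover have H2: "heat_form f x j2 = 0" using e[of x] H0 by simp
  have "coeff_x X x y t j * (4 * deriv f x * met x) + ?Z j2 - ?Z j0 = 0"
    using sym[of j2, OF u2 H2] sym[of j0, OF u0 H0] cx[of j2, OF u2] cx[of j0, OF u0]
    by (simp add: d algebra_simps del: prolongation_coeff.simps)
  ultimately have "coeff_x X x y t j * (4 * deriv f x * met x) - ?P (2, 2, 0) + 2 * met x * ?P (4, 0, 0) = 0"
    by simp
  moreover have "2 * met x * ?P (4, 0, 0) - ?P (2, 2, 0) = 4 * met x * (Dy (coeff_y X) x y t j - Dx (coeff_x X) x y t j)"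
    unfolding principal_part_def D by (simp add: algebra_simps)
  ultimately have "4 * met x * (deriv f x * coeff_x X x y t j - (Dx (coeff_x X) x y t j - Dy (coeff_y X) x y t j)) = 0"
    by (simp add: algebra_simps)
  then show "deriv f x * coeff_x X x y t j = Dx (coeff_x X) x y t j - Dy (coeff_y X) x y t j"
    using m by simp
qed

end


section \<open>Conformal fields and the Laplacian\<close>

context surface
begin

text \<open>Direct computation of both second derivatives. The conformal equations replace every
  derivative of the field by \<lambda> and its derivatives, except for \<xi>_y and \<xi>_yy; the
  terms with \<xi>_y cancel, and \<xi>_yy is fixed by an integrability condition.\<close>

lemma laplacian_conformal:
  assumes D: "open D" "D \<subseteq> I \<times> UNIV" and C: "C3 3 D xi" "C3 3 D ph" "C3 2 D lam" "C3 3 D w"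
    and conf: "\<And>x y t. (x, y, t) \<in> D \<Longrightarrow> dx xi x y t = lam x y t"
      "\<And>x y t. (x, y, t) \<in> D \<Longrightarrow> dy ph x y t = lam x y t - deriv f x * xi x y t"
      "\<And>x y t. (x, y, t) \<in> D \<Longrightarrow> dx ph x y t = - met x * dy xi x y t"
    and p: "(x, y, t) \<in> D"
  shows "laplacian f (\<lambda>x y t. xi x y t * dx w x y t + ph x y t * dy w x y t) x y t =
    xi x y t * dx (laplacian f w) x y t + ph x y t * dy (laplacian f w) x y t + 2 * lam x y t * laplacian f w x y t"
proof -
  have x: "x \<in> I" using D(2) p by auto
  have xi: "C3 (Suc (Suc (Suc 0))) D xi" and ph: "C3 (Suc (Suc (Suc 0))) D ph"
    and lam: "C3 (Suc (Suc 0)) D lam" and w: "C3 (Suc (Suc (Suc 0))) D w"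
    using C by (simp_all add: numeral_eq_Suc)
  note w1 = C3_dx[OF w D(1)] C3_dy[OF w D(1)]
  note w2 = C3_dx[OF w1(1) D(1)] C3_dx[OF w1(2) D(1)] C3_dy[OF w1(2) D(1)]
  note xi1 = C3_dy[OF xi D(1)]
  let ?E = "\<lambda>x y t. xi x y t * dx w x y t + ph x y t * dy w x y t"
  have E1: "dx ?E x y t = lam x y t * dx w x y t + xi x y t * dx (dx w) x y t
      - met x * dy xi x y t * dy w x y t + ph x y t * dx (dy w) x y t" if q: "(x, y, t) \<in> D" for x y t
    by (subst dx_def, rule DERIV_imp_deriv)
      (auto intro!: derivative_eq_intros C3_has_dx[OF xi q] C3_has_dx[OF ph q] C3_has_dx[OF w1(1) q]
        C3_has_dx[OF w1(2) q] simp: conf[OF q])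
  have E2: "dy ?E x y t = dy xi x y t * dx w x y t + xi x y t * dx (dy w) x y t
      + (lam x y t - deriv f x * xi x y t) * dy w x y t + ph x y t * dy (dy w) x y t" if q: "(x, y, t) \<in> D" for x y t
    by (subst dy_def, rule DERIV_imp_deriv)
      (auto intro!: derivative_eq_intros C3_has_dy[OF xi q] C3_has_dy[OF ph q] C3_has_dy[OF w1(1) q]
        C3_has_dy[OF w1(2) q] simp: conf[OF q] dx_dy_commute[OF w D(1) q])
  have c1: "dx (dy xi) x y t = dy lam x y t"
    using dx_dy_commute[OF xi D(1) p] dy_cong[OF D(1) conf(1) p] by simp
  have E11: "dx (dx ?E) x y t = dx lam x y t * dx w x y t + lam x y t * dx (dx w) x y t
      + (lam x y t * dx (dx w) x y t + xi x y t * dx (dx (dx w)) x y t)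
      - (- 2 * deriv f x * met x * dy xi x y t * dy w x y t + met x * dy lam x y t * dy w x y t
          + met x * dy xi x y t * dx (dy w) x y t)
      + (- met x * dy xi x y t * dx (dy w) x y t + ph x y t * dx (dx (dy w)) x y t)"
    by (subst dx_cong[OF D(1) E1 p], assumption, subst dx_def, rule DERIV_imp_deriv)
      (auto intro!: derivative_eq_intros metric_derivs(1)[OF x] C3_has_dx[OF xi p] C3_has_dx[OF ph p] C3_has_dx[OF w1(1) p]
        C3_has_dx[OF w1(2) p] C3_has_dx[OF w2(1) p] C3_has_dx[OF w2(2) p] C3_has_dx[OF lam p] C3_has_dx[OF xi1 p]
        simp: conf[OF p] c1 algebra_simps)
  have E22: "dy (dy ?E) x y t = dy (dy xi) x y t * dx w x y t + 2 * dy xi x y t * dx (dy w) x y t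
      + xi x y t * dx (dy (dy w)) x y t + (dy lam x y t - deriv f x * dy xi x y t) * dy w x y t
      + 2 * (lam x y t - deriv f x * xi x y t) * dy (dy w) x y t + ph x y t * dy (dy (dy w)) x y t"
    by (subst dy_cong[OF D(1) E2 p], assumption, subst dy_def, rule DERIV_imp_deriv)
      (auto intro!: derivative_eq_intros C3_has_dy[OF xi p] C3_has_dy[OF ph p] C3_has_dy[OF w1(1) p]
        C3_has_dy[OF w1(2) p] C3_has_dy[OF w2(2) p] C3_has_dy[OF w2(3) p] C3_has_dy[OF lam p] C3_has_dy[OF xi1 p]
        simp: conf[OF p] dx_dy_commute[OF w D(1) p] dx_dy_commute[OF w1(2) D(1) p] algebra_simps)
  \<comment> \<open>Equality of the mixed derivatives of \<open>ph\<close>, whose first derivatives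
    are both prescribed by the conformal equations.\<close>
  have "met x * dy (dy xi) x y t = - (dx lam x y t - deriv (deriv f) x * xi x y t - deriv f x * lam x y t)"
  proof -
    have "dy (dx ph) x y t = - met x * dy (dy xi) x y t"
      by (subst dy_cong[OF D(1) conf(3) p], assumption, subst dy_def, rule DERIV_imp_deriv)
        (auto intro!: derivative_eq_intros C3_has_dy[OF xi1 p])
    moreover have "dx (dy ph) x y t = dx lam x y t - deriv (deriv f) x * xi x y t - deriv f x * lam x y t"
      by (subst dx_cong[OF D(1) conf(2) p], assumption, subst dx_def, rule DERIV_imp_deriv)
        (auto intro!: derivative_eq_intros C3_has_dx[OF lam p] C3_has_dx[OF xi p] metric_derivs(2)[OF x] simp: conf[OF p])
    ultimately show ?thesis using dx_dy_commute[OF ph D(1) p] by simp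
  qed
  then have c2: "met x * dy (dy ?E) x y t = - (dx lam x y t - deriv (deriv f) x * xi x y t - deriv f x * lam x y t) * dx w x y t
      + met x * (2 * dy xi x y t * dx (dy w) x y t
      + xi x y t * dx (dy (dy w)) x y t + (dy lam x y t - deriv f x * dy xi x y t) * dy w x y t
      + 2 * (lam x y t - deriv f x * xi x y t) * dy (dy w) x y t + ph x y t * dy (dy (dy w)) x y t)"
    unfolding E22 by (simp only: distrib_left mult.assoc[symmetric])
  have "laplacian f ?E x y t = deriv f x * dx ?E x y t + dx (dx ?E) x y t + met x * dy (dy ?E) x y t"
    by (simp only: laplacian_eq)
  then show ?thesis
    unfolding c2 E11 E1[OF p] laplacian_first_derivs[OF D w p]
    by (simp add: laplacian_eq[of f w] algebra_simps)
qed

text \<open>The commutator is applied to \<open>w\<close> and to \<open>v\<close>, and the product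
  rule to \<open>lam * v\<close>. At this stage \<lambda> is an arbitrary function, so its gradient
  and Laplacian have to be carried along.\<close>

lemma bilaplacian_conformal:
  assumes D: "open D" "D \<subseteq> I \<times> UNIV" and C: "C3 3 D xi" "C3 3 D ph" "C3 2 D lam" "C3 5 D w"
    and conf: "\<And>x y t. (x, y, t) \<in> D \<Longrightarrow> dx xi x y t = lam x y t"
      "\<And>x y t. (x, y, t) \<in> D \<Longrightarrow> dy ph x y t = lam x y t - deriv f x * xi x y t"
      "\<And>x y t. (x, y, t) \<in> D \<Longrightarrow> dx ph x y t = - met x * dy xi x y t"
    and p: "(x, y, t) \<in> D"
  defines "v \<equiv> laplacian f w"
  shows "laplacian f (laplacian f (\<lambda>x y t. xi x y t * dx w x y t + ph x y t * dy w x y t)) x y t =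
    xi x y t * dx (laplacian f v) x y t + ph x y t * dy (laplacian f v) x y t + 4 * lam x y t * laplacian f v x y t
    + 2 * v x y t * laplacian f lam x y t + 4 * (dx lam x y t * dx v x y t + met x * dy lam x y t * dy v x y t)"
proof -
  have v: "C3 3 D v" unfolding v_def using C3_laplacian[OF D, of 3 w] C(4) by (simp add: numeral_eq_Suc)
  have v': "C3 (Suc 2) D v" using v by simp
  have w: "C3 3 D w" using C3_le[OF C(4)] by simp
  have v2: "C3 2 D v" and xi2: "C3 2 D xi" and ph2: "C3 2 D ph" using C3_le[OF v] C3_le[OF C(1)] C3_le[OF C(2)] by simp_all
  let ?V = "\<lambda>x y t. xi x y t * dx v x y t + ph x y t * dy v x y t" and ?L = "\<lambda>x y t. lam x y t * v x y t"
  have V2: "C3 2 D ?V" by (intro C3_add C3_mult D(1) xi2 ph2 C3_dx[OF v' D(1)] C3_dy[OF v' D(1)])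
  have L2: "C3 2 D ?L" by (intro C3_mult D(1) v2 C(3))
  have "laplacian f (\<lambda>x y t. xi x y t * dx w x y t + ph x y t * dy w x y t) x y t = ?V x y t + (?L x y t + ?L x y t)"
    if "(x, y, t) \<in> D" for x y t
    using laplacian_conformal[OF D C(1-3) w conf that] by (simp add: v_def)
  from laplacian_cong[where f = f, OF D(1) this p]
  have "laplacian f (laplacian f (\<lambda>x y t. xi x y t * dx w x y t + ph x y t * dy w x y t)) x y t
      = laplacian f (\<lambda>x y t. ?V x y t + (?L x y t + ?L x y t)) x y t" .
  also have "\<dots> = laplacian f ?V x y t + (laplacian f ?L x y t + laplacian f ?L x y t)"
    using laplacian_add[OF D(1) V2 C3_add[OF D(1) L2 L2] p] laplacian_add[OF D(1) L2 L2 p] by simp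
  finally have e: "laplacian f (laplacian f (\<lambda>x y t. xi x y t * dx w x y t + ph x y t * dy w x y t)) x y t
      = laplacian f ?V x y t + (laplacian f ?L x y t + laplacian f ?L x y t)" .
  have "laplacian f ?V x y t = xi x y t * dx (laplacian f v) x y t + ph x y t * dy (laplacian f v) x y t
      + 2 * lam x y t * laplacian f v x y t"
    by (rule laplacian_conformal[OF D C(1-3) v _ _ _ p]) (use conf in auto)
  then show ?thesis
    unfolding e laplacian_mult[OF D(1) C(3) v2 p]
    by (simp add: algebra_simps)
qed

section \<open>The heat operator on sums, time-dependent factors, conformal fields and time
  derivatives\<close>

lemma laplacian_dt:
  assumes D: "open D" "D \<subseteq> I \<times> UNIV" and w: "C3 (Suc (Suc (Suc k))) D w" and p: "(x, y, t) \<in> D"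
  shows "laplacian f (dt w) x y t = dt (laplacian f w) x y t"
proof -
  note w1 = C3_dx[OF w D(1)] C3_dy[OF w D(1)]
  note w2 = C3_dx[OF w1(1) D(1)] C3_dy[OF w1(2) D(1)]
  have "dt (laplacian f w) x y t = deriv f x * dt (dx w) x y t + dt (dx (dx w)) x y t + met x * dt (dy (dy w)) x y t"
    unfolding laplacian_eq
    by (subst dt_def, rule DERIV_imp_deriv)
      (auto intro!: derivative_eq_intros C3_has_dt[OF w1(1) p] C3_has_dt[OF w2(1) p] C3_has_dt[OF w2(2) p])
  moreover have "dx (dx (dt w)) x y t = dt (dx (dx w)) x y t"
    using dx_cong[OF D(1) dx_dt_commute[OF w D(1)] p] dx_dt_commute[OF w1(1) D(1) p] by simp
  moreover have "dy (dy (dt w)) x y t = dt (dy (dy w)) x y t"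
    using dy_cong[OF D(1) dy_dt_commute[OF w D(1)] p] dy_dt_commute[OF w1(2) D(1) p] by simp
  ultimately show ?thesis using dx_dt_commute[OF w D(1) p] by (simp add: laplacian_eq)
qed

lemma heat_op_add:
  assumes D: "open D" "D \<subseteq> I \<times> UNIV" and C: "C3 4 D v" "C3 4 D w" and p: "(x, y, t) \<in> D"
  shows "heat_op f (\<lambda>x y t. v x y t + w x y t) x y t = heat_op f v x y t + heat_op f w x y t"
proof -
  have C': "C3 (Suc (Suc 2)) D v" "C3 (Suc (Suc 2)) D w" "C3 2 D v" "C3 2 D w" "C3 (Suc 0) D v" "C3 (Suc 0) D w"
    using C C3_le[OF C(1)] C3_le[OF C(2)] by simp_all
  have "laplacian f (laplacian f (\<lambda>x y t. v x y t + w x y t)) x y t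
      = laplacian f (laplacian f v) x y t + laplacian f (laplacian f w) x y t"
    using laplacian_cong[where f = f, OF D(1) laplacian_add[OF D(1) C'(3,4)] p]
      laplacian_add[OF D(1) C3_laplacian[OF D C'(1)] C3_laplacian[OF D C'(2)] p] by simp
  then show ?thesis by (simp add: heat_op_def dt_add[OF C'(5,6) p])
qed

lemma heat_op_cmult:
  assumes D: "open D" "D \<subseteq> I \<times> UNIV" and C: "C3 4 D (\<lambda>x y t. g t)" "C3 4 D w" and p: "(x, y, t) \<in> D"
  shows "heat_op f (\<lambda>x y t. g t * w x y t) x y t = deriv g t * w x y t + g t * heat_op f w x y t"
proof -
  have C': "C3 (Suc (Suc 2)) D w" "C3 2 D w" "C3 (Suc 0) D (\<lambda>x y t. g t)" "C3 2 D (\<lambda>x y t. g t)" "C3 (Suc 0) D w"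
    using C C3_le[OF C(1)] C3_le[OF C(2)] by simp_all
  have g: "dx (\<lambda>x y t. g t) = (\<lambda>x y t. 0)" "dy (\<lambda>x y t. g t) = (\<lambda>x y t. 0)"
    by (simp_all add: fun_eq_iff dx_def dy_def)
  have 0: "dx (\<lambda>x y t. 0) = (\<lambda>x y t. 0)" "dy (\<lambda>x y t. 0) = (\<lambda>x y t. 0)"
    by (simp_all add: fun_eq_iff dx_def dy_def)
  have e: "laplacian f (\<lambda>x y t. g t * v x y t) x y t = g t * laplacian f v x y t"
    if "C3 2 D v" "(x, y, t) \<in> D" for v x y t
    using laplacian_mult[OF D(1) C'(4) that] by (simp add: g 0 laplacian_eq[of f "\<lambda>x y t. g t"])
  have "laplacian f (laplacian f (\<lambda>x y t. g t * w x y t)) x y t = g t * laplacian f (laplacian f w) x y t"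
    using laplacian_cong[where f = f, OF D(1) e[OF C'(2)] p] e[OF C3_laplacian[OF D C'(1)] p] by simp
  moreover have "dt (\<lambda>x y t. g t) x y t = deriv g t" by (simp add: dt_def)
  ultimately show ?thesis using dt_mult[OF C'(3,5) p] by (simp add: heat_op_def algebra_simps)
qed

lemma heat_op_conformal:
  assumes D: "open D" "D \<subseteq> I \<times> UNIV" and C: "C3 4 D xi" "C3 4 D ph" "C3 2 D lam" "\<And>k. C3 k D w"
    and conf: "\<And>x y t. (x, y, t) \<in> D \<Longrightarrow> dx xi x y t = lam x y t"
      "\<And>x y t. (x, y, t) \<in> D \<Longrightarrow> dy ph x y t = lam x y t - deriv f x * xi x y t"
      "\<And>x y t. (x, y, t) \<in> D \<Longrightarrow> dx ph x y t = - met x * dy xi x y t"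
    and p: "(x, y, t) \<in> D"
  defines "v \<equiv> laplacian f w"
  shows "heat_op f (\<lambda>x y t. xi x y t * dx w x y t + ph x y t * dy w x y t) x y t =
    dt xi x y t * dx w x y t + dt ph x y t * dy w x y t
    + xi x y t * dx (heat_op f w) x y t + ph x y t * dy (heat_op f w) x y t - 4 * lam x y t * laplacian f v x y t
    - 2 * v x y t * laplacian f lam x y t - 4 * (dx lam x y t * dx v x y t + met x * dy lam x y t * dy v x y t)"
proof -
  have C': "C3 3 D xi" "C3 3 D ph" "C3 (Suc 0) D xi" "C3 (Suc 0) D ph"
    using C3_le[OF C(1)] C3_le[OF C(2)] by simp_all
  have w: "C3 (Suc (Suc 0)) D w" using C(4) .
  note w1 = C3_dx[OF w D(1)] C3_dy[OF w D(1)]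
  have vv: "C3 (Suc 0) D (laplacian f v)" unfolding v_def
    by (intro C3_laplacian D C(4)) simp_all
  have wt: "C3 (Suc 0) D (dt w)" using C3_dt[OF w D(1)] .
  have "dt (\<lambda>x y t. xi x y t * dx w x y t + ph x y t * dy w x y t) x y t
     = dt xi x y t * dx w x y t + xi x y t * dx (dt w) x y t + (dt ph x y t * dy w x y t + ph x y t * dy (dt w) x y t)"
    using dt_add[OF C3_mult[OF D(1) C'(3) w1(1)] C3_mult[OF D(1) C'(4) w1(2)] p] dt_mult[OF C'(3) w1(1) p]
      dt_mult[OF C'(4) w1(2) p] dx_dt_commute[OF w D(1) p] dy_dt_commute[OF w D(1) p] by simp
  note dtV = this
  have dd: "dx (heat_op f w) x y t = dx (dt w) x y t - dx (laplacian f v) x y t"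
    "dy (heat_op f w) x y t = dy (dt w) x y t - dy (laplacian f v) x y t"
    unfolding heat_op_def[abs_def] v_def[symmetric] using dx_diff[OF wt vv p] dy_diff[OF wt vv p] by simp_all
  have b: "laplacian f (laplacian f (\<lambda>x y t. xi x y t * dx w x y t + ph x y t * dy w x y t)) x y t =
    xi x y t * dx (laplacian f v) x y t + ph x y t * dy (laplacian f v) x y t + 4 * lam x y t * laplacian f v x y t
    + 2 * v x y t * laplacian f lam x y t + 4 * (dx lam x y t * dx v x y t + met x * dy lam x y t * dy v x y t)"
    unfolding v_def by (rule bilaplacian_conformal[OF D C'(1,2) C(3) C(4) _ _ _ p]) (use conf in auto)
  show ?thesis
    unfolding heat_op_def[of f "\<lambda>x y t. xi x y t * dx w x y t + ph x y t * dy w x y t"] dtV dd b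
    by (simp add: algebra_simps)
qed

lemma heat_op_dt:
  assumes D: "open D" "D \<subseteq> I \<times> UNIV" and w: "\<And>k. C3 k D w" and p: "(x, y, t) \<in> D"
  shows "heat_op f (dt w) x y t = dt (heat_op f w) x y t"
proof -
  have "laplacian f (laplacian f (dt w)) x y t = dt (laplacian f (laplacian f w)) x y t"
  proof -
    have "laplacian f (laplacian f (dt w)) x y t = laplacian f (dt (laplacian f w)) x y t"
      by (rule laplacian_cong[OF D(1) _ p]) (rule laplacian_dt[OF D w])
    also have "\<dots> = dt (laplacian f (laplacian f w)) x y t"
      by (rule laplacian_dt[OF D C3_laplacian[OF D w] p]) simp
    finally show ?thesis .
  qed
  moreover have "C3 (Suc 0) D (laplacian f (laplacian f w))" by (intro C3_laplacian D w) simp_all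
  ultimately show ?thesis
    using dt_diff[OF C3_dt[OF w D(1)] _ p] by (simp add: heat_op_def[abs_def])
qed

text \<open>The characteristic is the \<open>u\<close>-component minus the spatial field applied to
  \<open>u\<close> minus \<open>tau\<close> times \<open>dt u\<close>. Commuting the last two with
  the heat operator reproduces the transport terms of \<open>fourth_prolongation_along\<close> with
  opposite sign; only derivatives of the coefficients and multiples of \<lambda> survive.\<close>

theorem symmetry_condition:
  assumes lift: "jet_lift X \<Omega> j" and \<Omega>: "\<Omega> \<subseteq> I \<times> UNIV" and D: "D = {(x, y, t). (x, y, t, j x y t (0, 0, 0)) \<in> \<Omega>}"
    and X: "\<And>x y t u. (x, y, t, u) \<in> \<Omega> \<Longrightarrow> X (x, y, t, u) = (xi x y t, ph x y t, tau t, zeta (x, y, t, u))"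
    and conf: "\<And>x y t. (x, y, t) \<in> D \<Longrightarrow> dx xi x y t = lam x y t"
      "\<And>x y t. (x, y, t) \<in> D \<Longrightarrow> dy ph x y t = lam x y t - deriv f x * xi x y t"
      "\<And>x y t. (x, y, t) \<in> D \<Longrightarrow> dx ph x y t = - met x * dy xi x y t"
    and p: "(x, y, t) \<in> D"
  defines "u \<equiv> \<lambda>x y t. j x y t (0, 0, 0)"
  defines "v \<equiv> laplacian f u"
  shows "fourth_prolongation X (biharmonic_heat f) x y t (j x y t) =
    heat_op f (\<lambda>x y t. zeta (x, y, t, u x y t)) x y t - dt xi x y t * j x y t (1, 0, 0)
    - dt ph x y t * j x y t (0, 1, 0) - deriv tau t * j x y t (0, 0, 1) + 4 * lam x y t * laplacian f v x y t
    + 2 * v x y t * laplacian f lam x y t + 4 * (dx lam x y t * dx v x y t + met x * dy lam x y t * dy v x y t)"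
proof -
  interpret L: jet_lift X \<Omega> j by fact
  have DD: "L.D = D" by (simp add: D L.D_def)
  note D_def = D
  have D: "open D" "D \<subseteq> I \<times> UNIV" using L.open_D \<Omega> by (auto simp: DD D_def)
  have c: "L.cx x y t = xi x y t" "L.cy x y t = ph x y t" "L.ct x y t = tau t" "L.cu x y t = zeta (x, y, t, u x y t)"
    if "(x, y, t) \<in> D" for x y t
    using X[of x y t "u x y t"] that
    by (auto simp: L.cx_def L.cy_def L.ct_def L.cu_def coeff_x_def coeff_y_def coeff_t_def coeff_u_def D_def u_def)
  note Cc = L.C3_coeffs[unfolded DD]
  have C: "C3 4 D xi" "C3 4 D ph" "C3 4 D (\<lambda>x y t. tau t)" "C3 4 D (\<lambda>x y t. zeta (x, y, t, u x y t))"
    using C3_cong[OF D(1) Cc(1) c(1)] C3_cong[OF D(1) Cc(2) c(2)] C3_cong[OF D(1) Cc(3) c(3)]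
      C3_cong[OF D(1) Cc(4) c(4)] by auto
  have "C3 3 D (dx xi)" using C3_dx[of 3 D xi] C(1) D(1) by simp
  then have "C3 2 D (dx xi)" by (rule C3_le) simp
  then have lam: "C3 2 D lam" by (rule C3_cong[OF D(1)]) (rule conf(1))
  have w: "C3 k D u" for k unfolding u_def by (rule C3_subset[OF L.smooth]) simp
  note h = holonomicD[OF L.holonomic]
  have du: "dx u = (\<lambda>x y t. j x y t (1, 0, 0))" "dy u = (\<lambda>x y t. j x y t (0, 1, 0))" "dt u = (\<lambda>x y t. j x y t (0, 0, 1))"
    by (simp_all add: fun_eq_iff u_def dx_def dy_def dt_def DERIV_imp_deriv[OF h(1)] DERIV_imp_deriv[OF h(2)] DERIV_imp_deriv[OF h(3)])
  let ?V = "\<lambda>x y t. xi x y t * dx u x y t + ph x y t * dy u x y t" and ?T = "\<lambda>x y t. tau t * dt u x y t"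
  let ?Z = "\<lambda>x y t. zeta (x, y, t, u x y t)"
  have CV: "C3 4 D ?V" "C3 4 D ?T" by (intro C3_add C3_mult D(1) C C3_dx[OF w] C3_dy[OF w] C3_dt[OF w])+
  have m1: "C3 4 D (\<lambda>x y t. (\<lambda>_. -1) t)" by (rule C3_const)
  have neg: "heat_op f (\<lambda>x y t. - 1 * v x y t) x y t = - heat_op f v x y t" if "C3 4 D v" for v
    using heat_op_cmult[OF D m1 that p] by simp
  have "heat_op f L.characteristic x y t = heat_op f (\<lambda>x y t. ?Z x y t + (- 1 * ?V x y t + - 1 * ?T x y t)) x y t"
    by (rule heat_op_cong[OF D(1) _ p]) (use c in \<open>simp add: L.characteristic_def du\<close>)
  also have "\<dots> = heat_op f ?Z x y t - heat_op f ?V x y t - heat_op f ?T x y t"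
    using heat_op_add[OF D C(4) C3_add[OF D(1) C3_mult[OF D(1) C3_const CV(1)] C3_mult[OF D(1) C3_const CV(2)]] p, of "-1" "-1"]
      heat_op_add[OF D C3_mult[OF D(1) C3_const CV(1)] C3_mult[OF D(1) C3_const CV(2)] p, of "-1" "-1"]
      neg[OF CV(1)] neg[OF CV(2)] by simp
  also have "heat_op f ?T x y t = deriv tau t * dt u x y t + tau t * dt (heat_op f u) x y t"
    using heat_op_cmult[OF D C(3) C3_dt[OF w D(1)] p] heat_op_dt[OF D w p] by simp
  finally have e: "heat_op f L.characteristic x y t = heat_op f ?Z x y t - heat_op f ?V x y t
      - (deriv tau t * dt u x y t + tau t * dt (heat_op f u) x y t)" .
  have pp: "(x, y, t, j x y t (0, 0, 0)) \<in> \<Omega>" using p by (simp add: D_def)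
  have V: "heat_op f ?V x y t =
    dt xi x y t * dx u x y t + dt ph x y t * dy u x y t
    + xi x y t * dx (heat_op f u) x y t + ph x y t * dy (heat_op f u) x y t - 4 * lam x y t * laplacian f v x y t
    - 2 * v x y t * laplacian f lam x y t - 4 * (dx lam x y t * dx v x y t + met x * dy lam x y t * dy v x y t)"
    unfolding v_def by (rule heat_op_conformal[OF D C(1,2) lam w _ _ _ p]) (use conf in auto)
  show ?thesis
    unfolding fourth_prolongation_along[OF lift \<Omega> pp, folded u_def] e V
    using c[OF p] by (simp add: L.cx_def L.cy_def L.ct_def du algebra_simps)
qed

end


section \<open>Determining equations of lower order\<close>

lemma holonomic_partials:
  assumes "holonomic j"
  shows "dx (\<lambda>x y t. j x y t (a, b, c)) = (\<lambda>x y t. j x y t (Suc a, b, c))"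
    "dy (\<lambda>x y t. j x y t (a, b, c)) = (\<lambda>x y t. j x y t (a, Suc b, c))"
    "dt (\<lambda>x y t. j x y t (a, b, c)) = (\<lambda>x y t. j x y t (a, b, Suc c))"
  using holonomicD[OF assms] by (simp_all add: fun_eq_iff dx_def dy_def dt_def DERIV_imp_deriv)

text \<open>With the uninvolved space variable frozen, \<open>h\<close> becomes a function of three
  variables in which \<open>u\<close> takes the role of \<open>t\<close>.\<close>

lemma
  assumes h: "C_k_on (Suc (Suc k)) h \<Omega>" and \<Omega>: "open \<Omega>" and p: "p \<in> \<Omega>"
  shows px_pu_commute: "px (pu h) p = pu (px h) p" and py_pu_commute: "py (pu h) p = pu (py h) p"
proof -
  obtain x y t u where pe: "p = (x, y, t, u)" by (metis prod.exhaust)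
  have *: "open {q. g q \<in> \<Omega>}" "C_k_on (Suc (Suc k)) (\<lambda>q. h (g q)) {q. g q \<in> \<Omega>}"
    if "\<And>S :: (real \<times> real \<times> real) set. open S \<Longrightarrow> C_k_on (Suc (Suc k)) g S" "continuous_on UNIV g" for g
  proof -
    have "open (g -` \<Omega>)" using \<Omega> that(2) by (auto intro: open_vimage)
    then show o: "open {q. g q \<in> \<Omega>}" by (simp add: vimage_def)
    show "C_k_on (Suc (Suc k)) (\<lambda>q. h (g q)) {q. g q \<in> \<Omega>}"
      by (rule C_k_on_compose[OF o that(1)[OF o] h]) auto
  qed
  have g1: "C_k_on (Suc (Suc k)) (\<lambda>q. (fst q, y, fst (snd q), snd (snd q))) S" if "open S" for S :: "(real \<times> real \<times> real) set"
    by (intro C_k_on_intros that)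
  have g2: "C_k_on (Suc (Suc k)) (\<lambda>q. (x, fst q, fst (snd q), snd (snd q))) S" if "open S" for S :: "(real \<times> real \<times> real) set"
    by (intro C_k_on_intros that)
  have c: "continuous_on UNIV (\<lambda>q::real\<times>real\<times>real. (fst q, y, fst (snd q), snd (snd q)))"
    "continuous_on UNIV (\<lambda>q::real\<times>real\<times>real. (x, fst q, fst (snd q), snd (snd q)))"
    by (auto intro!: continuous_intros)
  have C1: "C3 (Suc (Suc k)) {q. (fst q, y, fst (snd q), snd (snd q)) \<in> \<Omega>} (\<lambda>a b c. h (a, y, b, c))"
    and C2: "C3 (Suc (Suc k)) {q. (x, fst q, fst (snd q), snd (snd q)) \<in> \<Omega>} (\<lambda>a b c. h (x, a, b, c))"
    using *(2)[OF g1 c(1)] *(2)[OF g2 c(2)] by (simp_all add: C3_iff)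
  show "px (pu h) p = pu (px h) p"
    using dx_dt_commute[OF C1 *(1)[OF g1 c(1)], of x t u] p
    by (simp add: pe dx_def[abs_def] dt_def[abs_def] px_def pu_def)
  show "py (pu h) p = pu (py h) p"
    using dx_dt_commute[OF C2 *(1)[OF g2 c(2)], of y t u] p
    by (simp add: pe dx_def[abs_def] dt_def[abs_def] py_def pu_def)
qed

lemma
  assumes "open \<Omega>" "\<And>q. q \<in> \<Omega> \<Longrightarrow> h q = c" "p \<in> \<Omega>"
  shows px_const_on: "px h p = 0" and py_const_on: "py h p = 0" and pt_const_on: "pt h p = 0" and pu_const_on: "pu h p = 0"
proof -
  obtain x y t u where pe: "p = (x, y, t, u)" by (metis prod.exhaust)
  note ev = open4_nhds[OF assms(1), of x y t u] assms(3)[unfolded pe]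
  have "deriv (\<lambda>s. h (s, y, t, u)) x = deriv (\<lambda>s. c) x" "deriv (\<lambda>s. h (x, s, t, u)) y = deriv (\<lambda>s. c) y"
    "deriv (\<lambda>s. h (x, y, s, u)) t = deriv (\<lambda>s. c) t" "deriv (\<lambda>s. h (x, y, t, s)) u = deriv (\<lambda>s. c) u"
    using ev by - (rule deriv_cong_ev; auto elim!: eventually_mono intro: assms(2))+
  then show "px h p = 0" "py h p = 0" "pt h p = 0" "pu h p = 0"
    by (simp_all add: pe px_def py_def pt_def pu_def)
qed

section \<open>Derivatives of functions of \<open>(x, y, t, u)\<close> restricted to the graph of a
  function\<close>

locale composition =
  fixes \<Omega> :: "(real \<times> real \<times> real \<times> real) set" and D :: "(real \<times> real \<times> real) set"
    and u :: "real \<Rightarrow> real \<Rightarrow> real \<Rightarrow> real"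
  assumes open_\<Omega>: "open \<Omega>" and open_D: "open D" and smooth_u: "C3 k D u"
    and graph: "(x, y, t) \<in> D \<Longrightarrow> (x, y, t, u x y t) \<in> \<Omega>"
begin

definition along :: "(real \<times> real \<times> real \<times> real \<Rightarrow> real) \<Rightarrow> real \<Rightarrow> real \<Rightarrow> real \<Rightarrow> real" where
  "along h x y t = h (x, y, t, u x y t)"

lemma C3_along: "C_k_on k h \<Omega> \<Longrightarrow> C3 k D (along h)"
  unfolding along_def[abs_def] by (rule C3_graph[OF open_D smooth_u]) (auto intro: graph)

lemma
  assumes "C_k_on (Suc k) h \<Omega>" "(x, y, t) \<in> D"
  shows dx_along: "dx (along h) x y t = along (px h) x y t + along (pu h) x y t * dx u x y t"
    and dy_along: "dy (along h) x y t = along (py h) x y t + along (pu h) x y t * dy u x y t"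
    and dt_along: "dt (along h) x y t = along (pt h) x y t + along (pu h) x y t * dt u x y t"
proof -
  note q = graph[OF assms(2)]
  have u: "C3 (Suc 0) D u" by (rule smooth_u)
  note c = chain_rule4[OF assms(1)]
  show "dx (along h) x y t = along (px h) x y t + along (pu h) x y t * dx u x y t"
    unfolding along_def dx_def[of "\<lambda>x y t. h (x, y, t, u x y t)"]
    using c[of "\<lambda>s. s" x "\<lambda>s. y" "\<lambda>s. t" "\<lambda>s. u s y t", OF q DERIV_ident DERIV_const DERIV_const C3_has_dx[OF u assms(2)]]
    by (intro DERIV_imp_deriv) (simp add: Let_def)
  show "dy (along h) x y t = along (py h) x y t + along (pu h) x y t * dy u x y t"
    unfolding along_def dy_def[of "\<lambda>x y t. h (x, y, t, u x y t)"]
    using c[of "\<lambda>s. x" y "\<lambda>s. s" "\<lambda>s. t" "\<lambda>s. u x s t", OF q DERIV_const DERIV_ident DERIV_const C3_has_dy[OF u assms(2)]]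
    by (intro DERIV_imp_deriv) (simp add: Let_def)
  show "dt (along h) x y t = along (pt h) x y t + along (pu h) x y t * dt u x y t"
    unfolding along_def dt_def[of "\<lambda>x y t. h (x, y, t, u x y t)"]
    using c[of "\<lambda>s. x" t "\<lambda>s. y" "\<lambda>s. s" "\<lambda>s. u x y s", OF q DERIV_const DERIV_const DERIV_ident C3_has_dt[OF u assms(2)]]
    by (intro DERIV_imp_deriv) (simp add: Let_def)
qed

lemma u_derivs:
  assumes "(x, y, t) \<in> D"
  shows "((\<lambda>s. dx u s y t) has_real_derivative dx (dx u) x y t) (at x)"
    "((\<lambda>s. dx (dx u) s y t) has_real_derivative dx (dx (dx u)) x y t) (at x)"
    "((\<lambda>s. dx (dx (dx u)) s y t) has_real_derivative dx (dx (dx (dx u))) x y t) (at x)"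
    "((\<lambda>s. dy u x s t) has_real_derivative dy (dy u) x y t) (at y)"
    "((\<lambda>s. dy (dy u) x s t) has_real_derivative dy (dy (dy u)) x y t) (at y)"
    "((\<lambda>s. dy (dy (dy u)) x s t) has_real_derivative dy (dy (dy (dy u))) x y t) (at y)"
  by (rule C3_has_dx[OF C3_dx[OF smooth_u open_D, of 1, unfolded One_nat_def] assms]
      C3_has_dx[OF C3_dx[OF C3_dx[OF smooth_u open_D] open_D, of 1, unfolded One_nat_def] assms]
      C3_has_dx[OF C3_dx[OF C3_dx[OF C3_dx[OF smooth_u open_D] open_D] open_D, of 1, unfolded One_nat_def] assms]
      C3_has_dy[OF C3_dy[OF smooth_u open_D, of 1, unfolded One_nat_def] assms]
      C3_has_dy[OF C3_dy[OF C3_dy[OF smooth_u open_D] open_D, of 1, unfolded One_nat_def] assms]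
      C3_has_dy[OF C3_dy[OF C3_dy[OF C3_dy[OF smooth_u open_D] open_D] open_D, of 1, unfolded One_nat_def] assms])+

lemma dx2_along:
  assumes h: "C_k_on (Suc (Suc k)) h \<Omega>" and p: "(x, y, t) \<in> D"
  shows "dx (dx (along h)) x y t = dx (along (px h)) x y t + dx (along (pu h)) x y t * dx u x y t
    + along (pu h) x y t * dx (dx u) x y t"
  by (subst dx_cong[OF open_D dx_along[OF h] p], assumption, subst dx_def, rule DERIV_imp_deriv)
    (auto intro!: derivative_eq_intros C3_has_dx[OF C3_along[OF C_k_on_px[OF h open_\<Omega>]] p]
      C3_has_dx[OF C3_along[OF C_k_on_pu[OF h open_\<Omega>]] p] u_derivs[OF p])

lemma dx3_along:
  assumes h: "C_k_on (Suc (Suc (Suc k))) h \<Omega>" and p: "(x, y, t) \<in> D"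
  shows "dx (dx (dx (along h))) x y t = dx (dx (along (px h))) x y t + dx (dx (along (pu h))) x y t * dx u x y t
    + 2 * dx (along (pu h)) x y t * dx (dx u) x y t + along (pu h) x y t * dx (dx (dx u)) x y t"
  by (subst dx_cong[OF open_D dx2_along[OF h] p], assumption, subst dx_def, rule DERIV_imp_deriv)
    (auto intro!: derivative_eq_intros C3_has_dx[OF C3_dx[OF C3_along[OF C_k_on_px[OF h open_\<Omega>]] open_D] p]
      C3_has_dx[OF C3_dx[OF C3_along[OF C_k_on_pu[OF h open_\<Omega>]] open_D] p]
      C3_has_dx[OF C3_along[OF C_k_on_pu[OF h open_\<Omega>]] p] u_derivs[OF p])

lemma dx4_along:
  assumes h: "C_k_on (Suc (Suc (Suc (Suc k)))) h \<Omega>" and p: "(x, y, t) \<in> D"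
  shows "dx (dx (dx (dx (along h)))) x y t = dx (dx (dx (along (px h)))) x y t
    + dx (dx (dx (along (pu h)))) x y t * dx u x y t + 3 * dx (dx (along (pu h))) x y t * dx (dx u) x y t
    + 3 * dx (along (pu h)) x y t * dx (dx (dx u)) x y t + along (pu h) x y t * dx (dx (dx (dx u))) x y t"
  by (subst dx_cong[OF open_D dx3_along[OF h] p], assumption, subst dx_def, rule DERIV_imp_deriv)
    (auto intro!: derivative_eq_intros C3_has_dx[OF C3_dx[OF C3_dx[OF C3_along[OF C_k_on_px[OF h open_\<Omega>]] open_D] open_D] p]
      C3_has_dx[OF C3_dx[OF C3_dx[OF C3_along[OF C_k_on_pu[OF h open_\<Omega>]] open_D] open_D] p]
      C3_has_dx[OF C3_dx[OF C3_along[OF C_k_on_pu[OF h open_\<Omega>]] open_D] p]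
      C3_has_dx[OF C3_along[OF C_k_on_pu[OF h open_\<Omega>]] p] u_derivs[OF p])

lemma dy2_along:
  assumes h: "C_k_on (Suc (Suc k)) h \<Omega>" and p: "(x, y, t) \<in> D"
  shows "dy (dy (along h)) x y t = dy (along (py h)) x y t + dy (along (pu h)) x y t * dy u x y t
    + along (pu h) x y t * dy (dy u) x y t"
  by (subst dy_cong[OF open_D dy_along[OF h] p], assumption, subst dy_def, rule DERIV_imp_deriv)
    (auto intro!: derivative_eq_intros C3_has_dy[OF C3_along[OF C_k_on_py[OF h open_\<Omega>]] p]
      C3_has_dy[OF C3_along[OF C_k_on_pu[OF h open_\<Omega>]] p] u_derivs[OF p])

lemma dy3_along:
  assumes h: "C_k_on (Suc (Suc (Suc k))) h \<Omega>" and p: "(x, y, t) \<in> D"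
  shows "dy (dy (dy (along h))) x y t = dy (dy (along (py h))) x y t + dy (dy (along (pu h))) x y t * dy u x y t
    + 2 * dy (along (pu h)) x y t * dy (dy u) x y t + along (pu h) x y t * dy (dy (dy u)) x y t"
  by (subst dy_cong[OF open_D dy2_along[OF h] p], assumption, subst dy_def, rule DERIV_imp_deriv)
    (auto intro!: derivative_eq_intros C3_has_dy[OF C3_dy[OF C3_along[OF C_k_on_py[OF h open_\<Omega>]] open_D] p]
      C3_has_dy[OF C3_dy[OF C3_along[OF C_k_on_pu[OF h open_\<Omega>]] open_D] p]
      C3_has_dy[OF C3_along[OF C_k_on_pu[OF h open_\<Omega>]] p] u_derivs[OF p])

lemma dy4_along:
  assumes h: "C_k_on (Suc (Suc (Suc (Suc k)))) h \<Omega>" and p: "(x, y, t) \<in> D"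
  shows "dy (dy (dy (dy (along h)))) x y t = dy (dy (dy (along (py h)))) x y t
    + dy (dy (dy (along (pu h)))) x y t * dy u x y t + 3 * dy (dy (along (pu h))) x y t * dy (dy u) x y t
    + 3 * dy (along (pu h)) x y t * dy (dy (dy u)) x y t + along (pu h) x y t * dy (dy (dy (dy u))) x y t"
  by (subst dy_cong[OF open_D dy3_along[OF h] p], assumption, subst dy_def, rule DERIV_imp_deriv)
    (auto intro!: derivative_eq_intros C3_has_dy[OF C3_dy[OF C3_dy[OF C3_along[OF C_k_on_py[OF h open_\<Omega>]] open_D] open_D] p]
      C3_has_dy[OF C3_dy[OF C3_dy[OF C3_along[OF C_k_on_pu[OF h open_\<Omega>]] open_D] open_D] p]
      C3_has_dy[OF C3_dy[OF C3_along[OF C_k_on_pu[OF h open_\<Omega>]] open_D] p]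
      C3_has_dy[OF C3_along[OF C_k_on_pu[OF h open_\<Omega>]] p] u_derivs[OF p])

end

lemma (in surface) heat_op_expand:
  assumes "open D" "D \<subseteq> I \<times> UNIV" "C3 4 D w" "(x, y, t) \<in> D"
  shows "heat_op f w x y t = dt w x y t - (dx (dx (dx (dx w))) x y t + 2 * deriv f x * dx (dx (dx w)) x y t
     + (2 * deriv (deriv f) x + (deriv f x)\<^sup>2) * dx (dx w) x y t
     + (deriv (deriv (deriv f)) x + deriv f x * deriv (deriv f) x) * dx w x y t
     + 2 * met x * dx (dx (dy (dy w))) x y t - 2 * deriv f x * met x * dx (dy (dy w)) x y t
     + (2 * (deriv f x)\<^sup>2 - 2 * deriv (deriv f) x) * met x * dy (dy w) x y t
     + (met x)\<^sup>2 * dy (dy (dy (dy w))) x y t)"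
  using heat_form_deriv3[OF assms] by (simp add: heat_form_def deriv3_simps eval_nat_numeral)

locale surface_composition = surface + composition +
  assumes \<Omega>_subset: "\<Omega> \<subseteq> I \<times> UNIV"
begin

lemma D_subset: "D \<subseteq> I \<times> UNIV"
  using graph \<Omega>_subset by auto

text \<open>The biharmonic heat operator applied to \<open>h\<close> with frozen last argument. The version \<open>frozen_y\<close>
  takes the mixed derivatives in the opposite order.\<close>

definition frozen_x :: "(real \<times> real \<times> real \<times> real \<Rightarrow> real) \<Rightarrow> real \<times> real \<times> real \<times> real \<Rightarrow> real" where
  "frozen_x h p = (let x = fst p in pt h p - (px (px (px (px h))) p + 2 * deriv f x * px (px (px h)) p
     + (2 * deriv (deriv f) x + (deriv f x)\<^sup>2) * px (px h) p
     + (deriv (deriv (deriv f)) x + deriv f x * deriv (deriv f) x) * px h p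
     + 2 * met x * px (px (py (py h))) p - 2 * deriv f x * met x * px (py (py h)) p
     + (2 * (deriv f x)\<^sup>2 - 2 * deriv (deriv f) x) * met x * py (py h) p
     + (met x)\<^sup>2 * py (py (py (py h))) p))"

definition frozen_y :: "(real \<times> real \<times> real \<times> real \<Rightarrow> real) \<Rightarrow> real \<times> real \<times> real \<times> real \<Rightarrow> real" where
  "frozen_y h p = (let x = fst p in pt h p - (px (px (px (px h))) p + 2 * deriv f x * px (px (px h)) p
     + (2 * deriv (deriv f) x + (deriv f x)\<^sup>2) * px (px h) p
     + (deriv (deriv (deriv f)) x + deriv f x * deriv (deriv f) x) * px h p
     + 2 * met x * py (py (px (px h))) p - 2 * deriv f x * met x * py (py (px h)) p
     + (2 * (deriv f x)\<^sup>2 - 2 * deriv (deriv f) x) * met x * py (py h) p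
     + (met x)\<^sup>2 * py (py (py (py h))) p))"

text \<open>A function \<open>u\<close> without \<open>y\<close>-dependence and with
  \<open>u_x = 0\<close> at the point removes most of the fourth-order chain rule. Enough remains:
  the factor of \<open>u_xxx\<close> carries the mixed derivative of \<open>h\<close> in
  \<open>x\<close> and \<open>u\<close>, and the factor of \<open>(u_xx)\<^sup>2\<close> its second
  \<open>u\<close>-derivative.\<close>

lemma heat_op_along_x:
  assumes h: "C_k_on 4 h \<Omega>" and p: "(x, y, t) \<in> D"
    and uy: "\<And>x y t. (x, y, t) \<in> D \<Longrightarrow> dy u x y t = 0" and ux: "dx u x y t = 0"
  defines "q \<equiv> (x, y, t, u x y t)"
  shows "heat_op f (along h) x y t = frozen_x h q + pu h q * heat_op f u x y t
    - ((pu (px (px h)) q + 2 * px (pu (px h)) q + 3 * px (px (pu h)) q + 2 * deriv f x * (pu (px h) q + 2 * px (pu h) q)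
          + 2 * met x * pu (py (py h)) q) * dx (dx u) x y t
       + 3 * pu (pu h) q * (dx (dx u) x y t)\<^sup>2
       + (pu (px h) q + 3 * px (pu h) q) * dx (dx (dx u)) x y t)"
proof -
  have h4: "C_k_on (Suc (Suc (Suc (Suc 0)))) h \<Omega>" using h by (simp add: eval_nat_numeral del: C_k_on.simps)
  note h3 = C_k_on_px[OF h4 open_\<Omega>] C_k_on_py[OF h4 open_\<Omega>] C_k_on_pu[OF h4 open_\<Omega>]
  note h2 = C_k_on_px[OF h3(1) open_\<Omega>] C_k_on_pu[OF h3(1) open_\<Omega>] C_k_on_px[OF h3(3) open_\<Omega>] C_k_on_pu[OF h3(3) open_\<Omega>]
    C_k_on_py[OF h3(2) open_\<Omega>]
  note h1 = C_k_on_px[OF h2(1) open_\<Omega>] C_k_on_pu[OF h2(1) open_\<Omega>] C_k_on_px[OF h2(5) open_\<Omega>] C_k_on_py[OF h2(5) open_\<Omega>]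
  have a: "along g x y t = g q" for g by (simp add: along_def q_def)
  have d1: "dx (along g) x y t = px g q" if "C_k_on (Suc k) g \<Omega>" for g k
    using dx_along[OF that p] ux by (simp add: a)
  have d2: "dx (dx (along g)) x y t = px (px g) q + pu g q * dx (dx u) x y t" if "C_k_on (Suc (Suc k)) g \<Omega>" for g k
    using dx2_along[OF that p] ux d1[OF C_k_on_px[OF that open_\<Omega>]] by (simp add: a)
  have d3: "dx (dx (dx (along g))) x y t = px (px (px g)) q + (pu (px g) q + 2 * px (pu g) q) * dx (dx u) x y t
      + pu g q * dx (dx (dx u)) x y t" if "C_k_on (Suc (Suc (Suc k))) g \<Omega>" for g k
    using dx3_along[OF that p] ux d2[OF C_k_on_px[OF that open_\<Omega>]] d1[OF C_k_on_pu[OF that open_\<Omega>]]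
    by (simp add: a algebra_simps)
  have d4: "dx (dx (dx (dx (along h)))) x y t = px (px (px (px h))) q
      + (pu (px (px h)) q + 2 * px (pu (px h)) q) * dx (dx u) x y t + pu (px h) q * dx (dx (dx u)) x y t
      + 3 * (px (px (pu h)) q + pu (pu h) q * dx (dx u) x y t) * dx (dx u) x y t
      + 3 * px (pu h) q * dx (dx (dx u)) x y t + pu h q * dx (dx (dx (dx u))) x y t"
    using dx4_along[OF h4 p] ux d3[OF h3(1)] d2[OF h3(3)] d1[OF h3(3)] by (simp add: a)
  have e1: "dy (along g) x y t = along (py g) x y t" if "C_k_on (Suc k) g \<Omega>" "(x, y, t) \<in> D" for g k x y t
    using dy_along[OF that] uy[OF that(2)] by simp
  have e2: "dy (dy (along g)) x y t = along (py (py g)) x y t" if "C_k_on (Suc (Suc k)) g \<Omega>" "(x, y, t) \<in> D" for g k x y t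
    using dy_cong[OF open_D e1[OF that(1)] that(2)] e1[OF C_k_on_py[OF that(1) open_\<Omega>] that(2)] by simp
  have e4: "dy (dy (dy (dy (along h)))) x y t = py (py (py (py h))) q"
    using dy_cong[OF open_D dy_cong[OF open_D e2[OF h4]] p] e2[OF h2(5) p] by (simp add: a)
  have m: "dx (dy (dy (along h))) x y t = px (py (py h)) q"
    "dx (dx (dy (dy (along h)))) x y t = px (px (py (py h))) q + pu (py (py h)) q * dx (dx u) x y t"
    using dx_cong[OF open_D e2[OF h4] p] dx_cong[OF open_D dx_cong[OF open_D e2[OF h4]] p]
      d1[OF h2(5)] d2[OF h2(5)] by simp_all
  have uyy: "dy (dy u) x y t = 0" if "(x, y, t) \<in> D" for x y t
    using dy_cong[OF open_D uy that] by (simp add: dy_def)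
  have u0: "dx (dy (dy u)) x y t = 0" "dx (dx (dy (dy u))) x y t = 0" "dy (dy (dy (dy u))) x y t = 0"
    using dx_cong[OF open_D uyy p] dx_cong[OF open_D dx_cong[OF open_D uyy] p] dy_cong[OF open_D dy_cong[OF open_D uyy] p]
    by (simp_all add: dx_def dy_def)
  have hu: "heat_op f u x y t = dt u x y t - (dx (dx (dx (dx u))) x y t + 2 * deriv f x * dx (dx (dx u)) x y t
     + (2 * deriv (deriv f) x + (deriv f x)\<^sup>2) * dx (dx u) x y t)"
    unfolding heat_op_expand[OF open_D D_subset smooth_u p] by (simp add: ux uyy[OF p] u0)
  show ?thesis
    unfolding heat_op_expand[OF open_D D_subset C3_along[OF h] p] d4 d3[OF h4] d2[OF h4] d1[OF h4] m e4 e2[OF h4 p]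
      dt_along[OF h4 p] hu a
    by (simp add: frozen_x_def q_def algebra_simps power2_eq_square)
qed

text \<open>The counterpart in \<open>y\<close>, with \<open>u_yy = 0\<close> in addition, so that
  apart from \<open>heat_op f u\<close> only \<open>u_yyy\<close> is left. Derivatives in
  \<open>x\<close> now pass through the composition unchanged and are taken innermost; this yields
  the opposite order of mixed derivatives in \<open>frozen_y\<close>.\<close>

lemma heat_op_along_y:
  assumes h: "C_k_on 4 h \<Omega>" and p: "(x, y, t) \<in> D"
    and ux: "\<And>x y t. (x, y, t) \<in> D \<Longrightarrow> dx u x y t = 0" and uy: "dy u x y t = 0" "dy (dy u) x y t = 0"
  defines "q \<equiv> (x, y, t, u x y t)"
  shows "heat_op f (along h) x y t = frozen_y h q + pu h q * heat_op f u x y t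
    - (met x)\<^sup>2 * (pu (py h) q + 3 * py (pu h) q) * dy (dy (dy u)) x y t"
proof -
  have h4: "C_k_on (Suc (Suc (Suc (Suc 0)))) h \<Omega>" using h by (simp add: eval_nat_numeral del: C_k_on.simps)
  note h3 = C_k_on_px[OF h4 open_\<Omega>] C_k_on_py[OF h4 open_\<Omega>] C_k_on_pu[OF h4 open_\<Omega>]
  note h2 = C_k_on_px[OF h3(1) open_\<Omega>]
  have a: "along g x y t = g q" for g by (simp add: along_def q_def)
  have d1: "dy (along g) x y t = py g q" if "C_k_on (Suc k) g \<Omega>" for g k
    using dy_along[OF that p] uy by (simp add: a)
  have d2: "dy (dy (along g)) x y t = py (py g) q" if "C_k_on (Suc (Suc k)) g \<Omega>" for g k
    using dy2_along[OF that p] uy d1[OF C_k_on_py[OF that open_\<Omega>]] by (simp add: a)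
  have d3: "dy (dy (dy (along g))) x y t = py (py (py g)) q
      + pu g q * dy (dy (dy u)) x y t" if "C_k_on (Suc (Suc (Suc k))) g \<Omega>" for g k
    using dy3_along[OF that p] uy d2[OF C_k_on_py[OF that open_\<Omega>]] by (simp add: a)
  have d4: "dy (dy (dy (dy (along h)))) x y t = py (py (py (py h))) q + pu (py h) q * dy (dy (dy u)) x y t
      + 3 * py (pu h) q * dy (dy (dy u)) x y t + pu h q * dy (dy (dy (dy u))) x y t"
    using dy4_along[OF h4 p] uy d3[OF h3(2)] d1[OF h3(3)] by (simp add: a)
  have e1: "dx (along g) x y t = along (px g) x y t" if "C_k_on (Suc k) g \<Omega>" "(x, y, t) \<in> D" for g k x y t
    using dx_along[OF that] ux[OF that(2)] by simp
  have e2: "dx (dx (along g)) x y t = along (px (px g)) x y t" if "C_k_on (Suc (Suc k)) g \<Omega>" "(x, y, t) \<in> D" for g k x y t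
    using dx_cong[OF open_D e1[OF that(1)] that(2)] e1[OF C_k_on_px[OF that(1) open_\<Omega>] that(2)] by simp
  have e3: "dx (dx (dx (along h))) x y t = px (px (px h)) q"
    using dx_cong[OF open_D e2[OF h4] p] e1[OF h2 p] by (simp add: a)
  have e4: "dx (dx (dx (dx (along h)))) x y t = px (px (px (px h))) q"
    using dx_cong[OF open_D dx_cong[OF open_D e2[OF h4]] p] e2[OF h2 p] by (simp add: a)
  have c: "dx (dy (dy w)) x y t = dy (dy (dx w)) x y t" "dx (dx (dy (dy w))) x y t = dy (dy (dx (dx w))) x y t"
    if w: "C3 4 D w" for w
  proof -
    have w': "C3 (Suc (Suc (Suc (Suc 0)))) D w" using w by (simp add: eval_nat_numeral)
    note 1 = commute3(2)[OF open_D w', symmetric]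
    show "dx (dy (dy w)) x y t = dy (dy (dx w)) x y t" by (rule 1[OF p])
    show "dx (dx (dy (dy w))) x y t = dy (dy (dx (dx w))) x y t"
      using dx_cong[OF open_D 1 p] commute3(2)[OF open_D C3_dx[OF w' open_D] p] by simp
  qed
  have m: "dx (dy (dy (along h))) x y t = py (py (px h)) q" "dx (dx (dy (dy (along h)))) x y t = py (py (px (px h))) q"
    unfolding c[OF C3_along[OF h]]
    using dy_cong[OF open_D dy_cong[OF open_D e1[OF h4]] p] dy_cong[OF open_D dy_cong[OF open_D e2[OF h4]] p]
      d2[OF h3(1)] d2[OF h2] by simp_all
  have uxx: "dx (dx u) x y t = 0" if "(x, y, t) \<in> D" for x y t
    using dx_cong[OF open_D ux that] by (simp add: dx_def)
  have u0: "dx (dx (dx u)) x y t = 0" "dx (dx (dx (dx u))) x y t = 0" "dy (dy (dx u)) x y t = 0" "dy (dy (dx (dx u))) x y t = 0"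
    using dx_cong[OF open_D uxx p] dx_cong[OF open_D dx_cong[OF open_D uxx] p] dy_cong[OF open_D dy_cong[OF open_D ux] p]
      dy_cong[OF open_D dy_cong[OF open_D uxx] p]
    by (simp_all add: dx_def dy_def)
  have hu: "heat_op f u x y t = dt u x y t - (met x)\<^sup>2 * dy (dy (dy (dy u))) x y t"
    unfolding heat_op_expand[OF open_D D_subset smooth_u p] by (simp add: ux[OF p] uxx[OF p] uy u0 c[OF smooth_u])
  show ?thesis
    unfolding heat_op_expand[OF open_D D_subset C3_along[OF h] p] d4 d2[OF h4] e4 e3 e2[OF h4 p] e1[OF h4 p] m
      dt_along[OF h4 p] hu a
    by (simp add: frozen_y_def q_def algebra_simps power2_eq_square)
qed

end


section \<open>Symmetries and homotheties\<close>

text \<open>\<open>\<xi> \<partial>_x + \<phi> \<partial>_y\<close> scales the metric \<open>dx\<^sup>2 + exp (2 f) dy\<^sup>2\<close> by the constant \<open>2 \<Lambda>\<close>.\<close>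

definition homothety :: "(real \<Rightarrow> real) \<Rightarrow> real set \<Rightarrow> real set \<Rightarrow> real \<Rightarrow> (real \<Rightarrow> real \<Rightarrow> real) \<Rightarrow> (real \<Rightarrow> real \<Rightarrow> real) \<Rightarrow> bool" where
  "homothety f I J \<Lambda> \<xi> \<phi> \<longleftrightarrow> C_k_on 4 (\<lambda>(x, y). \<xi> x y) (I \<times> J) \<and> C_k_on 4 (\<lambda>(x, y). \<phi> x y) (I \<times> J) \<and>
     (\<forall>x\<in>I. \<forall>y\<in>J. ((\<lambda>s. \<xi> s y) has_real_derivative \<Lambda>) (at x) \<and>
        ((\<lambda>s. \<phi> x s) has_real_derivative \<Lambda> - deriv f x * \<xi> x y) (at y) \<and>
        (\<exists>d. ((\<lambda>s. \<xi> x s) has_real_derivative d) (at y) \<and>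
             ((\<lambda>s. \<phi> s y) has_real_derivative - exp (- 2 * f x) * d) (at x)))"

lemma interval_constant:
  fixes g :: "real \<Rightarrow> real"
  assumes "open_interval S" "\<And>s. s \<in> S \<Longrightarrow> (g has_real_derivative 0) (at s)" "a \<in> S" "b \<in> S"
  shows "g a = g b"
proof -
  have "convex S" using assms(1) by (simp add: open_interval_def is_interval_convex)
  then obtain c where "\<forall>s\<in>S. g s = c"
    using has_field_derivative_zero_constant[of S g] assms(2) has_field_derivative_at_within by blast
  then show ?thesis using assms(3,4) by simp
qed

locale surface_domain = surface +
  fixes J T U :: "real set"
  assumes intervals: "open_interval I" "open_interval J" "open_interval T" "open_interval U"
begin

definition \<Omega> :: "(real \<times> real \<times> real \<times> real) set" where "\<Omega> = I \<times> J \<times> T \<times> U"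

lemma open_\<Omega>: "open \<Omega>"
  using intervals by (auto simp: \<Omega>_def open_interval_def intro!: open_Times)

lemma \<Omega>_subset: "\<Omega> \<subseteq> I \<times> UNIV"
  by (auto simp: \<Omega>_def)

lemma open_IJT: "open (I \<times> J \<times> T)" "I \<times> J \<times> T \<subseteq> I \<times> UNIV"
  using intervals by (auto simp: open_interval_def intro!: open_Times)

lemma taylor_lift:
  assumes "C_k_on 4 X \<Omega>"
  shows "jet_lift X \<Omega> (taylor_jet x y t j)"
  by unfold_locales (auto intro: assms open_\<Omega> holonomic_taylor_jet C3_taylor_jet)

lemma taylor_composition:
  fixes x y t :: real and j :: jet
  defines "u \<equiv> \<lambda>x' y' t'. taylor_jet x y t j x' y' t' (0, 0, 0)"
  shows "surface_composition f I \<Omega> {(x, y, t). (x, y, t, u x y t) \<in> \<Omega>} u"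
proof unfold_locales
  \<comment> \<open>A dummy field, present only to reuse the openness of the domain proved in
    \<open>jet_lift\<close>.\<close>
  have "C_k_on 4 (\<lambda>_. 0) \<Omega>" by simp
  then interpret L: jet_lift "\<lambda>_. 0" \<Omega> "taylor_jet x y t j" by (rule taylor_lift)
  show "open {(x, y, t). (x, y, t, u x y t) \<in> \<Omega>}" using L.open_D by (simp add: L.D_def u_def)
  show "C3 k {(x, y, t). (x, y, t, u x y t) \<in> \<Omega>} u" for k
    unfolding u_def by (rule C3_subset[OF C3_taylor_jet]) simp
  show "\<Omega> \<subseteq> I \<times> UNIV" by (rule \<Omega>_subset)
qed (auto simp: open_\<Omega>)

text \<open>The prolonged equation reads only coordinates of order at most four, where the Taylor
  jet at its centre agrees with \<open>j\<close>. Statements along functions thus become statements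
  about arbitrary jets.\<close>

lemma fourth_prolongation_taylor:
  assumes "x \<in> I"
  shows "fourth_prolongation X (biharmonic_heat f) x y t j
    = fourth_prolongation X (biharmonic_heat f) x y t (taylor_jet x y t j x y t)"
proof -
  let ?j = "taylor_jet x y t j x y t"
  have e: "?j m = j m" if "m \<in> orders 4" for m using taylor_jet_at[OF that] .
  have 1: "heat_form f s ?j = heat_form f s j" for s by (rule heat_form_cong) (rule e)
  have 2: "coeff_x X x y t ?j = coeff_x X x y t j" using e[of "(0, 0, 0)"] by (simp add: coeff_x_def orders_def)
  have 3: "heat_form f x (\<lambda>(a, b, c). prolongation_coeff X a b c x y t ?j)
      = heat_form f x (\<lambda>(a, b, c). prolongation_coeff X a b c x y t j)"
  proof (rule heat_form_cong)
    fix m assume "m \<in> orders 4"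
    then obtain a b c where m: "m = (a, b, c)" "a + b + c \<le> 4" by (auto simp: orders_def)
    have "prolongation_coeff X a b c x y t ?j = prolongation_coeff X a b c x y t j"
      by (rule depends_on_orderD[OF depends_on_order_prolongation_coeff]) (use m e in \<open>auto simp: orders_def\<close>)
    then show "(case m of (a, b, c) \<Rightarrow> prolongation_coeff X a b c x y t ?j)
        = (case m of (a, b, c) \<Rightarrow> prolongation_coeff X a b c x y t j)" by (simp add: m)
  qed
  show ?thesis unfolding fourth_prolongation_eq[OF f open_I assms] 1 2 3 ..
qed

lemma taylor_values:
  fixes x y t :: real and j :: jet
  defines "u \<equiv> \<lambda>x' y' t'. taylor_jet x y t j x' y' t' (0, 0, 0)"
  assumes x: "x \<in> I"
  shows "u x y t = j (0, 0, 0)" "dx u x y t = j (1, 0, 0)" "dy u x y t = j (0, 1, 0)" "dt u x y t = j (0, 0, 1)"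
    "dx (dx u) x y t = j (2, 0, 0)" "dx (dx (dx u)) x y t = j (3, 0, 0)"
    "dy (dy u) x y t = j (0, 2, 0)" "dy (dy (dy u)) x y t = j (0, 3, 0)"
    "heat_op f u x y t = heat_form f x j"
    "laplacian f u x y t = deriv f x * j (1, 0, 0) + j (2, 0, 0) + met x * j (0, 2, 0)"
    "dx (laplacian f u) x y t = deriv (deriv f) x * j (1, 0, 0) + deriv f x * j (2, 0, 0) + j (3, 0, 0)
      - 2 * deriv f x * met x * j (0, 2, 0) + met x * j (1, 2, 0)"
    "dy (laplacian f u) x y t = deriv f x * j (1, 1, 0) + j (2, 1, 0) + met x * j (0, 3, 0)"
proof -
  note d = holonomic_partials[OF holonomic_taylor_jet]
  have e: "a + b + c \<le> 4 \<Longrightarrow> taylor_jet x y t j x y t (a, b, c) = j (a, b, c)" for a b c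
    using taylor_jet_at[of "(a, b, c)"] by (simp add: orders_def)
  have o: "open (I \<times> (UNIV :: (real \<times> real) set))" using open_I by (simp add: open_Times)
  have u: "C3 (Suc (Suc (Suc 0))) (I \<times> UNIV) u" unfolding u_def by (rule C3_subset[OF C3_taylor_jet]) simp
  note l = laplacian_first_derivs[OF o subset_refl u, of x y t]
  show "u x y t = j (0, 0, 0)" "dx u x y t = j (1, 0, 0)" "dy u x y t = j (0, 1, 0)" "dt u x y t = j (0, 0, 1)"
    "dx (dx u) x y t = j (2, 0, 0)" "dx (dx (dx u)) x y t = j (3, 0, 0)"
    "dy (dy u) x y t = j (0, 2, 0)" "dy (dy (dy u)) x y t = j (0, 3, 0)"
    "laplacian f u x y t = deriv f x * j (1, 0, 0) + j (2, 0, 0) + met x * j (0, 2, 0)"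
    by (simp_all add: laplacian_eq u_def d e eval_nat_numeral)
  show "dx (laplacian f u) x y t = deriv (deriv f) x * j (1, 0, 0) + deriv f x * j (2, 0, 0) + j (3, 0, 0)
      - 2 * deriv f x * met x * j (0, 2, 0) + met x * j (1, 2, 0)"
    "dy (laplacian f u) x y t = deriv f x * j (1, 1, 0) + j (2, 1, 0) + met x * j (0, 3, 0)"
    using l x by (simp_all add: u_def d e eval_nat_numeral)
  have "heat_op f u x y t = heat_form f x (taylor_jet x y t j x y t)"
    unfolding u_def by (rule heat_op_jet[OF holonomic_taylor_jet C3_taylor_jet x])
  also have "\<dots> = heat_form f x j" by (rule heat_form_cong) (rule taylor_jet_at)
  finally show "heat_op f u x y t = heat_form f x j" .
qed

lemma C3_of_xy:
  assumes "C_k_on k (\<lambda>(x, y). g x y) (I \<times> J)"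
  shows "C3 k (I \<times> J \<times> T) (\<lambda>x y t. g x y)"
proof -
  have "C_k_on k (\<lambda>p. (\<lambda>(x, y). g x y) (fst p, fst (snd p))) (I \<times> J \<times> T)"
    by (rule C_k_on_compose[OF open_IJT(1) _ assms]) (auto intro!: C_k_on_intros open_IJT(1))
  then show ?thesis by (simp add: C3_iff)
qed

lemma is_solution_iff: "is_solution f I J T G \<longleftrightarrow> C3 4 (I \<times> J \<times> T) G \<and> (\<forall>x\<in>I. \<forall>y\<in>J. \<forall>t\<in>T. heat_op f G x y t = 0)"
  by (auto simp: is_solution_def C3_def heat_op_def dt_def)

text \<open>For a constant \<lambda> = \<Lambda> the gradient and Laplacian terms of
  \<open>symmetry_condition\<close> disappear. On a jet of the equation the bilaplacian equals
  \<open>u_t\<close>, so \<open>4 * \<Lambda>\<close> times it cancels the contribution of the time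
  component, and the \<open>u\<close>-component is handled by linearity.\<close>

theorem homothety_imp_symmetry:
  assumes hom: "homothety f I J \<Lambda> \<xi> \<phi>" and G: "is_solution f I J T G"
    and X: "\<And>x y t u. (x, y, t, u) \<in> \<Omega> \<Longrightarrow> X (x, y, t, u) = (\<xi> x y, \<phi> x y, 4 * \<Lambda> * t + c, a * u + G x y t)"
    and X0: "\<And>p. p \<notin> \<Omega> \<Longrightarrow> X p = 0"
  shows "X \<in> lie_symmetries f \<Omega>"
proof -
  let ?S = "I \<times> J \<times> T"
  have S: "open ?S" by (rule open_IJT)
  have oIJ: "open (I \<times> J)" using intervals by (auto simp: open_interval_def intro!: open_Times)
  have C2: "C_k_on 4 (\<lambda>p. g (fst p) (fst (snd p))) \<Omega>" if "C_k_on 4 (\<lambda>(x, y). g x y) (I \<times> J)" for g :: "real \<Rightarrow> real \<Rightarrow> real"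
  proof -
    have "C_k_on 4 (\<lambda>p. (\<lambda>(x, y). g x y) (fst p, fst (snd p))) \<Omega>"
      by (rule C_k_on_compose[OF open_\<Omega> _ that]) (auto simp: \<Omega>_def intro!: C_k_on_intros open_\<Omega>[unfolded \<Omega>_def])
    then show ?thesis by simp
  qed
  have "C_k_on 4 (\<lambda>p. (\<lambda>p. G (fst p) (fst (snd p)) (snd (snd p))) (fst p, fst (snd p), fst (snd (snd p)))) \<Omega>"
    by (rule C_k_on_compose[OF open_\<Omega>, of _ _ _ ?S])
      (use G in \<open>auto simp: \<Omega>_def is_solution_iff C3_iff intro!: C_k_on_intros open_\<Omega>[unfolded \<Omega>_def]\<close>)
  then have C4: "C_k_on 4 (\<lambda>p. G (fst p) (fst (snd p)) (fst (snd (snd p)))) \<Omega>" by simp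
  have CX: "C_k_on 4 X \<Omega>"
  proof (rule C_k_on_cong[OF open_\<Omega>])
    show "C_k_on 4 (\<lambda>p. (\<xi> (fst p) (fst (snd p)), \<phi> (fst p) (fst (snd p)), 4 * \<Lambda> * fst (snd (snd p)) + c,
        a * snd (snd (snd p)) + G (fst p) (fst (snd p)) (fst (snd (snd p))))) \<Omega>"
      using hom by (intro C_k_on_intros open_\<Omega> C2 C4) (auto simp: homothety_def)
  qed (use X in \<open>auto simp: case_prod_unfold\<close>)
  have "fourth_prolongation X (biharmonic_heat f) x y t j = 0"
    if q: "(x, y, t, j (0, 0, 0)) \<in> \<Omega>" and H: "biharmonic_heat f x y t j = 0" for x y t j
  proof -
    have x: "x \<in> I" "y \<in> J" "t \<in> T" using q by (auto simp: \<Omega>_def)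
    have H0: "heat_form f x j = 0" using H biharmonic_heat_eq[OF f open_I x(1)] by simp
    define u where "u = (\<lambda>x' y' t'. taylor_jet x y t j x' y' t' (0, 0, 0))"
    define D where "D = {(x, y, t). (x, y, t, u x y t) \<in> \<Omega>}"
    interpret F: surface_composition f I \<Omega> D u unfolding D_def u_def by (rule taylor_composition)
    have DS: "D \<subseteq> ?S" by (auto simp: D_def \<Omega>_def)
    have Du: "D = {(x', y', t'). (x', y', t', taylor_jet x y t j x' y' t' (0, 0, 0)) \<in> \<Omega>}"
      by (simp add: D_def u_def)
    note tv = taylor_values[OF x(1), of y t j, folded u_def]
    have pD: "(x, y, t) \<in> D" using q taylor_values(1)[OF x(1), of y t j] by (simp add: D_def u_def)
    have conf: "dx (\<lambda>x y t. \<xi> x y) x y t = \<Lambda>" "dy (\<lambda>x y t. \<phi> x y) x y t = \<Lambda> - deriv f x * \<xi> x y"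
      "dx (\<lambda>x y t. \<phi> x y) x y t = - met x * dy (\<lambda>x y t. \<xi> x y) x y t" if "(x, y, t) \<in> D" for x y t
    proof -
      have xy: "x \<in> I" "y \<in> J" using that DS by auto
      then obtain d where d: "((\<lambda>s. \<xi> x s) has_real_derivative d) (at y)"
        "((\<lambda>s. \<phi> s y) has_real_derivative - met x * d) (at x)" using hom unfolding homothety_def by blast
      have "((\<lambda>s. \<xi> s y) has_real_derivative \<Lambda>) (at x)" "((\<lambda>s. \<phi> x s) has_real_derivative \<Lambda> - deriv f x * \<xi> x y) (at y)"
        using hom xy unfolding homothety_def by blast+
      with d show "dx (\<lambda>x y t. \<xi> x y) x y t = \<Lambda>" "dy (\<lambda>x y t. \<phi> x y) x y t = \<Lambda> - deriv f x * \<xi> x y"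
        "dx (\<lambda>x y t. \<phi> x y) x y t = - met x * dy (\<lambda>x y t. \<xi> x y) x y t"
        by (simp_all add: dx_def dy_def DERIV_imp_deriv)
    qed
    have c: "dx (\<lambda>x y t. c') = (\<lambda>x y t. 0)" "dy (\<lambda>x y t. c') = (\<lambda>x y t. 0)" for c' :: real
      by (simp_all add: fun_eq_iff dx_def dy_def)
    have dtau: "deriv (\<lambda>t. 4 * \<Lambda> * t + c) t = 4 * \<Lambda>"
      by (rule DERIV_imp_deriv) (auto intro!: derivative_eq_intros)
    let ?z = "\<lambda>p. a * snd (snd (snd p)) + G (fst p) (fst (snd p)) (fst (snd (snd p)))"
    have 1: "fourth_prolongation X (biharmonic_heat f) x y t (taylor_jet x y t j x y t) =
      heat_op f (\<lambda>x y t. ?z (x, y, t, u x y t)) x y t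
      - dt (\<lambda>x y t. \<xi> x y) x y t * taylor_jet x y t j x y t (1, 0, 0)
      - dt (\<lambda>x y t. \<phi> x y) x y t * taylor_jet x y t j x y t (0, 1, 0)
      - deriv (\<lambda>t. 4 * \<Lambda> * t + c) t * taylor_jet x y t j x y t (0, 0, 1) + 4 * \<Lambda> * laplacian f (laplacian f u) x y t
      + 2 * laplacian f u x y t * laplacian f (\<lambda>x y t. \<Lambda>) x y t
      + 4 * (dx (\<lambda>x y t. \<Lambda>) x y t * dx (laplacian f u) x y t + met x * dy (\<lambda>x y t. \<Lambda>) x y t * dy (laplacian f u) x y t)"
      unfolding u_def
      by (rule symmetry_condition[OF taylor_lift[OF CX] \<Omega>_subset Du]) (use X conf pD in auto)
    have G4: "C3 4 D G" using G DS by (auto simp: is_solution_iff intro: C3_subset)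
    have zu: "C3 4 D (\<lambda>x y t. a * u x y t)" by (intro C3_mult C3_const F.open_D F.smooth_u)
    have "heat_op f (\<lambda>x y t. ?z (x, y, t, u x y t)) x y t = a * heat_op f u x y t + heat_op f G x y t"
      using heat_op_add[OF F.open_D F.D_subset zu G4 pD] heat_op_cmult[where g = "\<lambda>_. a", OF F.open_D F.D_subset C3_const F.smooth_u pD]
      by simp
    also have "\<dots> = 0" using tv(9) H0 G x by (simp add: is_solution_iff)
    finally have 2: "heat_op f (\<lambda>x y t. ?z (x, y, t, u x y t)) x y t = 0" .
    have 3: "laplacian f (laplacian f u) x y t = j (0, 0, 1)"
      using tv(4,9) H0 by (simp add: heat_op_def)
    have 4: "dt (\<lambda>x y t. \<xi> x y) x y t = 0" "dt (\<lambda>x y t. \<phi> x y) x y t = 0" by (simp_all add: dt_def)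
    have 5: "taylor_jet x y t j x y t (0, 0, 1) = j (0, 0, 1)" by (rule taylor_jet_at) (simp add: orders_def)
    show ?thesis
      unfolding fourth_prolongation_taylor[OF x(1), of X y t j] 1 2 3 4 5 dtau by (simp add: c laplacian_eq[of f "\<lambda>x y t. \<Lambda>"])
  qed
  then show ?thesis using CX X0 by (auto simp: lie_symmetries_def)
qed

end

text \<open>A base point serves to freeze variables once independence of them is known; the second
  value \<open>u2\<close> is there to read off the slope of the \<open>u\<close>-component.\<close>

locale point_symmetry = surface_domain +
  fixes X :: vfield and x1 y1 t1 u1 u2 :: real
  assumes X: "X \<in> lie_symmetries f (I \<times> J \<times> T \<times> U)"
    and base: "x1 \<in> I" "y1 \<in> J" "t1 \<in> T" "u1 \<in> U" "u2 \<in> U" "u1 \<noteq> u2"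
begin

definition "\<xi>4 p = fst (X p)"
definition "\<phi>4 p = fst (snd (X p))"
definition "\<tau>4 p = fst (snd (snd (X p)))"
definition "\<zeta> p = snd (snd (snd (X p)))"

lemma CX: "C_k_on 4 X \<Omega>"
  using X by (simp add: lie_symmetries_def \<Omega>_def)

lemma C4: "C_k_on 4 \<xi>4 \<Omega>" "C_k_on 4 \<phi>4 \<Omega>" "C_k_on 4 \<tau>4 \<Omega>" "C_k_on 4 \<zeta> \<Omega>"
  unfolding \<xi>4_def[abs_def] \<phi>4_def[abs_def] \<tau>4_def[abs_def] \<zeta>_def[abs_def]
  by (intro C_k_on_fst_comp C_k_on_snd_comp open_\<Omega> CX)+

lemma C4': "C_k_on (Suc 3) \<xi>4 \<Omega>" "C_k_on (Suc 3) \<phi>4 \<Omega>" "C_k_on (Suc 3) \<tau>4 \<Omega>" "C_k_on (Suc 3) \<zeta> \<Omega>"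
  using C4 by (simp_all add: eval_nat_numeral del: C_k_on.simps)

lemma prolongation_zero:
  assumes "(x, y, t, j (0, 0, 0)) \<in> \<Omega>" "heat_form f x j = 0"
  shows "fourth_prolongation X (biharmonic_heat f) x y t j = 0"
proof -
  have "x \<in> I" using assms(1) by (auto simp: \<Omega>_def)
  then have "biharmonic_heat f x y t j = 0" using biharmonic_heat_eq[OF f open_I] assms(2) by simp
  then show ?thesis using X assms(1) unfolding lie_symmetries_def \<Omega>_def by blast
qed

lemma principal:
  assumes p: "(x, y, t, u) \<in> \<Omega>"
  shows "px \<tau>4 (x, y, t, u) = 0" "py \<tau>4 (x, y, t, u) = 0" "pu \<tau>4 (x, y, t, u) = 0"
    "pu \<xi>4 (x, y, t, u) = 0" "pu \<phi>4 (x, y, t, u) = 0"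
    "px \<phi>4 (x, y, t, u) = - met x * py \<xi>4 (x, y, t, u)"
    "py \<phi>4 (x, y, t, u) = px \<xi>4 (x, y, t, u) - deriv f x * \<xi>4 (x, y, t, u)"
proof -
  have x: "x \<in> I" using p by (auto simp: \<Omega>_def)
  let ?q = "(x, y, t, u)"
  have sym: "coeff_x X x y t j * deriv (\<lambda>s. heat_form f s j) x
      + heat_form f x (\<lambda>(a, b, c). prolongation_coeff X a b c x y t j) = 0"
    if "j (0, 0, 0) = u" "heat_form f x j = 0" for j
    using prolongation_zero[of x y t j] that p unfolding fourth_prolongation_eq[OF f open_I x] by simp
  have c: "coeff_x X = (\<lambda>x y t j. \<xi>4 (x, y, t, j (0, 0, 0)))" "coeff_y X = (\<lambda>x y t j. \<phi>4 (x, y, t, j (0, 0, 0)))"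
    "coeff_t X = (\<lambda>x y t j. \<tau>4 (x, y, t, j (0, 0, 0)))"
    by (simp_all add: fun_eq_iff coeff_x_def coeff_y_def coeff_t_def \<xi>4_def \<phi>4_def \<tau>4_def)
  \<comment> \<open>The first derivatives \<alpha> of \<open>u\<close> in \<open>x\<close> and
    \<beta> in \<open>y\<close> are free, and the equations are affine in them; the values 0 and 1
    separate the coefficients.\<close>
  have E: "px \<tau>4 ?q + \<alpha> * pu \<tau>4 ?q = 0" "py \<tau>4 ?q + \<beta> * pu \<tau>4 ?q = 0"
    "px \<phi>4 ?q + \<alpha> * pu \<phi>4 ?q + met x * (py \<xi>4 ?q + \<beta> * pu \<xi>4 ?q) = 0"
    "deriv f x * \<xi>4 ?q = px \<xi>4 ?q + \<alpha> * pu \<xi>4 ?q - (py \<phi>4 ?q + \<beta> * pu \<phi>4 ?q)" for \<alpha> \<beta>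
  proof -
    define j :: jet where "j = (\<lambda>m. if m = (0, 0, 0) then u else if m = (1, 0, 0) then \<alpha> else if m = (0, 1, 0) then \<beta> else 0)"
    have j: "j (0, 0, 0) = u" "j (1, 0, 0) = \<alpha>" "j (0, 1, 0) = \<beta>" by (simp_all add: j_def)
    note P = principal_determining_equations[where X = X and y = y and t = t and j = j, OF x sym j(1)]
    show "px \<tau>4 ?q + \<alpha> * pu \<tau>4 ?q = 0" "py \<tau>4 ?q + \<beta> * pu \<tau>4 ?q = 0"
      "px \<phi>4 ?q + \<alpha> * pu \<phi>4 ?q + met x * (py \<xi>4 ?q + \<beta> * pu \<xi>4 ?q) = 0"
      "deriv f x * \<xi>4 ?q = px \<xi>4 ?q + \<alpha> * pu \<xi>4 ?q - (py \<phi>4 ?q + \<beta> * pu \<phi>4 ?q)"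
      using P unfolding c Dx_base[of \<tau>4] Dx_base[of \<xi>4] Dx_base[of \<phi>4] Dy_base[of \<tau>4] Dy_base[of \<xi>4] Dy_base[of \<phi>4] j
      by auto
  qed
  show 1: "px \<tau>4 ?q = 0" "py \<tau>4 ?q = 0" using E(1,2)[of 0] by auto
  show "pu \<tau>4 ?q = 0" using E(1)[of 1] 1 by simp
  show 2: "pu \<phi>4 ?q = 0" using E(3)[of 1 0] E(3)[of 0 0] by simp
  show 3: "pu \<xi>4 ?q = 0" using E(4)[of 1 0] E(4)[of 0 0] by simp
  show "px \<phi>4 ?q = - met x * py \<xi>4 ?q" using E(3)[of 0 0] by simp
  show "py \<phi>4 ?q = px \<xi>4 ?q - deriv f x * \<xi>4 ?q" using E(4)[of 0 0] by simp
qed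

definition "\<xi> x y t = \<xi>4 (x, y, t, u1)"
definition "\<phi> x y t = \<phi>4 (x, y, t, u1)"
definition "\<tau> t = \<tau>4 (x1, y1, t, u1)"

lemma constant_in_u:
  assumes "C_k_on (Suc k) h \<Omega>" "\<And>p. p \<in> \<Omega> \<Longrightarrow> pu h p = 0" "(x, y, t, u) \<in> \<Omega>" "u' \<in> U"
  shows "h (x, y, t, u) = h (x, y, t, u')"
  using interval_constant[OF intervals(4), of "\<lambda>s. h (x, y, t, s)" u u']
    C_k_on_has_partials(4)[OF assms(1)] assms(2-4) by (simp add: \<Omega>_def)

lemma constant_in_x:
  assumes "C_k_on (Suc k) h \<Omega>" "\<And>p. p \<in> \<Omega> \<Longrightarrow> px h p = 0" "(x, y, t, u) \<in> \<Omega>" "x' \<in> I"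
  shows "h (x, y, t, u) = h (x', y, t, u)"
  using interval_constant[OF intervals(1), of "\<lambda>s. h (s, y, t, u)" x x']
    C_k_on_has_partials(1)[OF assms(1)] assms(2-4) by (simp add: \<Omega>_def)

lemma constant_in_y:
  assumes "C_k_on (Suc k) h \<Omega>" "\<And>p. p \<in> \<Omega> \<Longrightarrow> py h p = 0" "(x, y, t, u) \<in> \<Omega>" "y' \<in> J"
  shows "h (x, y, t, u) = h (x, y', t, u)"
  using interval_constant[OF intervals(2), of "\<lambda>s. h (x, s, t, u)" y y']
    C_k_on_has_partials(2)[OF assms(1)] assms(2-4) by (simp add: \<Omega>_def)

lemma constant_in_xyu:
  assumes "C_k_on (Suc k) h \<Omega>" "\<And>p. p \<in> \<Omega> \<Longrightarrow> px h p = 0" "\<And>p. p \<in> \<Omega> \<Longrightarrow> py h p = 0"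
    "\<And>p. p \<in> \<Omega> \<Longrightarrow> pu h p = 0" "(x, y, t, u) \<in> \<Omega>"
  shows "h (x, y, t, u) = h (x1, y1, t, u1)"
  using constant_in_x[OF assms(1,2,5) base(1)] constant_in_y[OF assms(1,3), of x1 y t u y1]
    constant_in_u[OF assms(1,4), of x1 y1 t u u1] assms(5) base by (simp add: \<Omega>_def)

lemma X_eq: "(x, y, t, u) \<in> \<Omega> \<Longrightarrow> X (x, y, t, u) = (\<xi> x y t, \<phi> x y t, \<tau> t, \<zeta> (x, y, t, u))"
  using constant_in_u[OF C4'(1), of x y t u u1] constant_in_u[OF C4'(2), of x y t u u1]
    constant_in_xyu[OF C4'(3), of x y t u] principal base(4)
  by (simp add: prod_eq_iff \<xi>_def \<phi>_def \<tau>_def \<zeta>_def \<xi>4_def \<phi>4_def \<tau>4_def split_paired_all)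

lemma C3_at_u1: "C_k_on k h \<Omega> \<Longrightarrow> C3 k (I \<times> J \<times> T) (\<lambda>x y t. h (x, y, t, u1))"
  by (rule C3_graph[OF open_IJT(1) C3_const]) (auto simp: \<Omega>_def base)

abbreviation "lam \<equiv> dx \<xi>"

lemma conformal:
  assumes "(x, y, t) \<in> I \<times> J \<times> T"
  shows "dy \<phi> x y t = lam x y t - deriv f x * \<xi> x y t" "dx \<phi> x y t = - met x * dy \<xi> x y t"
  using principal(6,7)[of x y t u1] assms base
  by (simp_all add: \<Omega>_def \<xi>_def[abs_def] \<phi>_def[abs_def] dx_def dy_def px_def py_def)

text \<open>On a jet of the equation the bilaplacian of the Taylor polynomial is
  \<open>j (0, 0, 1)\<close>, which merges \<tau>' and 4 \<lambda> into one coefficient. All other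
  terms are written out in coordinates so that test jets can be inserted.\<close>

lemma condition:
  assumes q: "(x, y, t, j (0, 0, 0)) \<in> \<Omega>" and H: "heat_form f x j = 0"
  defines "u \<equiv> \<lambda>x' y' t'. taylor_jet x y t j x' y' t' (0, 0, 0)"
  shows "heat_op f (\<lambda>x y t. \<zeta> (x, y, t, u x y t)) x y t = dt \<xi> x y t * j (1, 0, 0) + dt \<phi> x y t * j (0, 1, 0)
    + (deriv \<tau> t - 4 * lam x y t) * j (0, 0, 1)
    - 2 * (deriv f x * j (1, 0, 0) + j (2, 0, 0) + met x * j (0, 2, 0)) * laplacian f lam x y t
    - 4 * (dx lam x y t * (deriv (deriv f) x * j (1, 0, 0) + deriv f x * j (2, 0, 0) + j (3, 0, 0)
        - 2 * deriv f x * met x * j (0, 2, 0) + met x * j (1, 2, 0))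
      + met x * dy lam x y t * (deriv f x * j (1, 1, 0) + j (2, 1, 0) + met x * j (0, 3, 0)))"
proof -
  have x: "x \<in> I" using q by (auto simp: \<Omega>_def)
  define D where "D = {(x, y, t). (x, y, t, u x y t) \<in> \<Omega>}"
  note tv = taylor_values[OF x, of y t j, folded u_def]
  have pD: "(x, y, t) \<in> D" using q taylor_values(1)[OF x, of y t j] by (simp add: D_def u_def)
  have DS: "D \<subseteq> I \<times> J \<times> T" by (auto simp: D_def \<Omega>_def)
  have Du: "D = {(x', y', t'). (x', y', t', taylor_jet x y t j x' y' t' (0, 0, 0)) \<in> \<Omega>}"
    by (simp add: D_def u_def)
  have jj: "taylor_jet x y t j x y t m = j m" if "m \<in> orders 4" for m by (rule taylor_jet_at[OF that])
  have "fourth_prolongation X (biharmonic_heat f) x y t (taylor_jet x y t j x y t) =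
      heat_op f (\<lambda>x y t. \<zeta> (x, y, t, u x y t)) x y t
      - dt \<xi> x y t * taylor_jet x y t j x y t (1, 0, 0) - dt \<phi> x y t * taylor_jet x y t j x y t (0, 1, 0)
      - deriv \<tau> t * taylor_jet x y t j x y t (0, 0, 1) + 4 * lam x y t * laplacian f (laplacian f u) x y t
      + 2 * laplacian f u x y t * laplacian f lam x y t
      + 4 * (dx lam x y t * dx (laplacian f u) x y t + met x * dy lam x y t * dy (laplacian f u) x y t)"
    unfolding u_def
    by (rule symmetry_condition[OF taylor_lift[OF CX] \<Omega>_subset Du]) (use X_eq conformal pD DS in auto)
  moreover have "laplacian f (laplacian f u) x y t = j (0, 0, 1)"
    using tv(4,9) H by (simp add: heat_op_def)
  moreover have "fourth_prolongation X (biharmonic_heat f) x y t (taylor_jet x y t j x y t) = 0"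
    using prolongation_zero[OF q H] fourth_prolongation_taylor[OF x, of X y t j] by simp
  ultimately show ?thesis
    by (simp add: tv(10-12) jj orders_def algebra_simps)
qed

lemma taylor_jet_eq_0:
  "(\<And>m. fst m \<noteq> 0 \<Longrightarrow> j m = 0) \<Longrightarrow> taylor_jet x y t j x' y' t' (Suc a, b, c) = 0"
  "(\<And>m. fst (snd m) \<noteq> 0 \<Longrightarrow> j m = 0) \<Longrightarrow> taylor_jet x y t j x' y' t' (a, Suc b, c) = 0"
  unfolding taylor_jet_def case_prod_conv
  by (rule sum.neutral, auto simp: divided_power_def)+

text \<open>A jet without \<open>y\<close>-coordinates has a Taylor polynomial independent of
  \<open>y\<close>, so \<open>heat_op_along_x\<close> applies to its composition with
  \<zeta>.\<close>

lemma condition_x: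
  assumes q: "(x, y, t, j (0, 0, 0)) \<in> \<Omega>" and H: "heat_form f x j = 0"
    and j: "\<And>m. fst (snd m) \<noteq> 0 \<Longrightarrow> j m = 0" "j (1, 0, 0) = 0"
  defines "p \<equiv> (x, y, t, j (0, 0, 0))"
  shows "surface_composition.frozen_x f \<zeta> p
    - ((pu (px (px \<zeta>)) p + 2 * px (pu (px \<zeta>)) p + 3 * px (px (pu \<zeta>)) p
        + 2 * deriv f x * (pu (px \<zeta>) p + 2 * px (pu \<zeta>) p) + 2 * met x * pu (py (py \<zeta>)) p) * j (2, 0, 0)
      + 3 * pu (pu \<zeta>) p * (j (2, 0, 0))\<^sup>2 + (pu (px \<zeta>) p + 3 * px (pu \<zeta>) p) * j (3, 0, 0))
    = (deriv \<tau> t - 4 * lam x y t) * j (0, 0, 1) - 2 * j (2, 0, 0) * laplacian f lam x y t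
      - 4 * dx lam x y t * (deriv f x * j (2, 0, 0) + j (3, 0, 0))"
proof -
  have x: "x \<in> I" using q by (auto simp: \<Omega>_def)
  define u where "u = (\<lambda>x' y' t'. taylor_jet x y t j x' y' t' (0, 0, 0))"
  define D where "D = {(x, y, t). (x, y, t, u x y t) \<in> \<Omega>}"
  interpret F: surface_composition f I \<Omega> D u unfolding D_def u_def by (rule taylor_composition)
  note tv = taylor_values[OF x, of y t j, folded u_def]
  have ux: "u x y t = j (0, 0, 0)" using taylor_values(1)[OF x, of y t j] by (simp add: u_def)
  have pD: "(x, y, t) \<in> D" using q ux by (simp add: D_def)
  have uy: "dy u x' y' t' = 0" for x' y' t'
    unfolding u_def holonomic_partials[OF holonomic_taylor_jet] using taylor_jet_eq_0(2)[OF j(1)] by simp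
  have "heat_op f (F.along \<zeta>) x y t = (deriv \<tau> t - 4 * lam x y t) * j (0, 0, 1) - 2 * j (2, 0, 0) * laplacian f lam x y t
      - 4 * dx lam x y t * (deriv f x * j (2, 0, 0) + j (3, 0, 0))"
    unfolding F.along_def[abs_def] unfolding u_def using condition[OF q H] j by simp
  then show ?thesis
    using F.heat_op_along_x[OF C4(4) pD uy] tv H j(2) by (simp add: ux p_def)
qed

lemma condition_y:
  assumes q: "(x, y, t, j (0, 0, 0)) \<in> \<Omega>" and H: "heat_form f x j = 0"
    and j: "\<And>m. fst m \<noteq> 0 \<Longrightarrow> j m = 0" "j (0, 1, 0) = 0" "j (0, 2, 0) = 0" "j (0, 0, 1) = 0"
  defines "p \<equiv> (x, y, t, j (0, 0, 0))"
  shows "surface_composition.frozen_y f \<zeta> p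
    - (met x)\<^sup>2 * (pu (py \<zeta>) p + 3 * py (pu \<zeta>) p) * j (0, 3, 0)
    = - 4 * met x * dy lam x y t * (met x * j (0, 3, 0))"
proof -
  have x: "x \<in> I" using q by (auto simp: \<Omega>_def)
  define u where "u = (\<lambda>x' y' t'. taylor_jet x y t j x' y' t' (0, 0, 0))"
  define D where "D = {(x, y, t). (x, y, t, u x y t) \<in> \<Omega>}"
  interpret F: surface_composition f I \<Omega> D u unfolding D_def u_def by (rule taylor_composition)
  note tv = taylor_values[OF x, of y t j, folded u_def]
  have ux: "u x y t = j (0, 0, 0)" using taylor_values(1)[OF x, of y t j] by (simp add: u_def)
  have pD: "(x, y, t) \<in> D" using q ux by (simp add: D_def)
  have dxu: "dx u x' y' t' = 0" for x' y' t'
    unfolding u_def holonomic_partials[OF holonomic_taylor_jet] using taylor_jet_eq_0(1)[OF j(1)] by simp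
  have "heat_op f (F.along \<zeta>) x y t = - 4 * met x * dy lam x y t * (met x * j (0, 3, 0))"
    unfolding F.along_def[abs_def] unfolding u_def using condition[OF q H] j by simp
  then show ?thesis
    using F.heat_op_along_y[OF C4(4) pD dxu] tv H j by (simp add: ux p_def)
qed

text \<open>The jet with value \<open>u\<close> and no derivatives lies on the equation. The part of
  the condition with frozen \<open>u\<close> therefore vanishes separately and drops out of every
  later test.\<close>

lemma frozen_zero:
  assumes "(x, y, t, u) \<in> \<Omega>"
  shows "surface_composition.frozen_x f \<zeta> (x, y, t, u) = 0" "surface_composition.frozen_y f \<zeta> (x, y, t, u) = 0"
  using condition_x[of x y t "\<lambda>m. if m = (0, 0, 0) then u else 0"]
    condition_y[of x y t "\<lambda>m. if m = (0, 0, 0) then u else 0"] assms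
  by (auto simp: heat_form_def)

text \<open>The jet with \<open>u_t = u_xxxx = 1\<close> lies on the equation, the two entries
  cancelling. As \<open>u_xx\<close> and \<open>u_xxx\<close> vanish, only the coefficient of
  \<open>u_t\<close> is left.\<close>

lemma lam_eq:
  assumes "(x, y, t) \<in> I \<times> J \<times> T"
  shows "lam x y t = deriv \<tau> t / 4"
proof -
  have q: "(x, y, t, u1) \<in> \<Omega>" using assms base by (simp add: \<Omega>_def)
  show ?thesis
    using condition_x[of x y t "\<lambda>m. if m = (0, 0, 0) then u1 else if m = (0, 0, 1) \<or> m = (4, 0, 0) then 1 else 0"]
      frozen_zero(1)[OF q] q
    by (auto simp: heat_form_def)
qed

lemma lam_derivs:
  assumes "(x, y, t) \<in> I \<times> J \<times> T"
  shows "dx lam x y t = 0" "dy lam x y t = 0" "laplacian f lam x y t = 0"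
proof -
  have e: "lam x y t = (\<lambda>x y t. deriv \<tau> t / 4) x y t" if "(x, y, t) \<in> I \<times> J \<times> T" for x y t
    using lam_eq[OF that] .
  have c: "dx (\<lambda>x y. g) = (\<lambda>x y t. 0)" "dy (\<lambda>x y. g) = (\<lambda>x y t. 0)" for g :: "real \<Rightarrow> real"
    by (simp_all add: fun_eq_iff dx_def dy_def)
  show "dx lam x y t = 0" "dy lam x y t = 0" "laplacian f lam x y t = 0"
    using dx_cong[OF open_IJT(1) e assms] dy_cong[OF open_IJT(1) e assms]
      laplacian_cong[where f = f, OF open_IJT(1) e assms]
    by (simp_all add: laplacian_eq[of f "\<lambda>x y t. deriv \<tau> t / 4"] c)
qed

text \<open>The jet has \<open>u_xxx = 1\<close>, and \<open>u_xxxx = - 2 * deriv f x\<close>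
  balances the third-order term of the equation. With \<lambda> independent of \<open>x\<close>,
  four copies of the mixed derivative of \<zeta> remain.\<close>

lemma px_pu_zeta:
  assumes "p \<in> \<Omega>"
  shows "px (pu \<zeta>) p = 0" "pu (px \<zeta>) p = 0"
proof -
  obtain x y t u where p: "p = (x, y, t, u)" by (metis prod.exhaust)
  have z: "C_k_on (Suc (Suc 2)) \<zeta> \<Omega>" using C4(4) by (simp add: eval_nat_numeral del: C_k_on.simps)
  have q: "(x, y, t, u) \<in> \<Omega>" and xyt: "(x, y, t) \<in> I \<times> J \<times> T" using assms p by (simp_all add: \<Omega>_def)
  have "pu (px \<zeta>) p + 3 * px (pu \<zeta>) p = 0"
    using condition_x[of x y t "\<lambda>m. if m = (0, 0, 0) then u else if m = (3, 0, 0) then 1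
        else if m = (4, 0, 0) then - 2 * deriv f x else 0"]
      frozen_zero(1)[OF q] lam_derivs[OF xyt] q
    by (auto simp: heat_form_def p)
  with px_pu_commute[OF z open_\<Omega> assms] show "px (pu \<zeta>) p = 0" "pu (px \<zeta>) p = 0" by simp_all
qed

text \<open>The coordinate \<open>u_yyy\<close> does not occur in the equation, so raising it to 1
  needs no compensation.\<close>

lemma py_pu_zeta:
  assumes "p \<in> \<Omega>"
  shows "py (pu \<zeta>) p = 0" "pu (py \<zeta>) p = 0"
proof -
  obtain x y t u where p: "p = (x, y, t, u)" by (metis prod.exhaust)
  have z: "C_k_on (Suc (Suc 2)) \<zeta> \<Omega>" using C4(4) by (simp add: eval_nat_numeral del: C_k_on.simps)
  have q: "(x, y, t, u) \<in> \<Omega>" and xyt: "(x, y, t) \<in> I \<times> J \<times> T" using assms p by (simp_all add: \<Omega>_def)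
  have "pu (py \<zeta>) p + 3 * py (pu \<zeta>) p = 0"
    using condition_y[of x y t "\<lambda>m. if m = (0, 0, 0) then u else if m = (0, 3, 0) then 1 else 0"]
      frozen_zero(2)[OF q] lam_derivs[OF xyt] q
    by (auto simp: heat_form_def p)
  with py_pu_commute[OF z open_\<Omega> assms] show "py (pu \<zeta>) p = 0" "pu (py \<zeta>) p = 0" by simp_all
qed

text \<open>The jet has \<open>u_xx = 1\<close>, balanced in \<open>u_xxxx\<close>. Every term
  linear in \<open>u_xx\<close> contains a mixed derivative of \<zeta> or a derivative of \<lambda>
  and vanishes by the preceding lemmas, so the quadratic term with factor 3 stands alone.\<close>

lemma pu_pu_zeta:
  assumes "p \<in> \<Omega>"
  shows "pu (pu \<zeta>) p = 0"
proof -
  obtain x y t u where p: "p = (x, y, t, u)" by (metis prod.exhaust)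
  have q: "(x, y, t, u) \<in> \<Omega>" and xyt: "(x, y, t) \<in> I \<times> J \<times> T" using assms p by (simp_all add: \<Omega>_def)
  have z: "C_k_on (Suc (Suc (Suc (Suc 0)))) \<zeta> \<Omega>" using C4(4) by (simp add: eval_nat_numeral del: C_k_on.simps)
  note c = px_const_on[OF open_\<Omega> px_pu_zeta(1) assms] px_const_on[OF open_\<Omega> px_pu_zeta(2) assms]
  have "pu (px (px \<zeta>)) p = 0" "pu (py (py \<zeta>)) p = 0"
    using px_pu_commute[OF C_k_on_px[OF z open_\<Omega>] open_\<Omega> assms] c(2)
      py_pu_commute[OF C_k_on_py[OF z open_\<Omega>] open_\<Omega> assms] py_const_on[OF open_\<Omega> py_pu_zeta(2) assms] by simp_all
  then show ?thesis
    using condition_x[of x y t "\<lambda>m. if m = (0, 0, 0) then u else if m = (2, 0, 0) then 1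
        else if m = (4, 0, 0) then - (2 * deriv (deriv f) x + (deriv f x)\<^sup>2) else 0"]
      frozen_zero(1)[OF q] lam_derivs[OF xyt] q c px_pu_zeta[OF assms]
    by (auto simp: heat_form_def p)
qed

text \<open>The \<open>u\<close>-derivative of \<zeta>, written as a difference quotient:
  \<open>pu \<zeta>\<close> is only known to be of class three, whereas this expression inherits
  class four, as \<open>heat_op_cmult\<close> demands.\<close>

definition "slope t = (\<zeta> (x1, y1, t, u2) - \<zeta> (x1, y1, t, u1)) / (u2 - u1)"

lemma zeta_affine:
  assumes "(x, y, t, u) \<in> \<Omega>"
  shows "\<zeta> (x, y, t, u) = \<zeta> (x, y, t, u1) + slope t * (u - u1)"
proof -
  have z3: "C_k_on (Suc 2) (pu \<zeta>) \<Omega>" using C_k_on_pu[OF C4'(4) open_\<Omega>] by (simp add: eval_nat_numeral del: C_k_on.simps)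
  define a where "a = pu \<zeta> (x1, y1, t, u1)"
  have pu: "pu \<zeta> (x', y', t, u') = a" if "(x', y', t, u') \<in> \<Omega>" for x' y' u'
    unfolding a_def using constant_in_xyu[OF z3 px_pu_zeta(1) py_pu_zeta(1) pu_pu_zeta that] .
  have aff: "\<zeta> (x', y', t, u') - a * u' = \<zeta> (x', y', t, u1) - a * u1" if "(x', y', t, u') \<in> \<Omega>" for x' y' u'
  proof (rule interval_constant[where g = "\<lambda>s. \<zeta> (x', y', t, s) - a * s", OF intervals(4)])
    show "((\<lambda>s. \<zeta> (x', y', t, s) - a * s) has_real_derivative 0) (at s)" if "s \<in> U" for s
    proof -
      have s: "(x', y', t, s) \<in> \<Omega>" using \<open>(x', y', t, u') \<in> \<Omega>\<close> that by (simp add: \<Omega>_def)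
      show ?thesis using C_k_on_has_partials(4)[OF C4'(4) s] pu[OF s] by (auto intro!: derivative_eq_intros)
    qed
  qed (use that base in \<open>auto simp: \<Omega>_def\<close>)
  have "(x1, y1, t, u2) \<in> \<Omega>" using assms base by (simp add: \<Omega>_def)
  from aff[OF this] have "slope t = a" using base(6) by (simp add: slope_def field_simps)
  with aff[OF assms] show ?thesis by (simp add: algebra_simps)
qed

lemma C_k_on_t:
  fixes h :: "real \<times> real \<times> real \<times> real \<Rightarrow> real"
  assumes "C_k_on k h \<Omega>" "u \<in> U"
  shows "C_k_on k (\<lambda>t. h (x1, y1, t, u)) T"
proof -
  have o: "open T" using intervals by (simp add: open_interval_def)
  have "C_k_on k (\<lambda>t::real. t) T" by (rule C_k_on_linear[OF bounded_linear_ident o])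
  then show ?thesis
    by (intro C_k_on_compose[OF o _ assms(1)] C_k_on_Pair C_k_on_const o) (use base assms(2) in \<open>auto simp: \<Omega>_def\<close>)
qed

lemma C3_slope: "C3 4 (I \<times> J \<times> T) (\<lambda>x y t. slope t)"
proof (rule C3_cong[OF open_IJT(1)])
  have o: "open T" using intervals by (simp add: open_interval_def)
  have "C_k_on 4 (\<lambda>t. (\<zeta> (x1, y1, t, u2) - \<zeta> (x1, y1, t, u1)) / (u2 - u1)) T"
    using base(6) by (intro C_k_on_divide C_k_on_diff C_k_on_t C4(4) C_k_on_const o base) auto
  then have "C_k_on 4 (\<lambda>p. (\<lambda>t. (\<zeta> (x1, y1, t, u2) - \<zeta> (x1, y1, t, u1)) / (u2 - u1)) (snd (snd p))) (I \<times> J \<times> T)"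
    by (rule C_k_on_compose[OF open_IJT(1), rotated]) (auto intro!: C_k_on_intros open_IJT(1))
  then show "C3 4 (I \<times> J \<times> T) (\<lambda>x y t. (\<zeta> (x1, y1, t, u2) - \<zeta> (x1, y1, t, u1)) / (u2 - u1))"
    by (simp add: C3_iff)
qed (simp add: slope_def)

lemma lower_order:
  assumes q: "(x, y, t, u) \<in> \<Omega>"
  shows "deriv slope t * (u - u1) + heat_op f (\<lambda>x y t. \<zeta> (x, y, t, u1)) x y t = dt \<xi> x y t * \<alpha> + dt \<phi> x y t * \<beta>"
proof -
  have x: "x \<in> I" "y \<in> J" "t \<in> T" using q by (auto simp: \<Omega>_def)
  \<comment> \<open>The entry at \<open>(4, 0, 0)\<close> balances the coefficient of
    \<open>u_x\<close> in the equation; \<open>u_y\<close> does not occur there.\<close>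
  define j :: jet where "j = (\<lambda>m. if m = (0, 0, 0) then u else if m = (1, 0, 0) then \<alpha> else if m = (0, 1, 0) then \<beta>
    else if m = (4, 0, 0) then - (deriv (deriv (deriv f)) x + deriv f x * deriv (deriv f) x) * \<alpha> else 0)"
  have j: "j (0, 0, 0) = u" "j (1, 0, 0) = \<alpha>" "j (0, 1, 0) = \<beta>" "j (0, 0, 1) = 0" by (simp_all add: j_def)
  have H: "heat_form f x j = 0" by (simp add: heat_form_def j_def algebra_simps)
  have qj: "(x, y, t, j (0, 0, 0)) \<in> \<Omega>" using q j by simp
  define w where "w = (\<lambda>x' y' t'. taylor_jet x y t j x' y' t' (0, 0, 0))"
  define D where "D = {(x, y, t). (x, y, t, w x y t) \<in> \<Omega>}"
  interpret F: surface_composition f I \<Omega> D w unfolding D_def w_def by (rule taylor_composition)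
  have wx: "w x y t = u" using taylor_values(1)[OF x(1), of y t j] j by (simp add: w_def)
  have Hw: "heat_op f w x y t = 0" using taylor_values(9)[OF x(1), of y t j] H by (simp add: w_def)
  have pD: "(x, y, t) \<in> D" using q wx by (simp add: D_def)
  have DS: "D \<subseteq> I \<times> J \<times> T" by (auto simp: D_def \<Omega>_def)
  have C: "C3 4 D (\<lambda>x y t. slope t)" "C3 4 D (\<lambda>x y t. \<zeta> (x, y, t, u1))" "C3 4 D (\<lambda>x y t. w x y t + - u1)"
    by (rule C3_subset[OF C3_slope DS] C3_subset[OF C3_at_u1[OF C4(4)] DS] C3_add[OF F.open_D F.smooth_u C3_const])+
  have "heat_op f (\<lambda>x y t. \<zeta> (x, y, t, w x y t)) x y t
      = heat_op f (\<lambda>x y t. \<zeta> (x, y, t, u1) + slope t * (w x y t + - u1)) x y t"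
    by (rule heat_op_cong[OF F.open_D _ pD]) (use zeta_affine in \<open>auto simp: D_def\<close>)
  also have "\<dots> = heat_op f (\<lambda>x y t. \<zeta> (x, y, t, u1)) x y t + heat_op f (\<lambda>x y t. slope t * (w x y t + - u1)) x y t"
    by (rule heat_op_add[OF F.open_D F.D_subset C(2) C3_mult[OF F.open_D C(1,3)] pD])
  also have "heat_op f (\<lambda>x y t. slope t * (w x y t + - u1)) x y t
      = deriv slope t * (w x y t + - u1) + slope t * heat_op f (\<lambda>x y t. w x y t + - u1) x y t"
    by (rule heat_op_cmult[OF F.open_D F.D_subset C(1,3) pD])
  also have "heat_op f (\<lambda>x y t. w x y t + - u1) x y t = 0"
  proof -
    have "heat_op f (\<lambda>x y t. - u1) x y t = 0"
      by (simp add: heat_op_def laplacian_def dt_def)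
    then show ?thesis using heat_op_add[OF F.open_D F.D_subset F.smooth_u C3_const pD, of "- u1"] Hw by simp
  qed
  finally have "heat_op f (\<lambda>x y t. \<zeta> (x, y, t, w x y t)) x y t
      = heat_op f (\<lambda>x y t. \<zeta> (x, y, t, u1)) x y t + deriv slope t * (u - u1)" by (simp add: wx)
  moreover have "(x, y, t) \<in> I \<times> J \<times> T" using x by simp
  ultimately show ?thesis
    using condition[OF qj H] lam_derivs[of x y t] by (simp add: j[unfolded One_nat_def] w_def)
qed

text \<open>The parameters of \<open>lower_order\<close> are varied one at a time: at
  \<open>u1\<close> with \<alpha> = \<beta> = 0 the heat operator on \<zeta> must vanish, at
  \<open>u2\<close> the derivative of the slope, and unit values of \<alpha> and \<beta> give the
  time derivatives of the spatial components.\<close>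

lemma time_independence:
  assumes "(x, y, t) \<in> I \<times> J \<times> T"
  shows "dt \<xi> x y t = 0" "dt \<phi> x y t = 0" "deriv slope t = 0" "heat_op f (\<lambda>x y t. \<zeta> (x, y, t, u1)) x y t = 0"
proof -
  have q: "(x, y, t, u1) \<in> \<Omega>" "(x, y, t, u2) \<in> \<Omega>" using assms base by (simp_all add: \<Omega>_def)
  show h: "heat_op f (\<lambda>x y t. \<zeta> (x, y, t, u1)) x y t = 0" using lower_order[OF q(1), of 0 0] by simp
  show "deriv slope t = 0" using lower_order[OF q(2), of 0 0] h base(6) by simp
  show "dt \<xi> x y t = 0" "dt \<phi> x y t = 0"
    using lower_order[OF q(1), of 1 0] lower_order[OF q(1), of 0 1] h by simp_all
qed

lemma symmetry_form:
  "\<exists>\<Lambda> \<eta> \<theta> c a G. homothety f I J \<Lambda> \<eta> \<theta> \<and> is_solution f I J T G \<and>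
    (\<forall>x y t u. (x, y, t, u) \<in> \<Omega> \<longrightarrow> X (x, y, t, u) = (\<eta> x y, \<theta> x y, 4 * \<Lambda> * t + c, a * u + G x y t))"
proof -
  have C: "C3 4 (I \<times> J \<times> T) \<xi>" "C3 4 (I \<times> J \<times> T) \<phi>" "C3 4 (I \<times> J \<times> T) (\<lambda>x y t. \<zeta> (x, y, t, u1))"
    using C3_at_u1[OF C4(1)] C3_at_u1[OF C4(2)] C3_at_u1[OF C4(4)] by (simp_all add: \<xi>_def[abs_def] \<phi>_def[abs_def])
  have C': "C3 (Suc 0) (I \<times> J \<times> T) \<xi>" "C3 (Suc 0) (I \<times> J \<times> T) \<phi>" using C3_le[OF C(1)] C3_le[OF C(2)] by simp_all
  have t_const: "\<xi> x y t = \<xi> x y t1" "\<phi> x y t = \<phi> x y t1" if "x \<in> I" "y \<in> J" "t \<in> T" for x y t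
    using interval_constant[OF intervals(3), of "\<xi> x y" t t1] interval_constant[OF intervals(3), of "\<phi> x y" t t1]
      C3_has_dt[OF C'(1), of x y] C3_has_dt[OF C'(2), of x y] time_independence[of x y] that base by simp_all
  define \<Lambda> where "\<Lambda> = lam x1 y1 t1"
  \<comment> \<open>By \<open>lam_eq\<close> the factor does not depend on \<open>x\<close> and
    \<open>y\<close>, and since \<xi> does not change with \<open>t\<close>, neither does its
    \<open>x\<close>-derivative.\<close>
  have lam_const: "lam x y t = \<Lambda>" if "x \<in> I" "y \<in> J" "t \<in> T" for x y t
  proof -
    have "lam x y t = lam x1 y1 t" using lam_eq[of x y t] lam_eq[of x1 y1 t] that base by simp
    also have "lam x1 y1 t = lam x1 y1 t1"
      unfolding dx_def
    proof (rule deriv_cong_ev[OF _ refl])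
      show "eventually (\<lambda>s. \<xi> s y1 t = \<xi> s y1 t1) (nhds x1)"
        by (rule eventually_mono[OF eventually_nhds_in_open[OF open_I base(1)]])
          (rule t_const(1)[OF _ base(2) that(3)])
    qed
    finally show ?thesis by (simp add: \<Lambda>_def)
  qed
  have C2: "C_k_on 4 (\<lambda>(x, y). g x y t1) (I \<times> J)" if "C3 4 (I \<times> J \<times> T) g" for g
  proof -
    have o: "open (I \<times> J)" using intervals by (auto simp: open_interval_def intro!: open_Times)
    have "C_k_on 4 (\<lambda>p. (\<lambda>(x, y, t). g x y t) (fst p, snd p, t1)) (I \<times> J)"
      by (rule C_k_on_compose[OF o _ that[unfolded C3_def]]) (use base in \<open>auto intro!: C_k_on_intros o\<close>)
    then show ?thesis by (simp add: case_prod_unfold)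
  qed
  have hom: "homothety f I J \<Lambda> (\<lambda>x y. \<xi> x y t1) (\<lambda>x y. \<phi> x y t1)"
    unfolding homothety_def
  proof (intro conjI ballI exI)
    fix x y assume xy: "x \<in> I" "y \<in> J"
    then have p: "(x, y, t1) \<in> I \<times> J \<times> T" using base by simp
    show "((\<lambda>s. \<xi> s y t1) has_real_derivative \<Lambda>) (at x)"
      using C3_has_dx[OF C'(1) p] lam_const xy base by simp
    show "((\<lambda>s. \<phi> x s t1) has_real_derivative \<Lambda> - deriv f x * \<xi> x y t1) (at y)"
      using C3_has_dy[OF C'(2) p] conformal(1)[OF p] lam_const xy base by simp
    show "((\<lambda>s. \<xi> x s t1) has_real_derivative dy \<xi> x y t1) (at y)" using C3_has_dy[OF C'(1) p] .
    show "((\<lambda>s. \<phi> s y t1) has_real_derivative - exp (- 2 * f x) * dy \<xi> x y t1) (at x)"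
      using C3_has_dx[OF C'(2) p] conformal(2)[OF p] by simp
  qed (use C2 C in auto)
  have oT: "open T" using intervals by (simp add: open_interval_def)
  define c where "c = \<tau> t1 - 4 * \<Lambda> * t1"
  have tau: "\<tau> t = 4 * \<Lambda> * t + c" if "t \<in> T" for t
  proof -
    have "C_k_on (Suc 3) \<tau> T" using C_k_on_t[OF C4'(3) base(4)] by (simp add: \<tau>_def[abs_def])
    then have "(\<tau> has_real_derivative 4 * \<Lambda>) (at s)" if "s \<in> T" for s
      using C_k_on_realD[of 3 \<tau> T s] that lam_eq[of x1 y1 s] lam_const[of x1 y1 s] base
      by (simp add: mult.commute)
    then have "((\<lambda>s. \<tau> s - 4 * \<Lambda> * s) has_real_derivative 0) (at s)" if "s \<in> T" for s
      using that by (auto intro!: derivative_eq_intros)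
    from interval_constant[OF intervals(3) this that base(3)] show ?thesis by (simp add: c_def)
  qed
  have slope: "slope t = slope t1" if "t \<in> T" for t
  proof (rule interval_constant[where g = slope, OF intervals(3) _ that base(3)])
    fix s assume s: "s \<in> T"
    have "C3 (Suc 0) (I \<times> J \<times> T) (\<lambda>x y t. slope t)" using C3_le[OF C3_slope] by simp
    from C3_has_dt[OF this, of x1 y1 s] show "(slope has_real_derivative 0) (at s)"
      using s base time_independence(3)[of x1 y1 s] by (simp add: dt_def)
  qed
  \<comment> \<open>Subtracting \<open>slope t1 * u1\<close> moves the centre of the affine
    expression from \<open>u1\<close> to 0; constants solve the equation.\<close>
  define G where "G = (\<lambda>x y t. \<zeta> (x, y, t, u1) + - (slope t1 * u1))"
  have "heat_op f G x y t = 0" if p: "(x, y, t) \<in> I \<times> J \<times> T" for x y t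
  proof -
    have "heat_op f (\<lambda>x y t. - (slope t1 * u1)) x y t = 0" by (simp add: heat_op_def laplacian_def dt_def)
    then show ?thesis
      using heat_op_add[OF open_IJT C(3) C3_const p, of "- (slope t1 * u1)"] time_independence(4)[OF p]
      by (simp add: G_def)
  qed
  moreover have "C3 4 (I \<times> J \<times> T) G" unfolding G_def by (intro C3_add open_IJT C(3) C3_const)
  ultimately have "is_solution f I J T G" by (simp add: is_solution_iff)
  moreover have "X (x, y, t, u) = (\<xi> x y t1, \<phi> x y t1, 4 * \<Lambda> * t + c, slope t1 * u + G x y t)"
    if q: "(x, y, t, u) \<in> \<Omega>" for x y t u
    using X_eq[OF q] q t_const[of x y t] tau[of t] zeta_affine[OF q] slope[of t]
    by (simp add: \<Omega>_def G_def algebra_simps)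
  ultimately show ?thesis using hom by blast
qed

end

theorem (in surface_domain) lie_symmetries_iff:
  "X \<in> lie_symmetries f (I \<times> J \<times> T \<times> U) \<longleftrightarrow> (\<forall>p. p \<notin> I \<times> J \<times> T \<times> U \<longrightarrow> X p = 0) \<and>
    (\<exists>\<Lambda> \<eta> \<theta> c a G. homothety f I J \<Lambda> \<eta> \<theta> \<and> is_solution f I J T G \<and>
      (\<forall>x\<in>I. \<forall>y\<in>J. \<forall>t\<in>T. \<forall>u\<in>U. X (x, y, t, u) = (\<eta> x y, \<theta> x y, 4 * \<Lambda> * t + c, a * u + G x y t)))"
    (is "?L \<longleftrightarrow> ?R")
proof
  assume X: ?L
  obtain x1 y1 t1 u1 where b: "x1 \<in> I" "y1 \<in> J" "t1 \<in> T" "u1 \<in> U"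
    using intervals by (auto simp: open_interval_def)
  have "\<exists>u2\<in>U. u1 \<noteq> u2"
  proof -
    have "open U" using intervals by (simp add: open_interval_def)
    then obtain e where "e > 0" "ball u1 e \<subseteq> U" using b(4) openE by blast
    then have "u1 + e / 2 \<in> U" "u1 \<noteq> u1 + e / 2" by (auto simp: dist_real_def subset_iff)
    then show ?thesis by blast
  qed
  then obtain u2 where b2: "u2 \<in> U" "u1 \<noteq> u2" by blast
  interpret P: point_symmetry f I J T U X x1 y1 t1 u1 u2
    by unfold_locales (use X b b2 in auto)
  have "\<forall>p. p \<notin> I \<times> J \<times> T \<times> U \<longrightarrow> X p = 0" using X by (simp add: lie_symmetries_def)
  then show ?R using P.symmetry_form by (fastforce simp: \<Omega>_def)
next
  assume R: ?R
  then obtain \<Lambda> \<eta> \<theta> c a G where h: "homothety f I J \<Lambda> \<eta> \<theta>" "is_solution f I J T G"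
    and e: "\<forall>x\<in>I. \<forall>y\<in>J. \<forall>t\<in>T. \<forall>u\<in>U. X (x, y, t, u) = (\<eta> x y, \<theta> x y, 4 * \<Lambda> * t + c, a * u + G x y t)"
    by blast
  have "X \<in> lie_symmetries f \<Omega>"
  proof (rule homothety_imp_symmetry[OF h, of X c a])
    show "X p = 0" if "p \<notin> \<Omega>" for p using R that unfolding \<Omega>_def by blast
  qed (use e in \<open>auto simp: \<Omega>_def\<close>)
  then show ?L by (simp add: \<Omega>_def)
qed


section \<open>Homotheties of surfaces of revolution\<close>

subsection \<open>Linear equations of second order\<close>

text \<open>In the second and third case \<open>P\<close> and \<open>Q\<close> are the coefficients
  of the two fundamental solutions, recovered from the value and the derivative of \<open>g\<close>
  at a point. Along a solution both are constant, and \<open>g\<close> is their combination.\<close>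

lemma
  fixes g g1 :: "real \<Rightarrow> real"
  assumes S: "open_interval S" and g: "\<And>y. y \<in> S \<Longrightarrow> (g has_real_derivative g1 y) (at y)"
  shows ode_zero: "(\<And>y. y \<in> S \<Longrightarrow> (g1 has_real_derivative 0) (at y)) \<Longrightarrow> \<exists>p q. \<forall>y\<in>S. g y = p + q * y"
    and ode_neg: "\<omega> \<noteq> 0 \<Longrightarrow> (\<And>y. y \<in> S \<Longrightarrow> (g1 has_real_derivative - (\<omega>\<^sup>2) * g y) (at y)) \<Longrightarrow>
      \<exists>p q. \<forall>y\<in>S. g y = p * cos (\<omega> * y) + q * sin (\<omega> * y)"
    and ode_pos: "\<omega> \<noteq> 0 \<Longrightarrow> (\<And>y. y \<in> S \<Longrightarrow> (g1 has_real_derivative \<omega>\<^sup>2 * g y) (at y)) \<Longrightarrow>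
      \<exists>p q. \<forall>y\<in>S. g y = p * exp (\<omega> * y) + q * exp (- (\<omega> * y))"
proof -
  obtain y0 where y0: "y0 \<in> S" using S by (auto simp: open_interval_def)
  note const = interval_constant[OF S _ _ y0]
  show "\<exists>p q. \<forall>y\<in>S. g y = p + q * y" if g1: "\<And>y. y \<in> S \<Longrightarrow> (g1 has_real_derivative 0) (at y)"
  proof -
    have q: "g1 y = g1 y0" if "y \<in> S" for y using const[of g1 y] g1 that by simp
    have "g y - g1 y0 * y = g y0 - g1 y0 * y0" if y: "y \<in> S" for y
    proof (rule const[of "\<lambda>y. g y - g1 y0 * y", OF _ y])
      fix s assume s: "s \<in> S"
      show "((\<lambda>y. g y - g1 y0 * y) has_real_derivative 0) (at s)"
        using g[OF s] q[OF s] by (auto intro!: derivative_eq_intros)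
    qed
    then have "\<forall>y\<in>S. g y = (g y0 - g1 y0 * y0) + g1 y0 * y" by (simp add: algebra_simps)
    then show ?thesis by blast
  qed
  show "\<exists>p q. \<forall>y\<in>S. g y = p * cos (\<omega> * y) + q * sin (\<omega> * y)"
    if w: "\<omega> \<noteq> 0" and g1: "\<And>y. y \<in> S \<Longrightarrow> (g1 has_real_derivative - (\<omega>\<^sup>2) * g y) (at y)"
  proof -
    define P where "P = (\<lambda>y. g y * cos (\<omega> * y) - g1 y * sin (\<omega> * y) / \<omega>)"
    define Q where "Q = (\<lambda>y. g y * sin (\<omega> * y) + g1 y * cos (\<omega> * y) / \<omega>)"
    have "P y = P y0" "Q y = Q y0" if y: "y \<in> S" for y
    proof -
      show "P y = P y0"
      proof (rule const[OF _ y])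
        fix s assume s: "s \<in> S"
        show "(P has_real_derivative 0) (at s)"
          unfolding P_def using g[OF s] g1[OF s] w
          by (auto intro!: derivative_eq_intros simp: field_simps power2_eq_square)
      qed
      show "Q y = Q y0"
      proof (rule const[OF _ y])
        fix s assume s: "s \<in> S"
        show "(Q has_real_derivative 0) (at s)"
          unfolding Q_def using g[OF s] g1[OF s] w
          by (auto intro!: derivative_eq_intros simp: field_simps power2_eq_square)
      qed
    qed
    moreover have "g y = P y * cos (\<omega> * y) + Q y * sin (\<omega> * y)" for y
    proof -
      have "P y * cos (\<omega> * y) + Q y * sin (\<omega> * y)
          = g y * (cos (\<omega> * y) * cos (\<omega> * y) + sin (\<omega> * y) * sin (\<omega> * y))"
        unfolding P_def Q_def by algebra
      then show ?thesis by (simp only: sin_cos_squared_add3 mult_1_right)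
    qed
    ultimately have "\<forall>y\<in>S. g y = P y0 * cos (\<omega> * y) + Q y0 * sin (\<omega> * y)" by metis
    then show ?thesis by blast
  qed
  show "\<exists>p q. \<forall>y\<in>S. g y = p * exp (\<omega> * y) + q * exp (- (\<omega> * y))"
    if w: "\<omega> \<noteq> 0" and g1: "\<And>y. y \<in> S \<Longrightarrow> (g1 has_real_derivative \<omega>\<^sup>2 * g y) (at y)"
  proof -
    define P where "P = (\<lambda>y. (g y + g1 y / \<omega>) / 2 * exp (- (\<omega> * y)))"
    define Q where "Q = (\<lambda>y. (g y - g1 y / \<omega>) / 2 * exp (\<omega> * y))"
    have "P y = P y0" "Q y = Q y0" if y: "y \<in> S" for y
    proof -
      show "P y = P y0"
      proof (rule const[OF _ y])
        fix s assume s: "s \<in> S"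
        show "(P has_real_derivative 0) (at s)"
          unfolding P_def using g[OF s] g1[OF s] w
          by (auto intro!: derivative_eq_intros simp: field_simps power2_eq_square)
      qed
      show "Q y = Q y0"
      proof (rule const[OF _ y])
        fix s assume s: "s \<in> S"
        show "(Q has_real_derivative 0) (at s)"
          unfolding Q_def using g[OF s] g1[OF s] w
          by (auto intro!: derivative_eq_intros simp: field_simps power2_eq_square)
      qed
    qed
    moreover have "g y = P y * exp (\<omega> * y) + Q y * exp (- (\<omega> * y))" for y
      by (simp add: P_def Q_def exp_minus field_simps)
    ultimately have "\<forall>y\<in>S. g y = P y0 * exp (\<omega> * y) + Q y0 * exp (- (\<omega> * y))" by metis
    then show ?thesis by blast
  qed
qed


subsection \<open>The equations of a homothety\<close>

context surface_domain
begin

lemma homothetyD: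
  assumes "homothety f I J \<Lambda> \<xi> \<phi>" "x \<in> I" "y \<in> J"
  obtains d where "((\<lambda>s. \<xi> s y) has_real_derivative \<Lambda>) (at x)"
    "((\<lambda>s. \<phi> x s) has_real_derivative \<Lambda> - deriv f x * \<xi> x y) (at y)"
    "((\<lambda>s. \<xi> x s) has_real_derivative d) (at y)" "((\<lambda>s. \<phi> s y) has_real_derivative - met x * d) (at x)"
  using assms unfolding homothety_def by blast

text \<open>Integrating \<xi>_x = \<Lambda> gives \<xi> = \<Lambda> x + g(y). The final identity is
  the integrability condition for \<phi>, obtained by equating its mixed derivatives.\<close>

lemma homothety_equation:
  assumes hom: "homothety f I J \<Lambda> \<xi> \<phi>"
  obtains g g1 g2 where "\<And>y. y \<in> J \<Longrightarrow> (g has_real_derivative g1 y) (at y)"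
    "\<And>y. y \<in> J \<Longrightarrow> (g1 has_real_derivative g2 y) (at y)"
    "\<And>x y. x \<in> I \<Longrightarrow> y \<in> J \<Longrightarrow> \<xi> x y = \<Lambda> * x + g y"
    "\<And>x y. x \<in> I \<Longrightarrow> y \<in> J \<Longrightarrow> met x * g2 y = deriv (deriv f) x * (\<Lambda> * x + g y) + deriv f x * \<Lambda>"
proof -
  obtain x0 y0 t0 where b: "x0 \<in> I" "y0 \<in> J" "t0 \<in> T" using intervals by (auto simp: open_interval_def)
  let ?X = "\<lambda>x y t. \<xi> x y" and ?P = "\<lambda>x y t. \<phi> x y"
  define g where "g y = \<xi> x0 y - \<Lambda> * x0" for y
  define g1 where "g1 y = dy ?X x0 y t0" for y
  define g2 where "g2 y = dy (dy ?X) x0 y t0" for y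
  have C: "C3 4 (I \<times> J \<times> T) ?X" "C3 4 (I \<times> J \<times> T) ?P" using hom by (auto simp: homothety_def intro: C3_of_xy)
  have C': "C3 (Suc (Suc 0)) (I \<times> J \<times> T) ?X" "C3 (Suc (Suc 0)) (I \<times> J \<times> T) ?P"
    using C3_le[OF C(1)] C3_le[OF C(2)] by simp_all
  have xi: "\<xi> x y = \<Lambda> * x + g y" if "x \<in> I" "y \<in> J" for x y
  proof -
    have "\<xi> x y - \<Lambda> * x = \<xi> x0 y - \<Lambda> * x0"
    proof (rule interval_constant[where g = "\<lambda>s. \<xi> s y - \<Lambda> * s", OF intervals(1) _ that(1) b(1)])
      fix s assume "s \<in> I"
      then have "((\<lambda>s. \<xi> s y) has_real_derivative \<Lambda>) (at s)" using hom that(2) by (auto simp: homothety_def)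
      then show "((\<lambda>s. \<xi> s y - \<Lambda> * s) has_real_derivative 0) (at s)" by (auto intro!: derivative_eq_intros)
    qed
    then show ?thesis by (simp add: g_def)
  qed
  have G1: "(g has_real_derivative g1 y) (at y)" if "y \<in> J" for y
    using C3_has_dy[OF C'(1), of x0 y t0] b that unfolding g_def g1_def by (auto intro!: derivative_eq_intros)
  have G2: "(g1 has_real_derivative g2 y) (at y)" if "y \<in> J" for y
    using C3_has_dy[OF C3_dy[OF C'(1) open_IJT(1)], of x0 y t0] b that unfolding g1_def g2_def by simp
  have dyX: "((\<lambda>s. \<xi> x s) has_real_derivative g1 y) (at y)" if "x \<in> I" "y \<in> J" for x y
  proof -
    have "((\<lambda>s. \<Lambda> * x + g s) has_real_derivative g1 y) (at y)" using G1[OF that(2)] by (auto intro!: derivative_eq_intros)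
    moreover have ev: "eventually (\<lambda>s. \<Lambda> * x + g s = \<xi> x s) (nhds y)"
      by (rule eventually_mono[OF eventually_nhds_in_open[of J y]]) (use intervals that xi in \<open>auto simp: open_interval_def\<close>)
    ultimately show ?thesis using DERIV_cong_ev[OF refl ev refl] by simp
  qed
  have main: "met x * g2 y = deriv (deriv f) x * (\<Lambda> * x + g y) + deriv f x * \<Lambda>" if xy: "x \<in> I" "y \<in> J" for x y
  proof -
    have p: "(x, y, t0) \<in> I \<times> J \<times> T" using xy b by simp
    have 1: "dx ?P x y t = - met x * g1 y" "dy ?P x y t = \<Lambda> - deriv f x * (\<Lambda> * x + g y)"
      if q: "(x, y, t) \<in> I \<times> J \<times> T" for x y t
    proof -
      have q': "x \<in> I" "y \<in> J" using q by auto
      obtain d where d: "((\<lambda>s. \<phi> x s) has_real_derivative \<Lambda> - deriv f x * \<xi> x y) (at y)"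
        "((\<lambda>s. \<xi> x s) has_real_derivative d) (at y)" "((\<lambda>s. \<phi> s y) has_real_derivative - met x * d) (at x)"
        using homothetyD[OF hom q'] by blast
      have "d = g1 y" using DERIV_unique[OF d(2) dyX[OF q']] .
      then show "dx ?P x y t = - met x * g1 y" "dy ?P x y t = \<Lambda> - deriv f x * (\<Lambda> * x + g y)"
        using d(1,3) xi[OF q'] by (simp_all add: dx_def dy_def DERIV_imp_deriv)
    qed
    have "dy (dx ?P) x y t0 = - met x * g2 y"
      by (subst dy_cong[OF open_IJT(1) 1(1) p], assumption, subst dy_def, rule DERIV_imp_deriv)
        (auto intro!: derivative_eq_intros G2[OF xy(2)])
    moreover have "dx (dy ?P) x y t0 = - (deriv (deriv f) x * (\<Lambda> * x + g y) + deriv f x * \<Lambda>)"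
      by (subst dx_cong[OF open_IJT(1) 1(2) p], assumption, subst dx_def, rule DERIV_imp_deriv)
        (auto intro!: derivative_eq_intros metric_derivs(2)[OF xy(1)] simp: algebra_simps)
    ultimately show ?thesis using dx_dy_commute[OF C'(2) open_IJT(1) p] by simp
  qed
  show thesis by (rule that[OF G1 G2 xi main])
qed

text \<open>Both first derivatives of \<phi> are determined by \<Lambda> and \<xi>, so \<phi> is
  determined up to a constant, that is, up to a multiple of \<partial>_y. Hence only \<xi> has to be
  matched when homotheties are compared.\<close>

lemma homothety_unique:
  assumes hom: "homothety f I J \<Lambda> \<xi> \<phi>" "homothety f I J \<Lambda> \<xi>' \<phi>'"
    and eq: "\<And>x y. x \<in> I \<Longrightarrow> y \<in> J \<Longrightarrow> \<xi> x y = \<xi>' x y"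
  obtains k where "\<And>x y. x \<in> I \<Longrightarrow> y \<in> J \<Longrightarrow> \<phi> x y = \<phi>' x y + k"
proof -
  obtain x0 y0 where b: "x0 \<in> I" "y0 \<in> J" using intervals by (auto simp: open_interval_def)
  have d: "((\<lambda>s. \<phi> s y - \<phi>' s y) has_real_derivative 0) (at x)" "((\<lambda>s. \<phi> x s - \<phi>' x s) has_real_derivative 0) (at y)"
    if xy: "x \<in> I" "y \<in> J" for x y
  proof -
    obtain d where d: "((\<lambda>s. \<phi> x s) has_real_derivative \<Lambda> - deriv f x * \<xi> x y) (at y)"
      "((\<lambda>s. \<xi> x s) has_real_derivative d) (at y)" "((\<lambda>s. \<phi> s y) has_real_derivative - met x * d) (at x)"
      using homothetyD[OF hom(1) xy] by blast
    obtain d' where d': "((\<lambda>s. \<phi>' x s) has_real_derivative \<Lambda> - deriv f x * \<xi>' x y) (at y)"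
      "((\<lambda>s. \<xi>' x s) has_real_derivative d') (at y)" "((\<lambda>s. \<phi>' s y) has_real_derivative - met x * d') (at x)"
      using homothetyD[OF hom(2) xy] by blast
    have ev: "eventually (\<lambda>s. \<xi> x s = \<xi>' x s) (nhds y)"
      by (rule eventually_mono[OF eventually_nhds_in_open[of J y]]) (use intervals xy eq in \<open>auto simp: open_interval_def\<close>)
    have "d = d'" using DERIV_unique[OF d(2)] d'(2) DERIV_cong_ev[OF refl ev refl] by blast
    then show "((\<lambda>s. \<phi> s y - \<phi>' s y) has_real_derivative 0) (at x)" "((\<lambda>s. \<phi> x s - \<phi>' x s) has_real_derivative 0) (at y)"
      using DERIV_diff[OF d(3) d'(3)] DERIV_diff[OF d(1) d'(1)] eq[OF xy] by simp_all
  qed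
  have "\<phi> x y - \<phi>' x y = \<phi> x0 y0 - \<phi>' x0 y0" if "x \<in> I" "y \<in> J" for x y
    using interval_constant[where g = "\<lambda>s. \<phi> s y - \<phi>' s y", OF intervals(1) d(1) that(1) b(1)]
      interval_constant[where g = "\<lambda>s. \<phi> x0 s - \<phi>' x0 s", OF intervals(2) d(2) that(2) b(2)] that b by simp
  then show thesis using that[of "\<phi> x0 y0 - \<phi>' x0 y0"] by (simp add: algebra_simps)
qed

lemma homothety_linear:
  assumes "homothety f I J \<Lambda> \<xi> \<phi>" "homothety f I J \<Lambda>' \<xi>' \<phi>'"
  shows "homothety f I J (c * \<Lambda> + c' * \<Lambda>') (\<lambda>x y. c * \<xi> x y + c' * \<xi>' x y) (\<lambda>x y. c * \<phi> x y + c' * \<phi>' x y)"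
  unfolding homothety_def
proof (intro conjI ballI)
  have o: "open (I \<times> J)" using intervals by (auto simp: open_interval_def intro!: open_Times)
  show "C_k_on 4 (\<lambda>(x, y). c * \<xi> x y + c' * \<xi>' x y) (I \<times> J)" "C_k_on 4 (\<lambda>(x, y). c * \<phi> x y + c' * \<phi>' x y) (I \<times> J)"
    using assms unfolding homothety_def case_prod_unfold by (intro C_k_on_add C_k_on_cmult o; simp)+
  fix x y assume xy: "x \<in> I" "y \<in> J"
  obtain d where d: "((\<lambda>s. \<xi> s y) has_real_derivative \<Lambda>) (at x)" "((\<lambda>s. \<phi> x s) has_real_derivative \<Lambda> - deriv f x * \<xi> x y) (at y)"
      "((\<lambda>s. \<xi> x s) has_real_derivative d) (at y)" "((\<lambda>s. \<phi> s y) has_real_derivative - met x * d) (at x)"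
    using homothetyD[OF assms(1) xy] by blast
  obtain d' where d': "((\<lambda>s. \<xi>' s y) has_real_derivative \<Lambda>') (at x)" "((\<lambda>s. \<phi>' x s) has_real_derivative \<Lambda>' - deriv f x * \<xi>' x y) (at y)"
      "((\<lambda>s. \<xi>' x s) has_real_derivative d') (at y)" "((\<lambda>s. \<phi>' s y) has_real_derivative - met x * d') (at x)"
    using homothetyD[OF assms(2) xy] by blast
  note a = DERIV_add[OF DERIV_cmult DERIV_cmult]
  show "((\<lambda>s. c * \<xi> s y + c' * \<xi>' s y) has_real_derivative c * \<Lambda> + c' * \<Lambda>') (at x)" by (rule a[OF d(1) d'(1)])
  show "((\<lambda>s. c * \<phi> x s + c' * \<phi>' x s) has_real_derivative c * \<Lambda> + c' * \<Lambda>' - deriv f x * (c * \<xi> x y + c' * \<xi>' x y)) (at y)"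
    using a[OF d(2) d'(2), of c c'] by (simp add: algebra_simps)
  show "\<exists>d. ((\<lambda>s. c * \<xi> x s + c' * \<xi>' x s) has_real_derivative d) (at y) \<and>
      ((\<lambda>s. c * \<phi> s y + c' * \<phi>' s y) has_real_derivative - met x * d) (at x)"
    using a[OF d(3) d'(3), of c c'] a[OF d(4) d'(4), of c c'] by (intro exI conjI) (assumption, simp add: algebra_simps)
qed

lemma homothety_rotation: "homothety f I J 0 (\<lambda>x y. 0) (\<lambda>x y. k)"
  by (auto simp: homothety_def case_prod_unfold del: C_k_on.simps intro!: exI[of _ 0])


subsection \<open>Spans of vector fields\<close>

lemma solution_linear:
  assumes "is_solution f I J T G" "is_solution f I J T H"
  shows "is_solution f I J T (\<lambda>x y t. c * G x y t + d * H x y t)"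
proof -
  have C: "C3 4 (I \<times> J \<times> T) G" "C3 4 (I \<times> J \<times> T) H" using assms by (auto simp: is_solution_iff)
  have C': "C3 4 (I \<times> J \<times> T) (\<lambda>x y t. c * G x y t)" "C3 4 (I \<times> J \<times> T) (\<lambda>x y t. d * H x y t)"
    by (intro C3_mult open_IJT C3_const C)+
  show ?thesis
    using assms C3_add[OF open_IJT(1) C'] heat_op_add[OF open_IJT C']
      heat_op_cmult[where g = "\<lambda>_. c", OF open_IJT C3_const C(1)] heat_op_cmult[where g = "\<lambda>_. d", OF open_IJT C3_const C(2)]
    by (auto simp: is_solution_iff)
qed

lemma zero_solution: "is_solution f I J T (\<lambda>x y t. 0)"
  by (auto simp: is_solution_iff C3_const heat_op_def laplacian_def dt_def)

lemma lie_symmetriesI: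
  assumes "homothety f I J \<Lambda> \<eta> \<theta>" "is_solution f I J T G"
    "\<And>x y t u. x \<in> I \<Longrightarrow> y \<in> J \<Longrightarrow> t \<in> T \<Longrightarrow> u \<in> U \<Longrightarrow> X (x, y, t, u) = (\<eta> x y, \<theta> x y, 4 * \<Lambda> * t + c, a * u + G x y t)"
    "\<And>p. p \<notin> I \<times> J \<times> T \<times> U \<Longrightarrow> X p = 0"
  shows "X \<in> lie_symmetries f (I \<times> J \<times> T \<times> U)"
  unfolding lie_symmetries_iff using assms by blast

text \<open>Read off from the normal form \<open>lie_symmetries_iff\<close>, which is linear in its
  data, instead of from the prolongation formula.\<close>

lemma subspace_lie_symmetries: "vf.subspace (lie_symmetries f (I \<times> J \<times> T \<times> U))"
proof -
  have lin: "(\<lambda>p. c *\<^sub>R X p + d *\<^sub>R Y p) \<in> lie_symmetries f (I \<times> J \<times> T \<times> U)"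
    if XY: "X \<in> lie_symmetries f (I \<times> J \<times> T \<times> U)" "Y \<in> lie_symmetries f (I \<times> J \<times> T \<times> U)" for X Y c d
  proof -
    obtain \<Lambda> \<eta> \<theta> b a G where h: "homothety f I J \<Lambda> \<eta> \<theta>" "is_solution f I J T G"
      and X: "\<forall>x\<in>I. \<forall>y\<in>J. \<forall>t\<in>T. \<forall>u\<in>U. X (x, y, t, u) = (\<eta> x y, \<theta> x y, 4 * \<Lambda> * t + b, a * u + G x y t)"
        "\<forall>p. p \<notin> I \<times> J \<times> T \<times> U \<longrightarrow> X p = 0"
      using XY(1) unfolding lie_symmetries_iff by blast
    obtain \<Lambda>' \<eta>' \<theta>' b' a' G' where h': "homothety f I J \<Lambda>' \<eta>' \<theta>'" "is_solution f I J T G'"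
      and Y: "\<forall>x\<in>I. \<forall>y\<in>J. \<forall>t\<in>T. \<forall>u\<in>U. Y (x, y, t, u) = (\<eta>' x y, \<theta>' x y, 4 * \<Lambda>' * t + b', a' * u + G' x y t)"
        "\<forall>p. p \<notin> I \<times> J \<times> T \<times> U \<longrightarrow> Y p = 0"
      using XY(2) unfolding lie_symmetries_iff by blast
    show ?thesis
    proof (rule lie_symmetriesI[OF homothety_linear[OF h(1) h'(1)] solution_linear[OF h(2) h'(2)], of _ _ _ "c * b + d * b'" "c * a + d * a'"])
      show "c *\<^sub>R X p + d *\<^sub>R Y p = 0" if "p \<notin> I \<times> J \<times> T \<times> U" for p
      proof -
        have "X p = 0" "Y p = 0" using X(2) Y(2) that by blast+
        then show ?thesis by simp
      qed
    qed (use X(1) Y(1) in \<open>simp add: algebra_simps\<close>)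
  qed
  have 0: "(\<lambda>p. 0) \<in> lie_symmetries f (I \<times> J \<times> T \<times> U)"
    by (rule lie_symmetriesI[OF homothety_rotation[of 0] zero_solution, of _ 0 0]) (auto simp: zero_prod_def)
  show ?thesis
    unfolding vf.subspace_def
  proof (intro conjI allI impI ballI)
    show "0 \<in> lie_symmetries f (I \<times> J \<times> T \<times> U)" using 0 by (simp add: zero_fun_def)
    show "X + Y \<in> lie_symmetries f (I \<times> J \<times> T \<times> U)"
      if "X \<in> lie_symmetries f (I \<times> J \<times> T \<times> U)" "Y \<in> lie_symmetries f (I \<times> J \<times> T \<times> U)" for X Y
      using lin[OF that, of 1 1] by (simp add: plus_fun_def)
    show "vf_scale c X \<in> lie_symmetries f (I \<times> J \<times> T \<times> U)" if "X \<in> lie_symmetries f (I \<times> J \<times> T \<times> U)" for c X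
      using lin[OF that that, of c 0] by (simp add: vf_scale_def)
  qed
qed

lemma minimal_subset: "on_domain (I \<times> J \<times> T \<times> U) ` minimal_generators f I J T \<subseteq> lie_symmetries f (I \<times> J \<times> T \<times> U)"
proof -
  have "on_domain (I \<times> J \<times> T \<times> U) X \<in> lie_symmetries f (I \<times> J \<times> T \<times> U)" if X: "X \<in> minimal_generators f I J T" for X
  proof -
    consider "X = (\<lambda>(x, y, t, u). (0, 1, 0, 0))" | "X = (\<lambda>(x, y, t, u). (0, 0, 1, 0))" | "X = (\<lambda>(x, y, t, u). (0, 0, 0, u))"
      | G where "X = (\<lambda>(x, y, t, u). (0, 0, 0, G x y t))" "is_solution f I J T G"
      using X unfolding minimal_generators_def by blast
    then show ?thesis
    proof cases
      case 1
      show ?thesis by (rule lie_symmetriesI[OF homothety_rotation[of 1] zero_solution, of _ 0 0]) (auto simp: on_domain_def 1)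
    next
      case 2
      show ?thesis by (rule lie_symmetriesI[OF homothety_rotation[of 0] zero_solution, of _ 1 0]) (auto simp: on_domain_def 2)
    next
      case 3
      show ?thesis by (rule lie_symmetriesI[OF homothety_rotation[of 0] zero_solution, of _ 0 1]) (auto simp: on_domain_def 3)
    next
      case (4 G)
      show ?thesis by (rule lie_symmetriesI[OF homothety_rotation[of 0] 4(2), of _ 0 0]) (auto simp: on_domain_def 4(1))
    qed
  qed
  then show ?thesis by blast
qed

lemma generated_minimal_subset:
  "generated_algebra (I \<times> J \<times> T \<times> U) (minimal_generators f I J T) \<subseteq> lie_symmetries f (I \<times> J \<times> T \<times> U)"
  unfolding generated_algebra_def by (rule vf.span_minimal[OF minimal_subset subspace_lie_symmetries])

text \<open>The vanishing \<open>x\<close>-component is an invariant of the minimal algebra; a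
  symmetry with non-zero \<xi> then certifies that an inclusion is strict.\<close>

lemma generated_minimal_fst:
  assumes "X \<in> generated_algebra (I \<times> J \<times> T \<times> U) (minimal_generators f I J T)"
  shows "fst (X p) = 0"
proof -
  have "vf.subspace {X :: vfield. \<forall>p. fst (X p) = 0}"
    by (auto simp: vf.subspace_def vf_scale_def)
  moreover have "on_domain (I \<times> J \<times> T \<times> U) ` minimal_generators f I J T \<subseteq> {X. \<forall>p. fst (X p) = 0}"
    by (auto simp: minimal_generators_def on_domain_def)
  ultimately show ?thesis using assms vf.span_minimal unfolding generated_algebra_def by blast
qed

text \<open>The minimal generators absorb the constant \<open>k\<close> in \<theta>, the constant in
  the time component, the multiple of \<open>u\<close> and the solution \<open>G\<close>. It remains
  to represent the homothety together with its time scaling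
  \<open>4 * \<Lambda> * t\<close>.\<close>

lemma symmetries_generated:
  assumes A: "on_domain (I \<times> J \<times> T \<times> U) ` A \<subseteq> lie_symmetries f (I \<times> J \<times> T \<times> U)"
    and span: "\<And>\<Lambda> \<eta> \<theta>. homothety f I J \<Lambda> \<eta> \<theta> \<Longrightarrow> \<exists>k. \<exists>B\<in>vf.span (on_domain (I \<times> J \<times> T \<times> U) ` A).
      \<forall>x\<in>I. \<forall>y\<in>J. \<forall>t\<in>T. \<forall>u\<in>U. B (x, y, t, u) = (\<eta> x y, \<theta> x y - k, 4 * \<Lambda> * t, 0)"
  shows "lie_symmetries f (I \<times> J \<times> T \<times> U) = generated_algebra (I \<times> J \<times> T \<times> U) (minimal_generators f I J T \<union> A)"
proof
  let ?\<Omega> = "I \<times> J \<times> T \<times> U"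
  let ?S = "vf.span (on_domain ?\<Omega> ` (minimal_generators f I J T \<union> A))"
  show "generated_algebra ?\<Omega> (minimal_generators f I J T \<union> A) \<subseteq> lie_symmetries f ?\<Omega>"
    unfolding generated_algebra_def
    by (rule vf.span_minimal[OF _ subspace_lie_symmetries]) (use A minimal_subset in auto)
  show "lie_symmetries f ?\<Omega> \<subseteq> generated_algebra ?\<Omega> (minimal_generators f I J T \<union> A)"
    unfolding generated_algebra_def
  proof
    fix X assume "X \<in> lie_symmetries f ?\<Omega>"
    then obtain \<Lambda> \<eta> \<theta> c a G where h: "homothety f I J \<Lambda> \<eta> \<theta>" "is_solution f I J T G"
      and X: "\<forall>x\<in>I. \<forall>y\<in>J. \<forall>t\<in>T. \<forall>u\<in>U. X (x, y, t, u) = (\<eta> x y, \<theta> x y, 4 * \<Lambda> * t + c, a * u + G x y t)"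
        "\<forall>p. p \<notin> ?\<Omega> \<longrightarrow> X p = 0"
      unfolding lie_symmetries_iff by blast
    obtain k B where B: "B \<in> vf.span (on_domain ?\<Omega> ` A)"
      "\<forall>x\<in>I. \<forall>y\<in>J. \<forall>t\<in>T. \<forall>u\<in>U. B (x, y, t, u) = (\<eta> x y, \<theta> x y - k, 4 * \<Lambda> * t, 0)"
      using span[OF h(1)] by blast
    have B0: "B p = 0" if "p \<notin> ?\<Omega>" for p
    proof -
      have "vf.subspace {X :: vfield. X p = 0}" by (auto simp: vf.subspace_def vf_scale_def)
      moreover have "on_domain ?\<Omega> ` A \<subseteq> {X. X p = 0}" using that by (auto simp: on_domain_def)
      ultimately show ?thesis using B(1) vf.span_minimal by blast
    qed
    have BS: "B \<in> ?S" using B(1) vf.span_mono[of "on_domain ?\<Omega> ` A" "on_domain ?\<Omega> ` (minimal_generators f I J T \<union> A)"] by blast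
    define E1 :: vfield where "E1 = (\<lambda>(x, y, t, u). (0, 1, 0, 0))"
    define E2 :: vfield where "E2 = (\<lambda>(x, y, t, u). (0, 0, 1, 0))"
    define E3 :: vfield where "E3 = (\<lambda>(x, y, t, u). (0, 0, 0, u))"
    define E4 :: vfield where "E4 = (\<lambda>(x, y, t, u). (0, 0, 0, G x y t))"
    have "E1 \<in> minimal_generators f I J T" "E2 \<in> minimal_generators f I J T" "E3 \<in> minimal_generators f I J T"
      "E4 \<in> minimal_generators f I J T"
      using h(2) unfolding minimal_generators_def E1_def E2_def E3_def E4_def by blast+
    then have E: "on_domain ?\<Omega> E1 \<in> ?S" "on_domain ?\<Omega> E2 \<in> ?S" "on_domain ?\<Omega> E3 \<in> ?S" "on_domain ?\<Omega> E4 \<in> ?S"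
      by (auto intro!: vf.span_base)
    have "B + (vf_scale k (on_domain ?\<Omega> E1) + (vf_scale c (on_domain ?\<Omega> E2) + (vf_scale a (on_domain ?\<Omega> E3) + on_domain ?\<Omega> E4))) \<in> ?S"
      by (intro vf.span_add vf.span_scale BS E)
    also have "B + (vf_scale k (on_domain ?\<Omega> E1) + (vf_scale c (on_domain ?\<Omega> E2) + (vf_scale a (on_domain ?\<Omega> E3) + on_domain ?\<Omega> E4))) = X"
    proof
      fix p :: "real \<times> real \<times> real \<times> real"
      obtain x y t u where p: "p = (x, y, t, u)" by (metis prod.exhaust)
      show "(B + (vf_scale k (on_domain ?\<Omega> E1) + (vf_scale c (on_domain ?\<Omega> E2) + (vf_scale a (on_domain ?\<Omega> E3) + on_domain ?\<Omega> E4)))) p = X p"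
      proof (cases "p \<in> ?\<Omega>")
        case True
        then show ?thesis using X(1) B(2) by (simp add: p vf_scale_def on_domain_def E1_def E2_def E3_def E4_def)
      next
        case False
        then have "X p = 0" "B p = 0" using X(2) B0 by blast+
        with False show ?thesis by (simp add: vf_scale_def on_domain_def)
      qed
    qed
    finally show "X \<in> ?S" .
  qed
qed

text \<open>Once \<Lambda> and \<eta> vanish, \<open>homothety_unique\<close> leaves a constant
  \<theta>, which is already the generator \<partial>_y; so no further field is required.\<close>

lemma minimal_algebra:
  assumes "\<And>\<Lambda> \<eta> \<theta>. homothety f I J \<Lambda> \<eta> \<theta> \<Longrightarrow> \<Lambda> = 0 \<and> (\<forall>x\<in>I. \<forall>y\<in>J. \<eta> x y = 0)"
  shows "symmetry_algebra_is_minimal f I J T U"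
proof -
  have "lie_symmetries f (I \<times> J \<times> T \<times> U) = generated_algebra (I \<times> J \<times> T \<times> U) (minimal_generators f I J T \<union> {})"
  proof (rule symmetries_generated)
    fix \<Lambda> \<eta> \<theta> assume h: "homothety f I J \<Lambda> \<eta> \<theta>"
    then have 0: "\<Lambda> = 0" "\<And>x y. x \<in> I \<Longrightarrow> y \<in> J \<Longrightarrow> \<eta> x y = 0" using assms by blast+
    obtain k where "\<And>x y. x \<in> I \<Longrightarrow> y \<in> J \<Longrightarrow> \<theta> x y = 0 + k"
      using homothety_unique[OF h[unfolded 0(1)] homothety_rotation[of 0]] 0(2) by metis
    with 0 show "\<exists>k. \<exists>B\<in>vf.span (on_domain (I \<times> J \<times> T \<times> U) ` {}).
      \<forall>x\<in>I. \<forall>y\<in>J. \<forall>t\<in>T. \<forall>u\<in>U. B (x, y, t, u) = (\<eta> x y, \<theta> x y - k, 4 * \<Lambda> * t, 0)"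
      by (intro exI[of _ k] bexI[of _ 0]) (auto simp: zero_prod_def)
  qed simp
  then show ?thesis by (simp add: symmetry_algebra_is_minimal_def)
qed

text \<open>Three fields are what the flat surfaces require; surfaces with fewer additional fields
  repeat one. The assumption \<open>span\<close> compares only \<Lambda> and \<xi>, since
  \<open>homothety_unique\<close> supplies the \<open>y\<close>-component. Strictness is witnessed
  by a non-zero \<xi> of the first or second field.\<close>

lemma enlarged_algebra:
  assumes hom: "homothety f I J \<Lambda>1 \<xi>1 \<phi>1" "homothety f I J \<Lambda>2 \<xi>2 \<phi>2" "homothety f I J \<Lambda>3 \<xi>3 \<phi>3"
    and a: "\<And>x y t u. a1 (x, y, t, u) = (\<xi>1 x y, \<phi>1 x y, 4 * \<Lambda>1 * t, 0)"
      "\<And>x y t u. a2 (x, y, t, u) = (\<xi>2 x y, \<phi>2 x y, 4 * \<Lambda>2 * t, 0)"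
      "\<And>x y t u. a3 (x, y, t, u) = (\<xi>3 x y, \<phi>3 x y, 4 * \<Lambda>3 * t, 0)"
    and span: "\<And>\<Lambda> \<eta> \<theta>. homothety f I J \<Lambda> \<eta> \<theta> \<Longrightarrow> \<exists>c1 c2 c3. \<Lambda> = c1 * \<Lambda>1 + c2 * \<Lambda>2 + c3 * \<Lambda>3 \<and>
      (\<forall>x\<in>I. \<forall>y\<in>J. \<eta> x y = c1 * \<xi>1 x y + c2 * \<xi>2 x y + c3 * \<xi>3 x y)"
    and nz: "\<exists>x\<in>I. \<exists>y\<in>J. \<xi>1 x y \<noteq> 0 \<or> \<xi>2 x y \<noteq> 0"
  shows "symmetry_algebra_enlarged_by f I J T U {a1, a2, a3}"
proof -
  let ?\<Omega> = "I \<times> J \<times> T \<times> U" and ?d = "on_domain (I \<times> J \<times> T \<times> U)"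
  have A: "?d a1 \<in> lie_symmetries f ?\<Omega>" "?d a2 \<in> lie_symmetries f ?\<Omega>" "?d a3 \<in> lie_symmetries f ?\<Omega>"
    by (rule lie_symmetriesI[OF hom(1) zero_solution, of _ 0 0] lie_symmetriesI[OF hom(2) zero_solution, of _ 0 0]
        lie_symmetriesI[OF hom(3) zero_solution, of _ 0 0]; auto simp: on_domain_def a)+
  have 1: "lie_symmetries f ?\<Omega> = generated_algebra ?\<Omega> (minimal_generators f I J T \<union> {a1, a2, a3})"
  proof (rule symmetries_generated)
    fix \<Lambda> \<eta> \<theta> assume h: "homothety f I J \<Lambda> \<eta> \<theta>"
    obtain c1 c2 c3 where c: "\<Lambda> = c1 * \<Lambda>1 + c2 * \<Lambda>2 + c3 * \<Lambda>3"
      "\<And>x y. x \<in> I \<Longrightarrow> y \<in> J \<Longrightarrow> \<eta> x y = c1 * \<xi>1 x y + c2 * \<xi>2 x y + c3 * \<xi>3 x y"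
      using span[OF h] by blast
    have "homothety f I J \<Lambda> (\<lambda>x y. c1 * \<xi>1 x y + c2 * \<xi>2 x y + c3 * \<xi>3 x y) (\<lambda>x y. c1 * \<phi>1 x y + c2 * \<phi>2 x y + c3 * \<phi>3 x y)"
      using homothety_linear[OF homothety_linear[OF hom(1,2), of c1 c2] hom(3), of 1 c3] by (simp add: c(1))
    from homothety_unique[OF h this] c(2) obtain k
      where k: "\<And>x y. x \<in> I \<Longrightarrow> y \<in> J \<Longrightarrow> \<theta> x y = c1 * \<phi>1 x y + c2 * \<phi>2 x y + c3 * \<phi>3 x y + k" by metis
    let ?B = "vf_scale c1 (?d a1) + (vf_scale c2 (?d a2) + vf_scale c3 (?d a3))"
    have "?B \<in> vf.span (?d ` {a1, a2, a3})"
      by (intro vf.span_add vf.span_scale vf.span_base) auto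
    moreover have "\<forall>x\<in>I. \<forall>y\<in>J. \<forall>t\<in>T. \<forall>u\<in>U. ?B (x, y, t, u) = (\<eta> x y, \<theta> x y - k, 4 * \<Lambda> * t, 0)"
      by (auto simp: vf_scale_def on_domain_def a c k algebra_simps)
    ultimately show "\<exists>k. \<exists>B\<in>vf.span (?d ` {a1, a2, a3}). \<forall>x\<in>I. \<forall>y\<in>J. \<forall>t\<in>T. \<forall>u\<in>U. B (x, y, t, u) = (\<eta> x y, \<theta> x y - k, 4 * \<Lambda> * t, 0)"
      by blast
  qed (use A in auto)
  obtain t u where tu: "t \<in> T" "u \<in> U" using intervals by (auto simp: open_interval_def)
  from nz obtain x y where xy: "x \<in> I" "y \<in> J" "\<xi>1 x y \<noteq> 0 \<or> \<xi>2 x y \<noteq> 0" by blast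
  have "fst (?d a1 (x, y, t, u)) \<noteq> 0 \<or> fst (?d a2 (x, y, t, u)) \<noteq> 0" using xy tu by (simp add: on_domain_def a)
  then have "generated_algebra ?\<Omega> (minimal_generators f I J T) \<noteq> lie_symmetries f ?\<Omega>"
    using A(1,2) generated_minimal_fst by metis
  then show ?thesis using 1 generated_minimal_subset by (auto simp: symmetry_algebra_enlarged_by_def)
qed

end


subsection \<open>The individual surfaces\<close>

lemma exp_ln_met: "z > 0 \<Longrightarrow> exp (- 2 * ln z) = 1 / z\<^sup>2" for z :: real
proof -
  assume z: "z > 0"
  have "exp (- 2 * ln z) = inverse (exp (ln z) * exp (ln z))"
    by (simp only: exp_add[symmetric] exp_minus[symmetric]) simp
  then show ?thesis using z by (simp add: power2_eq_square divide_inverse)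
qed

lemma DERIV_const_divide: "x + b \<noteq> 0 \<Longrightarrow> ((\<lambda>s. k / (s + b)) has_real_derivative - k / (x + b)\<^sup>2) (at x)" for k :: real
  by (auto intro!: derivative_eq_intros simp: power2_eq_square)

text \<open>Rewrites the logarithm of an absolute value so that it can be differentiated without
  deciding the sign of its argument.\<close>

lemma ln_abs_eq: "z \<noteq> 0 \<Longrightarrow> ln \<bar>z\<bar> = ln (z\<^sup>2) / 2" for z :: real
  using ln_realpow[of "\<bar>z\<bar>" 2] by simp

context surface_domain
begin

lemma f_derivs:
  assumes "\<And>x. x \<in> I \<Longrightarrow> f x = F x" "\<And>x. x \<in> I \<Longrightarrow> (F has_real_derivative F1 x) (at x)"
    "\<And>x. x \<in> I \<Longrightarrow> (F1 has_real_derivative F2 x) (at x)" "x \<in> I"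
  shows "deriv f x = F1 x" "deriv (deriv f) x = F2 x"
proof -
  have ev: "eventually (\<lambda>s. s \<in> I) (nhds s)" if "s \<in> I" for s
    by (rule eventually_nhds_in_open[OF open_I that])
  have 1: "deriv f s = F1 s" if "s \<in> I" for s
  proof -
    have "deriv f s = deriv F s" by (rule deriv_cong_ev[OF eventually_mono[OF ev[OF that]] refl]) (rule assms(1))
    then show ?thesis using DERIV_imp_deriv[OF assms(2)[OF that]] by simp
  qed
  show "deriv f x = F1 x" by (rule 1[OF assms(4)])
  have "deriv (deriv f) x = deriv F1 x" by (rule deriv_cong_ev[OF eventually_mono[OF ev[OF assms(4)]] refl]) (rule 1)
  then show "deriv (deriv f) x = F2 x" using DERIV_imp_deriv[OF assms(3)[OF assms(4)]] by simp
qed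

lemma homothetyI:
  assumes "\<And>S. open S \<Longrightarrow> S = I \<times> J \<Longrightarrow> C_k_on 4 (\<lambda>p. \<xi> (fst p) (snd p)) S"
    "\<And>S. open S \<Longrightarrow> S = I \<times> J \<Longrightarrow> C_k_on 4 (\<lambda>p. \<phi> (fst p) (snd p)) S"
    and "\<And>x y. x \<in> I \<Longrightarrow> y \<in> J \<Longrightarrow> ((\<lambda>s. \<xi> s y) has_real_derivative \<Lambda>) (at x)"
    "\<And>x y. x \<in> I \<Longrightarrow> y \<in> J \<Longrightarrow> ((\<lambda>s. \<phi> x s) has_real_derivative \<Lambda> - deriv f x * \<xi> x y) (at y)"
    "\<And>x y. x \<in> I \<Longrightarrow> y \<in> J \<Longrightarrow> ((\<lambda>s. \<xi> x s) has_real_derivative d x y) (at y)"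
    "\<And>x y. x \<in> I \<Longrightarrow> y \<in> J \<Longrightarrow> ((\<lambda>s. \<phi> s y) has_real_derivative - met x * d x y) (at x)"
  shows "homothety f I J \<Lambda> \<xi> \<phi>"
proof -
  have o: "open (I \<times> J)" using intervals by (auto simp: open_interval_def intro!: open_Times)
  show ?thesis
    unfolding homothety_def case_prod_unfold
    using assms(1)[OF o refl] assms(2)[OF o refl] assms(3-6) by (intro conjI ballI exI[of _ "d _ _"])
qed

text \<open>Multiplied by \<open>(x - \<alpha>2)\<^sup>2\<close>, the homothety equation has a right
  side independent of \<open>x\<close>, while the left side is \<open>g2 y\<close> times a constant
  multiple of \<open>(x - \<alpha>2) powr (2 - 2 * \<alpha>3)\<close>. As \<alpha>3 differs from 1,
  differentiating in \<open>x\<close> gives \<open>g2 y = 0\<close>; as \<alpha>3 differs from 0,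
  the right side then determines \<open>g\<close>, leaving \<Lambda> as the only parameter.\<close>

lemma power_surface:
  assumes "\<beta>5 > 0" "\<alpha>3 \<noteq> 0" "\<alpha>3 \<noteq> 1" and fx: "\<forall>x\<in>I. x > \<alpha>2 \<and> f x = ln (\<beta>5 * (x - \<alpha>2) powr \<alpha>3)"
  shows "symmetry_algebra_enlarged_by f I J T U {\<lambda>(x, y, t, u). ((x - \<alpha>2) / 4, - ((\<alpha>3 - 1) / 4 * y), t, 0)}"
proof -
  have pos: "x - \<alpha>2 > 0" if "x \<in> I" for x using fx that by simp
  have F: "f x = ln \<beta>5 + \<alpha>3 * ln (x - \<alpha>2)" if "x \<in> I" for x
  proof -
    have "f x = ln (\<beta>5 * (x - \<alpha>2) powr \<alpha>3)" "(x - \<alpha>2) powr \<alpha>3 > 0" using fx pos[OF that] that by auto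
    then show ?thesis using ln_mult_pos[OF assms(1), of "(x - \<alpha>2) powr \<alpha>3"] pos[OF that] by (simp add: ln_powr)
  qed
  have d1: "((\<lambda>x. ln \<beta>5 + \<alpha>3 * ln (x - \<alpha>2)) has_real_derivative \<alpha>3 / (x - \<alpha>2)) (at x)" if "x \<in> I" for x
      using pos[OF that] by (auto intro!: derivative_eq_intros simp: field_simps)
  have d2: "((\<lambda>x. \<alpha>3 / (x - \<alpha>2)) has_real_derivative - \<alpha>3 / (x - \<alpha>2)\<^sup>2) (at x)" if "x \<in> I" for x
    using pos[OF that] by (auto intro!: derivative_eq_intros simp: field_simps power2_eq_square)
  have d: "deriv f x = \<alpha>3 / (x - \<alpha>2)" "deriv (deriv f) x = - \<alpha>3 / (x - \<alpha>2)\<^sup>2" if "x \<in> I" for x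
    by (rule f_derivs[OF F d1 d2]; use that in simp)+
  have hom: "homothety f I J (1 / 4) (\<lambda>x y. (x - \<alpha>2) / 4) (\<lambda>x y. - ((\<alpha>3 - 1) / 4 * y))"
  proof (rule homothetyI[where d = "\<lambda>x y. 0"])
    fix x y assume x: "x \<in> I" and "y \<in> J"
    show "((\<lambda>s. - ((\<alpha>3 - 1) / 4 * s)) has_real_derivative 1 / 4 - deriv f x * ((x - \<alpha>2) / 4)) (at y)"
      using pos[OF x] d(1)[OF x] by (auto intro!: derivative_eq_intros simp: field_simps)
  qed (auto intro!: C_k_on_intros derivative_eq_intros)
  have span: "\<eta> x y = \<Lambda> * (x - \<alpha>2)" if h: "homothety f I J \<Lambda> \<eta> \<theta>" and xy: "x \<in> I" "y \<in> J" for \<Lambda> \<eta> \<theta> x y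
  proof -
    obtain g g1 g2 where g: "\<And>x y. x \<in> I \<Longrightarrow> y \<in> J \<Longrightarrow> \<eta> x y = \<Lambda> * x + g y"
      and e: "\<And>x y. x \<in> I \<Longrightarrow> y \<in> J \<Longrightarrow> met x * g2 y = deriv (deriv f) x * (\<Lambda> * x + g y) + deriv f x * \<Lambda>"
      using homothety_equation[OF h] by metis
    have q: "met s * (s - \<alpha>2)\<^sup>2 * g2 y = - \<alpha>3 * (g y + \<Lambda> * \<alpha>2)" if "s \<in> I" for s
    proof -
      define z where "z = s - \<alpha>2"
      have z: "z > 0" "s = z + \<alpha>2" using pos[OF that] by (simp_all add: z_def)
      have "met s * z\<^sup>2 * g2 y = z\<^sup>2 * (- \<alpha>3 / z\<^sup>2 * (\<Lambda> * (z + \<alpha>2) + g y) + \<alpha>3 / z * \<Lambda>)"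
        using e[OF that xy(2)] unfolding d[OF that] z_def by simp
      also have "\<dots> = - \<alpha>3 * (g y + \<Lambda> * \<alpha>2)"
        using z(1) by (simp add: field_simps power2_eq_square)
      finally show ?thesis by (simp add: z_def)
    qed
    have fz: "deriv f x * (x - \<alpha>2) = \<alpha>3" using d(1)[OF xy(1)] pos[OF xy(1)] by simp
    have "((\<lambda>s. met s * (s - \<alpha>2)\<^sup>2 * g2 y) has_real_derivative
        (- 2 * deriv f x * met x * (x - \<alpha>2)\<^sup>2 + met x * (2 * (x - \<alpha>2))) * g2 y) (at x)"
      using metric_derivs(1)[OF xy(1)] by (auto intro!: derivative_eq_intros simp: algebra_simps)
    also have "(- 2 * deriv f x * met x * (x - \<alpha>2)\<^sup>2 + met x * (2 * (x - \<alpha>2))) * g2 y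
        = met x * (x - \<alpha>2) * (2 - 2 * \<alpha>3) * g2 y"
      unfolding fz[symmetric] by (simp add: algebra_simps power2_eq_square)
    finally have "((\<lambda>s. met s * (s - \<alpha>2)\<^sup>2 * g2 y) has_real_derivative
        met x * (x - \<alpha>2) * (2 - 2 * \<alpha>3) * g2 y) (at x)" .
    moreover have "((\<lambda>s. met s * (s - \<alpha>2)\<^sup>2 * g2 y) has_real_derivative 0) (at x)"
    proof -
      have "eventually (\<lambda>s. - \<alpha>3 * (g y + \<Lambda> * \<alpha>2) = met s * (s - \<alpha>2)\<^sup>2 * g2 y) (nhds x)"
        by (rule eventually_mono[OF eventually_nhds_in_open[OF open_I xy(1)]]) (use q in simp)
      from iffD1[OF DERIV_cong_ev[OF refl this refl] DERIV_const] show ?thesis .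
    qed
    ultimately have "met x * (x - \<alpha>2) * (2 - 2 * \<alpha>3) * g2 y = 0" by (rule DERIV_unique)
    then have "g2 y = 0" using pos[OF xy(1)] assms(3) by simp
    then have "g y + \<Lambda> * \<alpha>2 = 0" using q[OF xy(1)] assms(2) by simp
    then show ?thesis using g[OF xy] by (simp add: algebra_simps)
  qed
  obtain x0 y0 where b: "x0 \<in> I" "y0 \<in> J" using intervals by (auto simp: open_interval_def)
  let ?a = "\<lambda>(x, y, t, u). ((x - \<alpha>2) / 4, - ((\<alpha>3 - 1) / 4 * y), t, 0)"
  have "symmetry_algebra_enlarged_by f I J T U {?a, ?a, ?a}"
  proof (rule enlarged_algebra[OF hom hom hom])
    fix \<Lambda> \<eta> \<theta> assume "homothety f I J \<Lambda> \<eta> \<theta>"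
    from span[OF this] show "\<exists>c1 c2 c3. \<Lambda> = c1 * (1 / 4) + c2 * (1 / 4) + c3 * (1 / 4) \<and>
      (\<forall>x\<in>I. \<forall>y\<in>J. \<eta> x y = c1 * ((x - \<alpha>2) / 4) + c2 * ((x - \<alpha>2) / 4) + c3 * ((x - \<alpha>2) / 4))"
      by (intro exI[of _ "4 * \<Lambda>"] exI[of _ 0]) auto
  next
    show "\<exists>x\<in>I. \<exists>y\<in>J. (x - \<alpha>2) / 4 \<noteq> 0 \<or> (x - \<alpha>2) / 4 \<noteq> 0" using b pos by force
  qed auto
  then show ?thesis by simp
qed

text \<open>With constant \<open>f\<close> the homothety equation reads g'' = 0, so \<xi> =
  \<Lambda> x + p + q y, one parameter for each listed field.\<close>

lemma cylinder:
  assumes "\<beta>4 > 0" and fx: "\<forall>x\<in>I. f x = ln \<beta>4"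
  shows "symmetry_algebra_enlarged_by f I J T U {\<lambda>(x, y, t, u). (1, 0, 0, 0),
    \<lambda>(x, y, t, u). (- \<beta>4\<^sup>2 * y, x, 0, 0), \<lambda>(x, y, t, u). (x / 4, y / 4, t, 0)}"
proof -
  have d: "deriv f x = 0" "deriv (deriv f) x = 0" if "x \<in> I" for x
    by (rule f_derivs[of "\<lambda>_. ln \<beta>4" "\<lambda>_. 0" "\<lambda>_. 0", OF _ _ _ that]; use fx in simp)+
  have m: "met x = 1 / \<beta>4\<^sup>2" if "x \<in> I" for x using fx that exp_ln_met[OF assms(1)] by simp
  have 1: "homothety f I J 0 (\<lambda>x y. 1) (\<lambda>x y. 0)"
    by (rule homothetyI[where d = "\<lambda>x y. 0"]) (auto simp: d simp del: C_k_on.simps)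
  have 2: "homothety f I J 0 (\<lambda>x y. - \<beta>4\<^sup>2 * y) (\<lambda>x y. x)"
    by (rule homothetyI[where d = "\<lambda>x y. - \<beta>4\<^sup>2"])
      (use assms(1) in \<open>auto simp: d m[simplified] simp del: C_k_on.simps intro!: C_k_on_intros derivative_eq_intros\<close>)
  have 3: "homothety f I J (1 / 4) (\<lambda>x y. x / 4) (\<lambda>x y. y / 4)"
    by (rule homothetyI[where d = "\<lambda>x y. 0"]) (auto simp: d simp del: C_k_on.simps intro!: C_k_on_intros derivative_eq_intros)
  obtain x0 y0 where b: "x0 \<in> I" "y0 \<in> J" using intervals by (auto simp: open_interval_def)
  show ?thesis
  proof (rule enlarged_algebra[OF 1 2 3])
    fix \<Lambda> \<eta> \<theta> assume h: "homothety f I J \<Lambda> \<eta> \<theta>"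
    obtain g g1 g2 where g: "\<And>y. y \<in> J \<Longrightarrow> (g has_real_derivative g1 y) (at y)" "\<And>y. y \<in> J \<Longrightarrow> (g1 has_real_derivative g2 y) (at y)"
      "\<And>x y. x \<in> I \<Longrightarrow> y \<in> J \<Longrightarrow> \<eta> x y = \<Lambda> * x + g y"
      and e: "\<And>x y. x \<in> I \<Longrightarrow> y \<in> J \<Longrightarrow> met x * g2 y = deriv (deriv f) x * (\<Lambda> * x + g y) + deriv f x * \<Lambda>"
      using homothety_equation[OF h] by metis
    have "g2 y = 0" if "y \<in> J" for y using e[OF b(1) that] d[OF b(1)] by simp
    with g(2) have "(g1 has_real_derivative 0) (at y)" if "y \<in> J" for y using that by metis
    from ode_zero[OF intervals(2) g(1) this] obtain p q where "\<forall>y\<in>J. g y = p + q * y" by blast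
    with g(3) show "\<exists>c1 c2 c3. \<Lambda> = c1 * 0 + c2 * 0 + c3 * (1 / 4) \<and>
      (\<forall>x\<in>I. \<forall>y\<in>J. \<eta> x y = c1 * 1 + c2 * (- \<beta>4\<^sup>2 * y) + c3 * (x / 4))"
      using assms(1) by (intro exI[of _ p] exI[of _ "- q / \<beta>4\<^sup>2"] exI[of _ "4 * \<Lambda>"]) auto
  qed (use b in auto)
qed

text \<open>Multiplying the homothety equation by \<open>(l * (x + \<beta>4))\<^sup>2\<close>
  removes \<open>x\<close> and leaves a harmonic oscillator of frequency \<open>l\<close> about the
  value \<open>\<Lambda> * \<beta>4\<close>. The scaling field accounts for that shift, the two
  trigonometric fields for the oscillation. The plane is the case \<open>l = 1\<close>.\<close>

lemma cone:
  assumes "l > 0" and fx: "\<forall>x\<in>I. x > - \<beta>4 \<and> f x = ln (l * (x + \<beta>4))"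
  shows "symmetry_algebra_enlarged_by f I J T U {\<lambda>(x, y, t, u). ((x + \<beta>4) / 4, 0, t, 0),
    \<lambda>(x, y, t, u). (- l * cos (l * y), sin (l * y) / (x + \<beta>4), 0, 0),
    \<lambda>(x, y, t, u). (l * sin (l * y), cos (l * y) / (x + \<beta>4), 0, 0)}"
proof -
  have pos: "x + \<beta>4 > 0" if "x \<in> I" for x using fx that by force
  have F: "f x = ln l + ln (x + \<beta>4)" if "x \<in> I" for x
    using fx that pos[OF that] ln_mult_pos[OF assms(1) pos[OF that]] by simp
  have d1: "((\<lambda>x. ln l + ln (x + \<beta>4)) has_real_derivative 1 / (x + \<beta>4)) (at x)" if "x \<in> I" for x
      using pos[OF that] by (auto intro!: derivative_eq_intros simp: field_simps)
  have d2: "((\<lambda>x. 1 / (x + \<beta>4)) has_real_derivative - 1 / (x + \<beta>4)\<^sup>2) (at x)" if "x \<in> I" for x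
    using pos[OF that] by (auto intro!: derivative_eq_intros simp: field_simps power2_eq_square)
  have d: "deriv f x = 1 / (x + \<beta>4)" "deriv (deriv f) x = - 1 / (x + \<beta>4)\<^sup>2" if "x \<in> I" for x
    by (rule f_derivs[OF F d1 d2]; use that in simp)+
  have m: "met x = 1 / (l * (x + \<beta>4))\<^sup>2" if "x \<in> I" for x
    using fx that exp_ln_met[of "l * (x + \<beta>4)"] pos[OF that] assms(1) by simp
  have C: "C_k_on 4 (\<lambda>p. h (snd p) / (fst p + \<beta>4)) S" if "open S" "S = I \<times> J" "C_k_on 4 (\<lambda>p. h (snd p)) S"
    for S :: "(real \<times> real) set" and h
    using that pos by (intro C_k_on_divide C_k_on_add C_k_on_fst C_k_on_const) force+
  have 1: "homothety f I J (1 / 4) (\<lambda>x y. (x + \<beta>4) / 4) (\<lambda>x y. 0)"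
  proof (rule homothetyI[where d = "\<lambda>x y. 0"])
    fix x y assume x: "x \<in> I"
    show "((\<lambda>s. 0) has_real_derivative 1 / 4 - deriv f x * ((x + \<beta>4) / 4)) (at y)"
      using pos[OF x] d(1)[OF x] by simp
  qed (auto simp del: C_k_on.simps intro!: C_k_on_intros derivative_eq_intros)
  have 2: "homothety f I J 0 (\<lambda>x y. - l * cos (l * y)) (\<lambda>x y. sin (l * y) / (x + \<beta>4))"
  proof (rule homothetyI[where d = "\<lambda>x y. l * l * sin (l * y)"])
    fix x y assume x: "x \<in> I"
    show "((\<lambda>s. sin (l * s) / (x + \<beta>4)) has_real_derivative 0 - deriv f x * (- l * cos (l * y))) (at y)"
    proof -
      have "((\<lambda>s. sin (l * s)) has_real_derivative cos (l * y) * l) (at y)" by (auto intro!: derivative_eq_intros)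
      from DERIV_cdivide[OF this, of "x + \<beta>4"] show ?thesis by (simp add: d(1)[OF x] mult.commute)
    qed
    have "- met x * (l * l * sin (l * y)) = - sin (l * y) / (x + \<beta>4)\<^sup>2"
      unfolding m[OF x] using assms(1) by (simp add: power_mult_distrib power2_eq_square)
    then show "((\<lambda>s. sin (l * y) / (s + \<beta>4)) has_real_derivative - met x * (l * l * sin (l * y))) (at x)"
      using DERIV_const_divide[of x \<beta>4 "sin (l * y)"] pos[OF x] by simp
  qed (auto simp del: C_k_on.simps intro!: C C_k_on_intros derivative_eq_intros)
  have 3: "homothety f I J 0 (\<lambda>x y. l * sin (l * y)) (\<lambda>x y. cos (l * y) / (x + \<beta>4))"
  proof (rule homothetyI[where d = "\<lambda>x y. l * l * cos (l * y)"])
    fix x y assume x: "x \<in> I"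
    show "((\<lambda>s. cos (l * s) / (x + \<beta>4)) has_real_derivative 0 - deriv f x * (l * sin (l * y))) (at y)"
    proof -
      have "((\<lambda>s. cos (l * s)) has_real_derivative - (sin (l * y) * l)) (at y)" by (auto intro!: derivative_eq_intros)
      from DERIV_cdivide[OF this, of "x + \<beta>4"] show ?thesis by (simp add: d(1)[OF x] mult.commute)
    qed
    have "- met x * (l * l * cos (l * y)) = - cos (l * y) / (x + \<beta>4)\<^sup>2"
      unfolding m[OF x] using assms(1) by (simp add: power_mult_distrib power2_eq_square)
    then show "((\<lambda>s. cos (l * y) / (s + \<beta>4)) has_real_derivative - met x * (l * l * cos (l * y))) (at x)"
      using DERIV_const_divide[of x \<beta>4 "cos (l * y)"] pos[OF x] by simp
  qed (auto simp del: C_k_on.simps intro!: C C_k_on_intros derivative_eq_intros)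
  obtain x0 y0 where b: "x0 \<in> I" "y0 \<in> J" using intervals by (auto simp: open_interval_def)
  show ?thesis
  proof (rule enlarged_algebra[OF 1 2 3])
    fix \<Lambda> \<eta> \<theta> assume h: "homothety f I J \<Lambda> \<eta> \<theta>"
    obtain g g1 g2 where g: "\<And>y. y \<in> J \<Longrightarrow> (g has_real_derivative g1 y) (at y)" "\<And>y. y \<in> J \<Longrightarrow> (g1 has_real_derivative g2 y) (at y)"
      "\<And>x y. x \<in> I \<Longrightarrow> y \<in> J \<Longrightarrow> \<eta> x y = \<Lambda> * x + g y"
      and e: "\<And>x y. x \<in> I \<Longrightarrow> y \<in> J \<Longrightarrow> met x * g2 y = deriv (deriv f) x * (\<Lambda> * x + g y) + deriv f x * \<Lambda>"
      using homothety_equation[OF h] by metis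
    have "g2 y = - (l\<^sup>2) * (g y - \<Lambda> * \<beta>4)" if "y \<in> J" for y
    proof -
      define z where "z = x0 + \<beta>4"
      have z: "z > 0" "x0 = z - \<beta>4" using pos[OF b(1)] by (simp_all add: z_def)
      have "1 / (l * z)\<^sup>2 * g2 y = - 1 / z\<^sup>2 * (\<Lambda> * (z - \<beta>4) + g y) + 1 / z * \<Lambda>"
        using e[OF b(1) that] unfolding d[OF b(1)] m[OF b(1)] z_def by simp
      then have "(l * z)\<^sup>2 * (1 / (l * z)\<^sup>2 * g2 y) = (l * z)\<^sup>2 * (- 1 / z\<^sup>2 * (\<Lambda> * (z - \<beta>4) + g y) + 1 / z * \<Lambda>)"
        by simp
      moreover have "(l * z)\<^sup>2 * (1 / (l * z)\<^sup>2 * g2 y) = g2 y" using z(1) assms(1) by simp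
      moreover have "(l * z)\<^sup>2 * (- 1 / z\<^sup>2 * (\<Lambda> * (z - \<beta>4) + g y) + 1 / z * \<Lambda>) = - (l\<^sup>2) * (g y - \<Lambda> * \<beta>4)"
        using z(1) by (simp add: field_simps power2_eq_square)
      ultimately show ?thesis by simp
    qed
    with g(2) have 2: "(g1 has_real_derivative - (l\<^sup>2) * (g y - \<Lambda> * \<beta>4)) (at y)" if "y \<in> J" for y using that by metis
    have 1: "((\<lambda>y. g y - \<Lambda> * \<beta>4) has_real_derivative g1 y) (at y)" if "y \<in> J" for y
      using g(1)[OF that] by (auto intro!: derivative_eq_intros)
    obtain p q where pq: "\<forall>y\<in>J. g y - \<Lambda> * \<beta>4 = p * cos (l * y) + q * sin (l * y)"
      using ode_neg[OF intervals(2) 1 _ 2] assms(1) by auto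
    have "\<eta> x y = 4 * \<Lambda> * ((x + \<beta>4) / 4) + (- p / l) * (- l * cos (l * y)) + (q / l) * (l * sin (l * y))"
      if "x \<in> I" "y \<in> J" for x y
      using g(3)[OF that] pq that assms(1) by (simp add: algebra_simps)
    then show "\<exists>c1 c2 c3. \<Lambda> = c1 * (1 / 4) + c2 * 0 + c3 * 0 \<and>
      (\<forall>x\<in>I. \<forall>y\<in>J. \<eta> x y = c1 * ((x + \<beta>4) / 4) + c2 * (- l * cos (l * y)) + c3 * (l * sin (l * y)))"
      by (intro exI[of _ "4 * \<Lambda>"] exI[of _ "- p / l"] exI[of _ "q / l"]) auto
  next
    show "\<exists>x\<in>I. \<exists>y\<in>J. (x + \<beta>4) / 4 \<noteq> 0 \<or> - l * cos (l * y) \<noteq> 0" using b pos by force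
  qed auto
qed

text \<open>The Gaussian curvature is -(f'' + f'^2) = -c. Dividing the homothety equation by
  \<open>met x\<close> gives g'' = \<kappa> g + \<Lambda> (\<kappa> x + f' exp(2f)). The left side
  does not contain \<open>x\<close>, and the \<open>x\<close>-derivative of the right side is 2
  \<Lambda> c exp(2f); so non-zero constant curvature excludes proper homotheties.\<close>

lemma constant_curvature:
  assumes f2: "\<And>x. x \<in> I \<Longrightarrow> deriv (deriv f) x = \<kappa> * met x"
    and c: "\<And>x. x \<in> I \<Longrightarrow> deriv (deriv f) x + (deriv f x)\<^sup>2 = c" "c \<noteq> 0" and h: "homothety f I J \<Lambda> \<eta> \<theta>"
  obtains g g1 where "\<Lambda> = 0" "\<And>y. y \<in> J \<Longrightarrow> (g has_real_derivative g1 y) (at y)"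
    "\<And>y. y \<in> J \<Longrightarrow> (g1 has_real_derivative \<kappa> * g y) (at y)" "\<And>x y. x \<in> I \<Longrightarrow> y \<in> J \<Longrightarrow> \<eta> x y = g y"
proof -
  obtain g g1 g2 where g: "\<And>y. y \<in> J \<Longrightarrow> (g has_real_derivative g1 y) (at y)" "\<And>y. y \<in> J \<Longrightarrow> (g1 has_real_derivative g2 y) (at y)"
    "\<And>x y. x \<in> I \<Longrightarrow> y \<in> J \<Longrightarrow> \<eta> x y = \<Lambda> * x + g y"
    and e: "\<And>x y. x \<in> I \<Longrightarrow> y \<in> J \<Longrightarrow> met x * g2 y = deriv (deriv f) x * (\<Lambda> * x + g y) + deriv f x * \<Lambda>"
    using homothety_equation[OF h] by metis
  have ex: "exp (2 * f x) * met x = 1" for x by (simp add: exp_add[symmetric])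
  have e': "g2 y = \<kappa> * g y + \<Lambda> * (\<kappa> * x + deriv f x * exp (2 * f x))" if "x \<in> I" "y \<in> J" for x y
  proof -
    have "exp (2 * f x) * (met x * g2 y) = exp (2 * f x) * (\<kappa> * met x * (\<Lambda> * x + g y) + deriv f x * \<Lambda>)"
      using e[OF that] f2[OF that(1)] by simp
    then have "(exp (2 * f x) * met x) * g2 y = (exp (2 * f x) * met x) * \<kappa> * (\<Lambda> * x + g y) + exp (2 * f x) * deriv f x * \<Lambda>"
      by (simp add: algebra_simps)
    then show ?thesis unfolding ex by (simp add: algebra_simps)
  qed
  obtain x0 y0 where b: "x0 \<in> I" "y0 \<in> J" using intervals by (auto simp: open_interval_def)
  have "((\<lambda>x. \<kappa> * g y0 + \<Lambda> * (\<kappa> * x + deriv f x * exp (2 * f x))) has_real_derivative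
      \<Lambda> * (\<kappa> + (deriv (deriv f) x0 * exp (2 * f x0) + deriv f x0 * (2 * deriv f x0 * exp (2 * f x0))))) (at x0)"
    using metric_derivs(1,2)[OF b(1)] by (auto intro!: derivative_eq_intros)
  moreover have "((\<lambda>x. \<kappa> * g y0 + \<Lambda> * (\<kappa> * x + deriv f x * exp (2 * f x))) has_real_derivative 0) (at x0)"
  proof -
    have "eventually (\<lambda>x. g2 y0 = \<kappa> * g y0 + \<Lambda> * (\<kappa> * x + deriv f x * exp (2 * f x))) (nhds x0)"
      by (rule eventually_mono[OF eventually_nhds_in_open[OF open_I b(1)]]) (rule e'[OF _ b(2)])
    from iffD1[OF DERIV_cong_ev[OF refl this refl] DERIV_const] show ?thesis .
  qed
  ultimately have "\<Lambda> * (\<kappa> + (deriv (deriv f) x0 * exp (2 * f x0) + deriv f x0 * (2 * deriv f x0 * exp (2 * f x0)))) = 0"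
    by (rule DERIV_unique)
  moreover have "\<kappa> = deriv (deriv f) x0 * exp (2 * f x0)"
    using f2[OF b(1)] ex[of x0] by (simp add: mult.assoc mult.commute)
  ultimately have "\<Lambda> * (2 * exp (2 * f x0) * (deriv (deriv f) x0 + (deriv f x0)\<^sup>2)) = 0"
    by (simp add: algebra_simps power2_eq_square)
  then have \<Lambda>: "\<Lambda> = 0" using c(1)[OF b(1)] c(2) by simp
  have "g2 y = \<kappa> * g y" if "y \<in> J" for y using e'[OF b(1) that] \<Lambda> by simp
  then have "(g1 has_real_derivative \<kappa> * g y) (at y)" if "y \<in> J" for y using g(2)[OF that] that by simp
  then show thesis using that[OF \<Lambda> g(1)] g(3) \<Lambda> by simp
qed

text \<open>Here f'' = 0, so \<kappa> = 0, although the curvature -\<beta>3^2 is not zero: \<xi> is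
  affine in \<open>y\<close> and free of \<open>x\<close>. The constant part and the linear part
  correspond to the two fields.\<close>

lemma pseudosphere:
  assumes "\<beta>3 \<noteq> 0" and fx: "\<forall>x\<in>I. f x = \<beta>3 * x + C"
  shows "symmetry_algebra_enlarged_by f I J T U {\<lambda>(x, y, t, u). (- inverse \<beta>3, y, 0, 0),
    \<lambda>(x, y, t, u). (2 * \<beta>3 * exp (2 * C) * y, exp (- 2 * \<beta>3 * x) - \<beta>3\<^sup>2 * exp (2 * C) * y\<^sup>2, 0, 0)}"
proof -
  have d: "deriv f x = \<beta>3" "deriv (deriv f) x = 0" if "x \<in> I" for x
    by (rule f_derivs[of "\<lambda>x. \<beta>3 * x + C" "\<lambda>_. \<beta>3" "\<lambda>_. 0", OF _ _ _ that];
        use fx in \<open>auto intro!: derivative_eq_intros\<close>)+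
  have m: "met x * exp (2 * C) = exp (- 2 * \<beta>3 * x)" if "x \<in> I" for x
    using fx that by (simp add: exp_add[symmetric] algebra_simps)
  have 1: "homothety f I J 0 (\<lambda>x y. - inverse \<beta>3) (\<lambda>x y. y)"
    by (rule homothetyI[where d = "\<lambda>x y. 0"]) (auto simp: d assms simp del: C_k_on.simps intro: C_k_on_intros)
  have 2: "homothety f I J 0 (\<lambda>x y. 2 * \<beta>3 * exp (2 * C) * y) (\<lambda>x y. exp (- 2 * \<beta>3 * x) - \<beta>3\<^sup>2 * exp (2 * C) * y\<^sup>2)"
  proof (rule homothetyI[where d = "\<lambda>x y. 2 * \<beta>3 * exp (2 * C)"])
    fix x y assume x: "x \<in> I"
    show "((\<lambda>s. exp (- 2 * \<beta>3 * x) - \<beta>3\<^sup>2 * exp (2 * C) * s\<^sup>2) has_real_derivative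
        0 - deriv f x * (2 * \<beta>3 * exp (2 * C) * y)) (at y)"
      by (auto intro!: derivative_eq_intros simp: d[OF x] power2_eq_square)
    have "- met x * (2 * \<beta>3 * exp (2 * C)) = - 2 * \<beta>3 * exp (- 2 * \<beta>3 * x)"
      unfolding m[OF x, symmetric] by (simp add: algebra_simps)
    then show "((\<lambda>s. exp (- 2 * \<beta>3 * s) - \<beta>3\<^sup>2 * exp (2 * C) * y\<^sup>2) has_real_derivative
        - met x * (2 * \<beta>3 * exp (2 * C))) (at x)"
      by (simp only:) (auto intro!: derivative_eq_intros)
  qed (auto simp del: C_k_on.simps intro!: C_k_on_intros derivative_eq_intros)
  obtain x0 y0 where b: "x0 \<in> I" "y0 \<in> J" using intervals by (auto simp: open_interval_def)
  let ?a1 = "\<lambda>(x, y, t, u). (- inverse \<beta>3, y, 0, 0)"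
  let ?a2 = "\<lambda>(x, y, t, u). (2 * \<beta>3 * exp (2 * C) * y, exp (- 2 * \<beta>3 * x) - \<beta>3\<^sup>2 * exp (2 * C) * y\<^sup>2, 0, 0)"
  have "symmetry_algebra_enlarged_by f I J T U {?a1, ?a2, ?a2}"
  proof (rule enlarged_algebra[OF 1 2 2])
    fix \<Lambda> \<eta> \<theta> assume h: "homothety f I J \<Lambda> \<eta> \<theta>"
    obtain g g1 where \<Lambda>: "\<Lambda> = 0" and g: "\<And>y. y \<in> J \<Longrightarrow> (g has_real_derivative g1 y) (at y)"
      "\<And>y. y \<in> J \<Longrightarrow> (g1 has_real_derivative 0 * g y) (at y)" "\<And>x y. x \<in> I \<Longrightarrow> y \<in> J \<Longrightarrow> \<eta> x y = g y"
      by (rule constant_curvature[OF _ _ _ h, of 0 "\<beta>3\<^sup>2"]) (use d assms(1) in auto)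
    obtain p q where "\<forall>y\<in>J. g y = p + q * y" using ode_zero[OF intervals(2) g(1)] g(2) by auto
    with g(3) \<Lambda> show "\<exists>c1 c2 c3. \<Lambda> = c1 * 0 + c2 * 0 + c3 * 0 \<and> (\<forall>x\<in>I. \<forall>y\<in>J. \<eta> x y =
        c1 * (- inverse \<beta>3) + c2 * (2 * \<beta>3 * exp (2 * C) * y) + c3 * (2 * \<beta>3 * exp (2 * C) * y))"
      using assms(1) by (intro exI[of _ "- \<beta>3 * p"] exI[of _ "q / (2 * \<beta>3 * exp (2 * C))"] exI[of _ 0]) auto
  qed (use b assms(1) in auto)
  then show ?thesis by simp
qed

end


section \<open>Surfaces with trigonometric and hyperbolic profile functions\<close>

context surface_domain
begin

text \<open>Common treatment of all cases with \<kappa> = -\<omega>^2. For fields of this shape the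
  homothety equations reduce to f' = -A \<omega> / a and to the assumed derivative of
  \<open>A\<close>; together they give f'' = -\<omega>^2 exp(-2f). The last assumption states that
  f'' + f'^2 is the constant \<open>c\<close>.\<close>

lemma trigonometric_surface:
  assumes nz: "\<omega> \<noteq> 0" "a \<noteq> 0" "c \<noteq> 0" and A: "C_k_on 4 A I" "\<And>x. x \<in> I \<Longrightarrow> (A has_real_derivative met x * a * \<omega>) (at x)"
    and F: "\<And>x. x \<in> I \<Longrightarrow> f x = F x" "\<And>x. x \<in> I \<Longrightarrow> (F has_real_derivative - A x * \<omega> / a) (at x)"
    and c: "\<And>x. x \<in> I \<Longrightarrow> - (\<omega>\<^sup>2) * met x + (A x * \<omega> / a)\<^sup>2 = c"
  shows "symmetry_algebra_enlarged_by f I J T U {\<lambda>(x, y, t, u). (a * cos (\<omega> * y), A x * sin (\<omega> * y), 0, 0),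
    \<lambda>(x, y, t, u). (- a * sin (\<omega> * y), A x * cos (\<omega> * y), 0, 0)}"
proof -
  have F2: "((\<lambda>x. - A x * \<omega> / a) has_real_derivative - (\<omega>\<^sup>2) * met x) (at x)" if "x \<in> I" for x
    using DERIV_cmult[OF A(2)[OF that], of "- \<omega> / a"] nz by (simp add: power2_eq_square mult_ac)
  have d: "deriv f x = - A x * \<omega> / a" "deriv (deriv f) x = - (\<omega>\<^sup>2) * met x" if "x \<in> I" for x
    by (rule f_derivs[OF F F2]; use that in simp)+
  have CA: "C_k_on 4 (\<lambda>p. A (fst p) * h (snd p)) S" if "open S" "S = I \<times> J" "C_k_on 4 (\<lambda>p. h (snd p)) S"
    for S :: "(real \<times> real) set" and h
    by (rule C_k_on_mult[OF that(1) C_k_on_compose[OF that(1) C_k_on_fst[OF that(1)] A(1)] that(3)]) (use that(2) in auto)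
  have CA0: "C_k_on 4 (\<lambda>p. A (fst p)) S" if "open S" "S = I \<times> J" for S :: "(real \<times> real) set"
    using CA[of S "\<lambda>_. 1"] that C_k_on_const by simp
  have 1: "homothety f I J 0 (\<lambda>x y. a * cos (\<omega> * y)) (\<lambda>x y. A x * sin (\<omega> * y))"
  proof (rule homothetyI[where d = "\<lambda>x y. - a * \<omega> * sin (\<omega> * y)"])
    fix x y assume x: "x \<in> I"
    show "((\<lambda>s. A x * sin (\<omega> * s)) has_real_derivative 0 - deriv f x * (a * cos (\<omega> * y))) (at y)"
      using nz by (auto intro!: derivative_eq_intros simp: d[OF x])
    show "((\<lambda>s. A s * sin (\<omega> * y)) has_real_derivative - met x * (- a * \<omega> * sin (\<omega> * y))) (at x)"
      using DERIV_cmult_right[OF A(2)[OF x], of "sin (\<omega> * y)"] by (simp add: mult.assoc)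
  qed (auto simp del: C_k_on.simps intro!: CA CA0 C_k_on_intros derivative_eq_intros)
  have 2: "homothety f I J 0 (\<lambda>x y. - a * sin (\<omega> * y)) (\<lambda>x y. A x * cos (\<omega> * y))"
  proof (rule homothetyI[where d = "\<lambda>x y. - a * \<omega> * cos (\<omega> * y)"])
    fix x y assume x: "x \<in> I"
    show "((\<lambda>s. A x * cos (\<omega> * s)) has_real_derivative 0 - deriv f x * (- a * sin (\<omega> * y))) (at y)"
      using nz by (auto intro!: derivative_eq_intros simp: d[OF x])
    show "((\<lambda>s. A s * cos (\<omega> * y)) has_real_derivative - met x * (- a * \<omega> * cos (\<omega> * y))) (at x)"
      using DERIV_cmult_right[OF A(2)[OF x], of "cos (\<omega> * y)"] by (simp add: mult.assoc)
  qed (auto simp del: C_k_on.simps intro!: CA CA0 C_k_on_intros derivative_eq_intros)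
  obtain x0 y0 where b: "x0 \<in> I" "y0 \<in> J" using intervals by (auto simp: open_interval_def)
  let ?a1 = "\<lambda>(x, y, t, u). (a * cos (\<omega> * y), A x * sin (\<omega> * y), 0, 0)"
  let ?a2 = "\<lambda>(x, y, t, u). (- a * sin (\<omega> * y), A x * cos (\<omega> * y), 0, 0)"
  have "symmetry_algebra_enlarged_by f I J T U {?a1, ?a2, ?a2}"
  proof (rule enlarged_algebra[OF 1 2 2])
    fix \<Lambda> \<eta> \<theta> assume h: "homothety f I J \<Lambda> \<eta> \<theta>"
    obtain g g1 where \<Lambda>: "\<Lambda> = 0" and g: "\<And>y. y \<in> J \<Longrightarrow> (g has_real_derivative g1 y) (at y)"
      "\<And>y. y \<in> J \<Longrightarrow> (g1 has_real_derivative - (\<omega>\<^sup>2) * g y) (at y)" "\<And>x y. x \<in> I \<Longrightarrow> y \<in> J \<Longrightarrow> \<eta> x y = g y"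
      by (rule constant_curvature[OF _ _ nz(3) h, of "- (\<omega>\<^sup>2)"]) (use d c in auto)
    obtain p q where "\<forall>y\<in>J. g y = p * cos (\<omega> * y) + q * sin (\<omega> * y)" using ode_neg[OF intervals(2) g(1) nz(1) g(2)] by auto
    with g(3) \<Lambda> show "\<exists>c1 c2 c3. \<Lambda> = c1 * 0 + c2 * 0 + c3 * 0 \<and> (\<forall>x\<in>I. \<forall>y\<in>J. \<eta> x y =
        c1 * (a * cos (\<omega> * y)) + c2 * (- a * sin (\<omega> * y)) + c3 * (- a * sin (\<omega> * y)))"
      using nz(2) by (intro exI[of _ "p / a"] exI[of _ "- q / a"] exI[of _ 0]) auto
  next
    have "cos (\<omega> * y0) \<noteq> 0 \<or> sin (\<omega> * y0) \<noteq> 0" using sin_zero_norm_cos_one[of "\<omega> * y0"] by auto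
    then show "\<exists>x\<in>I. \<exists>y\<in>J. a * cos (\<omega> * y) \<noteq> 0 \<or> - a * sin (\<omega> * y) \<noteq> 0" using b nz(2) by auto
  qed auto
  then show ?thesis by simp
qed

text \<open>The case a = -\<alpha>7, \<omega> = \<alpha>7 / \<beta>7. The relation f' = -A \<omega>
  / a forces A = \<beta>7 f', so \<open>A\<close> is the hyperbolic cotangent with the same phase
  \<alpha>8 as \<open>f\<close>. The lower bound on \<open>x\<close> makes the sine positive and
  removes the absolute value.\<close>

lemma sinh_surface:
  assumes "\<alpha>7 > 0" "\<beta>7 > 0" and fx: "\<forall>x\<in>I. - \<alpha>8 * \<beta>7 < x \<and> f x = ln \<bar>\<alpha>7 * sinh (x / \<beta>7 + \<alpha>8)\<bar>"
  shows "symmetry_algebra_enlarged_by f I J T U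
    {\<lambda>(x, y, t, u). (- \<alpha>7 * cos (\<alpha>7 / \<beta>7 * y), cosh (x / \<beta>7 + \<alpha>8) / sinh (x / \<beta>7 + \<alpha>8) * sin (\<alpha>7 / \<beta>7 * y), 0, 0),
     \<lambda>(x, y, t, u). (\<alpha>7 * sin (\<alpha>7 / \<beta>7 * y), cosh (x / \<beta>7 + \<alpha>8) / sinh (x / \<beta>7 + \<alpha>8) * cos (\<alpha>7 / \<beta>7 * y), 0, 0)}"
proof -
  have pos: "sinh (x / \<beta>7 + \<alpha>8) > 0" if "x \<in> I" for x
  proof -
    have "- \<alpha>8 * \<beta>7 < x" using fx that by blast
    then have "- \<alpha>8 < x / \<beta>7" using assms(2) by (simp add: pos_less_divide_eq)
    then show ?thesis by simp
  qed
  define A where "A = (\<lambda>x. cosh (x / \<beta>7 + \<alpha>8) / sinh (x / \<beta>7 + \<alpha>8))"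
  have m: "met x = 1 / (\<alpha>7 * sinh (x / \<beta>7 + \<alpha>8))\<^sup>2" if "x \<in> I" for x
    using fx that exp_ln_met[of "\<alpha>7 * sinh (x / \<beta>7 + \<alpha>8)"] pos[OF that] assms(1) by simp
  have "symmetry_algebra_enlarged_by f I J T U {\<lambda>(x, y, t, u). (- \<alpha>7 * cos (\<alpha>7 / \<beta>7 * y), A x * sin (\<alpha>7 / \<beta>7 * y), 0, 0),
    \<lambda>(x, y, t, u). (- (- \<alpha>7) * sin (\<alpha>7 / \<beta>7 * y), A x * cos (\<alpha>7 / \<beta>7 * y), 0, 0)}"
  proof (rule trigonometric_surface[where c = "1 / \<beta>7\<^sup>2" and F = "\<lambda>x. ln (\<alpha>7 * sinh (x / \<beta>7 + \<alpha>8))"])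
    show "C_k_on 4 A I" unfolding A_def
    proof (rule C_k_on_divide[OF open_I])
      have "C_k_on 4 (\<lambda>x. x / \<beta>7 + \<alpha>8) I"
        by (intro C_k_on_add C_k_on_const open_I C_k_on_linear bounded_linear_divide)
      then show "C_k_on 4 (\<lambda>x. cosh (x / \<beta>7 + \<alpha>8)) I" "C_k_on 4 (\<lambda>x. sinh (x / \<beta>7 + \<alpha>8)) I"
        by (intro C_k_on_cosh_comp C_k_on_sinh_comp open_I; assumption)+
      show "sinh (x / \<beta>7 + \<alpha>8) \<noteq> 0" if "x \<in> I" for x using pos[OF that] by simp
    qed
    fix x assume x: "x \<in> I"
    define S where "S = sinh (x / \<beta>7 + \<alpha>8)"
    define K where "K = cosh (x / \<beta>7 + \<alpha>8)"
    have S: "S > 0" using pos[OF x] by (simp add: S_def)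
    have KS: "K\<^sup>2 = S\<^sup>2 + 1" unfolding K_def S_def by (rule cosh_square_eq)
    have "(A has_real_derivative (1 / \<beta>7 * S * S - K * (1 / \<beta>7 * K)) / (S * S)) (at x)"
      unfolding A_def using S assms by (auto intro!: derivative_eq_intros simp: S_def K_def)
    also have "(1 / \<beta>7 * S * S - K * (1 / \<beta>7 * K)) / (S * S) = (S\<^sup>2 - K\<^sup>2) / (\<beta>7 * S\<^sup>2)"
      using S assms(2) by (simp add: field_simps power2_eq_square)
    also have "\<dots> = met x * - \<alpha>7 * (\<alpha>7 / \<beta>7)"
      unfolding KS m[OF x] S_def[symmetric] using S assms by (simp add: field_simps power2_eq_square)
    finally show "(A has_real_derivative met x * - \<alpha>7 * (\<alpha>7 / \<beta>7)) (at x)" .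
    show "f x = ln (\<alpha>7 * sinh (x / \<beta>7 + \<alpha>8))" using fx x pos[OF x] assms(1) by simp
    show "((\<lambda>x. ln (\<alpha>7 * sinh (x / \<beta>7 + \<alpha>8))) has_real_derivative - A x * (\<alpha>7 / \<beta>7) / - \<alpha>7) (at x)"
      using pos[OF x] assms by (auto intro!: derivative_eq_intros simp: A_def field_simps)
    have "A x * (\<alpha>7 / \<beta>7) / - \<alpha>7 = - (K / (S * \<beta>7))" using assms by (simp add: A_def K_def S_def)
    then have "- ((\<alpha>7 / \<beta>7)\<^sup>2) * met x + (A x * (\<alpha>7 / \<beta>7) / - \<alpha>7)\<^sup>2 = - (1 / (\<beta>7\<^sup>2 * S\<^sup>2)) + K\<^sup>2 / (S\<^sup>2 * \<beta>7\<^sup>2)"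
      unfolding m[OF x] S_def[symmetric] using assms by (simp add: power_divide power_mult_distrib)
    also have "\<dots> = 1 / \<beta>7\<^sup>2" unfolding KS using S assms by (simp add: field_simps)
    finally show "- ((\<alpha>7 / \<beta>7)\<^sup>2) * met x + (A x * (\<alpha>7 / \<beta>7) / - \<alpha>7)\<^sup>2 = 1 / \<beta>7\<^sup>2" .
  qed (use assms in auto)
  then show ?thesis by (simp add: A_def)
qed

text \<open>The case a = \<alpha>5, \<omega> = \<alpha>5 / \<beta>6, with positive curvature 1 /
  \<beta>6^2. From f' = -A \<omega> / a the function \<open>A\<close> is the tangent with the phase
  of \<open>f\<close>. The sign of the cosine on \<open>I\<close> is unknown, so \<open>f\<close> is
  written as half the logarithm of a square.\<close>

lemma cos_surface:
  assumes "\<alpha>5 > 0" "\<beta>6 > 0" and fx: "\<forall>x\<in>I. cos (x / \<beta>6 + \<alpha>6) \<noteq> 0 \<and> f x = ln \<bar>\<alpha>5 * cos (x / \<beta>6 + \<alpha>6)\<bar>"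
  shows "symmetry_algebra_enlarged_by f I J T U
    {\<lambda>(x, y, t, u). (\<alpha>5 * cos (\<alpha>5 / \<beta>6 * y), tan (x / \<beta>6 + \<alpha>6) * sin (\<alpha>5 / \<beta>6 * y), 0, 0),
     \<lambda>(x, y, t, u). (- \<alpha>5 * sin (\<alpha>5 / \<beta>6 * y), tan (x / \<beta>6 + \<alpha>6) * cos (\<alpha>5 / \<beta>6 * y), 0, 0)}"
proof (rule trigonometric_surface[where c = "- (1 / \<beta>6\<^sup>2)" and F = "\<lambda>x. ln ((\<alpha>5 * cos (x / \<beta>6 + \<alpha>6))\<^sup>2) / 2"])
  have m: "met x = 1 / (\<alpha>5 * cos (x / \<beta>6 + \<alpha>6))\<^sup>2" if "x \<in> I" for x
    using fx that exp_ln_met[of "\<bar>\<alpha>5 * cos (x / \<beta>6 + \<alpha>6)\<bar>"] assms(1) by simp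
  show "C_k_on 4 (\<lambda>x. tan (x / \<beta>6 + \<alpha>6)) I" unfolding tan_def
  proof (rule C_k_on_divide[OF open_I])
    have "C_k_on 4 (\<lambda>x. x / \<beta>6 + \<alpha>6) I"
      by (intro C_k_on_add C_k_on_const open_I C_k_on_linear bounded_linear_divide)
    then show "C_k_on 4 (\<lambda>x. sin (x / \<beta>6 + \<alpha>6)) I" "C_k_on 4 (\<lambda>x. cos (x / \<beta>6 + \<alpha>6)) I"
      by (intro C_k_on_cos_comp C_k_on_sin_comp open_I; assumption)+
  qed (use fx in auto)
  fix x assume x: "x \<in> I"
  define S where "S = sin (x / \<beta>6 + \<alpha>6)"
  define K where "K = cos (x / \<beta>6 + \<alpha>6)"
  have K: "K \<noteq> 0" using fx x by (simp add: K_def)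
  have KS: "S\<^sup>2 = 1 - K\<^sup>2" unfolding K_def S_def by (rule sin_squared_eq)
  have "((\<lambda>x. tan (x / \<beta>6 + \<alpha>6)) has_real_derivative inverse (K\<^sup>2) * (1 / \<beta>6)) (at x)"
    using DERIV_chain2[OF DERIV_tan, of "\<lambda>x. x / \<beta>6 + \<alpha>6" x "1 / \<beta>6"] K assms
    by (auto intro!: derivative_eq_intros simp: K_def)
  also have "inverse (K\<^sup>2) * (1 / \<beta>6) = met x * \<alpha>5 * (\<alpha>5 / \<beta>6)"
    unfolding m[OF x] K_def[symmetric] using K assms by (simp add: field_simps power2_eq_square)
  finally show "((\<lambda>x. tan (x / \<beta>6 + \<alpha>6)) has_real_derivative met x * \<alpha>5 * (\<alpha>5 / \<beta>6)) (at x)" .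
  show "f x = ln ((\<alpha>5 * cos (x / \<beta>6 + \<alpha>6))\<^sup>2) / 2"
    using fx x assms(1) ln_abs_eq[of "\<alpha>5 * cos (x / \<beta>6 + \<alpha>6)"] by simp
  have "((\<lambda>x. (\<alpha>5 * cos (x / \<beta>6 + \<alpha>6))\<^sup>2) has_real_derivative 2 * (\<alpha>5 * K) * (\<alpha>5 * (- S / \<beta>6))) (at x)"
    using assms by (auto intro!: derivative_eq_intros simp: K_def S_def)
  moreover have "(\<alpha>5 * cos (x / \<beta>6 + \<alpha>6))\<^sup>2 > 0" using K assms(1) by (simp add: K_def)
  ultimately have "((\<lambda>x. ln ((\<alpha>5 * cos (x / \<beta>6 + \<alpha>6))\<^sup>2)) has_real_derivative
      1 / (\<alpha>5 * cos (x / \<beta>6 + \<alpha>6))\<^sup>2 * (2 * (\<alpha>5 * K) * (\<alpha>5 * (- S / \<beta>6)))) (at x)"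
    by (rule DERIV_chain2[where g = "\<lambda>x. (\<alpha>5 * cos (x / \<beta>6 + \<alpha>6))\<^sup>2", OF DERIV_ln_divide, rotated])
  from DERIV_cdivide[OF this, of 2]
  show "((\<lambda>x. ln ((\<alpha>5 * cos (x / \<beta>6 + \<alpha>6))\<^sup>2) / 2) has_real_derivative
      - tan (x / \<beta>6 + \<alpha>6) * (\<alpha>5 / \<beta>6) / \<alpha>5) (at x)"
    using K assms unfolding tan_def S_def[symmetric] K_def[symmetric] by (simp add: power2_eq_square)
  have "- ((\<alpha>5 / \<beta>6)\<^sup>2) * met x + (tan (x / \<beta>6 + \<alpha>6) * (\<alpha>5 / \<beta>6) / \<alpha>5)\<^sup>2 = - (1 / (\<beta>6\<^sup>2 * K\<^sup>2)) + S\<^sup>2 / (K\<^sup>2 * \<beta>6\<^sup>2)"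
    unfolding m[OF x] K_def[symmetric] tan_def S_def[symmetric] using assms by (simp add: power_divide power_mult_distrib)
  also have "\<dots> = - (1 / \<beta>6\<^sup>2)" unfolding KS using K assms by (simp add: field_simps)
  finally show "- ((\<alpha>5 / \<beta>6)\<^sup>2) * met x + (tan (x / \<beta>6 + \<alpha>6) * (\<alpha>5 / \<beta>6) / \<alpha>5)\<^sup>2 = - (1 / \<beta>6\<^sup>2)" .
qed (use assms in auto)

text \<open>Now f'' = \<omega>^2 exp(-2f) with a positive factor, so the equation for
  \<open>g\<close> has exponential solutions and \<open>trigonometric_surface\<close> does not cover
  it. The key identity \<open>m2\<close> expresses the metric coefficient through the square of
  \<open>A\<close>, which makes the derivative of the hyperbolic tangent match the homothety
  equations.\<close>

lemma cosh_surface: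
  assumes "\<alpha>7 > 0" "\<beta>7 > 0" and fx: "\<forall>x\<in>I. f x = ln (\<alpha>7 * cosh (x / \<beta>7 + \<alpha>8))"
  shows "symmetry_algebra_enlarged_by f I J T U
    {\<lambda>(x, y, t, u). (- \<alpha>7 * exp (\<alpha>7 / \<beta>7 * y), tanh (x / \<beta>7 + \<alpha>8) * exp (\<alpha>7 / \<beta>7 * y), 0, 0),
     \<lambda>(x, y, t, u). (\<alpha>7 * exp (- (\<alpha>7 / \<beta>7 * y)), tanh (x / \<beta>7 + \<alpha>8) * exp (- (\<alpha>7 / \<beta>7 * y)), 0, 0)}"
proof -
  define \<omega> where "\<omega> = \<alpha>7 / \<beta>7"
  define A where "A = (\<lambda>x. tanh (x / \<beta>7 + \<alpha>8))"
  have w: "\<omega> \<noteq> 0" using assms by (simp add: \<omega>_def)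
  have pos: "cosh (x / \<beta>7 + \<alpha>8) > 0" for x by (rule cosh_real_pos)
  have m: "met x = 1 / (\<alpha>7 * cosh (x / \<beta>7 + \<alpha>8))\<^sup>2" if "x \<in> I" for x
    using fx that exp_ln_met[of "\<alpha>7 * cosh (x / \<beta>7 + \<alpha>8)"] pos assms(1) by simp
  have m2: "met x * \<alpha>7\<^sup>2 = 1 - (A x)\<^sup>2" if "x \<in> I" for x
  proof -
    define S where "S = sinh (x / \<beta>7 + \<alpha>8)"
    define K where "K = cosh (x / \<beta>7 + \<alpha>8)"
    have K: "K > 0" using pos[of x] by (simp add: K_def)
    have "1 - (S / K)\<^sup>2 = (K\<^sup>2 - S\<^sup>2) / K\<^sup>2" using K by (simp add: power_divide diff_divide_distrib)
    also have "\<dots> = 1 / K\<^sup>2" unfolding K_def S_def cosh_square_eq by simp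
    also have "\<dots> = 1 / (\<alpha>7 * K)\<^sup>2 * \<alpha>7\<^sup>2" using assms(1) by (simp add: power_mult_distrib)
    finally show ?thesis unfolding m[OF that] A_def tanh_def S_def K_def by simp
  qed
  have DA: "(A has_real_derivative (1 - (A x)\<^sup>2) * (1 / \<beta>7)) (at x)" for x
    unfolding A_def using pos[of x] assms by (auto intro!: derivative_eq_intros)
  have DA': "(A has_real_derivative met x * \<alpha>7 * \<omega>) (at x)" if "x \<in> I" for x
  proof -
    have "(1 - (A x)\<^sup>2) * (1 / \<beta>7) = met x * \<alpha>7 * \<omega>" unfolding m2[OF that, symmetric] \<omega>_def by (simp add: power2_eq_square)
    then show ?thesis using DA[of x] by simp
  qed
  have F1: "((\<lambda>x. ln (\<alpha>7 * cosh (x / \<beta>7 + \<alpha>8))) has_real_derivative A x / \<beta>7) (at x)" for x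
    using pos[of x] assms by (auto intro!: derivative_eq_intros simp: A_def tanh_def field_simps)
  have F2: "((\<lambda>x. A x / \<beta>7) has_real_derivative \<omega>\<^sup>2 * met x) (at x)" if "x \<in> I" for x
    using DERIV_cdivide[OF DA'[OF that], of \<beta>7] by (simp add: \<omega>_def power2_eq_square mult_ac)
  have d: "deriv f x = A x / \<beta>7" "deriv (deriv f) x = \<omega>\<^sup>2 * met x" if "x \<in> I" for x
    by (rule f_derivs[of "\<lambda>x. ln (\<alpha>7 * cosh (x / \<beta>7 + \<alpha>8))", OF _ F1 F2]; use fx that in simp)+
  have c: "deriv (deriv f) x + (deriv f x)\<^sup>2 = 1 / \<beta>7\<^sup>2" if "x \<in> I" for x
  proof -
    have "\<omega>\<^sup>2 * met x = (met x * \<alpha>7\<^sup>2) / \<beta>7\<^sup>2" by (simp add: \<omega>_def power_divide)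
    also have "\<dots> = (1 - (A x)\<^sup>2) / \<beta>7\<^sup>2" by (simp only: m2[OF that])
    finally show ?thesis unfolding d[OF that] by (simp add: power_divide diff_divide_distrib)
  qed
  have CI: "C_k_on 4 A I" unfolding A_def tanh_def
  proof (rule C_k_on_divide[OF open_I])
    have "C_k_on 4 (\<lambda>x. x / \<beta>7 + \<alpha>8) I"
      by (intro C_k_on_add C_k_on_const open_I C_k_on_linear bounded_linear_divide)
    then show "C_k_on 4 (\<lambda>x. cosh (x / \<beta>7 + \<alpha>8)) I" "C_k_on 4 (\<lambda>x. sinh (x / \<beta>7 + \<alpha>8)) I"
      by (intro C_k_on_cosh_comp C_k_on_sinh_comp open_I; assumption)+
  qed simp
  have CA: "C_k_on 4 (\<lambda>p. A (fst p) * h (snd p)) S" if "open S" "S = I \<times> J" "C_k_on 4 (\<lambda>p. h (snd p)) S"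
    for S :: "(real \<times> real) set" and h
    by (rule C_k_on_mult[OF that(1) C_k_on_compose[OF that(1) C_k_on_fst[OF that(1)] CI] that(3)]) (use that(2) in auto)
  have CA0: "C_k_on 4 (\<lambda>p. A (fst p)) S" if "open S" "S = I \<times> J" for S :: "(real \<times> real) set"
    using CA[of S "\<lambda>_. 1"] that C_k_on_const by simp
  have fa: "A x * \<omega> = deriv f x * \<alpha>7" if "x \<in> I" for x by (simp add: d[OF that] \<omega>_def)
  have 1: "homothety f I J 0 (\<lambda>x y. - \<alpha>7 * exp (\<omega> * y)) (\<lambda>x y. A x * exp (\<omega> * y))"
  proof (rule homothetyI[where d = "\<lambda>x y. - \<alpha>7 * \<omega> * exp (\<omega> * y)"])
    fix x y assume x: "x \<in> I"
    show "((\<lambda>s. A x * exp (\<omega> * s)) has_real_derivative 0 - deriv f x * (- \<alpha>7 * exp (\<omega> * y))) (at y)"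
      using fa[OF x] by (auto intro!: derivative_eq_intros simp: mult.commute)
    show "((\<lambda>s. A s * exp (\<omega> * y)) has_real_derivative - met x * (- \<alpha>7 * \<omega> * exp (\<omega> * y))) (at x)"
      using DERIV_cmult_right[OF DA'[OF x], of "exp (\<omega> * y)"] by (simp add: mult.assoc)
  qed (auto simp del: C_k_on.simps intro!: CA CA0 C_k_on_intros derivative_eq_intros)
  have 2: "homothety f I J 0 (\<lambda>x y. \<alpha>7 * exp (- (\<omega> * y))) (\<lambda>x y. A x * exp (- (\<omega> * y)))"
  proof (rule homothetyI[where d = "\<lambda>x y. - \<alpha>7 * \<omega> * exp (- (\<omega> * y))"])
    fix x y assume x: "x \<in> I"
    show "((\<lambda>s. A x * exp (- (\<omega> * s))) has_real_derivative 0 - deriv f x * (\<alpha>7 * exp (- (\<omega> * y)))) (at y)"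
      using fa[OF x] by (auto intro!: derivative_eq_intros simp: mult.commute)
    show "((\<lambda>s. A s * exp (- (\<omega> * y))) has_real_derivative - met x * (- \<alpha>7 * \<omega> * exp (- (\<omega> * y)))) (at x)"
      using DERIV_cmult_right[OF DA'[OF x], of "exp (- (\<omega> * y))"] by (simp add: mult.assoc)
  qed (auto simp del: C_k_on.simps intro!: CA CA0 C_k_on_intros derivative_eq_intros)
  obtain x0 y0 where b: "x0 \<in> I" "y0 \<in> J" using intervals by (auto simp: open_interval_def)
  let ?a1 = "\<lambda>(x, y, t, u). (- \<alpha>7 * exp (\<omega> * y), A x * exp (\<omega> * y), 0, 0)"
  let ?a2 = "\<lambda>(x, y, t, u). (\<alpha>7 * exp (- (\<omega> * y)), A x * exp (- (\<omega> * y)), 0, 0)"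
  have "symmetry_algebra_enlarged_by f I J T U {?a1, ?a2, ?a2}"
  proof (rule enlarged_algebra[OF 1 2 2])
    fix \<Lambda> \<eta> \<theta> assume h: "homothety f I J \<Lambda> \<eta> \<theta>"
    have "1 / \<beta>7\<^sup>2 \<noteq> 0" using assms(2) by simp
    then obtain g g1 where \<Lambda>: "\<Lambda> = 0" and g: "\<And>y. y \<in> J \<Longrightarrow> (g has_real_derivative g1 y) (at y)"
      "\<And>y. y \<in> J \<Longrightarrow> (g1 has_real_derivative \<omega>\<^sup>2 * g y) (at y)" "\<And>x y. x \<in> I \<Longrightarrow> y \<in> J \<Longrightarrow> \<eta> x y = g y"
      using constant_curvature[OF d(2) c _ h] by metis
    obtain p q where "\<forall>y\<in>J. g y = p * exp (\<omega> * y) + q * exp (- (\<omega> * y))" using ode_pos[OF intervals(2) g(1) w g(2)] by auto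
    with g(3) \<Lambda> show "\<exists>c1 c2 c3. \<Lambda> = c1 * 0 + c2 * 0 + c3 * 0 \<and> (\<forall>x\<in>I. \<forall>y\<in>J. \<eta> x y =
        c1 * (- \<alpha>7 * exp (\<omega> * y)) + c2 * (\<alpha>7 * exp (- (\<omega> * y))) + c3 * (\<alpha>7 * exp (- (\<omega> * y))))"
      using assms(1) by (intro exI[of _ "- p / \<alpha>7"] exI[of _ "q / \<alpha>7"] exI[of _ 0]) auto
  next
    show "\<exists>x\<in>I. \<exists>y\<in>J. - \<alpha>7 * exp (\<omega> * y) \<noteq> 0 \<or> \<alpha>7 * exp (- (\<omega> * y)) \<noteq> 0" using b assms(1) by auto
  qed auto
  then show ?thesis by (simp add: A_def \<omega>_def)
qed

end


subsection \<open>Surfaces with a further homothety\<close>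

text \<open>Slope zero is a cylinder and belongs to the flat form with \<beta>3 = 0; any other slope
  gives a pseudosphere.\<close>

lemma affine_exceptional: "\<forall>x\<in>I. f x = b * x + C \<Longrightarrow> exceptional_form f I"
proof (cases "b = 0")
  case True
  assume "\<forall>x\<in>I. f x = b * x + C"
  with True have "\<forall>x\<in>I. 0 * x + exp C \<noteq> 0 \<and> f x = ln \<bar>0 * x + exp C\<bar>" by simp
  then show ?thesis unfolding exceptional_form_def by blast
next
  case False
  assume "\<forall>x\<in>I. f x = b * x + C"
  with False show ?thesis unfolding exceptional_form_def by blast
qed

text \<open>\<open>A\<close> is twice the geometric mean of \<open>P\<close> and \<open>Q\<close>,
  and exp(2 \<alpha>) is their quotient. This turns the sum or difference of two exponentials into a
  multiple of a shifted hyperbolic cosine or sine.\<close>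

lemma exponential_coefficients:
  fixes P Q :: real
  assumes "P > 0" "Q > 0"
  obtains A \<alpha> where "A > 0" "A\<^sup>2 = 4 * P * Q" "P = A / 2 * exp \<alpha>" "Q = A / 2 * exp (- \<alpha>)"
proof
  let ?\<alpha> = "(ln P - ln Q) / 2" and ?A = "2 * exp ((ln P + ln Q) / 2)"
  show "P = ?A / 2 * exp ?\<alpha>" "Q = ?A / 2 * exp (- ?\<alpha>)"
    using assms by (simp_all add: exp_add[symmetric] field_simps)
  have "?A\<^sup>2 = 4 * exp ((ln P + ln Q) / 2 + (ln P + ln Q) / 2)"
    unfolding exp_add by (simp add: power2_eq_square)
  then show "?A\<^sup>2 = 4 * P * Q" using assms by (simp add: exp_add)
qed simp

context surface_domain
begin

text \<open>The sign of \<open>c\<close> decides between an affine, a trigonometric and an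
  exponential exp(f). In the exponential case the signs of the two coefficients decide further: a
  missing one makes \<open>f\<close> affine, equal signs give the hyperbolic cosine, opposite signs
  the hyperbolic sine.\<close>

lemma constant_exceptional:
  assumes v: "unit_speed_profile v f I" and c: "\<And>x. x \<in> I \<Longrightarrow> deriv (deriv f) x + (deriv f x)\<^sup>2 = c"
  shows "exceptional_form f I"
proof -
  obtain x0 where x0: "x0 \<in> I" using intervals by (auto simp: open_interval_def)
  define h where "h = (\<lambda>x. exp (f x))"
  define h1 where "h1 = (\<lambda>x. exp (f x) * deriv f x)"
  have h: "(h has_real_derivative h1 x) (at x)" if "x \<in> I" for x
    unfolding h_def h1_def using metric_derivs(1)[OF that] by (auto intro!: derivative_eq_intros)
  have h1: "(h1 has_real_derivative c * h x) (at x)" if "x \<in> I" for x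
  proof -
    have "(h1 has_real_derivative exp (f x) * deriv (deriv f) x + deriv f x * (exp (f x) * deriv f x)) (at x)"
      unfolding h1_def using metric_derivs(1,2)[OF that] by (auto intro!: derivative_eq_intros)
    also have "exp (f x) * deriv (deriv f) x + deriv f x * (exp (f x) * deriv f x) = c * h x"
      unfolding c[OF that, symmetric] h_def by (simp add: algebra_simps power2_eq_square)
    finally show ?thesis .
  qed
  have fh: "f x = ln (h x)" "h x > 0" for x by (simp_all add: h_def)
  \<comment> \<open>\<open>h1\<close> is the second component of the unit tangent vector of the
    profile curve.\<close>
  have speed: "(h1 x)\<^sup>2 \<le> 1" if "x \<in> I" for x
  proof -
    have "(deriv v x)\<^sup>2 + (deriv h x)\<^sup>2 = 1" using v that by (auto simp: unit_speed_profile_def h_def)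
    then show ?thesis using DERIV_imp_deriv[OF h[OF that]] by (smt (verit) zero_le_power2)
  qed
  consider "c = 0" | "c < 0" | "c > 0" by linarith
  then show ?thesis
  proof cases
    case 1
    obtain p q where pq: "\<forall>x\<in>I. h x = p + q * x" using ode_zero[OF intervals(1) h] h1 1 by auto
    have "\<forall>x\<in>I. q * x + p \<noteq> 0 \<and> f x = ln \<bar>q * x + p\<bar>"
    proof
      fix x assume "x \<in> I"
      then have "h x = q * x + p" using pq by simp
      then show "q * x + p \<noteq> 0 \<and> f x = ln \<bar>q * x + p\<bar>" using fh[of x] by simp
    qed
    then show ?thesis unfolding exceptional_form_def by blast
  next
    case 2
    define \<omega> where "\<omega> = sqrt (- c)"
    have w: "\<omega> > 0" "c = - (\<omega>\<^sup>2)" using 2 by (simp_all add: \<omega>_def)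
    obtain p q where pq: "\<forall>x\<in>I. h x = p * cos (\<omega> * x) + q * sin (\<omega> * x)"
      using ode_neg[OF intervals(1) h, of \<omega>] h1 w by auto
    define r where "r = sqrt (p\<^sup>2 + q\<^sup>2)"
    have "p \<noteq> 0 \<or> q \<noteq> 0" using pq fh(2)[of x0] x0 by auto
    then have "p\<^sup>2 + q\<^sup>2 > 0" by (simp add: sum_power2_gt_zero_iff)
    then have r: "r > 0" "r\<^sup>2 = p\<^sup>2 + q\<^sup>2" by (simp_all add: r_def)
    have "(p / r)\<^sup>2 + (- q / r)\<^sup>2 = (p\<^sup>2 + q\<^sup>2) / r\<^sup>2" by (simp only: power_divide power2_minus add_divide_distrib)
    then have "(p / r)\<^sup>2 + (- q / r)\<^sup>2 = 1" using r(1) unfolding r(2)[symmetric] by simp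
    then obtain t where t: "0 \<le> t" "p / r = cos t" "- q / r = sin t" using sincos_total_2pi by metis
    \<comment> \<open>Amplitude and phase of the oscillation. The angle found is only non-negative;
      a full turn is added because the phase \<alpha>6 of the exceptional form must be
      positive.\<close>
    have pq': "p = r * cos (t + 2 * pi)" "q = - (r * sin (t + 2 * pi))"
      unfolding sin_periodic cos_periodic t(2,3)[symmetric] using r(1) by simp_all
    have "\<forall>x\<in>I. cos (x / (1 / \<omega>) + (t + 2 * pi)) \<noteq> 0 \<and> f x = ln \<bar>r * cos (x / (1 / \<omega>) + (t + 2 * pi))\<bar>"
    proof
      fix x assume "x \<in> I"
      then have "h x = p * cos (\<omega> * x) + q * sin (\<omega> * x)" using pq by simp
      also have "\<dots> = r * cos (x / (1 / \<omega>) + (t + 2 * pi))"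
        unfolding pq' cos_add[of "x / (1 / \<omega>)"] by (simp add: algebra_simps del: sin_periodic cos_periodic)
      finally show "cos (x / (1 / \<omega>) + (t + 2 * pi)) \<noteq> 0 \<and> f x = ln \<bar>r * cos (x / (1 / \<omega>) + (t + 2 * pi))\<bar>"
        using fh[of x] by (auto simp del: cos_periodic)
    qed
    moreover have "t + 2 * pi > 0" "1 / \<omega> > 0" using t(1) w(1) pi_gt_zero by (simp_all add: add_nonneg_pos)
    ultimately show ?thesis using r(1) unfolding exceptional_form_def by blast
  next
    case 3
    define \<omega> where "\<omega> = sqrt c"
    have w: "\<omega> > 0" "c = \<omega>\<^sup>2" using 3 by (simp_all add: \<omega>_def)
    obtain p q where pq: "\<forall>x\<in>I. h x = p * exp (\<omega> * x) + q * exp (- (\<omega> * x))"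
      using ode_pos[OF intervals(1) h, of \<omega>] h1 w by auto
    have pos: "p * exp (\<omega> * x) + q * exp (- (\<omega> * x)) > 0" if "x \<in> I" for x using pq that fh(2)[of x] by simp
    have npq: "\<not> (p \<le> 0 \<and> q \<le> 0)"
      using pos[OF x0] mult_nonpos_nonneg[of p "exp (\<omega> * x0)"] mult_nonpos_nonneg[of q "exp (- (\<omega> * x0))"] by force
    consider "p = 0" "q > 0" | "q = 0" "p > 0" | "p > 0" "q > 0" | "p * q < 0"
      using npq by (metis linorder_less_linear linorder_not_le mult_neg_pos mult_pos_neg order_le_less)
    then show ?thesis
    proof cases
      case 1
      then have "\<forall>x\<in>I. f x = - \<omega> * x + ln q" using pq by (simp add: fh(1) ln_mult)
      then show ?thesis by (rule affine_exceptional)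
    next
      case 2
      then have "\<forall>x\<in>I. f x = \<omega> * x + ln p" using pq by (simp add: fh(1) ln_mult)
      then show ?thesis by (rule affine_exceptional)
    next
      case 3
      obtain A \<alpha> where A: "A > 0" "p = A / 2 * exp \<alpha>" "q = A / 2 * exp (- \<alpha>)"
        using exponential_coefficients[OF 3] by metis
      have "\<forall>x\<in>I. f x = ln (A * cosh (x / (1 / \<omega>) + \<alpha>))"
      proof
        fix x assume "x \<in> I"
        then have "h x = A / 2 * exp \<alpha> * exp (\<omega> * x) + A / 2 * exp (- \<alpha>) * exp (- (\<omega> * x))" using pq by (simp only: A(2,3))
        also have "\<dots> = A * cosh (x / (1 / \<omega>) + \<alpha>)" by (simp add: cosh_field_def exp_add exp_minus exp_diff field_simps)
        finally show "f x = ln (A * cosh (x / (1 / \<omega>) + \<alpha>))" by (simp only: fh(1))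
      qed
      moreover have "1 / \<omega> > 0" using w(1) by simp
      ultimately show ?thesis using A(1) unfolding exceptional_form_def by blast
    next
      case 4
      then have "\<bar>p\<bar> > 0" "\<bar>q\<bar> > 0" by auto
      from exponential_coefficients[OF this] obtain A \<alpha>
        where A: "A > 0" "A\<^sup>2 = 4 * \<bar>p\<bar> * \<bar>q\<bar>" "\<bar>p\<bar> = A / 2 * exp \<alpha>" "\<bar>q\<bar> = A / 2 * exp (- \<alpha>)" by metis
      have A2: "A\<^sup>2 = - 4 * p * q" using A(2) 4 by (simp add: abs_mult[symmetric] mult.assoc)
      \<comment> \<open>Which of the two coefficients is negative does not matter: passing to
        absolute values changes the combination at most by a sign.\<close>
      have hx: "h x = \<bar>A * sinh (x / (1 / \<omega>) + \<alpha>)\<bar>" if "x \<in> I" for x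
      proof -
        have "A * sinh (x / (1 / \<omega>) + \<alpha>) = A / 2 * exp \<alpha> * exp (\<omega> * x) - A / 2 * exp (- \<alpha>) * exp (- (\<omega> * x))"
          by (simp add: sinh_field_def exp_add exp_minus exp_diff field_simps)
        also have "\<dots> = \<bar>p\<bar> * exp (\<omega> * x) - \<bar>q\<bar> * exp (- (\<omega> * x))" by (simp only: A(3,4))
        also have "\<bar>\<dots>\<bar> = \<bar>p * exp (\<omega> * x) + q * exp (- (\<omega> * x))\<bar>"
          using 4 by (auto simp: mult_less_0_iff abs_if)
        also have "\<dots> = h x" using pq that pos[OF that] by simp
        finally show ?thesis by simp
      qed
      have "\<forall>x\<in>I. sinh (x / (1 / \<omega>) + \<alpha>) \<noteq> 0 \<and> f x = ln \<bar>A * sinh (x / (1 / \<omega>) + \<alpha>)\<bar>"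
      proof
        fix x assume x: "x \<in> I"
        show "sinh (x / (1 / \<omega>) + \<alpha>) \<noteq> 0 \<and> f x = ln \<bar>A * sinh (x / (1 / \<omega>) + \<alpha>)\<bar>"
          using fh[of x] unfolding hx[OF x] by auto
      qed
      \<comment> \<open>From A^2 = -4pq one obtains h'^2 = \<omega>^2 (h^2 + A^2), which is at least
        (\<omega> A)^2; and h'^2 is at most 1 by \<open>speed\<close>.\<close>
      moreover have "A \<le> 1 / \<omega>"
      proof -
        have "((\<lambda>x. p * exp (\<omega> * x) + q * exp (- (\<omega> * x))) has_real_derivative
            \<omega> * (p * exp (\<omega> * x0) - q * exp (- (\<omega> * x0)))) (at x0)"
          by (auto intro!: derivative_eq_intros simp: algebra_simps)
        then have "(h has_real_derivative \<omega> * (p * exp (\<omega> * x0) - q * exp (- (\<omega> * x0)))) (at x0)"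
          by (rule has_field_derivative_transform_within_open[OF _ open_I x0]) (use pq in simp)
        then have h1': "h1 x0 = \<omega> * (p * exp (\<omega> * x0) - q * exp (- (\<omega> * x0)))"
          using DERIV_unique[OF h[OF x0]] by blast
        have ee: "exp (\<omega> * x0) * exp (- (\<omega> * x0)) = 1" by (simp add: exp_add[symmetric])
        have "(p * X - q * Y)\<^sup>2 = (p * X + q * Y)\<^sup>2 - 4 * p * q * (X * Y)" for X Y :: real
          by (simp add: power2_eq_square algebra_simps)
        from this[of "exp (\<omega> * x0)" "exp (- (\<omega> * x0))"]
        have "(p * exp (\<omega> * x0) - q * exp (- (\<omega> * x0)))\<^sup>2
            = (p * exp (\<omega> * x0) + q * exp (- (\<omega> * x0)))\<^sup>2 - 4 * p * q" unfolding ee by simp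
        then have "A\<^sup>2 \<le> (p * exp (\<omega> * x0) - q * exp (- (\<omega> * x0)))\<^sup>2" using A2 by simp
        then have "\<omega>\<^sup>2 * A\<^sup>2 \<le> (h1 x0)\<^sup>2" unfolding h1' power_mult_distrib by (intro mult_left_mono) auto
        then have "(\<omega> * A)\<^sup>2 \<le> 1\<^sup>2" using speed[OF x0] by (simp add: power_mult_distrib)
        then have "\<omega> * A \<le> 1" by (rule power2_le_imp_le) simp
        then show ?thesis using w(1) by (simp add: field_simps)
      qed
      moreover have "1 / \<omega> > 0" using w(1) by simp
      ultimately have "\<exists>\<alpha>7>0. \<exists>\<beta>7>0. \<exists>\<alpha>8. \<alpha>7 \<le> \<beta>7 \<and>
          (\<forall>x\<in>I. sinh (x / \<beta>7 + \<alpha>8) \<noteq> 0 \<and> f x = ln \<bar>\<alpha>7 * sinh (x / \<beta>7 + \<alpha>8)\<bar>)"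
        using A(1) by (intro exI[of _ A] conjI exI[of _ "1 / \<omega>"] exI[of _ \<alpha>])
      then show ?thesis unfolding exceptional_form_def by (rule disjI2[OF disjI2[OF disjI2[OF disjI1]]])
    qed
  qed
qed

text \<open>For \<Lambda> \<noteq> 0 the first integral gives f' = a / (x - z), where
  \<open>z\<close> is the zero of the linear factor. Integration yields the power form with exponent
  \<open>a\<close>; it degenerates to a constant \<open>f\<close> for a = 0 and to the flat form for
  a = 1.\<close>

lemma scaling_exceptional:
  assumes e: "\<And>x. x \<in> I \<Longrightarrow> deriv (deriv f) x * (\<Lambda> * x + k) + deriv f x * \<Lambda> = 0" and nz: "\<Lambda> \<noteq> 0 \<or> k \<noteq> 0"
  shows "exceptional_form f I"
proof -
  obtain x0 where x0: "x0 \<in> I" using intervals by (auto simp: open_interval_def)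
  note const = interval_constant[OF intervals(1) _ _ x0]
  define m where "m = deriv f x0 * (\<Lambda> * x0 + k)"
  have m: "deriv f x * (\<Lambda> * x + k) = m" if x: "x \<in> I" for x
    unfolding m_def
  proof (rule const[OF _ x])
    fix s assume s: "s \<in> I"
    show "((\<lambda>x. deriv f x * (\<Lambda> * x + k)) has_real_derivative 0) (at s)"
      using metric_derivs(2)[OF s] e[OF s] by (auto intro!: derivative_eq_intros simp: algebra_simps)
  qed
  have aff: "exceptional_form f I" if b: "\<And>x. x \<in> I \<Longrightarrow> deriv f x = b" for b
  proof (rule affine_exceptional)
    have "f x - b * x = f x0 - b * x0" if "x \<in> I" for x
    proof (rule const[where g = "\<lambda>x. f x - b * x", OF _ that])
      fix s assume s: "s \<in> I"
      show "((\<lambda>x. f x - b * x) has_real_derivative 0) (at s)"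
        using metric_derivs(1)[OF s] b[OF s] by (auto intro!: derivative_eq_intros)
    qed
    then show "\<forall>x\<in>I. f x = b * x + (f x0 - b * x0)" by (simp add: algebra_simps)
  qed
  show ?thesis
  proof (cases "\<Lambda> = 0")
    case True
    then show ?thesis using m nz by (intro aff[of "m / k"]) (auto simp: field_simps)
  next
    case False
    define z where "z = - k / \<Lambda>"
    define a where "a = m / \<Lambda>"
    have lz: "\<Lambda> * x + k = \<Lambda> * (x - z)" for x using False by (simp add: z_def algebra_simps)
    have fa: "deriv f x * (x - z) = a" if "x \<in> I" for x
      using m[OF that] False unfolding lz a_def by (simp add: field_simps)
    show ?thesis
    proof (cases "a = 0")
      case True
      \<comment> \<open>At x = z the relation \<open>fa\<close> is void; there the original
        equation, whose first summand vanishes, gives the claim.\<close>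
      have "deriv f x = 0" if "x \<in> I" for x
        using fa[OF that] e[OF that] True False unfolding lz by (cases "x = z") auto
      then show ?thesis by (rule aff)
    next
      case a: False
      have "z \<notin> I" using fa a by force
      \<comment> \<open>An interval that misses \<open>z\<close> lies on one side of it; this
        decides which branch of the power form applies.\<close>
      have side: "(\<forall>x\<in>I. x > z) \<or> (\<forall>x\<in>I. x < z)"
      proof (rule ccontr)
        assume "\<not> ?thesis"
        then obtain x y where "x \<in> I" "y \<in> I" "x \<le> z" "z \<le> y" by force
        then have "z \<in> I" using intervals(1) by (auto simp: open_interval_def intro: mem_is_interval_1_I)
        with \<open>z \<notin> I\<close> show False ..
      qed
      have nz: "x \<noteq> z" if "x \<in> I" for x using that \<open>z \<notin> I\<close> by auto
      define K where "K = f x0 - a * ln \<bar>x0 - z\<bar>"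
      have fK: "f x = K + a * ln \<bar>x - z\<bar>" if x: "x \<in> I" for x
      proof -
        have "f x - a * (ln ((x - z)\<^sup>2) / 2) = f x0 - a * (ln ((x0 - z)\<^sup>2) / 2)"
        proof (rule const[where g = "\<lambda>x. f x - a * (ln ((x - z)\<^sup>2) / 2)", OF _ x])
          fix s assume s: "s \<in> I"
          have "((\<lambda>x. f x - a * (ln ((x - z)\<^sup>2) / 2)) has_real_derivative
              deriv f s - a * (1 / (s - z)\<^sup>2 * (2 * (s - z)) / 2)) (at s)"
            using metric_derivs(1)[OF s] nz[OF s]
            by (intro DERIV_diff DERIV_cmult DERIV_cdivide DERIV_chain2[where f = ln] DERIV_ln_divide)
              (auto intro!: derivative_eq_intros)
          moreover have "deriv f s - a * (1 / (s - z)\<^sup>2 * (2 * (s - z)) / 2) = 0"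
          proof -
            define w where "w = s - z"
            have "w \<noteq> 0" "a = deriv f s * w" using nz[OF s] fa[OF s] by (simp_all add: w_def)
            then show ?thesis unfolding w_def[symmetric] by (simp add: power2_eq_square)
          qed
          ultimately show "((\<lambda>x. f x - a * (ln ((x - z)\<^sup>2) / 2)) has_real_derivative 0) (at s)" by simp
        qed
        moreover have "ln ((s - z)\<^sup>2) / 2 = ln \<bar>s - z\<bar>" if "s \<in> I" for s using ln_abs_eq[of "s - z"] nz[OF that] by simp
        ultimately have "f x - a * ln \<bar>x - z\<bar> = K" unfolding K_def using x x0 by metis
        then show ?thesis by linarith
      qed
      show ?thesis
      proof (cases "a = 1")
        case True
        have "\<forall>x\<in>I. exp K * x + - (exp K * z) \<noteq> 0 \<and> f x = ln \<bar>exp K * x + - (exp K * z)\<bar>"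
        proof
          fix x assume x: "x \<in> I"
          have "exp K * x + - (exp K * z) = exp K * (x - z)" by (simp add: algebra_simps)
          then show "exp K * x + - (exp K * z) \<noteq> 0 \<and> f x = ln \<bar>exp K * x + - (exp K * z)\<bar>"
            using fK[OF x] True nz[OF x] by (simp add: abs_mult ln_mult)
        qed
        then show ?thesis unfolding exceptional_form_def by blast
      next
        case False
        have "f x = ln (exp K * \<bar>x - z\<bar> powr a)" if "x \<in> I" for x
          using fK[OF that] nz[OF that] by (simp add: ln_mult ln_powr)
        then have "(\<forall>x\<in>I. x > z \<and> f x = ln (exp K * (x - z) powr a)) \<or> (\<forall>x\<in>I. x < z \<and> f x = ln (exp K * (z - x) powr a))"
          using side by force
        then have "\<exists>\<beta>5>0. \<exists>\<alpha>2 \<alpha>3. \<alpha>3 \<noteq> 0 \<and> \<alpha>3 \<noteq> 1 \<and>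
            ((\<forall>x\<in>I. x > \<alpha>2 \<and> f x = ln (\<beta>5 * (x - \<alpha>2) powr \<alpha>3)) \<or>
             (\<forall>x\<in>I. x < \<alpha>2 \<and> f x = ln (\<beta>5 * (\<alpha>2 - x) powr \<alpha>3)))"
          using False a by (intro exI[of _ "exp K"] conjI exI[of _ z] exI[of _ a] exp_gt_zero)
        then show ?thesis unfolding exceptional_form_def by (rule disjI1)
      qed
    qed
  qed
qed

text \<open>By \<open>homothety_unique\<close>, \<Lambda> = 0 and \<eta> = 0 would mean a multiple
  of \<partial>_y, so the assumption \<open>nz\<close> says that the homothety is genuinely
  additional. Constancy of \<open>g\<close> decides which of the two preceding lemmas
  applies.\<close>

lemma homothety_exceptional:
  assumes v: "unit_speed_profile v f I" and hom: "homothety f I J \<Lambda> \<eta> \<theta>"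
    and nz: "\<Lambda> \<noteq> 0 \<or> (\<exists>x\<in>I. \<exists>y\<in>J. \<eta> x y \<noteq> 0)"
  shows "exceptional_form f I"
proof -
  obtain g g1 g2 where g: "\<And>y. y \<in> J \<Longrightarrow> (g has_real_derivative g1 y) (at y)"
    "\<And>y. y \<in> J \<Longrightarrow> (g1 has_real_derivative g2 y) (at y)"
    and \<eta>: "\<And>x y. x \<in> I \<Longrightarrow> y \<in> J \<Longrightarrow> \<eta> x y = \<Lambda> * x + g y"
    and e: "\<And>x y. x \<in> I \<Longrightarrow> y \<in> J \<Longrightarrow> met x * g2 y = deriv (deriv f) x * (\<Lambda> * x + g y) + deriv f x * \<Lambda>"
    using homothety_equation[OF hom] by metis
  obtain x0 y0 where b: "x0 \<in> I" "y0 \<in> J" using intervals by (auto simp: open_interval_def)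
  show ?thesis
  proof (cases "\<exists>y1\<in>J. \<exists>y2\<in>J. g y1 \<noteq> g y2")
    case True
    then obtain y1 y2 where y: "y1 \<in> J" "y2 \<in> J" "g y1 - g y2 \<noteq> 0" by auto
    define \<kappa> where "\<kappa> = (g2 y1 - g2 y2) / (g y1 - g y2)"
    have f2: "deriv (deriv f) x = \<kappa> * met x" if x: "x \<in> I" for x
    proof -
      have "deriv (deriv f) x * (g y1 - g y2) = met x * (g2 y1 - g2 y2)"
        using e[OF x y(1)] e[OF x y(2)] by (simp add: algebra_simps)
      then show ?thesis using y(3) by (simp add: \<kappa>_def field_simps)
    qed
    \<comment> \<open>The energy integral of f'' = \<kappa> exp(-2f). Replacing its second term by
      f'' turns it into the constancy of f'' + f'^2.\<close>
    have "(deriv f x)\<^sup>2 + \<kappa> * met x = (deriv f x0)\<^sup>2 + \<kappa> * met x0" if x: "x \<in> I" for x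
    proof (rule interval_constant[where g = "\<lambda>x. (deriv f x)\<^sup>2 + \<kappa> * met x", OF intervals(1) _ x b(1)])
      fix s assume s: "s \<in> I"
      have "((\<lambda>x. (deriv f x)\<^sup>2 + \<kappa> * met x) has_real_derivative
          2 * deriv f s * deriv (deriv f) s + \<kappa> * (- 2 * deriv f s * met s)) (at s)"
        using DERIV_add[OF DERIV_power[OF metric_derivs(2)[OF s], of 2] DERIV_cmult[OF metric_derivs(5)[OF s], of \<kappa>]]
        by (simp add: algebra_simps)
      then show "((\<lambda>x. (deriv f x)\<^sup>2 + \<kappa> * met x) has_real_derivative 0) (at s)" by (simp add: f2[OF s])
    qed
    with f2 show ?thesis by (intro constant_exceptional[OF v]) (simp add: add.commute)
  next
    case False
    then have gc: "g y = g y0" if "y \<in> J" for y using that b by blast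
    have oJ: "open J" using intervals(2) by (simp add: open_interval_def)
    have g1: "g1 y = 0" if "y \<in> J" for y
      using DERIV_unique[OF g(1)[OF that] has_field_derivative_transform_within_open[OF DERIV_const oJ that]] gc by metis
    have "g2 y0 = 0"
      using DERIV_unique[OF g(2)[OF b(2)] has_field_derivative_transform_within_open[OF DERIV_const oJ b(2)]] g1 by metis
    then have e0: "deriv (deriv f) x * (\<Lambda> * x + g y0) + deriv f x * \<Lambda> = 0" if "x \<in> I" for x using e[OF that b(2)] by simp
    have "\<Lambda> \<noteq> 0 \<or> g y0 \<noteq> 0" using nz \<eta> gc by force
    with e0 show ?thesis by (intro scaling_exceptional) auto
  qed
qed

end


section \<open>The classification theorem\<close>

theorem mainTheorem1:
  fixes f v :: "real \<Rightarrow> real" and I J T U :: "real set"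
  assumes "open_interval I" "open_interval J" "open_interval T" "open_interval U"
    and "unit_speed_profile v f I"
  shows
    "generated_algebra (I \<times> J \<times> T \<times> U) (minimal_generators f I J T)
        \<subseteq> lie_symmetries f (I \<times> J \<times> T \<times> U) \<and>
     (\<forall>\<beta>5 \<alpha>2 \<alpha>3. \<beta>5 > 0 \<and> \<alpha>3 \<noteq> 0 \<and> \<alpha>3 \<noteq> 1 \<and>
        (\<forall>x\<in>I. x > \<alpha>2 \<and> f x = ln (\<beta>5 * (x - \<alpha>2) powr \<alpha>3)) \<longrightarrow>
        symmetry_algebra_enlarged_by f I J T U
          {\<lambda>(x, y, t, u). ((x - \<alpha>2) / 4, - ((\<alpha>3 - 1) / 4 * y), t, 0)}) \<and>
     (\<forall>\<beta>4. \<beta>4 > 0 \<and> (\<forall>x\<in>I. f x = ln \<beta>4) \<longrightarrow>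
        symmetry_algebra_enlarged_by f I J T U
          {\<lambda>(x, y, t, u). (1, 0, 0, 0),
           \<lambda>(x, y, t, u). (- \<beta>4\<^sup>2 * y, x, 0, 0),
           \<lambda>(x, y, t, u). (x / 4, y / 4, t, 0)}) \<and>
     (\<forall>\<beta>4. \<beta>4 > 0 \<and> (\<forall>x\<in>I. x > - \<beta>4 \<and> f x = ln (x + \<beta>4)) \<longrightarrow>
        symmetry_algebra_enlarged_by f I J T U
          {\<lambda>(x, y, t, u). ((x + \<beta>4) / 4, 0, t, 0),
           \<lambda>(x, y, t, u). (- cos y, sin y / (x + \<beta>4), 0, 0),
           \<lambda>(x, y, t, u). (sin y, cos y / (x + \<beta>4), 0, 0)}) \<and>
     (\<forall>\<beta>4 l. \<beta>4 > 0 \<and> l > 0 \<and> (\<forall>x\<in>I. x > - \<beta>4 \<and> f x = ln (l * (x + \<beta>4))) \<longrightarrow>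
        symmetry_algebra_enlarged_by f I J T U
          {\<lambda>(x, y, t, u). ((x + \<beta>4) / 4, 0, t, 0),
           \<lambda>(x, y, t, u). (- l * cos (l * y), sin (l * y) / (x + \<beta>4), 0, 0),
           \<lambda>(x, y, t, u). (l * sin (l * y), cos (l * y) / (x + \<beta>4), 0, 0)}) \<and>
     (\<forall>\<beta>3 C. \<beta>3 \<noteq> 0 \<and> (\<forall>x\<in>I. f x = \<beta>3 * x + C) \<longrightarrow>
        symmetry_algebra_enlarged_by f I J T U
          {\<lambda>(x, y, t, u). (- inverse \<beta>3, y, 0, 0),
           \<lambda>(x, y, t, u). (2 * \<beta>3 * exp (2 * C) * y,
              exp (- 2 * \<beta>3 * x) - \<beta>3\<^sup>2 * exp (2 * C) * y\<^sup>2, 0, 0)}) \<and>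
     (\<forall>\<alpha>7 \<beta>7 \<alpha>8. \<alpha>7 > 0 \<and> \<beta>7 > 0 \<and> \<alpha>7 \<le> \<beta>7 \<and>
        (\<forall>x\<in>I. - \<alpha>8 * \<beta>7 < x \<and> x \<le> \<beta>7 * arsinh (sqrt (\<beta>7\<^sup>2 - \<alpha>7\<^sup>2) / \<alpha>7) - \<alpha>8 * \<beta>7 \<and>
           f x = ln \<bar>\<alpha>7 * sinh (x / \<beta>7 + \<alpha>8)\<bar>) \<longrightarrow>
        symmetry_algebra_enlarged_by f I J T U
          {\<lambda>(x, y, t, u). (- \<alpha>7 * cos (\<alpha>7 / \<beta>7 * y),
              cosh (x / \<beta>7 + \<alpha>8) / sinh (x / \<beta>7 + \<alpha>8) * sin (\<alpha>7 / \<beta>7 * y), 0, 0),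
           \<lambda>(x, y, t, u). (\<alpha>7 * sin (\<alpha>7 / \<beta>7 * y),
              cosh (x / \<beta>7 + \<alpha>8) / sinh (x / \<beta>7 + \<alpha>8) * cos (\<alpha>7 / \<beta>7 * y), 0, 0)}) \<and>
     (\<forall>\<alpha>7 \<beta>7 \<alpha>8. \<alpha>7 > 0 \<and> \<beta>7 > 0 \<and>
        (\<forall>x\<in>I. - \<beta>7 * (arsinh (\<beta>7 / \<alpha>7) + \<alpha>8) \<le> x \<and> x \<le> \<beta>7 * (arsinh (\<beta>7 / \<alpha>7) - \<alpha>8) \<and>
           f x = ln (\<alpha>7 * cosh (x / \<beta>7 + \<alpha>8))) \<longrightarrow>
        symmetry_algebra_enlarged_by f I J T U
          {\<lambda>(x, y, t, u). (- \<alpha>7 * exp (\<alpha>7 / \<beta>7 * y),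
              tanh (x / \<beta>7 + \<alpha>8) * exp (\<alpha>7 / \<beta>7 * y), 0, 0),
           \<lambda>(x, y, t, u). (\<alpha>7 * exp (- (\<alpha>7 / \<beta>7 * y)),
              tanh (x / \<beta>7 + \<alpha>8) * exp (- (\<alpha>7 / \<beta>7 * y)), 0, 0)}) \<and>
     (\<forall>\<alpha>5 \<beta>6 \<alpha>6. \<alpha>5 > 0 \<and> \<beta>6 > 0 \<and> \<alpha>6 > 0 \<and>
        (\<alpha>5 = \<beta>6 \<longrightarrow> (\<forall>x\<in>I. - \<beta>6 * (pi / 2 + \<alpha>6) \<le> x \<and> x \<le> \<beta>6 * (pi / 2 - \<alpha>6))) \<and>
        (\<alpha>5 > \<beta>6 \<longrightarrow> (\<forall>x\<in>I. - \<beta>6 * (\<alpha>6 + arcsin (\<beta>6 / \<alpha>5)) \<le> x \<and>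
                              x \<le> \<beta>6 * (arcsin (\<beta>6 / \<alpha>5) - \<alpha>6))) \<and>
        (\<forall>x\<in>I. cos (x / \<beta>6 + \<alpha>6) \<noteq> 0 \<and> f x = ln \<bar>\<alpha>5 * cos (x / \<beta>6 + \<alpha>6)\<bar>) \<longrightarrow>
        symmetry_algebra_enlarged_by f I J T U
          {\<lambda>(x, y, t, u). (\<alpha>5 * cos (\<alpha>5 / \<beta>6 * y),
              tan (x / \<beta>6 + \<alpha>6) * sin (\<alpha>5 / \<beta>6 * y), 0, 0),
           \<lambda>(x, y, t, u). (- \<alpha>5 * sin (\<alpha>5 / \<beta>6 * y),
              tan (x / \<beta>6 + \<alpha>6) * cos (\<alpha>5 / \<beta>6 * y), 0, 0)}) \<and>
     (\<not> exceptional_form f I \<longrightarrow> symmetry_algebra_is_minimal f I J T U)"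
proof -
  interpret surface_domain f I J T U
    using assms by unfold_locales (auto simp: unit_speed_profile_def open_interval_def simp del: C_k_on.simps)
  have minimal: "symmetry_algebra_is_minimal f I J T U" if "\<not> exceptional_form f I"
    using homothety_exceptional[OF assms(5)] that by (intro minimal_algebra) blast
  show ?thesis
    \<comment> \<open>The items are matched with the lemmas by their generating fields; the plane is
      obtained from the cone with \<open>l = 1\<close>.\<close>
    by (intro conjI allI impI; (elim conjE)?)
      (rule generated_minimal_subset power_surface cylinder cone[where l = 1, simplified] cone pseudosphere
        sinh_surface cosh_surface cos_surface minimal; blast | assumption)+
qed

end
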